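(* Let $H\in\mathbb{H}^{n\times n}$ be an invertible Hermitian quaternion matrix and $X\in\mathbb{H}^{n\times n}$, and put $B=X^{[*]}X=H^{-1}X^*HX$ (which is $H$-selfadjoint). Then $X$ admits an $H$-polar decomposition if and only if all of the following hold. (i) In the canonical form of $(B,H)$, the blocks corresponding to negative eigenvalues can be grouped into pairs of the form $\left(J_{k}(\lambda)\oplus J_{k}(\lambda),\;Q_{k}\oplus(-Q_{k})\right)$ with $\lambda<0$. (ii) In the canonical form of $(B,H)$, the blocks corresponding to the eigenvalue $0$ can be grouped into blocks $(B_i,H_i)$ each of which is either of the form $\left(J_{k+1}(0)\oplus J_{k}(0),\;\eta Q_{k+1}\oplus\eta Q_{k}\right)$ with $\eta=\pm1$ and $k\ge 0$ (for $k=0$ this is a single block $(J_1(0),\eta)$), or of the form $\left(J_{k}(0)\oplus J_{k}(0),\;Q_{k}\oplus(-Q_{k})\right)$ with $k\ge1$. Collect all single blocks $J_1(0)$ into $B_0$, the $k_0\times k_0$ zero matrix, with $H_0$ the corresponding $k_0\times k_0$ diagonal matrix with entries $\pm1$, and denote the remaining zero-eigenvalue blocks by $B_1,\ldots,B_m$, with $\ell_i$ the order of $B_i$. (iii) There is a choice of basis of $\mathbb{H}^n$ producing the canonical form of $(B,H)$ with such a grouping, in which the basis vectors corresponding to $B_0$ are $e_{0,1},\ldots,e_{0,k_0}$ and those corresponding to $B_i$ ($i=1,\ldots,m$) are $e_{i,1},\ldots,e_{i,\ell_i}$, ordered so that the vectors of the first Jordan block of $B_i$ come first (i.e. if $B_i=J_p(0)\oplus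 J_q(0)$ then $e_{i,1},\ldots,e_{i,p}$ correspond to $J_p(0)$ and $e_{i,p+1},\ldots,e_{i,p+q}$ to $J_q(0)$), such that $$\mathrm{Ker}\,X=\mathrm{span}\{e_{i,1}+e_{i,k_i+1}\mid \ell_i=2k_i \text{ even},\ 1\le i\le m\}\oplus\mathrm{span}\{e_{i,1}\mid \ell_i \text{ odd},\ 1\le i\le m\}\oplus\mathrm{span}\{e_{0,j}\}_{j=1}^{k_0}.$$
   Context: $\mathbb{H}$ denotes the real quaternions, $\mathbb{H}^n$ is a right vector space, $A^*$ is the conjugate transpose. The $H$-adjoint is $X^{[*]}=H^{-1}X^*H$; $A$ is $H$-selfadjoint if $A^{[*]}=A$, $U$ is $H$-unitary if $U^*HU=H$; an $H$-polar decomposition of $X$ is $X=UA$ with $U$ $H$-unitary and $A$ $H$-selfadjoint. $J_k(\lambda)$ is the $k\times k$ upper triangular Jordan block with eigenvalue $\lambda$ (ones on the superdiagonal), and $Q_k$ is the $k\times k$ matrix with ones on the main anti-diagonal and zeros elsewhere. Canonical form: for an $H$-selfadjoint $B$ there is an invertible $S\in\mathbb{H}^{n\times n}$ such that $S^{-1}BS=J_{k_1}(\lambda_1)\oplus\cdots\oplus J_{k_\alpha}(\lambda_\alpha)\oplus\bigoplus_{i=\alpha+1}^{\beta}\big(J_{k_i}(\lambda_i)\oplus J_{k_i}(\bar\lambda_i)\big)$ with $\lambda_1,\ldots,\lambda_\alpha$ real and $\lambda_{\alpha+1},\ldots,\lambda_\beta$ complex with positive imaginary part, and $S^*HS=\eta_1Q_{k_1}\oplus\cdots\oplus\eta_\alpha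 Q_{k_\alpha}\oplus Q_{2k_{\alpha+1}}\oplus\cdots\oplus Q_{2k_\beta}$ with $\eta_i=\pm1$; this form is unique up to permutation of blocks. The columns of $S$ form the basis "producing the canonical form", with the columns belonging to each block ordered as the block's rows. *)

theory Defs
  imports "Jordan_Normal_Form.Jordan_Normal_Form" "HOL-Library.Multiset"
begin

datatype quat = Quat (qRe: real) (qI: real) (qJ: real) (qK: real)

lemma quat_eqI: "qRe x = qRe y \<Longrightarrow> qI x = qI y \<Longrightarrow> qJ x = qJ y \<Longrightarrow> qK x = qK y \<Longrightarrow> x = y"
  by (cases x; cases y) auto

instantiation quat :: ring_1
begin
definition "0 = Quat 0 0 0 0"
definition "1 = Quat 1 0 0 0"
definition "x + y = Quat (qRe x + qRe y) (qI x + qI y) (qJ x + qJ y) (qK x + qK y)"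
definition "x - y = Quat (qRe x - qRe y) (qI x - qI y) (qJ x - qJ y) (qK x - qK y)"
definition "- x = Quat (- qRe x) (- qI x) (- qJ x) (- qK x)"
definition "x * y = Quat
   (qRe x * qRe y - qI x * qI y - qJ x * qJ y - qK x * qK y)
   (qRe x * qI y + qI x * qRe y + qJ x * qK y - qK x * qJ y)
   (qRe x * qJ y - qI x * qK y + qJ x * qRe y + qK x * qI y)
   (qRe x * qK y + qI x * qJ y - qJ x * qI y + qK x * qRe y)"
instance
  by standard (auto intro!: quat_eqI simp: zero_quat_def one_quat_def plus_quat_def
      minus_quat_def uminus_quat_def times_quat_def algebra_simps)
end

definition qcnj :: "quat \<Rightarrow> quat" where
  "qcnj x = Quat (qRe x) (- qI x) (- qJ x) (- qK x)"

definition quat_of_complex :: "complex \<Rightarrow> quat" where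
  "quat_of_complex z = Quat (Re z) (Im z) 0 0"

definition quat_of_real :: "real \<Rightarrow> quat" where
  "quat_of_real r = Quat r 0 0 0"

definition qadj :: "quat mat \<Rightarrow> quat mat" where
  "qadj A = mat (dim_col A) (dim_row A) (\<lambda>(i,j). qcnj (A $$ (j,i)))"

definition qinv :: "quat mat \<Rightarrow> quat mat" where
  "qinv A = (SOME B. B \<in> carrier_mat (dim_row A) (dim_row A) \<and>
                     A * B = 1\<^sub>m (dim_row A) \<and> B * A = 1\<^sub>m (dim_row A))"

definition H_adjoint :: "quat mat \<Rightarrow> quat mat \<Rightarrow> quat mat" where
  "H_adjoint H X = qinv H * qadj X * H"

definition H_selfadjoint :: "quat mat \<Rightarrow> quat mat \<Rightarrow> bool" where
  "H_selfadjoint H A \<longleftrightarrow> H_adjoint H A = A"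

definition H_unitary :: "quat mat \<Rightarrow> quat mat \<Rightarrow> bool" where
  "H_unitary H U \<longleftrightarrow> qadj U * H * U = H"

definition has_H_polar_decomposition :: "nat \<Rightarrow> quat mat \<Rightarrow> quat mat \<Rightarrow> bool" where
  "has_H_polar_decomposition n H X \<longleftrightarrow>
     (\<exists>U A. U \<in> carrier_mat n n \<and> A \<in> carrier_mat n n \<and>
            H_unitary H U \<and> H_selfadjoint H A \<and> X = U * A)"

definition antidiag :: "nat \<Rightarrow> quat mat" where
  "antidiag k = mat k k (\<lambda>(i,j). if i + j + 1 = k then 1 else 0)"

text \<open>A block of the canonical form:
  \<open>RB k \<lambda> \<eta>\<close> is \<open>(J\<^sub>k(\<lambda>), \<eta> Q\<^sub>k)\<close> with \<open>\<lambda>\<close> real, \<open>\<eta> = \<plusminus>1\<close>;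
  \<open>CB k \<lambda>\<close> is \<open>(J\<^sub>k(\<lambda>) \<oplus> J\<^sub>k(conj \<lambda>), Q\<^sub>2\<^sub>k)\<close> with \<open>Im \<lambda> > 0\<close>.\<close>
datatype cblock = RB nat real int | CB nat complex

fun cblock_valid :: "cblock \<Rightarrow> bool" where
  "cblock_valid (RB k l e) \<longleftrightarrow> k \<ge> 1 \<and> (e = 1 \<or> e = -1)"
| "cblock_valid (CB k z) \<longleftrightarrow> k \<ge> 1 \<and> Im z > 0"

fun cblock_B :: "cblock \<Rightarrow> quat mat" where
  "cblock_B (RB k l e) = jordan_block k (quat_of_real l)"
| "cblock_B (CB k z) = diag_block_mat
     [jordan_block k (quat_of_complex z), jordan_block k (quat_of_complex (cnj z))]"

fun cblock_H :: "cblock \<Rightarrow> quat mat" where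
  "cblock_H (RB k l e) = of_int e \<cdot>\<^sub>m antidiag k"
| "cblock_H (CB k z) = antidiag (2 * k)"

fun cblock_size :: "cblock \<Rightarrow> nat" where
  "cblock_size (RB k l e) = k"
| "cblock_size (CB k z) = 2 * k"

definition canonical_form :: "nat \<Rightarrow> quat mat \<Rightarrow> quat mat \<Rightarrow> cblock list \<Rightarrow> quat mat \<Rightarrow> bool" where
  "canonical_form n B H bs S \<longleftrightarrow>
     S \<in> carrier_mat n n \<and> invertible_mat S \<and>
     (\<forall>b\<in>set bs. cblock_valid b) \<and>
     qinv S * B * S = diag_block_mat (map cblock_B bs) \<and>
     qadj S * H * S = diag_block_mat (map cblock_H bs)"

fun neg_block :: "cblock \<Rightarrow> bool" where
  "neg_block (RB k l e) \<longleftrightarrow> l < 0"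
| "neg_block (CB k z) \<longleftrightarrow> False"

fun zero_block :: "cblock \<Rightarrow> bool" where
  "zero_block (RB k l e) \<longleftrightarrow> l = 0"
| "zero_block (CB k z) \<longleftrightarrow> False"

definition neg_pairable :: "cblock list \<Rightarrow> bool" where
  "neg_pairable bs \<longleftrightarrow> (\<exists>ps :: (nat \<times> real) list.
     (\<forall>(k,l)\<in>set ps. l < 0) \<and>
     mset (filter neg_block bs) = mset (concat (map (\<lambda>(k,l). [RB k l 1, RB k l (-1)]) ps)))"

text \<open>Groups of zero-eigenvalue blocks:
  \<open>ZOdd k \<eta>\<close> is \<open>(J\<^sub>k\<^sub>+\<^sub>1(0) \<oplus> J\<^sub>k(0), \<eta>Q\<^sub>k\<^sub>+\<^sub>1 \<oplus> \<eta>Q\<^sub>k)\<close>, \<open>k \<ge> 0\<close>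
  (for \<open>k = 0\<close> the single block \<open>(J\<^sub>1(0), \<eta>)\<close>, i.e. a block of \<open>B\<^sub>0\<close>);
  \<open>ZEven k\<close> is \<open>(J\<^sub>k(0) \<oplus> J\<^sub>k(0), Q\<^sub>k \<oplus> (-Q\<^sub>k))\<close>, \<open>k \<ge> 1\<close>.\<close>
datatype zgroup = ZOdd nat int | ZEven nat

fun zgroup_valid :: "zgroup \<Rightarrow> bool" where
  "zgroup_valid (ZOdd k e) \<longleftrightarrow> e = 1 \<or> e = -1"
| "zgroup_valid (ZEven k) \<longleftrightarrow> k \<ge> 1"

fun zgroup_blocks :: "zgroup \<Rightarrow> cblock list" where
  "zgroup_blocks (ZOdd k e) = RB (k+1) 0 e # (if k = 0 then [] else [RB k 0 e])"
| "zgroup_blocks (ZEven k) = [RB k 0 1, RB k 0 (-1)]"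

fun zgroup_size :: "zgroup \<Rightarrow> nat" where
  "zgroup_size (ZOdd k e) = 2 * k + 1"
| "zgroup_size (ZEven k) = 2 * k"

definition zero_groupable :: "cblock list \<Rightarrow> bool" where
  "zero_groupable bs \<longleftrightarrow> (\<exists>gs. (\<forall>g\<in>set gs. zgroup_valid g) \<and>
     mset (filter zero_block bs) = mset (concat (map zgroup_blocks gs)))"

text \<open>Right span (\<open>\<bbbH>\<^sup>n\<close> is a right vector space) of a list of vectors in \<open>\<bbbH>\<^sup>n\<close>.\<close>
definition rspan :: "nat \<Rightarrow> quat vec list \<Rightarrow> quat vec set" where
  "rspan n vs = {vec n (\<lambda>i. \<Sum>j<length vs. (vs ! j) $ i * c j) | c. True}"

definition qker :: "nat \<Rightarrow> quat mat \<Rightarrow> quat vec set" where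
  "qker n X = {v \<in> carrier_vec n. X *\<^sub>v v = 0\<^sub>v n}"

text \<open>Kernel-generating vectors in a basis \<open>S\<close> for the zero groups \<open>gs\<close>, whose columns start
  at offset \<open>off\<close>: for \<open>ZOdd\<close> (odd order \<open>\<ell>\<^sub>i\<close>, including the single blocks of \<open>B\<^sub>0\<close>)
  the first basis vector \<open>e\<^sub>i\<^sub>,\<^sub>1\<close> (resp. \<open>e\<^sub>0\<^sub>,\<^sub>j\<close>);
  for \<open>ZEven k\<close> (order \<open>\<ell>\<^sub>i = 2k\<close>) the vector \<open>e\<^sub>i\<^sub>,\<^sub>1 + e\<^sub>i\<^sub>,\<^sub>k\<^sub>+\<^sub>1\<close>.\<close>
fun zgroup_kernel_vecs :: "quat mat \<Rightarrow> nat \<Rightarrow> zgroup list \<Rightarrow> quat vec list" where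
  "zgroup_kernel_vecs S off [] = []"
| "zgroup_kernel_vecs S off (ZOdd k e # gs) =
     col S off # zgroup_kernel_vecs S (off + zgroup_size (ZOdd k e)) gs"
| "zgroup_kernel_vecs S off (ZEven k # gs) =
     (col S off + col S (off + k)) # zgroup_kernel_vecs S (off + zgroup_size (ZEven k)) gs"

end

theory Submission
  imports Defs "HOL-Library.Function_Algebras" "HOL-Computational_Algebra.Formal_Power_Series"
    "HOL-Computational_Algebra.Fundamental_Theorem_Algebra"
begin

text \<open>
  If \<open>X = U A\<close> is a polar decomposition then \<open>B = A\<^sup>2\<close> and \<open>Ker X = Ker A\<close>. On the invertible part of
  \<open>A\<close> one takes any canonical form of \<open>A\<^sup>2\<close>; a nilpotent block \<open>(J\<^sub>K(0), s Q\<^sub>K)\<close> of \<open>A\<close> squares, after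
  separating the odd and the even members of its Jordan chain, to one of the groups in (ii), and the
  first vector of the chain spans the kernel. For \<open>l < 0\<close> the map \<open>A\<close> preserves \<open>Ker (B - l)\<^sup>k\<close> and
  multiplies the form \<open>[x, (B - l)\<^sup>k\<^sup>-\<^sup>1 y]\<close> by \<open>l\<close>, so that this form has equally many positive and negative
  squares; its signature counts the blocks of size \<open>k\<close> with either sign.

  Conversely, each pair of negative blocks, each zero group and every remaining block has a selfadjoint
  square root, on the zero groups with the prescribed kernel. They assemble to a selfadjoint \<open>A\<close> with
  \<open>A\<^sup>2 = B\<close> and \<open>Ker A = Ker X\<close>. Then \<open>A v \<mapsto> X v\<close> is a well-defined isometry, and by Witt's theorem it
  extends to an \<open>H\<close>-unitary \<open>U\<close> with \<open>X = U A\<close>.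
\<close>

section \<open>Quaternions and linear algebra over division rings\<close>

text \<open>Invertibility is therefore handled through trivial kernels and dimension counts, and
  eigenvalues come from a polynomial with real coefficients annihilating the matrix: real scalars
  are central, and over the complex numbers the polynomial splits into linear factors that act by
  right multiplication with complex scalars. Conditions (i) and (ii) range over every canonical
  form, whereas (iii) asks for one; the forward direction therefore rests on the uniqueness of the
  blocks with real eigenvalue, which is a law of inertia. The same uniqueness, for the zero
  endomorphism, yields Witt cancellation. In extending the isometry the obstacle is that the range
  of \<open>A\<close> may be degenerate: its radical is first paired with a dual isotropic space, so
  that both ranges are enlarged to nondegenerate spaces with the same Gram matrix.\<close>

definition qnorm2 :: "quat \<Rightarrow> real" where
  "qnorm2 x = (qRe x)\<^sup>2 + (qI x)\<^sup>2 + (qJ x)\<^sup>2 + (qK x)\<^sup>2"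

lemma qnorm2_pos: "x \<noteq> 0 \<Longrightarrow> qnorm2 x > 0"
proof -
  assume "x \<noteq> 0"
  hence "qRe x \<noteq> 0 \<or> qI x \<noteq> 0 \<or> qJ x \<noteq> 0 \<or> qK x \<noteq> 0"
    by (auto simp: zero_quat_def intro: quat_eqI)
  hence "(qRe x)\<^sup>2 > 0 \<or> (qI x)\<^sup>2 > 0 \<or> (qJ x)\<^sup>2 > 0 \<or> (qK x)\<^sup>2 > 0" by auto
  thus ?thesis unfolding qnorm2_def
    by (smt (verit) zero_le_power2)
qed

lemma qnorm2_0 [simp]: "qnorm2 0 = 0"
  by (simp add: qnorm2_def zero_quat_def)

lemma qnorm2_nonneg: "qnorm2 x \<ge> 0"
  by (simp add: qnorm2_def)

lemma quat_sel_simps [simp]: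
  "qRe 0 = 0" "qI 0 = 0" "qJ 0 = 0" "qK 0 = 0"
  "qRe 1 = 1" "qI 1 = 0" "qJ 1 = 0" "qK 1 = 0"
  "qRe (x + y) = qRe x + qRe y" "qI (x + y) = qI x + qI y"
  "qJ (x + y) = qJ x + qJ y" "qK (x + y) = qK x + qK y"
  "qRe (x - y) = qRe x - qRe y" "qI (x - y) = qI x - qI y"
  "qJ (x - y) = qJ x - qJ y" "qK (x - y) = qK x - qK y"
  "qRe (- x) = - qRe x" "qI (- x) = - qI x" "qJ (- x) = - qJ x" "qK (- x) = - qK x"
  "qRe (qcnj x) = qRe x" "qI (qcnj x) = - qI x" "qJ (qcnj x) = - qJ x" "qK (qcnj x) = - qK x"
  by (auto simp: zero_quat_def one_quat_def plus_quat_def minus_quat_def uminus_quat_def qcnj_def)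

lemma quat_sel_times:
  "qRe (x * y) = qRe x * qRe y - qI x * qI y - qJ x * qJ y - qK x * qK y"
  "qI (x * y) = qRe x * qI y + qI x * qRe y + qJ x * qK y - qK x * qJ y"
  "qJ (x * y) = qRe x * qJ y - qI x * qK y + qJ x * qRe y + qK x * qI y"
  "qK (x * y) = qRe x * qK y + qI x * qJ y - qJ x * qI y + qK x * qRe y"
  by (auto simp: times_quat_def)

lemma quat_sel_of_real [simp]:
  "qRe (quat_of_real r) = r" "qI (quat_of_real r) = 0" "qJ (quat_of_real r) = 0" "qK (quat_of_real r) = 0"
  "qRe (quat_of_complex z) = Re z" "qI (quat_of_complex z) = Im z"
  "qJ (quat_of_complex z) = 0" "qK (quat_of_complex z) = 0"
  by (auto simp: quat_of_real_def quat_of_complex_def)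

instantiation quat :: division_ring
begin
definition inverse_quat :: "quat \<Rightarrow> quat" where
  "inverse_quat x = Quat (qRe x / qnorm2 x) (- qI x / qnorm2 x) (- qJ x / qnorm2 x) (- qK x / qnorm2 x)"
definition divide_quat :: "quat \<Rightarrow> quat \<Rightarrow> quat" where
  "divide_quat x y = x * inverse y"
instance
proof
  fix x y :: quat
  show "x \<noteq> 0 \<Longrightarrow> inverse x * x = 1"
  proof -
    assume "x \<noteq> 0"
    note p = qnorm2_pos[OF this]
    hence "qRe x * qRe x + qI x * qI x + qJ x * qJ x + qK x * qK x \<noteq> 0"
      by (simp add: qnorm2_def power2_eq_square)
    thus ?thesis using p
      by (intro quat_eqI; simp add: quat_sel_times inverse_quat_def field_simps)
         (simp add: qnorm2_def power2_eq_square)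
  qed
  show "x \<noteq> 0 \<Longrightarrow> x * inverse x = 1"
  proof -
    assume "x \<noteq> 0"
    note p = qnorm2_pos[OF this]
    thus ?thesis
      by (intro quat_eqI; simp add: quat_sel_times inverse_quat_def field_simps)
         (simp add: qnorm2_def power2_eq_square)
  qed
  show "x div y = x * inverse y" by (rule divide_quat_def)
  show "inverse (0::quat) = 0" by (rule quat_eqI) (auto simp: inverse_quat_def)
qed
end

lemma qcnj_simps [simp]:
  "qcnj 0 = 0" "qcnj 1 = 1" "qcnj (qcnj x) = x" "qcnj (- x) = - qcnj x"
  "qcnj (x + y) = qcnj x + qcnj y" "qcnj (x - y) = qcnj x - qcnj y"
  "qcnj (quat_of_real r) = quat_of_real r" "qcnj (quat_of_complex z) = quat_of_complex (cnj z)"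
  by (auto intro: quat_eqI)

lemma qcnj_mult: "qcnj (x * y) = qcnj y * qcnj x"
  by (rule quat_eqI) (auto simp: quat_sel_times algebra_simps)

lemma qcnj_sum: "qcnj (sum f A) = (\<Sum>i\<in>A. qcnj (f i))"
  by (induction A rule: infinite_finite_induct) auto

lemma qcnj_mult_self: "qcnj x * x = quat_of_real (qnorm2 x)"
  by (rule quat_eqI) (auto simp: quat_sel_times qnorm2_def power2_eq_square)

lemma quat_of_real_simps [simp]:
  "quat_of_real 0 = 0" "quat_of_real 1 = 1"
  "quat_of_real (a + b) = quat_of_real a + quat_of_real b"
  "quat_of_real (a - b) = quat_of_real a - quat_of_real b"
  "quat_of_real (- a) = - quat_of_real a"
  "quat_of_real (a * b) = quat_of_real a * quat_of_real b"
  "quat_of_real a = quat_of_real b \<longleftrightarrow> a = b"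
  "quat_of_real a = 0 \<longleftrightarrow> a = 0"
  by (auto simp: quat_of_real_def zero_quat_def one_quat_def plus_quat_def minus_quat_def
      uminus_quat_def times_quat_def)

lemma quat_of_complex_simps [simp]:
  "quat_of_complex 0 = 0" "quat_of_complex 1 = 1"
  "quat_of_complex (v + w) = quat_of_complex v + quat_of_complex w"
  "quat_of_complex (v - w) = quat_of_complex v - quat_of_complex w"
  "quat_of_complex (- v) = - quat_of_complex v"
  "quat_of_complex (v * w) = quat_of_complex v * quat_of_complex w"
  "quat_of_complex v = quat_of_complex w \<longleftrightarrow> v = w"
  "quat_of_complex v = 0 \<longleftrightarrow> v = 0"
  "quat_of_complex (complex_of_real r) = quat_of_real r"
  by (auto simp: quat_of_complex_def quat_of_real_def zero_quat_def one_quat_def plus_quat_def minus_quat_def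
      uminus_quat_def times_quat_def complex_eq_iff)

lemma quat_of_real_comm: "quat_of_real r * x = x * quat_of_real r"
  by (rule quat_eqI) (auto simp: quat_sel_times)

lemma quat_of_real_lcomm: "x * (quat_of_real r * y) = quat_of_real r * (x * y)"
  by (metis quat_of_real_comm mult.assoc)

text \<open>Elimination of one equation and one unknown. Coefficients stand on the left and unknowns
  on the right, so the order of factors matters throughout. Arbitrary finite index sets and an
  arbitrary division ring are allowed because the lemma serves quaternion matrices as well as a real
  system indexed by triples.\<close>

lemma homogeneous_system_set:
  fixes f :: "'i \<Rightarrow> 'j \<Rightarrow> 'a::division_ring"
  assumes "finite I" "finite J" "card I < card J"
  shows "\<exists>c. (\<exists>j\<in>J. c j \<noteq> 0) \<and> (\<forall>i\<in>I. (\<Sum>j\<in>J. f i j * c j) = 0)"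
  using assms
proof (induction I arbitrary: J f rule: finite_induct)
  case empty
  hence "J \<noteq> {}" by auto
  thus ?case by (intro exI[of _ "\<lambda>_. 1"]) auto
next
  case (insert a I)
  show ?case
  proof (cases "\<forall>j\<in>J. f a j = 0")
    case True
    have "card I < card J" using insert by simp
    from insert.IH[OF \<open>finite J\<close> this, of f] obtain c where
      "\<exists>j\<in>J. c j \<noteq> 0" "\<forall>i\<in>I. (\<Sum>j\<in>J. f i j * c j) = 0" by auto
    thus ?thesis using True by (intro exI[of _ c]) auto
  next
    case False
    then obtain p where p: "p \<in> J" "f a p \<noteq> 0" by auto
    define J' where "J' = J - {p}"
    have fJ': "finite J'" "card I < card J'" using insert p by (auto simp: J'_def)
    \<comment> \<open>Row \<open>i\<close> minus the left multiple of the pivot row \<open>a\<close>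
      that clears column \<open>p\<close>.\<close>
    define g where "g i j = f i j - f i p * inverse (f a p) * f a j" for i j
    from insert.IH[OF fJ', of g] obtain c where
      c: "\<exists>j\<in>J'. c j \<noteq> 0" "\<And>i. i \<in> I \<Longrightarrow> (\<Sum>j\<in>J'. g i j * c j) = 0" by auto
    define s where "s = (\<Sum>j\<in>J'. f a j * c j)"
    \<comment> \<open>The pivot unknown is chosen so as to satisfy equation
      \<open>a\<close>.\<close>
    define d where "d j = (if j = p then - inverse (f a p) * s else c j)" for j
    have J: "J = insert p J'" "p \<notin> J'" using p by (auto simp: J'_def)
    have sd: "(\<Sum>j\<in>J. f i j * d j) = f i p * (- inverse (f a p) * s) + (\<Sum>j\<in>J'. f i j * c j)" for i
    proof -
      have "(\<Sum>j\<in>J'. f i j * d j) = (\<Sum>j\<in>J'. f i j * c j)"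
        by (rule sum.cong) (auto simp: d_def J)
      thus ?thesis using fJ' J by (simp add: d_def)
    qed
    have "(\<Sum>j\<in>J. f a j * d j) = 0"
      unfolding sd using p by (simp add: s_def[symmetric] mult.assoc[symmetric])
    moreover have "(\<Sum>j\<in>J. f i j * d j) = 0" if "i \<in> I" for i
    proof -
      have "0 = (\<Sum>j\<in>J'. f i j * c j - f i p * inverse (f a p) * (f a j * c j))"
        using c(2)[OF that] by (simp add: g_def left_diff_distrib mult.assoc)
      also have "\<dots> = (\<Sum>j\<in>J'. f i j * c j) - f i p * inverse (f a p) * s"
        by (simp add: sum_subtractf sum_distrib_left s_def)
      finally show ?thesis unfolding sd by (simp add: mult.assoc algebra_simps)
    qed
    moreover have "\<exists>j\<in>J. d j \<noteq> 0"
    proof -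
      from c(1) obtain j where "j \<in> J'" "c j \<noteq> 0" by auto
      thus ?thesis using J by (intro bexI[of _ j]) (auto simp: d_def)
    qed
    ultimately show ?thesis by (intro exI[of _ d]) auto
  qed
qed

text \<open>Equations between dimensions are decided by the simplifier without guessing intermediate
  sizes, so this form can reassociate long products; the version with carrier premises leaves the
  simpset just below.\<close>

lemma mult_assoc_dim:
  fixes A B C :: "'a::semiring_0 mat"
  assumes "dim_col A = dim_row B" "dim_col B = dim_row C"
  shows "(A * B) * C = A * (B * C)"
  by (rule assoc_mult_mat[of A "dim_row A" "dim_col A" B "dim_col B" C "dim_col C"]) (use assms in auto)

declare assoc_mult_mat [simp del]

section \<open>Conjugate transposes and real scalars\<close>

lemma qadj_dim [simp]: "dim_row (qadj A) = dim_col A" "dim_col (qadj A) = dim_row A"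
  by (auto simp: qadj_def)

lemma qadj_carrier: "A \<in> carrier_mat n m \<Longrightarrow> qadj A \<in> carrier_mat m n"
  by auto

lemma qadj_index [simp]:
  "i < dim_col A \<Longrightarrow> j < dim_row A \<Longrightarrow> qadj A $$ (i,j) = qcnj (A $$ (j,i))"
  by (auto simp: qadj_def)

lemma qadj_qadj [simp]: "qadj (qadj A) = A"
  by (rule eq_matI) auto

lemma qadj_mult: "dim_col A = dim_row B \<Longrightarrow> qadj (A * B) = qadj B * qadj A"
  by (rule eq_matI) (auto simp: scalar_prod_def qcnj_sum qcnj_mult intro!: sum.cong)

lemma qadj_zero [simp]: "qadj (0\<^sub>m n m) = 0\<^sub>m m n"
  by (rule eq_matI) auto

lemma qadj_one [simp]: "qadj (1\<^sub>m n) = 1\<^sub>m n"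
  by (rule eq_matI) auto

lemma qadj_minus: "dim_row A = dim_row B \<Longrightarrow> dim_col A = dim_col B \<Longrightarrow> qadj (A - B) = qadj A - qadj B"
  by (rule eq_matI) auto

lemma qadj_smult_real: "qadj (quat_of_real r \<cdot>\<^sub>m A) = quat_of_real r \<cdot>\<^sub>m qadj A"
  by (rule eq_matI) (auto simp: qcnj_mult quat_of_real_comm)

text \<open>A scalar leaves the right factor only by passing the entries of \<open>A\<close>, which
  requires it to be central.\<close>

lemma smult_real_mult:
  "dim_col A = dim_row B \<Longrightarrow> A * (quat_of_real r \<cdot>\<^sub>m B) = quat_of_real r \<cdot>\<^sub>m (A * B)"
  by (rule eq_matI)
     (auto simp: scalar_prod_def sum_distrib_left quat_of_real_lcomm intro!: sum.cong)

lemma smult_mult: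
  fixes A B :: "'a::semiring_0 mat"
  shows "dim_col A = dim_row B \<Longrightarrow> (c \<cdot>\<^sub>m A) * B = c \<cdot>\<^sub>m (A * B)"
  by (rule eq_matI) (auto simp: scalar_prod_def sum_distrib_left mult.assoc intro!: sum.cong)

section \<open>Juxtaposition, stacking and direct sums of matrices\<close>

definition hcat :: "'a mat \<Rightarrow> 'a mat \<Rightarrow> 'a mat" where
  "hcat A B = mat (dim_row A) (dim_col A + dim_col B)
     (\<lambda>(i,j). if j < dim_col A then A $$ (i,j) else B $$ (i, j - dim_col A))"

definition vcat :: "'a mat \<Rightarrow> 'a mat \<Rightarrow> 'a mat" where
  "vcat A B = mat (dim_row A + dim_row B) (dim_col A)
     (\<lambda>(i,j). if i < dim_row A then A $$ (i,j) else B $$ (i - dim_row A, j))"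

definition dsum :: "'a::zero mat \<Rightarrow> 'a mat \<Rightarrow> 'a mat" where
  "dsum A B = four_block_mat A (0\<^sub>m (dim_row A) (dim_col B)) (0\<^sub>m (dim_row B) (dim_col A)) B"

lemma hcat_dim [simp]: "dim_row (hcat A B) = dim_row A" "dim_col (hcat A B) = dim_col A + dim_col B"
  by (auto simp: hcat_def)

lemma vcat_dim [simp]: "dim_row (vcat A B) = dim_row A + dim_row B" "dim_col (vcat A B) = dim_col A"
  by (auto simp: vcat_def)

lemma dsum_dim [simp]: "dim_row (dsum A B) = dim_row A + dim_row B" "dim_col (dsum A B) = dim_col A + dim_col B"
  by (auto simp: dsum_def)

lemma hcat_carrier: "A \<in> carrier_mat n p \<Longrightarrow> B \<in> carrier_mat n q \<Longrightarrow> hcat A B \<in> carrier_mat n (p + q)"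
  by auto

lemma dsum_carrier: "A \<in> carrier_mat n p \<Longrightarrow> B \<in> carrier_mat m q \<Longrightarrow> dsum A B \<in> carrier_mat (n + m) (p + q)"
  by auto

lemma sum_lessThan_add:
  fixes f :: "nat \<Rightarrow> 'a::comm_monoid_add"
  shows "(\<Sum>i = 0..<m + n. f i) = (\<Sum>i = 0..<m. f i) + (\<Sum>i = 0..<n. f (m + i))"
  by (induction n) (auto simp: add.assoc)

lemma mult_hcat:
  fixes A B C :: "'a::semiring_0 mat"
  shows "dim_row A = dim_row B \<Longrightarrow> dim_col C = dim_row A \<Longrightarrow> C * hcat A B = hcat (C * A) (C * B)"
  by (rule eq_matI) (auto simp: scalar_prod_def hcat_def intro!: sum.cong)

lemma vcat_mult:
  fixes A B C :: "'a::semiring_0 mat"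
  shows "dim_col A = dim_col B \<Longrightarrow> dim_col A = dim_row C \<Longrightarrow> vcat A B * C = vcat (A * C) (B * C)"
  by (rule eq_matI) (auto simp: scalar_prod_def vcat_def intro!: sum.cong)

lemma hcat_mult_vcat:
  fixes A B C D :: "'a::semiring_0 mat"
  shows "dim_row A = dim_row B \<Longrightarrow> dim_col C = dim_col D \<Longrightarrow> dim_col A = dim_row C \<Longrightarrow>
    dim_col B = dim_row D \<Longrightarrow> hcat A B * vcat C D = A * C + B * D"
  by (rule eq_matI) (auto simp: scalar_prod_def hcat_def vcat_def sum_lessThan_add)

lemma hcat_mult_four_block:
  fixes A B C D :: "'a::semiring_0 mat"
  shows "dim_row A = dim_row B \<Longrightarrow> dim_row C1 = dim_row C2 \<Longrightarrow> dim_row C3 = dim_row C4 \<Longrightarrow>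
    dim_col C1 = dim_col C3 \<Longrightarrow> dim_col C2 = dim_col C4 \<Longrightarrow> dim_col A = dim_row C1 \<Longrightarrow> dim_col B = dim_row C4 \<Longrightarrow>
    hcat A B * four_block_mat C1 C2 C3 C4 = hcat (A * C1 + B * C3) (A * C2 + B * C4)"
  by (rule eq_matI) (auto simp: scalar_prod_def hcat_def sum_lessThan_add)

lemma vcat_mult_hcat:
  fixes A B C D :: "'a::semiring_0 mat"
  shows "dim_col A = dim_col B \<Longrightarrow> dim_row C = dim_row D \<Longrightarrow> dim_col A = dim_row C \<Longrightarrow>
    vcat A B * hcat C D = four_block_mat (A * C) (A * D) (B * C) (B * D)"
  by (rule eq_matI) (auto simp: scalar_prod_def hcat_def vcat_def)

lemma hcat_mult_dsum:
  fixes A B C D :: "'a::semiring_0 mat"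
  shows "dim_row A = dim_row B \<Longrightarrow> dim_col A = dim_row C \<Longrightarrow> dim_col B = dim_row D \<Longrightarrow>
    hcat A B * dsum C D = hcat (A * C) (B * D)"
  unfolding dsum_def by (subst hcat_mult_four_block) (auto intro!: arg_cong2[of _ _ _ _ hcat])

lemma qadj_hcat: "dim_row A = dim_row B \<Longrightarrow> qadj (hcat A B) = vcat (qadj A) (qadj B)"
  by (rule eq_matI) (auto simp: hcat_def vcat_def)

lemma hcat_assoc:
  "dim_row A = dim_row B \<Longrightarrow> dim_row B = dim_row C \<Longrightarrow> hcat (hcat A B) C = hcat A (hcat B C)"
  by (rule eq_matI) (auto simp: hcat_def diff_diff_add)

lemma hcat_zero: "hcat (0\<^sub>m n p) (0\<^sub>m n q) = 0\<^sub>m n (p + q)"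
  by (rule eq_matI) (auto simp: hcat_def)

lemma hcat_eqD:
  assumes "hcat A B = hcat C D" "dim_col A = dim_col C" "dim_row B = dim_row A" "dim_row D = dim_row C"
  shows "A = C" "B = D"
proof -
  have d: "dim_row A = dim_row C" "dim_col B = dim_col D"
    using assms(1,2) by (metis hcat_dim(1), metis hcat_dim(2) add_left_cancel)
  have e: "hcat A B $$ (i,j) = hcat C D $$ (i,j)" for i j using assms(1) by simp
  show "A = C"
  proof (rule eq_matI)
    fix i j assume "i < dim_row C" "j < dim_col C"
    thus "A $$ (i,j) = C $$ (i,j)" using e[of i j] d assms(2) by (auto simp: hcat_def)
  qed (use d assms in auto)
  show "B = D"
  proof (rule eq_matI)
    fix i j assume "i < dim_row D" "j < dim_col D"
    thus "B $$ (i,j) = D $$ (i,j)" using e[of i "dim_col A + j"] d assms by (auto simp: hcat_def)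
  qed (use d assms in auto)
qed

lemma dsum_index:
  "i < dim_row A + dim_row B \<Longrightarrow> j < dim_col A + dim_col B \<Longrightarrow>
   dsum A B $$ (i,j) = (if i < dim_row A then if j < dim_col A then A $$ (i,j) else 0
     else if j < dim_col A then 0 else B $$ (i - dim_row A, j - dim_col A))"
  by (auto simp: dsum_def)

lemma dsum_mult:
  fixes A B C D :: "'a::semiring_0 mat"
  shows "dim_col A = dim_row C \<Longrightarrow> dim_col B = dim_row D \<Longrightarrow> dsum A B * dsum C D = dsum (A * C) (B * D)"
  unfolding dsum_def
  by (subst mult_four_block_mat[of _ "dim_row A" "dim_col A" _ "dim_col B" _ "dim_row B" _ _ "dim_col C" _ "dim_col D"])
     (auto intro!: cong_four_block_mat)

lemma qadj_dsum: "qadj (dsum A B) = dsum (qadj A) (qadj B)"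
  by (rule eq_matI) (auto simp: dsum_index)

lemma dsum_one: "dsum (1\<^sub>m n) (1\<^sub>m m) = 1\<^sub>m (n + m)"
  unfolding dsum_def by simp

lemma dsum_zero: "dsum (0\<^sub>m n p) (0\<^sub>m m q) = 0\<^sub>m (n + m) (p + q)"
  unfolding dsum_def by simp

lemma dsum_add: "dim_row A = dim_row C \<Longrightarrow> dim_col A = dim_col C \<Longrightarrow> dim_row B = dim_row D \<Longrightarrow> dim_col B = dim_col D \<Longrightarrow>
  dsum (A::'a::monoid_add mat) B + dsum C D = dsum (A + C) (B + D)"
  by (rule eq_matI) (auto simp: dsum_index)

lemma dsum_assoc: "dsum (dsum A B) C = dsum A (dsum B C)"
  using assoc_four_block_mat[of A B C] by (simp add: dsum_def)

lemma diag_block_Cons: "diag_block_mat (A # As) = dsum A (diag_block_mat As)"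
  by (simp add: dsum_def Let_def)

lemma dsum_empty [simp]: "dsum (0\<^sub>m 0 0) A = A" "dsum A (0\<^sub>m 0 0) = A"
  by (rule eq_matI, auto simp: dsum_index)+

lemma diag_block_append: "diag_block_mat (As @ Bs) = dsum (diag_block_mat As) (diag_block_mat Bs)"
proof (induction As)
  case (Cons A As)
  thus ?case by (simp add: diag_block_Cons dsum_assoc del: diag_block_mat.simps)
qed auto

declare diag_block_mat.simps(2) [simp del]

lemma four_block_eqD:
  assumes "four_block_mat A B C D = four_block_mat A' B' C' D'"
    "A \<in> carrier_mat p q" "B \<in> carrier_mat p s" "C \<in> carrier_mat r q" "D \<in> carrier_mat r s"
    "A' \<in> carrier_mat p q" "B' \<in> carrier_mat p s" "C' \<in> carrier_mat r q" "D' \<in> carrier_mat r s"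
  shows "A = A'" "B = B'" "C = C'" "D = D'"
proof -
  have e: "four_block_mat A B C D $$ (i,j) = four_block_mat A' B' C' D' $$ (i,j)" for i j
    using assms(1) by simp
  show "A = A'"
  proof (rule eq_matI)
    fix i j assume "i < dim_row A'" "j < dim_col A'"
    thus "A $$ (i,j) = A' $$ (i,j)" using e[of i j] assms(2-) by auto
  qed (use assms in auto)
  show "B = B'"
  proof (rule eq_matI)
    fix i j assume "i < dim_row B'" "j < dim_col B'"
    thus "B $$ (i,j) = B' $$ (i,j)" using e[of i "q + j"] assms(2-) by auto
  qed (use assms in auto)
  show "C = C'"
  proof (rule eq_matI)
    fix i j assume "i < dim_row C'" "j < dim_col C'"
    thus "C $$ (i,j) = C' $$ (i,j)" using e[of "p + i" j] assms(2-) by auto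
  qed (use assms in auto)
  show "D = D'"
  proof (rule eq_matI)
    fix i j assume "i < dim_row D'" "j < dim_col D'"
    thus "D $$ (i,j) = D' $$ (i,j)" using e[of "p + i" "q + j"] assms(2-) by auto
  qed (use assms in auto)
qed

lemma dsum_eqD:
  assumes "dsum A B = dsum A' B'"
    "A \<in> carrier_mat p q" "B \<in> carrier_mat r s" "A' \<in> carrier_mat p q" "B' \<in> carrier_mat r s"
  shows "A = A'" "B = B'"
  using four_block_eqD[OF assms(1)[unfolded dsum_def], of p q s r] assms by auto

text \<open>Over a noncommutative ring, right multiplication by a scalar commutes with the
  application of a matrix, while left multiplication does not.\<close>

definition rscale :: "'a::times vec \<Rightarrow> 'a \<Rightarrow> 'a vec" where
  "rscale v c = map_vec (\<lambda>x. x * c) v"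

lemma rscale_carrier [simp]: "rscale v c \<in> carrier_vec n \<longleftrightarrow> v \<in> carrier_vec n"
  by (auto simp: rscale_def)

lemma rscale_dim [simp]: "dim_vec (rscale v c) = dim_vec v"
  by (auto simp: rscale_def)

lemma rscale_index [simp]: "i < dim_vec v \<Longrightarrow> rscale v c $ i = v $ i * c"
  by (auto simp: rscale_def)

lemma mult_rscale:
  fixes A :: "'a::semiring_0 mat"
  shows "dim_col A = dim_vec v \<Longrightarrow> A *\<^sub>v rscale v c = rscale (A *\<^sub>v v) c"
  by (rule eq_vecI) (auto simp: scalar_prod_def sum_distrib_right mult.assoc intro!: sum.cong)

definition col_mat :: "'a vec \<Rightarrow> 'a mat" where
  "col_mat v = mat (dim_vec v) 1 (\<lambda>(i,j). v $ i)"

lemma col_mat_dim [simp]: "dim_row (col_mat v) = dim_vec v" "dim_col (col_mat v) = 1"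
  by (auto simp: col_mat_def)

lemma col_mat_mult: 
  fixes v :: "'a::semiring_0 vec"
  shows "dim_vec c = 1 \<Longrightarrow> col_mat v *\<^sub>v c = rscale v (c $ 0)"
  by (rule eq_vecI) (auto simp: col_mat_def scalar_prod_def)

lemma mult_col_mat:
  fixes v :: "'a::semiring_0 vec"
  shows "A * col_mat v = col_mat (A *\<^sub>v v)"
  by (rule eq_matI) (auto simp: col_mat_def scalar_prod_def)

lemma hcat_mult_append:
  fixes A B :: "'a::semiring_0 mat"
  shows "dim_row A = dim_row B \<Longrightarrow> dim_col A = dim_vec a \<Longrightarrow> dim_col B = dim_vec b \<Longrightarrow>
   hcat A B *\<^sub>v (a @\<^sub>v b) = A *\<^sub>v a + B *\<^sub>v b"
  by (rule eq_vecI) (auto simp: scalar_prod_def hcat_def sum_lessThan_add)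

lemma dsum_mult_append:
  fixes A B :: "'a::semiring_0 mat"
  shows "dim_col A = dim_vec a \<Longrightarrow> dim_col B = dim_vec b \<Longrightarrow>
   dsum A B *\<^sub>v (a @\<^sub>v b) = (A *\<^sub>v a) @\<^sub>v (B *\<^sub>v b)"
  by (rule eq_vecI) (auto simp: scalar_prod_def dsum_index sum_lessThan_add)

lemma vec_split:
  assumes "v \<in> carrier_vec (n + m)"
  obtains a b where "v = a @\<^sub>v b" "a \<in> carrier_vec n" "b \<in> carrier_vec m"
proof
  show "v = vec_first v n @\<^sub>v vec_last v m" using assms by simp
qed auto

lemma append_zero_vec: "0\<^sub>v n @\<^sub>v 0\<^sub>v m = 0\<^sub>v (n + m)"
  by (rule eq_vecI) auto

lemma append_vec_eq_0:
  "a \<in> carrier_vec n \<Longrightarrow> b \<in> carrier_vec m \<Longrightarrow> a @\<^sub>v b = 0\<^sub>v (n + m) \<longleftrightarrow> a = 0\<^sub>v n \<and> b = 0\<^sub>v m"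
  using append_vec_eq[of a n "0\<^sub>v n" b "0\<^sub>v m"]
  by (metis append_zero_vec zero_carrier_vec)

text \<open>Trivial kernel, the substitute for a nonvanishing determinant. For a rectangular matrix
  it expresses right linear independence of the columns.\<close>

definition minj :: "'a::semiring_0 mat \<Rightarrow> bool" where
  "minj M \<longleftrightarrow> (\<forall>v\<in>carrier_vec (dim_col M). M *\<^sub>v v = 0\<^sub>v (dim_row M) \<longrightarrow> v = 0\<^sub>v (dim_col M))"

lemma minjD:
  "minj M \<Longrightarrow> M \<in> carrier_mat n m \<Longrightarrow> v \<in> carrier_vec m \<Longrightarrow> M *\<^sub>v v = 0\<^sub>v n \<Longrightarrow> v = 0\<^sub>v m"
  unfolding minj_def by auto

lemma minjI:
  "M \<in> carrier_mat n m \<Longrightarrow> (\<And>v. v \<in> carrier_vec m \<Longrightarrow> M *\<^sub>v v = 0\<^sub>v n \<Longrightarrow> v = 0\<^sub>v m) \<Longrightarrow> minj M"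
  unfolding minj_def by auto

lemma minj_mult_zero:
  fixes M :: "'a::semiring_0 mat"
  assumes "minj M" "M \<in> carrier_mat n m" "C \<in> carrier_mat m k" "M * C = 0\<^sub>m n k"
  shows "C = 0\<^sub>m m k"
proof (rule eq_matI)
  fix i j assume ij: "i < dim_row (0\<^sub>m m k :: 'a mat)" "j < dim_col (0\<^sub>m m k :: 'a mat)"
  have "M *\<^sub>v col C j = col (M * C) j"
    using ij by (intro col_mult2[OF assms(2,3), symmetric]) auto
  also have "\<dots> = 0\<^sub>v n" unfolding assms(4) using ij by auto
  finally have "col C j = 0\<^sub>v m" using minjD[OF assms(1,2)] assms(3) ij by auto
  hence "col C j $ i = 0" using ij by auto
  thus "C $$ (i,j) = 0\<^sub>m m k $$ (i,j)" using ij assms(3) by auto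
qed (use assms in auto)

lemma minj_mult_cancel:
  fixes M :: "'a::ring mat"
  assumes "minj M" "M \<in> carrier_mat n m" "C \<in> carrier_mat m k" "D \<in> carrier_mat m k" "M * C = M * D"
  shows "C = D"
proof -
  have "M * (C - D) = 0\<^sub>m n k"
    using assms by (subst mult_minus_distrib_mat[OF assms(2-4)]) auto
  hence "C - D = 0\<^sub>m m k" using minj_mult_zero[OF assms(1,2) minus_carrier_mat[OF assms(4)]] by auto
  hence e: "(C - D) $$ (i,j) = 0\<^sub>m m k $$ (i,j)" for i j by simp
  show ?thesis
  proof (rule eq_matI)
    fix i j assume "i < dim_row D" "j < dim_col D"
    thus "C $$ (i,j) = D $$ (i,j)" using e[of i j] assms(3,4) by auto
  qed (use assms in auto)
qed

lemma homogeneous_system: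
  fixes M :: "'a::division_ring mat"
  assumes "M \<in> carrier_mat m n" "m < n"
  shows "\<exists>v\<in>carrier_vec n. v \<noteq> 0\<^sub>v n \<and> M *\<^sub>v v = 0\<^sub>v m"
proof -
  obtain c where c: "\<exists>j\<in>{0..<n}. c j \<noteq> 0" "\<forall>i\<in>{0..<m}. (\<Sum>j\<in>{0..<n}. M $$ (i,j) * c j) = 0"
    using homogeneous_system_set[of "{0..<m}" "{0..<n}" "\<lambda>i j. M $$ (i,j)"] assms by auto
  have "vec n c \<noteq> 0\<^sub>v n" using c(1) by (metis atLeastLessThan_iff index_vec index_zero_vec(1))
  moreover have "M *\<^sub>v vec n c = 0\<^sub>v m"
    using c(2) assms by (intro eq_vecI) (auto simp: scalar_prod_def)
  ultimately show ?thesis by (intro bexI[of _ "vec n c"]) auto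
qed

lemma minj_dim_le:
  fixes M :: "'a::division_ring mat"
  assumes "minj M" "M \<in> carrier_mat m n"
  shows "n \<le> m"
  using homogeneous_system[of M m n] minjD[OF assms] assms(2) by (meson not_le)

lemma invertible_matE:
  assumes "invertible_mat M" "M \<in> carrier_mat n n"
  obtains R where "R \<in> carrier_mat n n" "M * R = 1\<^sub>m n" "R * M = 1\<^sub>m n"
proof -
  from assms(1) obtain R where R: "M * R = 1\<^sub>m (dim_row M)" "R * M = 1\<^sub>m (dim_row R)"
    unfolding invertible_mat_def inverts_mat_def by auto
  have "dim_row R = n" using arg_cong[OF R(2), of dim_col] assms(2) by auto
  moreover have "dim_col R = n" using arg_cong[OF R(1), of dim_col] assms(2) by auto
  ultimately show ?thesis using R that[of R] assms(2) by auto
qed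

lemma invertible_matI:
  assumes "M \<in> carrier_mat n n" "R \<in> carrier_mat n n" "M * R = 1\<^sub>m n" "R * M = 1\<^sub>m n"
  shows "invertible_mat M"
  using assms unfolding invertible_mat_def inverts_mat_def by auto

lemma left_inverse_minj:
  fixes M :: "'a::semiring_1 mat"
  assumes "L \<in> carrier_mat m n" "M \<in> carrier_mat n m" "L * M = 1\<^sub>m m"
  shows "minj M"
proof (rule minjI[OF assms(2)])
  fix v :: "'a vec" assume v: "v \<in> carrier_vec m" "M *\<^sub>v v = 0\<^sub>v n"
  have "v = (L * M) *\<^sub>v v" using v assms by auto
  also have "\<dots> = L *\<^sub>v (M *\<^sub>v v)" by (rule assoc_mult_mat_vec[OF assms(1,2) v(1)])
  also have "\<dots> = 0\<^sub>v m" unfolding v(2) using assms by auto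
  finally show "v = 0\<^sub>v m" .
qed

lemma mult_mat_eq_cols:
  fixes M :: "'a::semiring_0 mat"
  assumes "M \<in> carrier_mat n m" "\<And>j. j < k \<Longrightarrow> x j \<in> carrier_vec m"
    "\<And>j. j < k \<Longrightarrow> M *\<^sub>v x j = col C j" "C \<in> carrier_mat n k"
  shows "M * mat m k (\<lambda>(i,j). x j $ i) = C"
proof (rule eq_matI)
  fix i j assume ij: "i < dim_row C" "j < dim_col C"
  have "col (mat m k (\<lambda>(i,j). x j $ i)) j = x j"
    using ij assms(2)[of j] assms(4) by (intro eq_vecI) auto
  hence "(M * mat m k (\<lambda>(i,j). x j $ i)) $$ (i,j) = (M *\<^sub>v x j) $ i"
    using ij assms(1,4) by (auto simp del: assms(3))
  thus "(M * mat m k (\<lambda>(i,j). x j $ i)) $$ (i,j) = C $$ (i,j)" using ij assms by auto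
qed (use assms in auto)

text \<open>For every \<open>b\<close> the matrix \<open>hcat M (col_mat b)\<close> has more columns
  than rows and hence a nonzero kernel vector, whose last coordinate cannot vanish when
  \<open>M\<close> is injective; so \<open>b\<close> lies in the range of \<open>M\<close>. The
  right inverse obtained from the unit vectors is two-sided because \<open>M\<close> can be
  cancelled.\<close>

lemma minj_square_invertible:
  fixes M :: "'a::division_ring mat"
  assumes "minj M" "M \<in> carrier_mat n n"
  shows "invertible_mat M"
proof -
  have "\<exists>x\<in>carrier_vec n. M *\<^sub>v x = b" if b: "b \<in> carrier_vec n" for b
  proof -
    have "hcat M (col_mat b) \<in> carrier_mat n (n + 1)" using assms(2) b by auto
    from homogeneous_system[OF this] obtain v where v: "v \<in> carrier_vec (n+1)"
      "v \<noteq> 0\<^sub>v (n+1)" "hcat M (col_mat b) *\<^sub>v v = 0\<^sub>v n" by auto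
    obtain c d where cd: "v = c @\<^sub>v d" "c \<in> carrier_vec n" "d \<in> carrier_vec 1"
      using vec_split[OF v(1)] by metis
    have e: "M *\<^sub>v c + rscale b (d $ 0) = 0\<^sub>v n"
      using v(3) cd assms(2) b by (simp add: hcat_mult_append col_mat_mult)
    have d0: "d $ 0 \<noteq> 0"
    proof
      assume 0: "d $ 0 = 0"
      hence "rscale b (d $ 0) = 0\<^sub>v n" using b by (intro eq_vecI) auto
      hence "M *\<^sub>v c = 0\<^sub>v n" using e cd assms(2) by auto
      hence "c = 0\<^sub>v n" using minjD[OF assms] cd by auto
      moreover have "d = 0\<^sub>v 1" using 0 cd by (intro eq_vecI) auto
      ultimately show False using v(2) cd by auto
    qed
    define x where "x = rscale c (- inverse (d $ 0))"
    have "M *\<^sub>v x = rscale (M *\<^sub>v c) (- inverse (d $ 0))"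
      unfolding x_def using assms(2) cd by (intro mult_rscale) auto
    also have "\<dots> = b"
    proof (rule eq_vecI)
      fix i assume i: "i < dim_vec b"
      have "(M *\<^sub>v c + rscale b (d $ 0)) $ i = 0" unfolding e using i b by auto
      hence "(M *\<^sub>v c) $ i = - (b $ i * d $ 0)"
        using i b assms(2) cd by (auto simp: eq_neg_iff_add_eq_0)
      thus "rscale (M *\<^sub>v c) (- inverse (d $ 0)) $ i = b $ i"
        using i b assms(2) d0 by (simp add: mult.assoc)
    qed (use assms(2) b in auto)
    finally show ?thesis using cd by (intro bexI[of _ x]) (auto simp: x_def)
  qed
  hence "\<forall>j. \<exists>x. x \<in> carrier_vec n \<and> (j < n \<longrightarrow> M *\<^sub>v x = col (1\<^sub>m n) j)"
    by (metis col_dim index_one_mat(2))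
  then obtain x where x: "\<And>j. x j \<in> carrier_vec n" "\<And>j. j < n \<Longrightarrow> M *\<^sub>v x j = col (1\<^sub>m n) j"
    by metis
  define R where "R = mat n n (\<lambda>(i,j). x j $ i)"
  have R: "R \<in> carrier_mat n n" "M * R = 1\<^sub>m n"
    unfolding R_def using mult_mat_eq_cols[of M n n n x "1\<^sub>m n"] assms(2) x by auto
  have "M * (R * M) = M * 1\<^sub>m n" using R assms(2) by (simp add: mult_assoc_dim[symmetric])
  hence "R * M = 1\<^sub>m n" using minj_mult_cancel[OF assms, of "R * M" n "1\<^sub>m n"] R assms(2) by auto
  thus ?thesis using invertible_matI[OF assms(2) R(1) R(2)] by simp
qed

lemma invertible_minj:
  fixes M :: "'a::semiring_1 mat"
  assumes "invertible_mat M" "M \<in> carrier_mat n n" shows "minj M"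
  using invertible_matE[OF assms] left_inverse_minj assms(2) by metis

lemma right_inverse_invertible:
  fixes M :: "'a::division_ring mat"
  assumes "M \<in> carrier_mat n n" "R \<in> carrier_mat n n" "M * R = 1\<^sub>m n"
  shows "invertible_mat M" "R * M = 1\<^sub>m n"
proof -
  have "minj R" using left_inverse_minj assms by blast
  from invertible_matE[OF minj_square_invertible[OF this assms(2)] assms(2)]
  obtain Q where Q: "Q \<in> carrier_mat n n" "R * Q = 1\<^sub>m n" "Q * R = 1\<^sub>m n" by auto
  have "M = M * (R * Q)" using Q assms by simp
  also have "\<dots> = (M * R) * Q" using Q(1) assms(1,2) by (intro mult_assoc_dim[symmetric]) auto
  also have "\<dots> = Q" using Q assms by simp
  finally have "M = Q" .
  thus "R * M = 1\<^sub>m n" using Q by simp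
  thus "invertible_mat M" using invertible_matI assms by metis
qed

lemma invertible_mult:
  fixes M :: "'a::semiring_1 mat"
  assumes "invertible_mat M" "M \<in> carrier_mat n n" "invertible_mat N" "N \<in> carrier_mat n n"
  shows "invertible_mat (M * N)"
proof -
  obtain R where R: "R \<in> carrier_mat n n" "M * R = 1\<^sub>m n" "R * M = 1\<^sub>m n" using invertible_matE assms by metis
  obtain Q where Q: "Q \<in> carrier_mat n n" "N * Q = 1\<^sub>m n" "Q * N = 1\<^sub>m n" using invertible_matE assms by metis
  have "(M * N) * (Q * R) = M * ((N * Q) * R)" using assms R(1) Q(1) by (simp add: mult_assoc_dim)
  also have "\<dots> = 1\<^sub>m n" using R Q by simp
  finally have 1: "(M * N) * (Q * R) = 1\<^sub>m n" .
  have "(Q * R) * (M * N) = Q * ((R * M) * N)" using assms R(1) Q(1) by (simp add: mult_assoc_dim)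
  also have "\<dots> = 1\<^sub>m n" using R Q assms by simp
  finally show ?thesis using invertible_matI[OF _ _ 1] assms R Q by auto
qed

lemma invertible_dsum:
  fixes A B :: "'a::semiring_1 mat"
  assumes "invertible_mat A" "A \<in> carrier_mat n n" "invertible_mat B" "B \<in> carrier_mat m m"
  shows "invertible_mat (dsum A B)"
proof -
  obtain R where R: "R \<in> carrier_mat n n" "A * R = 1\<^sub>m n" "R * A = 1\<^sub>m n" using invertible_matE assms by metis
  obtain Q where Q: "Q \<in> carrier_mat m m" "B * Q = 1\<^sub>m m" "Q * B = 1\<^sub>m m" using invertible_matE assms by metis
  show ?thesis
    by (rule invertible_matI[of _ "n + m" "dsum R Q"]) (use assms R Q in \<open>auto simp: dsum_mult dsum_one\<close>)
qed

lemma invertible_one [simp]: "invertible_mat (1\<^sub>m n :: 'a::semiring_1 mat)"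
  by (rule invertible_matI[of _ n "1\<^sub>m n"]) auto

lemma qadj_invertible:
  assumes "invertible_mat A" "A \<in> carrier_mat n n"
  shows "invertible_mat (qadj A)"
proof -
  obtain R where R: "R \<in> carrier_mat n n" "A * R = 1\<^sub>m n" "R * A = 1\<^sub>m n" using invertible_matE assms by metis
  have "qadj A * qadj R = qadj (R * A)" "qadj R * qadj A = qadj (A * R)"
    using R(1) assms by (auto simp: qadj_mult)
  thus ?thesis using R assms by (intro invertible_matI[of _ n "qadj R"]) auto
qed

lemma qinv:
  assumes "invertible_mat A" "A \<in> carrier_mat n n"
  shows "qinv A \<in> carrier_mat n n" "A * qinv A = 1\<^sub>m n" "qinv A * A = 1\<^sub>m n"
proof -
  obtain R where R: "R \<in> carrier_mat n n" "A * R = 1\<^sub>m n" "R * A = 1\<^sub>m n" using invertible_matE assms by metis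
  have "qinv A \<in> carrier_mat n n \<and> A * qinv A = 1\<^sub>m n \<and> qinv A * A = 1\<^sub>m n"
    unfolding qinv_def carrier_matD(1)[OF assms(2)] using assms(2) R
    by (intro someI[of "\<lambda>B. B \<in> carrier_mat n n \<and> A * B = 1\<^sub>m n \<and> B * A = 1\<^sub>m n" R]) auto
  thus "qinv A \<in> carrier_mat n n" "A * qinv A = 1\<^sub>m n" "qinv A * A = 1\<^sub>m n" by auto
qed

text \<open>With fewer than \<open>n\<close> columns the range of \<open>V\<close> misses some
  \<open>w\<close>: otherwise \<open>V\<close> would have a right inverse, an injective map from
  dimension \<open>n\<close> to the smaller dimension \<open>m\<close>. Prepending \<open>w\<close>
  keeps the columns independent.\<close>

lemma minj_extend_basis:
  fixes V :: "'a::division_ring mat"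
  assumes "minj V" "V \<in> carrier_mat n m"
  shows "\<exists>W\<in>carrier_mat n (n - m). invertible_mat (hcat W V)"
  using assms
proof (induction "n - m" arbitrary: V m)
  case 0
  have "m = n" using minj_dim_le[OF 0(2,3)] 0 by simp
  have "hcat (0\<^sub>m n 0) V = V" using 0(3) by (intro eq_matI) (auto simp: hcat_def)
  thus ?case using minj_square_invertible 0 \<open>m = n\<close>
    by (intro bexI[of _ "0\<^sub>m n 0"]) auto
next
  case (Suc k)
  hence mn: "m < n" by simp
  have "\<exists>w\<in>carrier_vec n. \<forall>v\<in>carrier_vec m. V *\<^sub>v v \<noteq> w"
  proof (rule ccontr)
    assume "\<not> ?thesis"
    hence "\<forall>j. \<exists>x. x \<in> carrier_vec m \<and> (j < n \<longrightarrow> V *\<^sub>v x = col (1\<^sub>m n) j)"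
      by (metis col_dim index_one_mat(2))
    then obtain x where x: "\<And>j. x j \<in> carrier_vec m" "\<And>j. j < n \<Longrightarrow> V *\<^sub>v x j = col (1\<^sub>m n) j"
      by metis
    define R where "R = mat m n (\<lambda>(i,j). x j $ i)"
    have R: "R \<in> carrier_mat m n" "V * R = 1\<^sub>m n"
      unfolding R_def using mult_mat_eq_cols[of V n m n x "1\<^sub>m n"] Suc.prems(2) x by auto
    have "minj R" by (rule left_inverse_minj[OF Suc.prems(2) R])
    from minj_dim_le[OF this R(1)] mn show False by simp
  qed
  then obtain w where w: "w \<in> carrier_vec n" "\<And>v. v \<in> carrier_vec m \<Longrightarrow> V *\<^sub>v v \<noteq> w" by auto
  define V' where "V' = hcat (col_mat w) V"
  have V': "V' \<in> carrier_mat n (Suc m)" using w(1) Suc.prems(2) by (auto simp: V'_def)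
  have "minj V'"
  proof (rule minjI[OF V'])
    fix v :: "'a vec" assume v: "v \<in> carrier_vec (Suc m)" "V' *\<^sub>v v = 0\<^sub>v n"
    obtain c d where cd: "v = c @\<^sub>v d" "c \<in> carrier_vec 1" "d \<in> carrier_vec m"
      using vec_split[of v 1 m] v(1) by auto
    have e: "rscale w (c $ 0) + V *\<^sub>v d = 0\<^sub>v n"
      using v(2) cd Suc.prems(2) w(1) by (simp add: V'_def hcat_mult_append col_mat_mult)
    have ei: "w $ i * c $ 0 + (V *\<^sub>v d) $ i = 0" if "i < n" for i
      using arg_cong[OF e, of "\<lambda>v. v $ i"] that w(1) Suc.prems(2) by auto
    have c0: "c $ 0 = 0"
    proof (rule ccontr)
      assume c0: "c $ 0 \<noteq> 0"
      have "V *\<^sub>v rscale d (- inverse (c $ 0)) = rscale (V *\<^sub>v d) (- inverse (c $ 0))"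
        using Suc.prems(2) cd by (intro mult_rscale) auto
      also have "\<dots> = w"
      proof (rule eq_vecI)
        fix i assume i: "i < dim_vec w"
        have "(V *\<^sub>v d) $ i = - (w $ i * c $ 0)" using ei[of i] i w(1)
          by (metis add.commute carrier_vecD eq_neg_iff_add_eq_0)
        thus "rscale (V *\<^sub>v d) (- inverse (c $ 0)) $ i = w $ i"
          using i w(1) Suc.prems(2) c0 by (simp add: mult.assoc)
      qed (use w(1) Suc.prems(2) in auto)
      finally show False using w(2) cd by (metis rscale_carrier)
    qed
    have "V *\<^sub>v d = 0\<^sub>v n" using ei Suc.prems(2) by (intro eq_vecI) (auto simp: c0)
    hence "d = 0\<^sub>v m" using minjD[OF Suc.prems] cd by auto
    moreover have "c = 0\<^sub>v 1" using c0 cd by (intro eq_vecI) auto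
    ultimately show "v = 0\<^sub>v (Suc m)" using cd by (metis append_zero_vec plus_1_eq_Suc)
  qed
  have "k = n - Suc m" using Suc.hyps(2) by simp
  from Suc.hyps(1)[OF this \<open>minj V'\<close> V'] obtain W where
    W: "W \<in> carrier_mat n (n - Suc m)" "invertible_mat (hcat W V')" by auto
  have "hcat (hcat W (col_mat w)) V = hcat W V'" unfolding V'_def
    using W(1) w(1) Suc.prems(2) by (intro hcat_assoc) auto
  thus ?case using W w(1) mn by (intro bexI[of _ "hcat W (col_mat w)"]) auto
qed

text \<open>A nonzero kernel vector is completed to a basis with that vector last; it then produces
  a zero column, and the remaining columns are treated recursively.\<close>

lemma column_rank_factorization:
  fixes M :: "'a::division_ring mat"
  assumes "M \<in> carrier_mat m n"
  shows "\<exists>T r M0. T \<in> carrier_mat n n \<and> invertible_mat T \<and> r \<le> n \<and> M0 \<in> carrier_mat m r \<and> minj M0 \<and>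
     M * T = hcat M0 (0\<^sub>m m (n - r))"
  using assms
proof (induction n arbitrary: M)
  case 0
  thus ?case by (intro exI[of _ "1\<^sub>m 0"] exI[of _ 0] exI[of _ M]) (auto intro!: minjI eq_matI)
next
  case (Suc n)
  show ?case
  proof (cases "minj M")
    case True
    have "hcat M (0\<^sub>m m 0) = M" using Suc.prems by (intro eq_matI) (auto simp: hcat_def)
    thus ?thesis using True Suc.prems
      by (intro exI[of _ "1\<^sub>m (Suc n)"] exI[of _ "Suc n"] exI[of _ M]) auto
  next
    case False
    then obtain v where v: "v \<in> carrier_vec (Suc n)" "v \<noteq> 0\<^sub>v (Suc n)" "M *\<^sub>v v = 0\<^sub>v m"
      unfolding minj_def using Suc.prems by auto
    have cv: "col_mat v \<in> carrier_mat (Suc n) 1" using v by auto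
    obtain i where i: "i < Suc n" "v $ i \<noteq> 0" using v(1,2) by (metis carrier_vecD eq_vecI index_zero_vec)
    have "minj (col_mat v)"
    proof (rule minjI[OF cv])
      fix c :: "'a vec" assume c: "c \<in> carrier_vec 1" "col_mat v *\<^sub>v c = 0\<^sub>v (Suc n)"
      have "rscale v (c $ 0) $ i = 0" using c i by (simp add: col_mat_mult)
      thus "c = 0\<^sub>v 1" using i v(1) c by (intro eq_vecI) auto
    qed
    from minj_extend_basis[OF this cv] obtain W where
      W: "W \<in> carrier_mat (Suc n) n" "invertible_mat (hcat W (col_mat v))" by auto
    have "M * W \<in> carrier_mat m n" using Suc.prems W by auto
    from Suc.IH[OF this] obtain T r M0 where T: "T \<in> carrier_mat n n" "invertible_mat T" "r \<le> n"
      "M0 \<in> carrier_mat m r" "minj M0" "M * W * T = hcat M0 (0\<^sub>m m (n - r))" by auto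
    let ?T = "hcat W (col_mat v) * dsum T (1\<^sub>m 1)"
    have "invertible_mat ?T"
      by (rule invertible_mult[of _ "Suc n"]) (use T W v invertible_dsum[of T n "1\<^sub>m 1" 1] in auto)
    moreover have "M * ?T = hcat M0 (0\<^sub>m m (Suc n - r))"
    proof -
      have z: "M * col_mat v = 0\<^sub>m m 1" using v(3) by (simp add: mult_col_mat) (intro eq_matI; auto simp: col_mat_def)
      have "M * ?T = hcat (M * W) (M * col_mat v) * dsum T (1\<^sub>m 1)"
        using Suc.prems W T v by (simp add: mult_assoc_dim[symmetric] mult_hcat)
      also have "\<dots> = hcat (M * W * T) (0\<^sub>m m 1 * 1\<^sub>m 1)"
        unfolding z using Suc.prems W T by (intro hcat_mult_dsum) auto
      also have "\<dots> = hcat M0 (hcat (0\<^sub>m m (n - r)) (0\<^sub>m m 1))"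
        unfolding T(6) using T by (simp add: hcat_assoc)
      finally show ?thesis using T(3) by (simp add: hcat_zero Suc_diff_le)
    qed
    ultimately show ?thesis using W v T
      by (intro exI[of _ ?T] exI[of _ r] exI[of _ M0]) auto
  qed
qed

section \<open>Splitting off nondegenerate invariant subspaces\<close>

lemma vcat_eqD:
  assumes "vcat A B = vcat C D" "dim_row A = dim_row C" "dim_col B = dim_col A" "dim_col D = dim_col C"
  shows "A = C" "B = D"
proof -
  have d: "dim_col A = dim_col C" "dim_row B = dim_row D"
    using assms(1,2) by (metis vcat_dim(2), metis vcat_dim(1) add_left_cancel)
  have e: "vcat A B $$ (i,j) = vcat C D $$ (i,j)" for i j using assms(1) by simp
  show "A = C"
  proof (rule eq_matI)
    fix i j assume "i < dim_row C" "j < dim_col C"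
    thus "A $$ (i,j) = C $$ (i,j)" using e[of i j] d assms(2) by (auto simp: vcat_def)
  qed (use d assms in auto)
  show "B = D"
  proof (rule eq_matI)
    fix i j assume "i < dim_row D" "j < dim_col D"
    thus "B $$ (i,j) = D $$ (i,j)" using e[of "dim_row A + i" "j"] d assms by (auto simp: vcat_def)
  qed (use d assms in auto)
qed

lemma mult_zero_vec [simp]:
  fixes A :: "'a::semiring_0 mat"
  shows "A \<in> carrier_mat n m \<Longrightarrow> A *\<^sub>v 0\<^sub>v m = 0\<^sub>v n"
  by (rule eq_vecI) (auto simp: scalar_prod_def)

lemma mult_uminus_vec:
  fixes A :: "'a::ring mat"
  shows "dim_col A = dim_vec v \<Longrightarrow> A *\<^sub>v (- v) = - (A *\<^sub>v v)"
  by (rule eq_vecI) (auto simp: scalar_prod_def sum_negf)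

lemma dsum_mult_four_block:
  fixes A :: "'a::semiring_0 mat"
  assumes "A \<in> carrier_mat p q" "B \<in> carrier_mat r s" "C1 \<in> carrier_mat q k" "C2 \<in> carrier_mat q l"
    "C3 \<in> carrier_mat s k" "C4 \<in> carrier_mat s l"
  shows "dsum A B * four_block_mat C1 C2 C3 C4 = four_block_mat (A * C1) (A * C2) (B * C3) (B * C4)"
  using assms unfolding dsum_def
  by (subst mult_four_block_mat[of _ p q _ s _ r _ _ k _ l]) (auto intro!: cong_four_block_mat)

lemma four_block_mult_dsum:
  fixes A :: "'a::semiring_0 mat"
  assumes "A \<in> carrier_mat q k" "B \<in> carrier_mat s l" "C1 \<in> carrier_mat p q" "C2 \<in> carrier_mat p s"
    "C3 \<in> carrier_mat r q" "C4 \<in> carrier_mat r s"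
  shows "four_block_mat C1 C2 C3 C4 * dsum A B = four_block_mat (C1 * A) (C2 * B) (C3 * A) (C4 * B)"
  using assms unfolding dsum_def
  by (subst mult_four_block_mat[of _ p q _ s _ r _ _ k _ l]) (auto intro!: cong_four_block_mat)

lemma hcat_mult_vec_four:
  fixes A :: "'a::semiring_0 mat"
  shows "A \<in> carrier_mat m n \<Longrightarrow> B \<in> carrier_mat m p \<Longrightarrow> C \<in> carrier_mat k m \<Longrightarrow> v \<in> carrier_vec n \<Longrightarrow> w \<in> carrier_vec p \<Longrightarrow>
   C *\<^sub>v (A *\<^sub>v v + B *\<^sub>v w) = (C * A) *\<^sub>v v + (C * B) *\<^sub>v w"
  by (simp add: mult_add_distrib_mat_vec)

lemma invertible_dsumD:
  fixes A B :: "'a::division_ring mat"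
  assumes "invertible_mat (dsum A B)" "A \<in> carrier_mat n n" "B \<in> carrier_mat m m"
  shows "invertible_mat A" "invertible_mat B"
proof -
  have c: "dsum A B \<in> carrier_mat (n + m) (n + m)" using assms by auto
  note inj = minjD[OF invertible_minj[OF assms(1) c] c]
  have "minj A"
  proof (rule minjI[OF assms(2)])
    fix v :: "'a vec" assume v: "v \<in> carrier_vec n" "A *\<^sub>v v = 0\<^sub>v n"
    have "dsum A B *\<^sub>v (v @\<^sub>v 0\<^sub>v m) = 0\<^sub>v (n + m)"
      using v assms by (simp add: dsum_mult_append append_zero_vec)
    hence "v @\<^sub>v 0\<^sub>v m = 0\<^sub>v (n + m)" using inj v by auto
    thus "v = 0\<^sub>v n" using append_vec_eq_0[OF v(1), of "0\<^sub>v m" m] by auto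
  qed
  thus "invertible_mat A" using minj_square_invertible assms by blast
  have "minj B"
  proof (rule minjI[OF assms(3)])
    fix v :: "'a vec" assume v: "v \<in> carrier_vec m" "B *\<^sub>v v = 0\<^sub>v m"
    have "dsum A B *\<^sub>v (0\<^sub>v n @\<^sub>v v) = 0\<^sub>v (n + m)"
      using v assms by (simp add: dsum_mult_append append_zero_vec)
    hence "0\<^sub>v n @\<^sub>v v = 0\<^sub>v (n + m)" using inj v by auto
    thus "v = 0\<^sub>v m" using append_vec_eq_0[of "0\<^sub>v n" n v m] v by auto
  qed
  thus "invertible_mat B" using minj_square_invertible assms by blast
qed

lemma gram_hcat:
  assumes "W \<in> carrier_mat n p" "V \<in> carrier_mat n m" "H \<in> carrier_mat n n"
  shows "qadj (hcat W V) * H * hcat W V =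
    four_block_mat (qadj W * H * W) (qadj W * H * V) (qadj V * H * W) (qadj V * H * V)"
  using assms by (simp add: qadj_hcat vcat_mult[of _ _ H] vcat_mult_hcat)

text \<open>The orthogonal complement of a nondegenerate invariant subspace is a complement, and it
  is invariant because \<open>A\<close> is selfadjoint for \<open>H\<close>. The split part is
  placed last in the new basis.\<close>

lemma split_off:
  assumes H: "H \<in> carrier_mat n n" "qadj H = H"
    and A: "A \<in> carrier_mat n n" "qadj A * H = H * A"
    and V: "V \<in> carrier_mat n m" and J: "J \<in> carrier_mat m m" "A * V = V * J"
    and G: "qadj V * H * V = G" "invertible_mat G"
  obtains W A' H' where "m \<le> n" "W \<in> carrier_mat n (n - m)" "A' \<in> carrier_mat (n - m) (n - m)"
    "H' \<in> carrier_mat (n - m) (n - m)" "invertible_mat (hcat W V)" "qadj H' = H'" "qadj A' * H' = H' * A'"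
    "A * hcat W V = hcat W V * dsum A' J" "qadj (hcat W V) * H * hcat W V = dsum H' G"
proof -
  have Gc: "G \<in> carrier_mat m m" using G(1) V H by auto
  obtain Gi where Gi: "Gi \<in> carrier_mat m m" "G * Gi = 1\<^sub>m m" "Gi * G = 1\<^sub>m m"
    using invertible_matE[OF G(2) Gc] by metis
  define K where "K = qadj V * H"
  have K: "K \<in> carrier_mat m n" "K * V = G" using V H G by (auto simp: K_def)
  \<comment> \<open>The orthogonal projection onto the range of \<open>V\<close>, written in the
    coordinates given by the columns of \<open>V\<close>.\<close>
  define L where "L = Gi * K"
  have Lc: "L \<in> carrier_mat m n" using Gi(1) K by (auto simp: L_def)
  have "L * V = 1\<^sub>m m" using Gi K V by (simp add: L_def mult_assoc_dim)
  hence "minj V" using left_inverse_minj[OF Lc V] by simp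
  note mn = minj_dim_le[OF this V]
  obtain W0 where W0: "W0 \<in> carrier_mat n (n - m)" "invertible_mat (hcat W0 V)"
    using minj_extend_basis[OF \<open>minj V\<close> V] by auto
  \<comment> \<open>An arbitrary complement is made orthogonal to \<open>V\<close> by subtracting
    its projection.\<close>
  define W where "W = W0 - V * (L * W0)"
  have W: "W \<in> carrier_mat n (n - m)" using W0 V Lc by (auto simp: W_def)
  have KW: "K * W = 0\<^sub>m m (n - m)"
  proof -
    have "K * W = K * W0 - K * (V * (L * W0))"
      unfolding W_def using K W0 V Lc by (intro mult_minus_distrib_mat[of _ m n _ "n-m"]) auto
    also have "K * (V * (L * W0)) = (K * V) * (L * W0)"
      using K V Lc W0 by (intro mult_assoc_dim[symmetric]) auto
    also have "\<dots> = (G * Gi) * (K * W0)"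
      unfolding K(2) L_def using Gc Gi(1) K(1) W0 by (simp add: mult_assoc_dim)
    also have "\<dots> = K * W0" unfolding Gi(2) using K W0 by simp
    finally show ?thesis using K W0 by auto
  qed
  define S where "S = hcat W V"
  have S: "S \<in> carrier_mat n n" using W V mn by (auto simp: S_def)
  have nm: "n - m + m = n" using mn by simp
  have "minj S"
  proof (rule minjI[OF S])
    fix v :: "quat vec" assume v: "v \<in> carrier_vec n" "S *\<^sub>v v = 0\<^sub>v n"
    obtain a b where ab: "v = a @\<^sub>v b" "a \<in> carrier_vec (n - m)" "b \<in> carrier_vec m"
      using vec_split[of v "n-m" m] v(1) nm by auto
    have e: "W *\<^sub>v a + V *\<^sub>v b = 0\<^sub>v n"
      using v(2) ab W V by (simp add: S_def hcat_mult_append)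
    have "0\<^sub>v m = K *\<^sub>v (W *\<^sub>v a + V *\<^sub>v b)" unfolding e using K by auto
    also have "\<dots> = (K * W) *\<^sub>v a + (K * V) *\<^sub>v b"
      by (rule hcat_mult_vec_four[OF W V K(1) ab(2,3)])
    also have "\<dots> = G *\<^sub>v b" unfolding KW K(2) using ab Gc by auto
    finally have "G *\<^sub>v b = 0\<^sub>v m" by simp
    hence b: "b = 0\<^sub>v m" using minjD[OF invertible_minj[OF G(2) Gc] Gc] ab by auto
    hence "W *\<^sub>v a = 0\<^sub>v n" using e W V ab by auto
    moreover have "W *\<^sub>v a = W0 *\<^sub>v a - V *\<^sub>v (L *\<^sub>v (W0 *\<^sub>v a))"
    proof -
      have "W *\<^sub>v a = W0 *\<^sub>v a - (V * (L * W0)) *\<^sub>v a"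
        unfolding W_def using W0 V Lc ab by (intro minus_mult_distrib_mat_vec) auto
      also have "(V * (L * W0)) *\<^sub>v a = V *\<^sub>v ((L * W0) *\<^sub>v a)"
        using V Lc W0 ab by (intro assoc_mult_mat_vec) auto
      also have "(L * W0) *\<^sub>v a = L *\<^sub>v (W0 *\<^sub>v a)" using Lc W0 ab by (intro assoc_mult_mat_vec) auto
      finally show ?thesis .
    qed
    \<comment> \<open>A relation among the columns of \<open>W\<close> is also a relation among
      those of the invertible matrix \<open>hcat W0 V\<close>, as \<open>W\<close> differs from
      \<open>W0\<close> by combinations of columns of \<open>V\<close>.\<close>
    ultimately have "hcat W0 V *\<^sub>v (a @\<^sub>v - (L *\<^sub>v (W0 *\<^sub>v a))) = 0\<^sub>v n"
      using W0 V Lc ab by (subst hcat_mult_append) (auto simp: minus_add_uminus_vec[of _ n] mult_uminus_vec)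
    moreover have "hcat W0 V \<in> carrier_mat n n" using W0 V nm by auto
    ultimately have "a @\<^sub>v - (L *\<^sub>v (W0 *\<^sub>v a)) = 0\<^sub>v n"
      using minjD[OF invertible_minj[OF W0(2)]] ab Lc nm by (metis append_carrier_vec mult_mat_vec_carrier uminus_carrier_vec W0(1))
    moreover have "- (L *\<^sub>v (W0 *\<^sub>v a)) \<in> carrier_vec m" using Lc by (intro uminus_carrier_vec[THEN iffD2] carrier_vecI) auto
    ultimately have "a = 0\<^sub>v (n - m)" using append_vec_eq_0[OF ab(2), of "- (L *\<^sub>v (W0 *\<^sub>v a))" m] nm by auto
    thus "v = 0\<^sub>v n" using b ab nm by (simp add: append_zero_vec)
  qed
  hence Sinv: "invertible_mat S" using minj_square_invertible S by blast
  have VW: "qadj V * H * W = 0\<^sub>m m (n - m)" using KW K_def by simp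
  have WV: "qadj W * H * V = 0\<^sub>m (n - m) m"
  proof -
    have "qadj W * H * V = qadj (qadj V * H * W)" using V H W by (simp add: qadj_mult mult_assoc_dim)
    thus ?thesis unfolding VW by simp
  qed
  define H' where "H' = qadj W * H * W"
  have H': "H' \<in> carrier_mat (n - m) (n - m)" using W H by (auto simp: H'_def)
  have H'h: "qadj H' = H'" using W H by (simp add: H'_def qadj_mult mult_assoc_dim)
  have gram: "qadj S * H * S = dsum H' G"
    unfolding S_def gram_hcat[OF W V H(1)] WV VW G(1) H'_def[symmetric] using H' Gc by (simp add: dsum_def)
  obtain R where R: "R \<in> carrier_mat n n" "S * R = 1\<^sub>m n" "R * S = 1\<^sub>m n"
    using invertible_matE[OF Sinv S] by metis
  define M where "M = R * (A * S)"
  have M: "M \<in> carrier_mat n n" "A * S = S * M"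
  proof -
    show "M \<in> carrier_mat n n" using R A S by (auto simp: M_def)
    have "S * M = (S * R) * (A * S)" unfolding M_def using R A S by (intro mult_assoc_dim[symmetric]) auto
    thus "A * S = S * M" unfolding R(2) using A S by simp
  qed
  obtain a b c d where sb: "split_block M (n - m) (n - m) = (a, b, c, d)" by (metis prod_cases4)
  from split_block[OF sb, of m m] M(1) nm have
    abcd: "a \<in> carrier_mat (n-m) (n-m)" "b \<in> carrier_mat (n-m) m" "c \<in> carrier_mat m (n-m)"
    "d \<in> carrier_mat m m" "M = four_block_mat a b c d" by auto
  have "hcat (A * W) (V * J) = hcat (W * a + V * c) (W * b + V * d)"
    using M(2) unfolding S_def abcd(5) using A W V abcd J by (simp add: mult_hcat hcat_mult_four_block)
  hence "V * J = W * b + V * d" using A W V abcd J by (elim hcat_eqD(2)) auto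
  hence "S * vcat b d = S * vcat (0\<^sub>m (n-m) m) J"
    unfolding S_def using W V abcd J by (simp add: hcat_mult_vcat)
  moreover have "vcat b d \<in> carrier_mat n m" "vcat (0\<^sub>m (n-m) m) J \<in> carrier_mat n m"
    using abcd(2,4) J(1) nm by (auto intro!: carrier_matI simp del: add_diff_assoc2)
  ultimately have "vcat b d = vcat (0\<^sub>m (n-m) m) J"
    using minj_mult_cancel[OF \<open>minj S\<close> S] by blast
  hence bd: "b = 0\<^sub>m (n-m) m" "d = J"
    using vcat_eqD[of b d "0\<^sub>m (n-m) m" J] abcd J by auto
  \<comment> \<open>\<open>M\<close> is \<open>A\<close> in the new basis. Invariance of the range
    of \<open>V\<close> has made it block lower triangular; selfadjointness for the block diagonal
    Gram matrix then forces \<open>G * c = 0\<close>, so the last off-diagonal block vanishes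
    too.\<close>
  have "dsum H' G * M = qadj M * dsum H' G"
  proof -
    have "dsum H' G * M = qadj S * (H * (S * M))"
      unfolding gram[symmetric] using S H M by (simp add: mult_assoc_dim)
    also have "\<dots> = qadj S * ((H * A) * S)"
      unfolding M(2)[symmetric] using S H A by (simp add: mult_assoc_dim)
    also have "\<dots> = qadj (A * S) * H * S"
      unfolding A(2)[symmetric] using S H A by (simp add: qadj_mult mult_assoc_dim)
    also have "\<dots> = qadj M * (qadj S * H * S)"
      unfolding M(2) using S H M by (simp add: qadj_mult mult_assoc_dim)
    finally show ?thesis unfolding gram .
  qed
  also have "qadj M = four_block_mat (qadj a) (qadj c) (0\<^sub>m m (n-m)) (qadj J)"
    unfolding abcd(5) bd using abcd J by (intro eq_matI) auto
  also have "\<dots> * dsum H' G = four_block_mat (qadj a * H') (qadj c * G) (0\<^sub>m m (n-m)) (qadj J * G)"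
    using abcd J H' Gc by (subst four_block_mult_dsum[of _ "n-m" "n-m" _ m m _ "n-m" _ _ m]) auto
  also have "dsum H' G * M = four_block_mat (H' * a) (0\<^sub>m (n-m) m) (G * c) (G * J)"
    unfolding abcd(5) bd using abcd J H' Gc
    by (subst dsum_mult_four_block[of _ "n-m" "n-m" _ m m _ "n-m" _ m]) auto
  finally have e: "four_block_mat (H' * a) (0\<^sub>m (n-m) m) (G * c) (G * J) =
    four_block_mat (qadj a * H') (qadj c * G) (0\<^sub>m m (n-m)) (qadj J * G)" .
  have "H' * a = qadj a * H'"
    by (rule four_block_eqD(1)[OF e, of "n-m" "n-m" m m]) (use abcd(1,3) H' Gc J(1) in auto)
  have "G * c = 0\<^sub>m m (n-m)"
    by (rule four_block_eqD(3)[OF e, of "n-m" "n-m" m m]) (use abcd(1,3) H' Gc J(1) in auto)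
  hence c0: "c = 0\<^sub>m m (n-m)" using minj_mult_zero[OF invertible_minj[OF G(2) Gc] Gc abcd(3)] by simp
  have "M = dsum a J" unfolding abcd(5) bd c0 using abcd J by (simp add: dsum_def)
  thus ?thesis using that[OF mn W abcd(1) H'] Sinv H'h \<open>H' * a = qadj a * H'\<close> M(2) gram by (simp add: S_def)
qed

text \<open>Equality up to a change of basis, \<open>A\<close> being an endomorphism and \<open>H\<close> a form.\<close>

definition peq :: "nat \<Rightarrow> quat mat \<Rightarrow> quat mat \<Rightarrow> quat mat \<Rightarrow> quat mat \<Rightarrow> bool" where
  "peq n A H A' H' \<longleftrightarrow> (\<exists>P\<in>carrier_mat n n. invertible_mat P \<and> A * P = P * A' \<and> qadj P * H * P = H')"

lemma peqI:
  "P \<in> carrier_mat n n \<Longrightarrow> invertible_mat P \<Longrightarrow> A * P = P * A' \<Longrightarrow> qadj P * H * P = H' \<Longrightarrow> peq n A H A' H'"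
  unfolding peq_def by blast

lemma peq_refl: "A \<in> carrier_mat n n \<Longrightarrow> H \<in> carrier_mat n n \<Longrightarrow> peq n A H A H"
  by (rule peqI[of "1\<^sub>m n"]) auto

lemma peq_trans:
  assumes "peq n A H A' H'" "peq n A' H' A'' H''"
    "A \<in> carrier_mat n n" "H \<in> carrier_mat n n" "A' \<in> carrier_mat n n" "A'' \<in> carrier_mat n n"
  shows "peq n A H A'' H''"
proof -
  obtain P where P: "P\<in>carrier_mat n n" "invertible_mat P" "A * P = P * A'" "qadj P * H * P = H'"
    using assms(1) unfolding peq_def by auto
  obtain Q where Q: "Q\<in>carrier_mat n n" "invertible_mat Q" "A' * Q = Q * A''" "qadj Q * H' * Q = H''"
    using assms(2) unfolding peq_def by auto
  show ?thesis
  proof (rule peqI[of "P * Q"])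
    have "A * (P * Q) = (A * P) * Q" using assms P(1) Q(1) by (intro mult_assoc_dim[symmetric]) auto
    also have "\<dots> = P * (A' * Q)" unfolding P(3) using assms P(1) Q(1) by (simp add: mult_assoc_dim)
    also have "\<dots> = P * Q * A''" unfolding Q(3) using assms P(1) Q(1) by (simp add: mult_assoc_dim)
    finally show "A * (P * Q) = P * Q * A''" .
    have "qadj (P * Q) * H * (P * Q) = qadj Q * (qadj P * H * P) * Q"
      using assms(4) P(1) Q(1) by (simp add: mult_assoc_dim qadj_mult)
    thus "qadj (P * Q) * H * (P * Q) = H''" unfolding P(4) Q(4) .
  qed (use P Q invertible_mult in auto)
qed

lemma peq_sym:
  assumes "peq n A H A' H'" "A \<in> carrier_mat n n" "H \<in> carrier_mat n n" "A' \<in> carrier_mat n n"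
  shows "peq n A' H' A H"
proof -
  obtain P where P: "P\<in>carrier_mat n n" "invertible_mat P" "A * P = P * A'" "qadj P * H * P = H'"
    using assms(1) unfolding peq_def by auto
  obtain R where R: "R \<in> carrier_mat n n" "P * R = 1\<^sub>m n" "R * P = 1\<^sub>m n"
    using invertible_matE P by metis
  show ?thesis
  proof (rule peqI[of R])
    have "A' * R = (R * P) * A' * R" using R(3) assms by simp
    also have "\<dots> = R * (P * A') * R" using R(1) P(1) assms by (simp add: mult_assoc_dim)
    also have "\<dots> = R * A * (P * R)" unfolding P(3)[symmetric] using R(1) P(1) assms by (simp add: mult_assoc_dim)
    finally show "A' * R = R * A" using R(1,2) assms by simp
    have "qadj R * H' * R = (qadj R * qadj P) * H * (P * R)"
      unfolding P(4)[symmetric] using R(1) P(1) assms by (simp add: mult_assoc_dim)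
    also have "qadj R * qadj P = qadj (P * R)" using R(1) P(1) by (simp add: qadj_mult)
    finally show "qadj R * H' * R = H" unfolding R(2) using assms by simp
    show "invertible_mat R" using invertible_matI[OF R(1) P(1)] R by simp
  qed fact
qed

lemma peq_dsum:
  assumes "peq n A H A' H'" "peq m B K B' K'"
    "A \<in> carrier_mat n n" "H \<in> carrier_mat n n" "A' \<in> carrier_mat n n"
    "B \<in> carrier_mat m m" "K \<in> carrier_mat m m" "B' \<in> carrier_mat m m"
  shows "peq (n + m) (dsum A B) (dsum H K) (dsum A' B') (dsum H' K')"
proof -
  obtain P where P: "P\<in>carrier_mat n n" "invertible_mat P" "A * P = P * A'" "qadj P * H * P = H'"
    using assms(1) unfolding peq_def by auto
  obtain Q where Q: "Q\<in>carrier_mat m m" "invertible_mat Q" "B * Q = Q * B'" "qadj Q * K * Q = K'"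
    using assms(2) unfolding peq_def by auto
  show ?thesis
    by (rule peqI[of "dsum P Q"])
       (use P Q assms in \<open>auto simp: dsum_mult qadj_dsum intro!: invertible_dsum[of P n Q m]\<close>)
qed

lemma peq_dsum_comm:
  assumes "A \<in> carrier_mat n n" "H \<in> carrier_mat n n" "B \<in> carrier_mat m m" "K \<in> carrier_mat m m"
  shows "peq (n + m) (dsum A B) (dsum H K) (dsum B A) (dsum K H)"
proof (rule peqI)
  let ?P = "four_block_mat (0\<^sub>m n m) (1\<^sub>m n) (1\<^sub>m m) (0\<^sub>m m n) :: quat mat"
  let ?Q = "four_block_mat (0\<^sub>m m n) (1\<^sub>m m) (1\<^sub>m n) (0\<^sub>m n m) :: quat mat"
  show c: "?P \<in> carrier_mat (n + m) (n + m)" by (intro carrier_matI) auto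
  have PQ: "?P * ?Q = 1\<^sub>m (n + m)"
    by (subst mult_four_block_mat[of _ n m _ n _ m _ _ n _ m]) auto
  show "invertible_mat ?P"
    by (rule right_inverse_invertible(1)[OF c _ PQ]) (intro carrier_matI; simp)
  show "dsum A B * ?P = ?P * dsum B A"
    using assms
    by (simp add: dsum_mult_four_block[of _ n n _ m m _ m _ n] four_block_mult_dsum[of _ m m _ n n _ n _ _ m])
  have "qadj ?P = ?Q" by (rule eq_matI) auto
  moreover have "?Q * dsum H K = four_block_mat (0\<^sub>m m n) K H (0\<^sub>m n m)"
    using assms by (simp add: four_block_mult_dsum[of _ n n _ m m _ m _ _ n])
  moreover have "\<dots> * ?P = dsum K H"
    unfolding dsum_def using assms
    by (subst mult_four_block_mat[of _ m n _ m _ n _ _ m _ n]) (simp_all add: carrier_matD[OF assms(2)] carrier_matD[OF assms(4)])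
  ultimately show "qadj ?P * dsum H K * ?P = dsum K H" by simp
qed

section \<open>Matrices of a list of blocks, up to reordering\<close>

definition blocks_B :: "cblock list \<Rightarrow> quat mat" where
  "blocks_B bs = diag_block_mat (map cblock_B bs)"

definition blocks_H :: "cblock list \<Rightarrow> quat mat" where
  "blocks_H bs = diag_block_mat (map cblock_H bs)"

abbreviation "blocks_size bs \<equiv> sum_list (map cblock_size bs)"

lemma blocks_simps [simp]:
  "blocks_B [] = 0\<^sub>m 0 0" "blocks_H [] = 0\<^sub>m 0 0"
  "blocks_B (b # bs) = dsum (cblock_B b) (blocks_B bs)"
  "blocks_H (b # bs) = dsum (cblock_H b) (blocks_H bs)"
  "blocks_B (bs @ cs) = dsum (blocks_B bs) (blocks_B cs)"
  "blocks_H (bs @ cs) = dsum (blocks_H bs) (blocks_H cs)"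
  by (auto simp: blocks_B_def blocks_H_def diag_block_Cons diag_block_append)

lemma antidiag_carrier [simp]: "antidiag k \<in> carrier_mat k k"
  by (simp add: antidiag_def)

lemma antidiag_dim [simp]: "dim_row (antidiag k) = k" "dim_col (antidiag k) = k"
  by (auto simp: antidiag_def)

lemma cblock_carrier [simp]:
  "cblock_B b \<in> carrier_mat (cblock_size b) (cblock_size b)"
  "cblock_H b \<in> carrier_mat (cblock_size b) (cblock_size b)"
  by (cases b; auto simp: diag_block_Cons)+

lemma cblock_dim [simp]:
  "dim_row (cblock_B b) = cblock_size b" "dim_col (cblock_B b) = cblock_size b"
  "dim_row (cblock_H b) = cblock_size b" "dim_col (cblock_H b) = cblock_size b"
  using cblock_carrier[of b] by (auto simp del: cblock_carrier)

lemma blocks_dim [simp]: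
  "dim_row (blocks_B bs) = blocks_size bs" "dim_col (blocks_B bs) = blocks_size bs"
  "dim_row (blocks_H bs) = blocks_size bs" "dim_col (blocks_H bs) = blocks_size bs"
  by (induction bs) auto

lemma blocks_carrier [simp]:
  "blocks_B bs \<in> carrier_mat (blocks_size bs) (blocks_size bs)"
  "blocks_H bs \<in> carrier_mat (blocks_size bs) (blocks_size bs)"
  by auto

lemma peq_blocks_move:
  "peq (blocks_size (xs @ b # ys)) (blocks_B (xs @ b # ys)) (blocks_H (xs @ b # ys))
     (blocks_B (b # xs @ ys)) (blocks_H (b # xs @ ys))"
proof -
  have "peq (blocks_size xs + cblock_size b + blocks_size ys)
    (dsum (dsum (blocks_B xs) (cblock_B b)) (blocks_B ys)) (dsum (dsum (blocks_H xs) (cblock_H b)) (blocks_H ys))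
    (dsum (dsum (cblock_B b) (blocks_B xs)) (blocks_B ys)) (dsum (dsum (cblock_H b) (blocks_H xs)) (blocks_H ys))"
    by (rule peq_dsum[OF peq_dsum_comm peq_refl]) (auto intro!: carrier_matI)
  thus ?thesis by (simp add: dsum_assoc add.assoc)
qed

text \<open>The grouping conditions determine the blocks only as a multiset; their order is absorbed
  into the basis.\<close>

lemma peq_blocks_mset:
  assumes "mset bs = mset bs'"
  shows "peq (blocks_size bs) (blocks_B bs) (blocks_H bs) (blocks_B bs') (blocks_H bs')"
  using assms
proof (induction bs' arbitrary: bs)
  case Nil
  thus ?case using peq_refl[of "0\<^sub>m 0 0" 0] by simp
next
  case (Cons b bs')
  from Cons.prems have "b \<in> set bs" by (metis list.set_intros(1) mset_eq_setD)
  then obtain xs ys where bs: "bs = xs @ b # ys" by (meson split_list)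
  have ms: "mset (xs @ ys) = mset bs'" using Cons.prems bs by simp
  have "sum_mset (image_mset cblock_size (mset (xs @ ys))) = sum_mset (image_mset cblock_size (mset bs'))"
    unfolding ms ..
  hence sz: "blocks_size bs' = blocks_size (xs @ ys)" "blocks_size bs = cblock_size b + blocks_size (xs @ ys)"
    using bs by (auto simp: sum_mset_sum_list[symmetric])
  have 2: "peq (cblock_size b + blocks_size (xs @ ys)) (dsum (cblock_B b) (blocks_B (xs @ ys))) (dsum (cblock_H b) (blocks_H (xs @ ys)))
    (dsum (cblock_B b) (blocks_B bs')) (dsum (cblock_H b) (blocks_H bs'))"
    by (rule peq_dsum[OF peq_refl Cons.IH[OF ms]]) (use sz in \<open>auto intro!: carrier_matI\<close>)
  show ?case unfolding bs
    by (rule peq_trans[OF peq_blocks_move[of xs b ys]])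
       (use 2 sz in \<open>auto simp: bs add_ac intro!: carrier_matI\<close>)
qed

section \<open>Jordan chains of selfadjoint maps\<close>

abbreviation "qC \<equiv> quat_of_complex"
abbreviation "qR \<equiv> quat_of_real"

text \<open>Commuting \<open>j\<close> past a complex number conjugates the number. Right
  multiplication by \<open>j\<close> therefore turns an eigenvector for \<open>z\<close> into one
  for \<open>cnj z\<close>, which is why eigenvalues may be taken in the closed upper half
  plane.\<close>

definition quat_j :: quat where "quat_j = Quat 0 0 1 0"

lemma quat_j_sel [simp]: "qRe quat_j = 0" "qI quat_j = 0" "qJ quat_j = 1" "qK quat_j = 0"
  by (auto simp: quat_j_def)

lemma quat_j_complex: "quat_j * qC (cnj z) = qC z * quat_j"
  by (rule quat_eqI) (auto simp: quat_sel_times)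

lemma quat_j_nz [simp]: "quat_j \<noteq> 0"
  by (metis quat_j_sel(3) quat_sel_simps(3) zero_neq_one)

lemma quat_self_conj: "qcnj q = q \<Longrightarrow> q = qR (qRe q)"
  by (rule quat_eqI) (auto dest: arg_cong[of _ _ qI] arg_cong[of _ _ qJ] arg_cong[of _ _ qK])

lemma quat_complexI: "qJ q = 0 \<Longrightarrow> qK q = 0 \<Longrightarrow> q = qC (Complex (qRe q) (qI q))"
  by (rule quat_eqI) auto

text \<open>The algebraic laws hold on the whole ambient type and only closure and nondegeneracy
  refer to \<open>V\<close>, which frees the computations from membership premises. Finite dimension
  enters below through the premise that a product of factors \<open>T z\<close> annihilates
  \<open>V\<close>.\<close>

locale quat_space =
  fixes V :: "'v::ab_group_add set"
    and scl :: "'v \<Rightarrow> quat \<Rightarrow> 'v" (infixl "\<cdot>" 75)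
    and B :: "'v \<Rightarrow> 'v"
    and form :: "'v \<Rightarrow> 'v \<Rightarrow> quat"
  assumes V_add: "v \<in> V \<Longrightarrow> w \<in> V \<Longrightarrow> v + w \<in> V"
    and V_scl: "v \<in> V \<Longrightarrow> v \<cdot> q \<in> V"
    and V_B: "v \<in> V \<Longrightarrow> B v \<in> V"
    and scl_add_left: "(v + w) \<cdot> q = v \<cdot> q + w \<cdot> q"
    and scl_add_right: "v \<cdot> (p + q) = v \<cdot> p + v \<cdot> q"
    and scl_mult: "v \<cdot> (p * q) = v \<cdot> p \<cdot> q"
    and scl_one [simp]: "v \<cdot> 1 = v"
    and B_add: "B (v + w) = B v + B w"
    and B_scl: "B (v \<cdot> q) = B v \<cdot> q"
    and form_add_right: "form v (w + w') = form v w + form v w'"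
    and form_scl_right: "form v (w \<cdot> q) = form v w * q"
    and form_herm: "form w v = qcnj (form v w)"
    and form_B: "form (B v) w = form v (B w)"
    and form_nondeg: "y \<in> V \<Longrightarrow> y \<noteq> 0 \<Longrightarrow> \<exists>w\<in>V. form w y \<noteq> 0"
begin

section \<open>Elementary rules for right scalars, the endomorphism and the form\<close>

lemma scl_zero_right [simp]: "v \<cdot> 0 = 0"
  using scl_add_right[of v 0 0] by simp

lemma scl_zero_left [simp]: "0 \<cdot> q = 0"
  using scl_add_left[of 0 0 q] by simp

lemma scl_minus_right: "v \<cdot> (- q) = - (v \<cdot> q)"
  using scl_add_right[of v q "- q"] by (simp add: eq_neg_iff_add_eq_0 add.commute)

lemma scl_minus_left: "(- v) \<cdot> q = - (v \<cdot> q)"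
  using scl_add_left[of v "- v" q] by (simp add: eq_neg_iff_add_eq_0 add.commute)

lemma scl_diff_left: "(v - w) \<cdot> q = v \<cdot> q - w \<cdot> q"
  using scl_add_left[of v "- w" q] by (simp add: scl_minus_left)

lemma scl_diff_right: "v \<cdot> (p - q) = v \<cdot> p - v \<cdot> q"
  using scl_add_right[of v p "- q"] by (simp add: scl_minus_right)

lemma scl_eq_0: "v \<cdot> q = 0 \<longleftrightarrow> v = 0 \<or> q = 0"
proof
  assume "v \<cdot> q = 0"
  thus "v = 0 \<or> q = 0"
    using scl_mult[of v q "inverse q"] by (metis right_inverse scl_one scl_zero_left)
qed auto

lemma B_zero [simp]: "B 0 = 0"
  using B_add[of 0 0] by simp

lemma B_minus: "B (- v) = - B v"
  using B_add[of v "- v"] by (simp add: eq_neg_iff_add_eq_0 add.commute)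

lemma B_diff: "B (v - w) = B v - B w"
  using B_add[of v "- w"] by (simp add: B_minus)

lemma form_zero_right [simp]: "form v 0 = 0"
  using form_add_right[of v 0 0] by simp

lemma form_zero_left [simp]: "form 0 v = 0"
  using form_herm[of 0 v] by simp

lemma form_minus_right: "form v (- w) = - form v w"
  using form_add_right[of v w "- w"] by (simp add: eq_neg_iff_add_eq_0 add.commute)

lemma form_diff_right: "form v (w - w') = form v w - form v w'"
  using form_add_right[of v w "- w'"] by (simp add: form_minus_right)

lemma form_add_left: "form (v + v') w = form v w + form v' w"
  by (metis form_herm form_add_right qcnj_simps(5))

lemma form_diff_left: "form (v - v') w = form v w - form v' w"
  by (metis form_herm form_diff_right qcnj_simps(6))

lemma form_scl_left: "form (v \<cdot> q) w = qcnj q * form v w"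
  by (metis form_herm form_scl_right qcnj_mult qcnj_simps(3))

text \<open>Scalars act from the right, so \<open>T z\<close> is complex linear, but quaternion linear only for real \<open>z\<close>.\<close>

definition T :: "complex \<Rightarrow> 'v \<Rightarrow> 'v" where
  "T z v = B v - v \<cdot> qC z"

lemma V_diff: "v \<in> V \<Longrightarrow> w \<in> V \<Longrightarrow> v - w \<in> V"
  using V_add[of v "w \<cdot> (- 1)"] V_scl[of w "- 1"] by (simp add: scl_minus_right)

lemma V_T: "v \<in> V \<Longrightarrow> T z v \<in> V"
  unfolding T_def by (intro V_diff V_B V_scl)

lemma V_Tpow: "v \<in> V \<Longrightarrow> (T z ^^ k) v \<in> V"
  by (induction k) (auto intro: V_T)

lemma T_zero [simp]: "T z 0 = 0"
  by (simp add: T_def)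

lemma Tpow_zero [simp]: "(T z ^^ k) 0 = 0"
  by (induction k) auto

lemma T_add: "T z (v + w) = T z v + T z w"
  by (simp add: T_def B_add scl_add_left)

lemma Tpow_add: "(T z ^^ k) (v + w) = (T z ^^ k) v + (T z ^^ k) w"
  by (induction k) (auto simp: T_add)

lemma T_scl_complex: "T z (v \<cdot> qC w) = T z v \<cdot> qC w"
  by (simp add: T_def B_scl scl_diff_left scl_mult[symmetric] quat_of_complex_simps(6)[symmetric] mult.commute
           del: quat_of_complex_simps(6))

lemma Tpow_scl_complex: "(T z ^^ k) (v \<cdot> qC w) = (T z ^^ k) v \<cdot> qC w"
  by (induction k) (auto simp: T_scl_complex)

lemma Tpow_scl_real: "(T z ^^ k) (v \<cdot> qR r) = (T z ^^ k) v \<cdot> qR r"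
  using Tpow_scl_complex[of k z v "complex_of_real r"] by simp

lemma T_real_scl: "T (complex_of_real l) (v \<cdot> q) = T (complex_of_real l) v \<cdot> q"
  by (simp add: T_def B_scl scl_diff_left scl_mult[symmetric] quat_of_real_comm)

lemma Tpow_real_scl: "(T (complex_of_real l) ^^ k) (v \<cdot> q) = (T (complex_of_real l) ^^ k) v \<cdot> q"
  by (induction k) (auto simp: T_real_scl)

lemma T_scl_j: "T (cnj z) (v \<cdot> quat_j) = T z v \<cdot> quat_j"
  by (simp add: T_def B_scl scl_diff_left scl_mult[symmetric] quat_j_complex)

lemma Tpow_scl_j: "(T (cnj z) ^^ k) (v \<cdot> quat_j) = (T z ^^ k) v \<cdot> quat_j"
  by (induction k) (auto simp: T_scl_j)

lemma T_commute: "T z (T w v) = T w (T z v)"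
proof -
  have "v \<cdot> qC z \<cdot> qC w = v \<cdot> qC w \<cdot> qC z"
    by (metis scl_mult quat_of_complex_simps(6) mult.commute)
  thus ?thesis by (simp add: T_def B_diff B_scl scl_diff_left)
qed

lemma Tpow_commute: "T z ((T w ^^ k) v) = (T w ^^ k) (T z v)"
  by (induction k) (auto simp: T_commute)

lemma foldr_T_in_V: "v \<in> V \<Longrightarrow> foldr T zs v \<in> V"
  by (induction zs) (auto intro: V_T)

text \<open>The factors commute, since complex scalars do, so those with root \<open>z\<close> can
  be collected and applied before the others.\<close>

lemma foldr_T_split:
  "foldr T zs v = foldr T (filter (\<lambda>a. a \<noteq> z) zs) ((T z ^^ count_list zs z) v)"
proof (induction zs)
  case (Cons a zs)
  have c: "foldr T xs (T z w) = T z (foldr T xs w)" for xs w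
    by (induction xs) (auto simp: T_commute)
  show ?case using Cons by (auto simp: c[symmetric])
qed auto

lemma foldr_T_eigen:
  assumes "T z y = 0"
  shows "foldr T qs y = y \<cdot> qC (\<Prod>a\<leftarrow>qs. z - a)"
proof (induction qs)
  case (Cons a qs)
  have By: "B y = y \<cdot> qC z" using assms by (simp add: T_def)
  have "foldr T (a # qs) y = T a (y \<cdot> qC (\<Prod>a\<leftarrow>qs. z - a))" using Cons by simp
  also have "\<dots> = T a y \<cdot> qC (\<Prod>a\<leftarrow>qs. z - a)" by (rule T_scl_complex)
  also have "T a y = y \<cdot> qC (z - a)" by (simp add: T_def By scl_diff_right)
  finally show ?case by (simp add: scl_mult del: quat_of_complex_simps(4))
qed auto

lemma prod_list_nz: "z \<notin> set qs \<Longrightarrow> (\<Prod>a\<leftarrow>qs. z - a) \<noteq> (0::complex)"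
  by (auto simp: prod_list_zero_iff)

text \<open>The first factor that sends the growing product to zero supplies the eigenvalue, and the
  product before it the eigenvector.\<close>

lemma eigenvector_exists:
  assumes "foldr T zs v = 0" "v \<noteq> 0" "v \<in> V"
  shows "\<exists>z y. y \<in> V \<and> y \<noteq> 0 \<and> T z y = 0"
  using assms(1)
proof (induction zs)
  case Nil
  thus ?case using assms(2) by simp
next
  case (Cons a zs)
  show ?case
  proof (cases "foldr T zs v = 0")
    case False
    thus ?thesis using Cons.prems foldr_T_in_V[OF assms(3)] by (intro exI[of _ a] exI[of _ "foldr T zs v"]) auto
  qed (use Cons in auto)
qed

lemma Tpow_mono: "(T z ^^ k) v = 0 \<Longrightarrow> k \<le> m \<Longrightarrow> (T z ^^ m) v = 0"
  by (metis Tpow_zero funpow_add o_apply le_add_diff_inverse2)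

text \<open>By induction the vector left after \<open>count_list zs z\<close> applications is killed
  by \<open>T z\<close>. The other factors of the annihilating product act on such a vector by a
  nonzero complex scalar, so it must be zero.\<close>

lemma Tpow_bounded:
  assumes ann: "\<And>v. v \<in> V \<Longrightarrow> foldr T zs v = 0" and v: "v \<in> V" "(T z ^^ m) v = 0"
  shows "(T z ^^ count_list zs z) v = 0"
  using v
proof (induction m arbitrary: v)
  case (Suc m)
  let ?K = "count_list zs z"
  have "(T z ^^ ?K) (T z v) = 0"
    by (rule Suc.IH) (use Suc.prems in \<open>auto intro: V_T simp: funpow_swap1\<close>)
  hence e: "T z ((T z ^^ ?K) v) = 0" by (simp add: Tpow_commute)
  have "(T z ^^ ?K) v \<cdot> qC (\<Prod>a\<leftarrow>filter (\<lambda>a. a \<noteq> z) zs. z - a) = 0"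
    unfolding foldr_T_eigen[OF e, symmetric] foldr_T_split[symmetric] using ann Suc.prems by simp
  moreover have "(\<Prod>a\<leftarrow>filter (\<lambda>a. a \<noteq> z) zs. z - a) \<noteq> 0" by (rule prod_list_nz) simp
  ultimately show ?case by (simp add: scl_eq_0)
qed auto

text \<open>A chain of maximal length for the eigenvalue \<open>z\<close>. Maximality matters
  because a vector of the same generalised eigenspace, found later by duality, is then killed by
  \<open>T z ^^ Suc k\<close> as well and can be used as the top of a chain itself.\<close>

lemma max_chain:
  assumes ann: "\<And>v. v \<in> V \<Longrightarrow> foldr T zs v = 0" and y: "y \<in> V" "y \<noteq> 0" "T z y = 0"
  obtains k u where "\<And>v m. v \<in> V \<Longrightarrow> (T z ^^ m) v = 0 \<Longrightarrow> (T z ^^ Suc k) v = 0"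
    "u \<in> V" "(T z ^^ Suc k) u = 0" "(T z ^^ k) u \<noteq> 0"
proof -
  define P where "P k \<longleftrightarrow> (\<forall>v\<in>V. \<forall>m. (T z ^^ m) v = 0 \<longrightarrow> (T z ^^ k) v = 0)" for k
  have "P (count_list zs z)" using Tpow_bounded[OF ann] by (auto simp: P_def)
  define K where "K = (LEAST k. P k)"
  have K: "P K" unfolding K_def by (rule LeastI) fact
  have "K \<noteq> 0"
  proof
    assume "K = 0"
    with K have "\<And>m. (T z ^^ m) y = 0 \<Longrightarrow> y = 0" using y by (auto simp: P_def)
    from this[of 1] show False using y by simp
  qed
  then obtain k where k: "K = Suc k" by (cases K) auto
  have "\<not> P k" using not_less_Least[of k P] k K_def by simp
  then obtain u m where u: "u \<in> V" "(T z ^^ m) u = 0" "(T z ^^ k) u \<noteq> 0" by (auto simp: P_def)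
  show ?thesis by (rule that[of k u]) (use K u k in \<open>auto simp: P_def simp del: funpow.simps\<close>)
qed

text \<open>
  Start from \<open>w\<close> with \<open>[w, y] = 1\<close> and apply the factors \<open>T a\<close>, \<open>a \<noteq> z\<close>, of the annihilating product:
  this moves \<open>w\<close> into the generalised eigenspace of \<open>z\<close>, and each factor multiplies the pairing with
  the eigenvector \<open>y\<close> by a nonzero complex number.
\<close>

lemma dual_vector:
  assumes ann: "\<And>v. v \<in> V \<Longrightarrow> foldr T zs v = 0"
    and y: "y \<in> V" "y \<noteq> 0" "T (cnj z) y = 0"
  obtains x m c where "x \<in> V" "(T z ^^ m) x = 0" "form x y = qC c" "c \<noteq> 0"
proof -
  obtain w where w: "w \<in> V" "form w y \<noteq> 0" using form_nondeg y by auto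
  define w' where "w' = w \<cdot> qcnj (inverse (form w y))"
  have w': "w' \<in> V" "form w' y = qC 1"
    using w by (auto simp: w'_def form_scl_left intro: V_scl)
  have By: "B y = y \<cdot> qC (cnj z)" using y by (simp add: T_def)
  have f: "form (foldr T qs w') y = qC (\<Prod>a\<leftarrow>qs. cnj z - cnj a)" for qs
  proof (induction qs)
    case (Cons a qs)
    have "form (foldr T (a # qs) w') y = form (foldr T qs w') y * qC (cnj z) - qC (cnj a) * form (foldr T qs w') y"
      by (simp add: T_def form_diff_left form_B By form_scl_left form_scl_right)
    also have "\<dots> = qC ((\<Prod>a\<leftarrow>qs. cnj z - cnj a) * cnj z - cnj a * (\<Prod>a\<leftarrow>qs. cnj z - cnj a))"
      unfolding Cons by simp
    finally show ?case by (simp add: algebra_simps)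
  qed (use w' in auto)
  define qs where "qs = filter (\<lambda>a. a \<noteq> z) zs"
  show ?thesis
  proof (rule that[of "foldr T qs w'" "count_list zs z"])
    show "foldr T qs w' \<in> V" by (rule foldr_T_in_V) fact
    have "foldr T xs ((T z ^^ k) v) = (T z ^^ k) (foldr T xs v)" for xs k v
      by (induction xs) (auto simp: Tpow_commute)
    thus "(T z ^^ count_list zs z) (foldr T qs w') = 0"
      using foldr_T_split[of zs w' z] ann[OF w'(1)] by (simp add: qs_def)
    show "form (foldr T qs w') y = qC (\<Prod>a\<leftarrow>qs. cnj z - cnj a)" by (rule f)
    show "(\<Prod>a\<leftarrow>qs. cnj z - cnj a) \<noteq> 0" by (auto simp: prod_list_zero_iff qs_def)
  qed
qed

section \<open>Normalised chains for a real eigenvalue\<close>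

lemma form_T_real: "form (T (complex_of_real l) v) w = form v (T (complex_of_real l) w)"
  by (simp add: T_def form_diff_left form_diff_right form_B form_scl_left form_scl_right quat_of_real_comm)

lemma form_Tpow_real: "form ((T (complex_of_real l) ^^ i) v) w = form v ((T (complex_of_real l) ^^ i) w)"
proof (induction i arbitrary: w)
  case (Suc i)
  have "form (T (complex_of_real l) ((T (complex_of_real l) ^^ i) v)) w
    = form v ((T (complex_of_real l) ^^ i) (T (complex_of_real l) w))"
    unfolding form_T_real Suc ..
  thus ?case by (simp add: Tpow_commute)
qed simp

lemma form_Tpow_self_real:
  "form v ((T (complex_of_real l) ^^ i) v) = qR (qRe (form v ((T (complex_of_real l) ^^ i) v)))"
proof (rule quat_self_conj)
  show "qcnj (form v ((T (complex_of_real l) ^^ i) v)) = form v ((T (complex_of_real l) ^^ i) v)"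
    by (metis form_herm form_Tpow_real)
qed

text \<open>If the diagonal values at \<open>x\<close> and \<open>u\<close> both vanish, the vector
  \<open>x \<cdot> a + u\<close>, with \<open>a\<close> the mixed value, has value
  \<open>2 * qnorm2 a\<close>: weighting \<open>x\<close> by \<open>a\<close> makes the two cross
  terms equal to the same positive real, so they cannot cancel.\<close>

lemma real_polarize:
  assumes "form x ((T (complex_of_real l) ^^ k) u) \<noteq> 0" "x \<in> V" "u \<in> V"
    "(T (complex_of_real l) ^^ m) x = 0" "(T (complex_of_real l) ^^ m) u = 0"
  obtains v where "v \<in> V" "(T (complex_of_real l) ^^ m) v = 0" "form v ((T (complex_of_real l) ^^ k) v) \<noteq> 0"
proof -
  let ?T = "T (complex_of_real l)"
  define a where "a = form x ((?T ^^ k) u)"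
  have a': "form u ((?T ^^ k) x) = qcnj a" unfolding a_def by (metis form_herm form_Tpow_real)
  consider "form x ((?T ^^ k) x) \<noteq> 0" | "form u ((?T ^^ k) u) \<noteq> 0"
    | "form x ((?T ^^ k) x) = 0" "form u ((?T ^^ k) u) = 0" by blast
  thus ?thesis
  proof cases
    case 3
    define v where "v = x \<cdot> a + u"
    have "form v ((?T ^^ k) v) = qcnj a * a + qcnj a * a"
      using 3 by (simp add: v_def Tpow_add Tpow_real_scl form_add_left form_add_right form_scl_left
          form_scl_right a' a_def[symmetric])
    also have "\<dots> = qR (2 * qnorm2 a)" by (simp only: qcnj_mult_self mult_2 quat_of_real_simps(3))
    also have "\<dots> \<noteq> 0"
    proof -
      have "qnorm2 a > 0" using assms(1) by (intro qnorm2_pos) (simp add: a_def)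
      hence "2 * qnorm2 a \<noteq> 0" by simp
      thus ?thesis unfolding quat_of_real_simps(8) .
    qed
    finally have nz: "form v ((?T ^^ k) v) \<noteq> 0" .
    have "(?T ^^ m) v = 0" unfolding v_def Tpow_add Tpow_real_scl assms(4,5) by simp
    moreover have "v \<in> V" unfolding v_def by (intro V_add V_scl assms)
    ultimately show ?thesis using that nz by blast
  qed (use that assms in auto)
qed

text \<open>
  Adding a multiple of \<open>T\<^sup>m\<^sup>+\<^sup>1 v\<close> to \<open>v\<close> kills \<open>[v, T\<^sup>k\<^sup>-\<^sup>m\<^sup>-\<^sup>1 v]\<close> and leaves the later values unchanged.
\<close>

lemma real_normalize:
  assumes "v \<in> V" "(T (complex_of_real l) ^^ Suc k) v = 0"
    "form v ((T (complex_of_real l) ^^ k) v) = qR s" "s = 1 \<or> s = -1" "m \<le> k"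
  shows "\<exists>v\<in>V. (T (complex_of_real l) ^^ Suc k) v = 0 \<and> form v ((T (complex_of_real l) ^^ k) v) = qR s \<and>
    (\<forall>i. k - m \<le> i \<and> i < k \<longrightarrow> form v ((T (complex_of_real l) ^^ i) v) = 0)"
  using assms(5)
proof (induction m)
  case 0
  thus ?case using assms by (intro bexI[of _ v]) auto
next
  case (Suc m)
  let ?T = "T (complex_of_real l)"
  from Suc obtain v where v: "v \<in> V" "(?T ^^ Suc k) v = 0" "form v ((?T ^^ k) v) = qR s"
    "\<And>i. k - m \<le> i \<Longrightarrow> i < k \<Longrightarrow> form v ((?T ^^ i) v) = 0" by auto
  define g where "g i = qRe (form v ((?T ^^ i) v))" for i
  have g: "form v ((?T ^^ i) v) = qR (g i)" for i unfolding g_def by (rule form_Tpow_self_real)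
  have g0: "g i = 0" if "i > k" for i
    unfolding g_def using Tpow_mono[OF v(2), of i] that by simp
  have gk: "g k = s" using g[of k] v(3) by simp
  have gm: "g i = 0" if "k - m \<le> i" "i < k" for i using v(4)[OF that] g[of i] by simp
  \<comment> \<open>Solves \<open>g (k - Suc m) + 2 * r * g k = 0\<close>, where
    \<open>g k = s\<close> is its own inverse. The term quadratic in \<open>r\<close> involves
    \<open>g\<close> beyond index \<open>k\<close> and vanishes.\<close>
  define r where "r = - s * g (k - Suc m) / 2"
  define v' where "v' = v + (?T ^^ Suc m) v \<cdot> qR r"
  have form': "form v' ((?T ^^ i) v') = qR (g i + 2 * r * g (i + Suc m) + r * r * g (i + 2 * Suc m))" for i
  proof -
    have p: "(?T ^^ a) ((?T ^^ b) w) = (?T ^^ (a + b)) w" for a b w by (simp add: funpow_add)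
    have "form v' ((?T ^^ i) v') = form v ((?T ^^ i) v) + form v ((?T ^^ (i + Suc m)) v) * qR r
      + qR r * form v ((?T ^^ (Suc m + i)) v) + qR r * form v ((?T ^^ (Suc m + (i + Suc m))) v) * qR r"
      unfolding v'_def
      by (simp only: Tpow_add Tpow_scl_real form_add_left form_add_right form_scl_left form_scl_right
          form_Tpow_real p qcnj_simps) (simp add: distrib_left distrib_right mult.assoc add.assoc)
    also have "\<dots> = qR (g i + g (i + Suc m) * r + r * g (Suc m + i) + r * g (Suc m + (i + Suc m)) * r)"
      unfolding g by (simp del: funpow.simps)
    also have "\<dots> = qR (g i + 2 * r * g (i + Suc m) + r * r * g (i + 2 * Suc m))"
    proof (rule arg_cong[where f = qR])
      have e: "Suc m + i = i + Suc m" "Suc m + (i + Suc m) = i + 2 * Suc m" by auto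
      show "g i + g (i + Suc m) * r + r * g (Suc m + i) + r * g (Suc m + (i + Suc m)) * r =
        g i + 2 * r * g (i + Suc m) + r * r * g (i + 2 * Suc m)"
        unfolding e by (simp only: mult.commute mult.left_commute mult.assoc)
    qed
    finally show ?thesis .
  qed
  have "v' \<in> V" unfolding v'_def using v(1) by (intro V_add V_scl V_Tpow)
  moreover have "(?T ^^ Suc k) v' = 0"
  proof -
    have "(?T ^^ Suc k) ((?T ^^ Suc m) v) = (?T ^^ Suc m) ((?T ^^ Suc k) v)"
      by (metis funpow_add o_apply add.commute)
    thus ?thesis unfolding v'_def by (simp only: Tpow_add Tpow_scl_real v(2) Tpow_zero scl_zero_left add_0_right)
  qed
  moreover have "form v' ((?T ^^ k) v') = qR s"
    unfolding form' by (simp add: gk g0)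
  moreover have "form v' ((?T ^^ i) v') = 0" if i: "k - Suc m \<le> i" "i < k" for i
  proof (cases "i = k - Suc m")
    case True
    have "i + Suc m = k" using True Suc.prems by simp
    moreover have "g (i + 2 * Suc m) = 0" using calculation by (intro g0) simp
    ultimately show ?thesis unfolding form' using assms(4) by (auto simp: gk r_def True[symmetric])
  next
    case False
    hence "i + Suc m > k" "k - m \<le> i" using i Suc.prems by auto
    thus ?thesis unfolding form' using gm[of i] i by (simp add: g0)
  qed
  ultimately show ?case by (intro bexI[of _ v']) auto
qed

text \<open>The dual vector of the bottom of a maximal chain provides a nonzero mixed value, and
  polarisation turns it into one generator with \<open>form v (T^k v)\<close> nonzero. The sign of
  this real number is the sign of the block.\<close>

lemma real_chain:
  assumes ann: "\<And>v. v \<in> V \<Longrightarrow> foldr T zs v = 0"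
    and y: "y \<in> V" "y \<noteq> 0" "T (complex_of_real l) y = 0"
  obtains k v s where "v \<in> V" "(T (complex_of_real l) ^^ Suc k) v = 0" "s = 1 \<or> s = (-1::int)"
    "\<And>i. form v ((T (complex_of_real l) ^^ i) v) = (if i = k then of_int s else 0)"
proof -
  let ?T = "T (complex_of_real l)"
  obtain k u where k: "\<And>v m. v \<in> V \<Longrightarrow> (?T ^^ m) v = 0 \<Longrightarrow> (?T ^^ Suc k) v = 0"
    "u \<in> V" "(?T ^^ Suc k) u = 0" "(?T ^^ k) u \<noteq> 0"
    using max_chain[OF ann y] by metis
  have "T (cnj (complex_of_real l)) ((?T ^^ k) u) = 0" using k(3) by simp
  from dual_vector[OF ann V_Tpow[OF k(2)] k(4) this] obtain x m c where
    x: "x \<in> V" "(?T ^^ m) x = 0" "form x ((?T ^^ k) u) = qC c" "c \<noteq> 0" by metis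
  have "form x ((?T ^^ k) u) \<noteq> 0" using x by simp
  from real_polarize[OF this x(1) k(2) k(1)[OF x(1,2)] k(3)] obtain v where
    v: "v \<in> V" "(?T ^^ Suc k) v = 0" "form v ((?T ^^ k) v) \<noteq> 0" by metis
  define r where "r = qRe (form v ((?T ^^ k) v))"
  have r: "form v ((?T ^^ k) v) = qR r" unfolding r_def by (rule form_Tpow_self_real)
  have r0: "r \<noteq> 0" using v(3) r by simp
  \<comment> \<open>Scaling \<open>v\<close> by a real \<open>t\<close> multiplies the value
    \<open>r\<close> by \<open>t * t\<close>, so the modulus can be normalised and exactly the sign
    remains.\<close>
  define t where "t = 1 / sqrt \<bar>r\<bar>"
  have t: "t * r * t = sgn r"
    using r0 by (simp add: t_def real_sqrt_mult_self field_simps sgn_if abs_if)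
  have "\<exists>v\<in>V. (?T ^^ Suc k) v = 0 \<and> form v ((?T ^^ k) v) = qR (sgn r) \<and>
    (\<forall>i. k - k \<le> i \<and> i < k \<longrightarrow> form v ((?T ^^ i) v) = 0)"
  proof (rule real_normalize)
    show "v \<cdot> qR t \<in> V" using v V_scl by auto
    show "(?T ^^ Suc k) (v \<cdot> qR t) = 0" by (simp only: Tpow_scl_real v(2) scl_zero_left)
    show "form (v \<cdot> qR t) ((?T ^^ k) (v \<cdot> qR t)) = qR (sgn r)"
      by (simp add: Tpow_scl_real form_scl_left form_scl_right r t[symmetric])
    show "sgn r = 1 \<or> sgn r = - 1" using r0 by (auto simp: sgn_if)
  qed simp
  then obtain v where v: "v \<in> V" "(?T ^^ Suc k) v = 0" "form v ((?T ^^ k) v) = qR (sgn r)"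
    "\<And>i. i < k \<Longrightarrow> form v ((?T ^^ i) v) = 0" by auto
  show ?thesis
  proof (rule that[OF v(1,2), of "if r > 0 then 1 else -1"])
    fix i
    consider "i < k" | "i = k" | "i > k" by linarith
    thus "form v ((?T ^^ i) v) = (if i = k then of_int (if r > 0 then 1 else -1) else 0)"
    proof cases
      case 3
      thus ?thesis using Tpow_mono[OF v(2), of i] by simp
    qed (use v r0 in \<open>auto simp: sgn_if\<close>)
  qed auto
qed

text \<open>
  By induction \<open>d = [T z x, u] - [x, T z' u] = [x, u] z' - z' [x, u]\<close>, with \<open>z'\<close> the conjugate of \<open>z\<close>, is
  complex; as \<open>z\<close> is not real this forces \<open>[x, u]\<close> to be complex, whence \<open>d = 0\<close>.
\<close>

lemma form_complex:
  assumes "Im z \<noteq> 0" "(T z ^^ a) x = 0" "(T (cnj z) ^^ b) u = 0"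
  shows "qJ (form x u) = 0 \<and> qK (form x u) = 0 \<and> form (T z x) u = form x (T (cnj z) u)"
  using assms(2,3)
proof (induction "a + b" arbitrary: a b x u)
  case 0
  thus ?case by simp
next
  case (Suc n)
  let ?d = "form (T z x) u - form x (T (cnj z) u)"
  let ?q = "form x u"
  have d: "?d = ?q * qC (cnj z) - qC (cnj z) * ?q"
    by (simp add: T_def form_diff_left form_diff_right form_scl_left form_scl_right form_B)
  have 1: "qJ (form (T z x) u) = 0 \<and> qK (form (T z x) u) = 0"
  proof (cases a)
    case 0
    thus ?thesis using Suc.prems by simp
  next
    case (Suc a')
    thus ?thesis using Suc.hyps(1)[of a' b "T z x" u] Suc.prems Suc.hyps(2) by (simp add: funpow_swap1)
  qed
  have 2: "qJ (form x (T (cnj z) u)) = 0 \<and> qK (form x (T (cnj z) u)) = 0"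
  proof (cases b)
    case 0
    thus ?thesis using Suc.prems by simp
  next
    case (Suc b')
    thus ?thesis using Suc.hyps(1)[of a b' x "T (cnj z) u"] Suc.prems Suc.hyps(2) by (simp add: funpow_swap1)
  qed
  have "qJ ?d = - 2 * Im z * qK ?q" "qK ?d = 2 * Im z * qJ ?q"
    unfolding d by (auto simp: quat_sel_times)
  hence q: "qJ ?q = 0" "qK ?q = 0" using 1 2 assms(1) by auto
  have "?q = qC (Complex (qRe ?q) (qI ?q))" using q by (rule quat_complexI)
  hence "?q * qC (cnj z) = qC (cnj z) * ?q" by (metis quat_of_complex_simps(6) mult.commute)
  hence "?d = 0" unfolding d by simp
  thus ?case using q by simp
qed

text \<open>Moving \<open>T z\<close> across the form turns it into \<open>T (cnj z)\<close> up to
  the commutator of the form value with \<open>cnj z\<close>. That commutator vanishes where the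
  values are complex, that is, between these two generalised eigenspaces.\<close>

lemma form_Tpow_complex:
  assumes "Im z \<noteq> 0" "(T z ^^ a) x = 0" "(T (cnj z) ^^ b) u = 0"
  shows "form ((T z ^^ i) x) u = form x ((T (cnj z) ^^ i) u)"
  using assms(2,3)
proof (induction i arbitrary: x a)
  case (Suc i)
  have "(T z ^^ a) (T z x) = 0" using Suc.prems by (metis Tpow_commute T_zero)
  from Suc.IH[OF this Suc.prems(2)]
  have "form ((T z ^^ Suc i) x) u = form (T z x) ((T (cnj z) ^^ i) u)" by (simp add: funpow_swap1)
  also have "\<dots> = form x (T (cnj z) ((T (cnj z) ^^ i) u))"
  proof -
    have "(T (cnj z) ^^ b) ((T (cnj z) ^^ i) u) = 0"
      using Suc.prems(2) by (metis funpow_add o_apply add.commute Tpow_zero)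
    from form_complex[OF assms(1) Suc.prems(1) this] show ?thesis by simp
  qed
  finally show ?case by simp
qed simp

text \<open>
  On the generalised eigenspace of a nonreal \<open>z\<close> the form takes values in the complex multiples of
  \<open>j\<close>, so it is alternating there, while all powers of \<open>T z\<close> are selfadjoint.
\<close>

lemma form_Tpow_isotropic:
  assumes "Im z \<noteq> 0" "(T z ^^ a) x = 0"
  shows "form ((T z ^^ i) x) ((T z ^^ j) x) = 0"
proof -
  define w where "w = (T z ^^ (i + j)) x"
  \<comment> \<open>Multiplication by \<open>j\<close> carries the chain into the generalised
    eigenspace of \<open>cnj z\<close>, so that the shift identity for two different spaces applies
    to a single chain.\<close>
  have xj: "(T (cnj z) ^^ a) ((T z ^^ k) x \<cdot> quat_j) = 0" for k
    using assms(2) unfolding Tpow_scl_j by (metis funpow_add o_apply add.commute Tpow_zero scl_zero_left)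
  have shift: "form ((T z ^^ k) x) ((T z ^^ m) x) = form x ((T z ^^ (k + m)) x)" for k m
  proof -
    have "form ((T z ^^ k) x) ((T z ^^ m) x) * quat_j = form ((T z ^^ k) x) ((T z ^^ m) x \<cdot> quat_j)"
      by (simp add: form_scl_right)
    also have "\<dots> = form x ((T (cnj z) ^^ k) ((T z ^^ m) x \<cdot> quat_j))"
      by (rule form_Tpow_complex[OF assms xj])
    also have "\<dots> = form x ((T z ^^ (k + m)) x) * quat_j"
      by (simp add: Tpow_scl_j form_scl_right funpow_add)
    finally show ?thesis by (simp add: mult_right_cancel)
  qed
  let ?q = "form x w"
  \<comment> \<open>Here \<open>q * j\<close> is complex, so \<open>q\<close> has only components
    along \<open>j\<close> and \<open>k\<close>; being equal to its conjugate, \<open>q\<close> is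
    also real, hence zero.\<close>
  have "qJ (form x (w \<cdot> quat_j)) = 0 \<and> qK (form x (w \<cdot> quat_j)) = 0"
    using form_complex[OF assms xj] unfolding w_def by blast
  hence "qRe ?q = 0" "qI ?q = 0" by (auto simp: form_scl_right quat_sel_times)
  moreover have "qcnj ?q = ?q"
    unfolding form_herm[of w x, symmetric] using shift[of "i + j" 0] by (simp add: w_def)
  hence "?q = qR (qRe ?q)" by (rule quat_self_conj)
  ultimately show ?thesis unfolding shift w_def by simp
qed

text \<open>Here \<open>x\<close> stays fixed and \<open>u\<close> alone is corrected, so the
  equation for the coefficient is linear: with \<open>g k = 1\<close> the value
  \<open>- g (k - Suc m)\<close> solves it. Complex form values are carried along because the
  correcting scalar must commute with \<open>T z\<close>.\<close>

lemma complex_normalize: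
  assumes "u \<in> V" "(T z ^^ Suc k) u = 0" "form x ((T z ^^ k) u) = 1"
    "\<And>i. \<exists>c. form x ((T z ^^ i) u) = qC c" "m \<le> k"
  shows "\<exists>u\<in>V. (T z ^^ Suc k) u = 0 \<and> form x ((T z ^^ k) u) = 1 \<and> (\<forall>i. \<exists>c. form x ((T z ^^ i) u) = qC c) \<and>
    (\<forall>i. k - m \<le> i \<and> i < k \<longrightarrow> form x ((T z ^^ i) u) = 0)"
  using assms(5)
proof (induction m)
  case 0
  thus ?case using assms by (intro bexI[of _ u]) auto
next
  case (Suc m)
  let ?T = "T z"
  from Suc obtain u where u: "u \<in> V" "(?T ^^ Suc k) u = 0" "form x ((?T ^^ k) u) = 1"
    "\<And>i. k - m \<le> i \<Longrightarrow> i < k \<Longrightarrow> form x ((?T ^^ i) u) = 0" "\<forall>i. \<exists>c. form x ((T z ^^ i) u) = qC c" by auto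
  from u(5) obtain g where g: "\<And>i. form x ((T z ^^ i) u) = qC (g i)" by metis
  have g0: "g i = 0" if "i > k" for i
    using g[of i] Tpow_mono[OF u(2), of i] that by simp
  have gk: "g k = 1" using g[of k] u(3) by (metis quat_of_complex_simps(2,7))
  have gm: "g i = 0" if "k - m \<le> i" "i < k" for i using u(4)[OF that] g[of i] by simp
  define r where "r = - g (k - Suc m)"
  define u' where "u' = u + (?T ^^ Suc m) u \<cdot> qC r"
  have form': "form x ((?T ^^ i) u') = qC (g i + g (i + Suc m) * r)" for i
  proof -
    have p: "(?T ^^ a) ((?T ^^ b) w) = (?T ^^ (a + b)) w" for a b w by (simp add: funpow_add)
    show ?thesis
      unfolding u'_def
      by (simp only: Tpow_add Tpow_scl_complex form_add_right form_scl_right p g) simp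
  qed
  have "u' \<in> V" unfolding u'_def using u(1) by (intro V_add V_scl V_Tpow)
  moreover have "(?T ^^ Suc k) u' = 0"
  proof -
    have "(?T ^^ Suc k) ((?T ^^ Suc m) u) = (?T ^^ Suc m) ((?T ^^ Suc k) u)"
      by (metis funpow_add o_apply add.commute)
    thus ?thesis unfolding u'_def by (simp only: Tpow_add Tpow_scl_complex u(2) Tpow_zero scl_zero_left add_0_right)
  qed
  moreover have "form x ((?T ^^ k) u') = 1"
    unfolding form' by (simp add: gk g0)
  moreover have "form x ((?T ^^ i) u') = 0" if i: "k - Suc m \<le> i" "i < k" for i
  proof (cases "i = k - Suc m")
    case True
    have "i + Suc m = k" using True Suc.prems by simp
    thus ?thesis unfolding form' by (simp add: gk r_def True[symmetric])
  next
    case False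
    hence "i + Suc m > k" "k - m \<le> i" using i Suc.prems by auto
    thus ?thesis unfolding form' using gm[of i] i by (simp add: g0)
  qed
  moreover have "\<exists>c. form x ((?T ^^ i) u') = qC c" for i using form' by blast
  ultimately show ?case by (intro bexI[of _ u']) auto
qed

text \<open>A maximal chain for \<open>z\<close> is moved to \<open>cnj z\<close> by
  \<open>j\<close>; duality then gives a partner \<open>x\<close> in the generalised eigenspace of
  \<open>z\<close>. The two chains generate the two halves of a block, each isotropic and paired
  with the other.\<close>

lemma complex_chain:
  assumes ann: "\<And>v. v \<in> V \<Longrightarrow> foldr T zs v = 0"
    and y: "y \<in> V" "y \<noteq> 0" "T z y = 0" and z: "Im z \<noteq> 0"
  obtains k x u where "x \<in> V" "u \<in> V" "(T z ^^ Suc k) x = 0" "(T (cnj z) ^^ Suc k) u = 0"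
    "\<And>i. form x ((T (cnj z) ^^ i) u) = (if i = k then 1 else 0)"
proof -
  obtain k u where k: "\<And>v m. v \<in> V \<Longrightarrow> (T z ^^ m) v = 0 \<Longrightarrow> (T z ^^ Suc k) v = 0"
    "u \<in> V" "(T z ^^ Suc k) u = 0" "(T z ^^ k) u \<noteq> 0"
    using max_chain[OF ann y] by metis
  define u' where "u' = u \<cdot> quat_j"
  have u': "u' \<in> V" "(T (cnj z) ^^ Suc k) u' = 0" "(T (cnj z) ^^ k) u' \<noteq> 0"
    unfolding u'_def Tpow_scl_j using k by (auto simp: scl_eq_0 intro: V_scl)
  from dual_vector[OF ann V_Tpow[OF u'(1)] u'(3), of z] u'(2) obtain x m c where
    x: "x \<in> V" "(T z ^^ m) x = 0" "form x ((T (cnj z) ^^ k) u') = qC c" "c \<noteq> 0" by auto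
  have x': "(T z ^^ Suc k) x = 0" by (rule k(1)[OF x(1,2)])
  have "\<exists>u\<in>V. (T (cnj z) ^^ Suc k) u = 0 \<and> form x ((T (cnj z) ^^ k) u) = 1 \<and> (\<forall>i. \<exists>c. form x ((T (cnj z) ^^ i) u) = qC c) \<and>
    (\<forall>i. k - k \<le> i \<and> i < k \<longrightarrow> form x ((T (cnj z) ^^ i) u) = 0)"
  proof (rule complex_normalize)
    show "u' \<cdot> qC (inverse c) \<in> V" using u' V_scl by auto
    show z0: "(T (cnj z) ^^ Suc k) (u' \<cdot> qC (inverse c)) = 0"
      by (simp only: Tpow_scl_complex u'(2) scl_zero_left)
    show "form x ((T (cnj z) ^^ k) (u' \<cdot> qC (inverse c))) = 1"
      using x by (simp add: Tpow_scl_complex form_scl_right quat_of_complex_simps(6)[symmetric] del: quat_of_complex_simps(6))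
    show "\<exists>c'. form x ((T (cnj z) ^^ i) (u' \<cdot> qC (inverse c))) = qC c'" for i
    proof -
      have "(T (cnj z) ^^ Suc k) ((T (cnj z) ^^ i) (u' \<cdot> qC (inverse c))) = 0"
        using z0 by (metis funpow_add o_apply add.commute Tpow_zero)
      from form_complex[OF z x(2) this] show ?thesis using quat_complexI by blast
    qed
  qed simp
  then obtain u where u: "u \<in> V" "(T (cnj z) ^^ Suc k) u = 0" "form x ((T (cnj z) ^^ k) u) = 1"
    "\<And>i. i < k \<Longrightarrow> form x ((T (cnj z) ^^ i) u) = 0" by auto
  show ?thesis
  proof (rule that[OF x(1) u(1) x' u(2)])
    fix i
    consider "i < k" | "i = k" | "i > k" by linarith
    thus "form x ((T (cnj z) ^^ i) u) = (if i = k then 1 else 0)"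
    proof cases
      case 3
      thus ?thesis using Tpow_mono[OF u(2), of i] by simp
    qed (use u in auto)
  qed
qed

section \<open>From chains to blocks of the canonical form\<close>

lemma sum_jordan_column:
  assumes "j < k" "\<And>i. i < k \<Longrightarrow> c i = (if i = j then l else if Suc i = j then 1 else 0)"
  shows "(\<Sum>i<k. e i \<cdot> c i) = e j \<cdot> l + (if j = 0 then 0 else e (j - 1))"
proof -
  have "(\<Sum>i<k. e i \<cdot> c i) = (\<Sum>i<k. (if i = j then e j \<cdot> l else 0) + (if Suc i = j then e i else 0))"
    by (rule sum.cong) (auto simp: assms(2))
  also have "\<dots> = e j \<cdot> l + (\<Sum>i<k. if Suc i = j then e i else 0)"
    using assms(1) by (simp add: sum.distrib)
  also have "(\<Sum>i<k. if Suc i = j then e i else 0) = (if j = 0 then 0 else e (j - 1))"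
  proof (cases j)
    case (Suc j')
    have "(\<Sum>i<k. if Suc i = j then e i else 0) = (\<Sum>i<k. if i = j' then e i else 0)"
      by (rule sum.cong) (auto simp: Suc)
    thus ?thesis using assms(1) Suc by simp
  qed auto
  finally show ?thesis .
qed

text \<open>An upper Jordan block lists its chain from the eigenvector upwards, so basis vector
  \<open>j\<close> is the chain member with exponent \<open>k - j\<close>.\<close>

lemma chain_step:
  assumes "(T z ^^ Suc k) x = 0" "j \<le> k"
  shows "B ((T z ^^ (k - j)) x) = (T z ^^ (k - j)) x \<cdot> qC z + (if j = 0 then 0 else (T z ^^ (k - (j - 1))) x)"
proof -
  have "B ((T z ^^ (k - j)) x) = (T z ^^ (k - j)) x \<cdot> qC z + (T z ^^ Suc (k - j)) x"
    by (simp add: T_def)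
  also have "(T z ^^ Suc (k - j)) x = (if j = 0 then 0 else (T z ^^ (k - (j - 1))) x)"
    using assms by (auto simp: Suc_diff_le[symmetric] simp del: funpow.simps)
  finally show ?thesis .
qed

text \<open>The form of two chain members depends on the sum of their exponents and is nonzero
  exactly when that sum is \<open>k\<close>; in the basis order this is an antidiagonal. The last
  conclusion records the eigenvalue, which is what allows a block for the eigenvalue 0 to be
  demanded later.\<close>

lemma block_exists:
  assumes ann: "\<And>v. v \<in> V \<Longrightarrow> foldr T zs v = 0"
    and y: "y \<in> V" "y \<noteq> 0" "T z y = 0" and z: "Im z \<ge> 0"
  obtains b e where "cblock_valid b" "\<And>i. i < cblock_size b \<Longrightarrow> e i \<in> V"
    "\<And>j. j < cblock_size b \<Longrightarrow> B (e j) = (\<Sum>i<cblock_size b. e i \<cdot> cblock_B b $$ (i, j))"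
    "\<And>i j. i < cblock_size b \<Longrightarrow> j < cblock_size b \<Longrightarrow> form (e i) (e j) = cblock_H b $$ (i, j)"
    "Im z = 0 \<Longrightarrow> \<exists>k s. b = RB k (Re z) s"
proof (cases "Im z = 0")
  case True
  define l where "l = Re z"
  have zl: "z = complex_of_real l" using True by (simp add: l_def complex_eq_iff)
  let ?T = "T (complex_of_real l)"
  obtain k v s where v: "v \<in> V" "(?T ^^ Suc k) v = 0" "s = 1 \<or> s = (-1::int)"
    "\<And>i. form v ((?T ^^ i) v) = (if i = k then of_int s else 0)"
    using real_chain[OF ann y[unfolded zl]] by metis
  define e where "e i = (?T ^^ (k - i)) v" for i
  show ?thesis
  proof (rule that[of "RB (Suc k) l s" e])
    show "cblock_valid (RB (Suc k) l s)" using v(3) by simp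
    show "e i \<in> V" for i unfolding e_def using v(1) by (rule V_Tpow)
    fix j assume j: "j < cblock_size (RB (Suc k) l s)"
    have "(\<Sum>i<Suc k. e i \<cdot> jordan_block (Suc k) (qR l) $$ (i, j)) = e j \<cdot> qR l + (if j = 0 then 0 else e (j - 1))"
      by (rule sum_jordan_column) (use j in auto)
    also have "\<dots> = B (e j)" unfolding e_def using chain_step[OF v(2), of j] j by simp
    finally show "B (e j) = (\<Sum>i<cblock_size (RB (Suc k) l s). e i \<cdot> cblock_B (RB (Suc k) l s) $$ (i, j))"
      by simp
    fix i assume i: "i < cblock_size (RB (Suc k) l s)"
    have "form (e i) (e j) = form v ((?T ^^ (k - i + (k - j))) v)"
      unfolding e_def by (simp add: form_Tpow_real funpow_add)
    also have "\<dots> = cblock_H (RB (Suc k) l s) $$ (i, j)"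
      unfolding v(4) using i j by (auto simp: antidiag_def)
    finally show "form (e i) (e j) = cblock_H (RB (Suc k) l s) $$ (i, j)" .
  qed (auto simp: l_def)
next
  case False
  obtain k x u where xu: "x \<in> V" "u \<in> V" "(T z ^^ Suc k) x = 0" "(T (cnj z) ^^ Suc k) u = 0"
    "\<And>i. form x ((T (cnj z) ^^ i) u) = (if i = k then 1 else 0)"
    using complex_chain[OF ann y False] by metis
  \<comment> \<open>The chain of \<open>z\<close> comes before that of \<open>cnj z\<close>, each
    from its eigenvector upwards. As the chains are isotropic and dual to each other, the Gram
    matrix is one antidiagonal of size \<open>2 * Suc k\<close> without further signs.\<close>
  define e where "e i = (if i \<le> k then (T z ^^ (k - i)) x else (T (cnj z) ^^ (k - (i - Suc k))) u)" for i
  let ?b = "CB (Suc k) z"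
  have sz: "cblock_size ?b = Suc k + Suc k" by simp
  have Bb: "cblock_B ?b = dsum (jordan_block (Suc k) (qC z)) (jordan_block (Suc k) (qC (cnj z)))"
    by (simp add: diag_block_Cons)
  have z': "Im (cnj z) \<noteq> 0" using False by simp
  have exu: "form ((T z ^^ i) x) ((T (cnj z) ^^ j) u) = (if i + j = k then 1 else 0)" for i j
  proof -
    have "(T (cnj z) ^^ Suc k) ((T (cnj z) ^^ j) u) = 0"
      using xu(4) by (metis funpow_add o_apply add.commute Tpow_zero)
    from form_Tpow_complex[OF False xu(3) this, of i] show ?thesis
      using xu(5)[of "i + j"] by (simp add: funpow_add)
  qed
  show ?thesis
  proof (rule that[of ?b e])
    show "cblock_valid ?b" using z False by simp
    show "e i \<in> V" for i unfolding e_def using xu(1,2) by (auto intro: V_Tpow)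
    show "\<exists>k s. ?b = RB k (Re z) s" if "Im z = 0" using that False by simp
    have split: "(\<Sum>i<Suc k + Suc k. f i) = (\<Sum>i<Suc k. f i) + (\<Sum>i<Suc k. f (Suc k + i))" for f :: "nat \<Rightarrow> 'v"
      using sum_lessThan_add[of f "Suc k" "Suc k"] by (simp add: atLeast0LessThan)
    fix j assume j: "j < cblock_size ?b"
    show "B (e j) = (\<Sum>i<cblock_size ?b. e i \<cdot> cblock_B ?b $$ (i, j))"
    proof (cases "j \<le> k")
      case True
      have "(\<Sum>i<Suc k. e i \<cdot> cblock_B ?b $$ (i, j)) = e j \<cdot> qC z + (if j = 0 then 0 else e (j - 1))"
        by (rule sum_jordan_column) (use True in \<open>auto simp: Bb dsum_index simp del: cblock_B.simps\<close>)
      moreover have "(\<Sum>i<Suc k. e (Suc k + i) \<cdot> cblock_B ?b $$ (Suc k + i, j)) = 0"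
        by (rule sum.neutral) (use True in \<open>auto simp: Bb dsum_index simp del: cblock_B.simps\<close>)
      moreover have "B (e j) = e j \<cdot> qC z + (if j = 0 then 0 else e (j - 1))"
        unfolding e_def using chain_step[OF xu(3) True] True by auto
      ultimately show ?thesis unfolding sz split by simp
    next
      case False
      define j' where "j' = j - Suc k"
      have j': "j = Suc k + j'" "j' \<le> k" using False j by (auto simp: j'_def)
      have "(\<Sum>i<Suc k. e (Suc k + i) \<cdot> cblock_B ?b $$ (Suc k + i, j)) =
        e (Suc k + j') \<cdot> qC (cnj z) + (if j' = 0 then 0 else e (Suc k + (j' - 1)))"
        by (rule sum_jordan_column[where e = "\<lambda>i. e (Suc k + i)"]) (use j' in \<open>auto simp: Bb dsum_index simp del: cblock_B.simps\<close>)
      moreover have "(\<Sum>i<Suc k. e i \<cdot> cblock_B ?b $$ (i, j)) = 0"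
        by (rule sum.neutral) (use j' in \<open>auto simp: Bb dsum_index simp del: cblock_B.simps\<close>)
      moreover have "B (e j) = e (Suc k + j') \<cdot> qC (cnj z) + (if j' = 0 then 0 else e (Suc k + (j' - 1)))"
        unfolding e_def using chain_step[OF xu(4) j'(2)] j' by auto
      ultimately show ?thesis unfolding sz split by simp
    qed
    fix i assume i: "i < cblock_size ?b"
    have H: "cblock_H ?b $$ (i, j) = (if i + j = 2 * k + 1 then 1 else 0)"
      using i j by (auto simp: antidiag_def)
    have uu: "form ((T (cnj z) ^^ a) u) ((T (cnj z) ^^ b) u) = 0" for a b
      by (rule form_Tpow_isotropic[OF z' xu(4)])
    have xx: "form ((T z ^^ a) x) ((T z ^^ b) x) = 0" for a b
      by (rule form_Tpow_isotropic[OF False xu(3)])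
    have eux: "form ((T (cnj z) ^^ j) u) ((T z ^^ i) x) = (if i + j = k then 1 else 0)" for i j
      unfolding form_herm[of "(T (cnj z) ^^ j) u"] exu by simp
    show "form (e i) (e j) = cblock_H ?b $$ (i, j)"
      unfolding H e_def using i j by (auto simp: exu eux uu xx)
  qed
qed

end

section \<open>Existence of the canonical form\<close>

context quat_space
begin

lemma B_sum: "B (sum f A) = (\<Sum>i\<in>A. B (f i))"
  by (induction A rule: infinite_finite_induct) (auto simp: B_add)

lemma scl_sum_left: "sum f A \<cdot> q = (\<Sum>i\<in>A. f i \<cdot> q)"
  by (induction A rule: infinite_finite_induct) (auto simp: scl_add_left)

text \<open>Evaluation of a polynomial at \<open>B\<close> on the right complex space underlying
  \<open>V\<close>. It commutes with complex scalars, but for nonreal coefficients in general not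
  with quaternions.\<close>

definition pact :: "complex poly \<Rightarrow> 'v \<Rightarrow> 'v" where
  "pact p v = (\<Sum>i\<le>degree p. (B ^^ i) v \<cdot> qC (coeff p i))"

lemma pact_bound:
  assumes "degree p \<le> n"
  shows "pact p v = (\<Sum>i\<le>n. (B ^^ i) v \<cdot> qC (coeff p i))"
  unfolding pact_def using assms
  by (intro sum.mono_neutral_left) (auto simp: coeff_eq_0)

lemma pact_linear_factor: "pact ([:- z, 1:] * q) v = T z (pact q v)"
proof -
  let ?N = "degree q"
  have d: "degree ([:- z, 1:] * q) \<le> Suc ?N"
    by (rule order_trans[OF degree_mult_le]) simp
  have c: "coeff ([:- z, 1:] * q) i = coeff (pCons 0 q) i - z * coeff q i" for i by simp
  have "pact ([:- z, 1:] * q) v =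
     (\<Sum>i\<le>Suc ?N. (B ^^ i) v \<cdot> qC (coeff (pCons 0 q) i)) - (\<Sum>i\<le>Suc ?N. (B ^^ i) v \<cdot> qC (z * coeff q i))"
    unfolding pact_bound[OF d] c quat_of_complex_simps(4) scl_diff_right sum_subtractf ..
  also have "(\<Sum>i\<le>Suc ?N. (B ^^ i) v \<cdot> qC (coeff (pCons 0 q) i)) = (\<Sum>i\<le>?N. (B ^^ Suc i) v \<cdot> qC (coeff q i))"
    by (subst sum.atMost_Suc_shift) (simp del: sum.atMost_Suc)
  also have "\<dots> = B (pact q v)"
    by (simp add: pact_def B_sum B_scl)
  also have "(\<Sum>i\<le>Suc ?N. (B ^^ i) v \<cdot> qC (z * coeff q i)) = (\<Sum>i\<le>Suc ?N. (B ^^ i) v \<cdot> qC (coeff q i) \<cdot> qC z)"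
    by (intro sum.cong refl) (metis scl_mult quat_of_complex_simps(6) mult.commute)
  also have "\<dots> = pact q v \<cdot> qC z"
    by (subst pact_bound[of q "Suc ?N"]) (simp_all only: scl_sum_left le_SucI order_refl)
  finally show ?thesis by (simp add: T_def)
qed

text \<open>The fundamental theorem of algebra splits off one root at a time; the constant that
  remains acts as the scalar \<open>a\<close>.\<close>

lemma pact_factorization:
  assumes "p \<noteq> 0"
  shows "\<exists>zs a. a \<noteq> 0 \<and> (\<forall>v. pact p v = foldr T zs (v \<cdot> qC a))"
  using assms
proof (induction "degree p" arbitrary: p)
  case 0
  then obtain a where a: "p = [:a:]" by (metis degree_eq_zeroE)
  thus ?case using 0 by (intro exI[of _ "[]"] exI[of _ a]) (auto simp: pact_def)
next
  case (Suc n)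
  hence "\<not> constant (poly p)" by (simp add: constant_degree)
  then obtain z where "poly p z = 0" using fundamental_theorem_of_algebra by blast
  then obtain q where q: "p = [:- z, 1:] * q" by (auto simp: poly_eq_0_iff_dvd)
  have q0: "q \<noteq> 0" using q Suc by auto
  have "degree p = Suc (degree q)" unfolding q by (subst degree_mult_eq) (use q0 in auto)
  from Suc.hyps(1)[of q] this Suc.hyps(2) q0 obtain zs a where
    za: "a \<noteq> 0" "\<And>v. pact q v = foldr T zs (v \<cdot> qC a)" by auto
  show ?case unfolding q pact_linear_factor
    by (intro exI[of _ "z # zs"] exI[of _ a]) (use za in auto)
qed

text \<open>A real linear relation among the powers of \<open>B\<close> becomes a product of linear
  factors that vanishes on \<open>V\<close>; applying the relation to \<open>v\<close> divided by
  the leading scalar removes that scalar.\<close>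

lemma annihilator:
  assumes c: "\<exists>i\<le>N. c i \<noteq> 0" "\<And>v. v \<in> V \<Longrightarrow> (\<Sum>i\<le>N. (B ^^ i) v \<cdot> qR (c i)) = 0"
  obtains zs where "\<And>v. v \<in> V \<Longrightarrow> foldr T zs v = 0"
proof -
  define p where "p = Poly (map (\<lambda>i. complex_of_real (c i)) [0..<Suc N])"
  have cf: "coeff p i = (if i \<le> N then complex_of_real (c i) else 0)" for i
    unfolding p_def by (simp add: coeff_Poly_eq nth_default_def del: upt_Suc)
  have "p \<noteq> 0" using c(1) cf by (metis coeff_0 of_real_eq_0_iff)
  have "degree p \<le> N" by (rule degree_le) (simp add: cf)
  from pact_factorization[OF \<open>p \<noteq> 0\<close>] obtain zs a where
    za: "a \<noteq> 0" "\<And>v. pact p v = foldr T zs (v \<cdot> qC a)" by auto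
  show ?thesis
  proof (rule that[of zs])
    fix v assume v: "v \<in> V"
    define w where "w = v \<cdot> qC (inverse a)"
    have w: "w \<in> V" "w \<cdot> qC a = v"
      unfolding w_def using v za(1)
      by (auto simp: V_scl scl_mult[symmetric] quat_of_complex_simps(6)[symmetric] simp del: quat_of_complex_simps(6))
    have "foldr T zs v = pact p w" using za w by simp
    also have "\<dots> = (\<Sum>i\<le>N. (B ^^ i) w \<cdot> qR (c i))"
      unfolding pact_bound[OF \<open>degree p \<le> N\<close>] by (rule sum.cong) (auto simp: cf)
    finally show "foldr T zs v = 0" using c(2)[OF w(1)] by simp
  qed
qed

end

section \<open>Matrices as endomorphisms and forms on coordinate functions\<close>

lemma sum_fun_apply: "(sum f A) x = (\<Sum>i\<in>A. f i x)"
  by (induction A rule: infinite_finite_induct) auto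

text \<open>
  The vectors of \<open>\<bbbH>\<^sup>n\<close> as functions vanishing outside \<open>{..<n}\<close>: unlike carrier-based vectors these are
  elements of a type of class \<^class>\<open>ab_group_add\<close>, so that sums are available.
\<close>

definition fV :: "nat \<Rightarrow> (nat \<Rightarrow> quat) set" where
  "fV n = {v. \<forall>i\<ge>n. v i = 0}"

definition fscl :: "(nat \<Rightarrow> quat) \<Rightarrow> quat \<Rightarrow> nat \<Rightarrow> quat" where
  "fscl v q = (\<lambda>i. v i * q)"

definition fmap :: "nat \<Rightarrow> quat mat \<Rightarrow> (nat \<Rightarrow> quat) \<Rightarrow> nat \<Rightarrow> quat" where
  "fmap n B v = (\<lambda>i. if i < n then \<Sum>j<n. B $$ (i,j) * v j else 0)"

definition fform :: "nat \<Rightarrow> quat mat \<Rightarrow> (nat \<Rightarrow> quat) \<Rightarrow> (nat \<Rightarrow> quat) \<Rightarrow> quat" where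
  "fform n H v w = (\<Sum>i<n. \<Sum>j<n. qcnj (v i) * H $$ (i,j) * w j)"

definition funit :: "nat \<Rightarrow> nat \<Rightarrow> quat" where
  "funit b = (\<lambda>i. if i = b then 1 else 0)"

lemma fform_fmap_right:
  assumes "H \<in> carrier_mat n n" "B \<in> carrier_mat n n"
  shows "fform n H v (fmap n B w) = fform n (H * B) v w"
proof -
  have "fform n H v (fmap n B w) = (\<Sum>i<n. \<Sum>j<n. \<Sum>k<n. qcnj (v i) * H $$ (i,j) * (B $$ (j,k) * w k))"
    by (simp add: fform_def fmap_def sum_distrib_left)
  also have "\<dots> = (\<Sum>i<n. \<Sum>k<n. \<Sum>j<n. qcnj (v i) * H $$ (i,j) * (B $$ (j,k) * w k))"
    by (intro sum.cong refl sum.swap)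
  also have "\<dots> = fform n (H * B) v w"
    using assms by (auto simp: fform_def scalar_prod_def sum_distrib_left sum_distrib_right mult.assoc
        atLeast0LessThan intro!: sum.cong)
  finally show ?thesis .
qed

lemma fform_fmap_left:
  assumes "H \<in> carrier_mat n n" "B \<in> carrier_mat n n"
  shows "fform n H (fmap n B v) w = fform n (qadj B * H) v w"
proof -
  have "fform n H (fmap n B v) w = (\<Sum>i<n. \<Sum>j<n. \<Sum>k<n. qcnj (v k) * qcnj (B $$ (i,k)) * H $$ (i,j) * w j)"
    by (simp add: fform_def fmap_def sum_distrib_right qcnj_sum qcnj_mult)
  also have "\<dots> = (\<Sum>i<n. \<Sum>k<n. \<Sum>j<n. qcnj (v k) * qcnj (B $$ (i,k)) * H $$ (i,j) * w j)"
    by (intro sum.cong refl sum.swap)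
  also have "\<dots> = (\<Sum>k<n. \<Sum>i<n. \<Sum>j<n. qcnj (v k) * qcnj (B $$ (i,k)) * H $$ (i,j) * w j)"
    by (rule sum.swap)
  also have "\<dots> = (\<Sum>k<n. \<Sum>j<n. \<Sum>i<n. qcnj (v k) * qcnj (B $$ (i,k)) * H $$ (i,j) * w j)"
    by (intro sum.cong refl sum.swap)
  also have "\<dots> = fform n (qadj B * H) v w"
    using assms by (auto simp: fform_def scalar_prod_def sum_distrib_left sum_distrib_right mult.assoc
        atLeast0LessThan intro!: sum.cong)
  finally show ?thesis .
qed

lemma fform_unit:
  assumes "i < n" shows "fform n H (funit i) w = (\<Sum>j<n. H $$ (i,j) * w j)"
proof -
  have "fform n H (funit i) w = (\<Sum>k<n. if k = i then (\<Sum>j<n. H $$ (i,j) * w j) else 0)"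
    unfolding fform_def by (rule sum.cong) (auto simp: funit_def)
  thus ?thesis using assms by simp
qed

lemma quat_space_mat:
  assumes H: "H \<in> carrier_mat n n" "invertible_mat H" "qadj H = H"
    and B: "B \<in> carrier_mat n n" "qadj B * H = H * B"
  shows "quat_space (fV n) fscl (fmap n B) (fform n H)"
proof
  fix v w w' :: "nat \<Rightarrow> quat" and p q :: quat
  show "fmap n B (v + w) = fmap n B v + fmap n B w"
    by (auto simp: fmap_def sum.distrib distrib_left)
  show "fmap n B (fscl v q) = fscl (fmap n B v) q"
    by (auto simp: fmap_def fscl_def sum_distrib_right mult.assoc)
  show "fform n H v (w + w') = fform n H v w + fform n H v w'"
    by (simp add: fform_def distrib_left sum.distrib)
  show "fform n H v (fscl w q) = fform n H v w * q"
    by (simp add: fform_def fscl_def sum_distrib_right mult.assoc)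
  have h: "qcnj (H $$ (i,j)) = H $$ (j,i)" if "i < n" "j < n" for i j
    using that H(1) arg_cong[OF H(3), of "\<lambda>M. M $$ (j,i)"] by auto
  show "fform n H w v = qcnj (fform n H v w)"
    unfolding fform_def qcnj_sum
    by (subst sum.swap) (auto simp: qcnj_mult h mult.assoc intro!: sum.cong)
  show "fform n H (fmap n B v) w = fform n H v (fmap n B w)"
    using H(1) B by (simp add: fform_fmap_left fform_fmap_right)
  assume v: "v \<in> fV n" "v \<noteq> 0"
  show "\<exists>w\<in>fV n. fform n H w v \<noteq> 0"
  proof (rule ccontr)
    assume c: "\<not> ?thesis"
    have "H *\<^sub>v vec n v = 0\<^sub>v n"
    proof (rule eq_vecI)
      fix i assume i: "i < dim_vec (0\<^sub>v n :: quat vec)"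
      have "funit i \<in> fV n" using i by (auto simp: fV_def funit_def)
      hence "fform n H (funit i) v = 0" using c by auto
      thus "(H *\<^sub>v vec n v) $ i = 0\<^sub>v n $ i"
        using i H(1) by (simp add: fform_unit scalar_prod_def atLeast0LessThan)
    qed (use H in auto)
    hence "vec n v = 0\<^sub>v n" using minjD[OF invertible_minj[OF H(2,1)] H(1)] by auto
    hence "v i = 0" if "i < n" for i using that by (metis index_vec index_zero_vec(1))
    hence "v = 0" using v(1) by (auto simp: fV_def not_le fun_eq_iff) (metis not_le)
    thus False using v by simp
  qed
qed (auto simp: fV_def fscl_def fmap_def distrib_left distrib_right mult.assoc)

text \<open>Quaternion matrices of size \<open>n\<close> form a real space of dimension
  \<open>4 * n * n\<close>, the number \<open>N\<close> of triples below, so the first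
  \<open>N + 1\<close> powers are linearly dependent over the reals. The relation is found on the
  unit vectors, one equation for each real component of each entry.\<close>

lemma fmap_annihilated:
  assumes "quat_space (fV n) fscl (fmap n B) (fform n H)"
  obtains zs where "\<And>v. v \<in> fV n \<Longrightarrow> foldr (quat_space.T fscl (fmap n B)) zs v = 0"
proof -
  interpret quat_space "fV n" fscl "fmap n B" "fform n H" by fact
  define comp :: "nat \<Rightarrow> quat \<Rightarrow> real" where
    "comp t q = (if t = 0 then qRe q else if t = 1 then qI q else if t = 2 then qJ q else qK q)" for t q
  define I where "I = {..<n} \<times> {..<n} \<times> {..<4::nat}"
  define N where "N = card I"
  have "finite I" by (simp add: I_def)
  obtain c where c: "\<exists>i\<in>{..N}. c i \<noteq> 0"
    "\<forall>abt\<in>I. (\<Sum>i\<in>{..N}. (case abt of (a,b,t) \<Rightarrow> comp t ((fmap n B ^^ i) (funit b) a)) * c i) = 0"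
    using homogeneous_system_set[OF \<open>finite I\<close>, of "{..N}" "\<lambda>abt i. (case abt of (a,b,t) \<Rightarrow> comp t ((fmap n B ^^ i) (funit b) a))"]
    by (auto simp: N_def)
  have fu: "funit b \<in> fV n" if "b < n" for b using that by (auto simp: fV_def funit_def)
  have pV: "(fmap n B ^^ i) v \<in> fV n" if "v \<in> fV n" for i v
    using that by (induction i) (auto intro: V_B)
  have u: "(\<Sum>i\<le>N. (fmap n B ^^ i) (funit b) a * qR (c i)) = 0" if b: "b < n" for a b
  proof (cases "a < n")
    case True
    have s: "(\<Sum>i\<le>N. comp t ((fmap n B ^^ i) (funit b) a) * c i) = 0" if "t < 4" for t
      using c(2) that b True by (auto simp: I_def)
    have q: "qRe (\<Sum>i\<in>A. f i) = (\<Sum>i\<in>A. qRe (f i))" "qI (\<Sum>i\<in>A. f i) = (\<Sum>i\<in>A. qI (f i))"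
      "qJ (\<Sum>i\<in>A. f i) = (\<Sum>i\<in>A. qJ (f i))" "qK (\<Sum>i\<in>A. f i) = (\<Sum>i\<in>A. qK (f i))" for f and A :: "nat set"
      by (induction A rule: infinite_finite_induct) auto
    show ?thesis
      by (rule quat_eqI)
         (use s[of 0] s[of 1] s[of 2] s[of 3] in \<open>auto simp: q quat_sel_times comp_def\<close>)
  next
    case False
    hence "(fmap n B ^^ i) (funit b) a = 0" for i using pV[OF fu[OF b], of i] by (auto simp: fV_def)
    thus ?thesis by simp
  qed
  have ex: "v = (\<Sum>b<n. fscl (funit b) (v b))" if "v \<in> fV n" for v
  proof
    fix a
    have "(\<Sum>b<n. fscl (funit b) (v b)) a = (\<Sum>b<n. if b = a then v a else 0)"
      unfolding sum_fun_apply by (rule sum.cong) (auto simp: fscl_def funit_def)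
    also have "\<dots> = v a" using that by (auto simp: fV_def)
    finally show "v a = (\<Sum>b<n. fscl (funit b) (v b)) a" by simp
  qed
  have "(\<Sum>i\<le>N. fscl ((fmap n B ^^ i) v) (qR (c i))) = 0" if v: "v \<in> fV n" for v
  proof -
    have p: "(fmap n B ^^ i) v = (\<Sum>b<n. fscl ((fmap n B ^^ i) (funit b)) (v b))" for i
    proof (induction i)
      case (Suc i)
      have "(fmap n B ^^ Suc i) v = fmap n B ((fmap n B ^^ i) v)" by simp
      thus ?case unfolding Suc by (simp only: B_sum B_scl funpow.simps o_apply)
    qed (use ex[OF v] in simp)
    show ?thesis
    proof
      fix a
      have "(\<Sum>i\<le>N. fscl ((fmap n B ^^ i) v) (qR (c i))) a
        = (\<Sum>i\<le>N. \<Sum>b<n. (fmap n B ^^ i) (funit b) a * v b * qR (c i))"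
        unfolding p sum_fun_apply fscl_def by (simp add: sum_fun_apply sum_distrib_right)
      also have "\<dots> = (\<Sum>b<n. \<Sum>i\<le>N. (fmap n B ^^ i) (funit b) a * v b * qR (c i))"
        by (rule sum.swap)
      also have "\<dots> = (\<Sum>b<n. (\<Sum>i\<le>N. (fmap n B ^^ i) (funit b) a * qR (c i)) * v b)"
      proof -
        \<comment> \<open>Centrality of the real coefficients extends the relation from the unit
          vectors to all right combinations of them.\<close>
        have e: "x * v b * qR r = x * qR r * v b" for x r b
          by (metis mult.assoc quat_of_real_comm)
        show ?thesis unfolding sum_distrib_right e ..
      qed
      also have "\<dots> = 0" by (simp add: u)
      finally show "(\<Sum>i\<le>N. fscl ((fmap n B ^^ i) v) (qR (c i))) a = 0 a" by simp
    qed
  qed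
  with c(1) show ?thesis using annihilator[of N c] that by auto
qed

lemma matrix_block_of_eigenvector:
  assumes H: "H \<in> carrier_mat n n" "invertible_mat H" "qadj H = H"
    and B: "B \<in> carrier_mat n n" "qadj B * H = H * B"
    and y: "y \<in> fV n" "y \<noteq> 0" "fmap n B y = fscl y (qC z)" and z: "Im z \<ge> 0"
  obtains b V where "cblock_valid b" "V \<in> carrier_mat n (cblock_size b)" "B * V = V * cblock_B b"
    "qadj V * H * V = cblock_H b" "Im z = 0 \<Longrightarrow> \<exists>k s. b = RB k (Re z) s"
proof -
  have qs: "quat_space (fV n) fscl (fmap n B) (fform n H)" by (rule quat_space_mat) fact+
  interpret quat_space "fV n" fscl "fmap n B" "fform n H" by fact
  obtain zs where ann: "\<And>v. v \<in> fV n \<Longrightarrow> foldr T zs v = 0" using fmap_annihilated[OF qs] by blast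
  have Ty: "T z y = 0" using y(3) by (simp add: T_def)
  obtain b e where
    be: "cblock_valid b" "\<And>i. i < cblock_size b \<Longrightarrow> e i \<in> fV n"
    "\<And>j. j < cblock_size b \<Longrightarrow> fmap n B (e j) = (\<Sum>i<cblock_size b. fscl (e i) (cblock_B b $$ (i, j)))"
    "\<And>i j. i < cblock_size b \<Longrightarrow> j < cblock_size b \<Longrightarrow> fform n H (e i) (e j) = cblock_H b $$ (i, j)"
    "Im z = 0 \<Longrightarrow> \<exists>k s. b = RB k (Re z) s"
    by (rule block_exists[OF ann y(1,2) Ty z], assumption) (rule that, assumption+)
  define V where "V = mat n (cblock_size b) (\<lambda>(i,j). e j i)"
  show ?thesis
  proof (rule that[OF be(1) _ _ _ be(5)])
    show V: "V \<in> carrier_mat n (cblock_size b)" by (simp add: V_def)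
    show "B * V = V * cblock_B b"
    proof (rule eq_matI)
      fix i j assume ij: "i < dim_row (V * cblock_B b)" "j < dim_col (V * cblock_B b)"
      hence "(B * V) $$ (i,j) = fmap n B (e j) i"
        using V B(1) by (auto simp: scalar_prod_def V_def fmap_def atLeast0LessThan intro!: sum.cong)
      also have "\<dots> = (V * cblock_B b) $$ (i,j)"
        using ij V by (subst be(3)) (auto simp: sum_fun_apply scalar_prod_def V_def fscl_def atLeast0LessThan intro!: sum.cong)
      finally show "(B * V) $$ (i,j) = (V * cblock_B b) $$ (i,j)" .
    qed (use V B(1) in auto)
    show "qadj V * H * V = cblock_H b"
    proof (rule eq_matI)
      fix i j assume ij: "i < dim_row (cblock_H b)" "j < dim_col (cblock_H b)"
      have "(qadj V * H * V) $$ (i,j) = (\<Sum>l<n. (\<Sum>k<n. qcnj (e i k) * H $$ (k,l)) * e j l)"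
        using ij V H(1) by (auto simp: scalar_prod_def V_def atLeast0LessThan intro!: sum.cong)
      also have "\<dots> = fform n H (e i) (e j)"
        unfolding fform_def sum_distrib_right by (rule sum.swap)
      finally show "(qadj V * H * V) $$ (i,j) = cblock_H b $$ (i,j)" using be(4) ij by simp
    qed (use V in auto)
  qed
qed

lemma matrix_block_exists:
  assumes H: "H \<in> carrier_mat n n" "invertible_mat H" "qadj H = H"
    and B: "B \<in> carrier_mat n n" "qadj B * H = H * B" and n: "n > 0"
  obtains b V where "cblock_valid b" "V \<in> carrier_mat n (cblock_size b)" "B * V = V * cblock_B b"
    "qadj V * H * V = cblock_H b"
proof -
  have qs: "quat_space (fV n) fscl (fmap n B) (fform n H)" by (rule quat_space_mat) fact+
  interpret quat_space "fV n" fscl "fmap n B" "fform n H" by fact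
  obtain zs where ann: "\<And>v. v \<in> fV n \<Longrightarrow> foldr T zs v = 0" using fmap_annihilated[OF qs] by blast
  have "funit 0 \<in> fV n" "funit 0 \<noteq> 0"
    using n by (auto simp: fV_def funit_def fun_eq_iff)
  from eigenvector_exists[OF ann[OF this(1)] this(2,1)] obtain z y where
    y: "y \<in> fV n" "y \<noteq> 0" "T z y = 0" by auto
  show ?thesis
  proof (cases "Im z \<ge> 0")
    case True
    have "fmap n B y = fscl y (qC z)" using y(3) by (simp add: T_def)
    from matrix_block_of_eigenvector[OF H B y(1,2) this True] that show ?thesis by metis
  next
    case False
    \<comment> \<open>An eigenvalue in the lower half plane is exchanged for its conjugate.\<close>
    define x where "x = fscl y quat_j"
    have x: "x \<in> fV n" "x \<noteq> 0" "T (cnj z) x = 0"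
      unfolding x_def T_scl_j using y by (auto simp: scl_eq_0 intro: V_scl)
    have "fmap n B x = fscl x (qC (cnj z))" using x(3) by (simp add: T_def)
    from matrix_block_of_eigenvector[OF H B x(1,2) this] False that show ?thesis by auto
  qed
qed

text \<open>Meant for a singular selfadjoint matrix whose nilpotent part is to be removed one Jordan
  block at a time. A kernel vector is an eigenvector for a real eigenvalue, so the block has a
  sign.\<close>

lemma matrix_zero_block_exists:
  assumes H: "H \<in> carrier_mat n n" "invertible_mat H" "qadj H = H"
    and B: "B \<in> carrier_mat n n" "qadj B * H = H * B" and nB: "\<not> minj B"
  obtains k s V where "cblock_valid (RB k 0 s)" "V \<in> carrier_mat n k" "B * V = V * cblock_B (RB k 0 s)"
    "qadj V * H * V = cblock_H (RB k 0 s)"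
proof -
  from nB B(1) obtain v where v: "v \<in> carrier_vec n" "B *\<^sub>v v = 0\<^sub>v n" "v \<noteq> 0\<^sub>v n"
    unfolding minj_def by auto
  define y where "y i = (if i < n then v $ i else 0)" for i
  have "y \<in> fV n" by (auto simp: fV_def y_def)
  moreover have "y \<noteq> 0"
  proof
    assume "y = 0"
    hence "v = 0\<^sub>v n" using v(1) by (intro eq_vecI) (auto simp: y_def fun_eq_iff, metis)
    thus False using v by simp
  qed
  moreover have "fmap n B y = fscl y (qC 0)"
  proof
    fix i
    have "(B *\<^sub>v v) $ i = 0" if "i < n" unfolding v(2) using that by simp
    thus "fmap n B y i = fscl y (qC 0) i"
      using v(1) B(1) by (auto simp: fmap_def fscl_def y_def scalar_prod_def atLeast0LessThan)
  qed
  ultimately obtain b V where bV: "cblock_valid b" "V \<in> carrier_mat n (cblock_size b)" "B * V = V * cblock_B b"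
    "qadj V * H * V = cblock_H b" "\<exists>k s. b = RB k 0 s"
    using matrix_block_of_eigenvector[OF H B, of y 0] by auto
  thus ?thesis using that by (metis cblock_size.simps(1))
qed

section \<open>Assembling the canonical form block by block\<close>

lemma antidiag_square: "antidiag k * antidiag k = 1\<^sub>m k"
proof (rule eq_matI)
  fix i j assume ij: "i < dim_row (1\<^sub>m k :: quat mat)" "j < dim_col (1\<^sub>m k :: quat mat)"
  have "(antidiag k * antidiag k) $$ (i,j) =
    (\<Sum>l<k. (if i + l + 1 = k then 1 else 0) * (if l + j + 1 = k then 1 else 0))"
    using ij by (simp add: antidiag_def scalar_prod_def atLeast0LessThan)
  also have "\<dots> = (\<Sum>l<k. if l = k - Suc i then (if i = j then 1 else 0) else 0)"
    by (rule sum.cong) (use ij in auto)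
  finally show "(antidiag k * antidiag k) $$ (i,j) = 1\<^sub>m k $$ (i,j)" using ij by simp
qed auto

lemma cblock_H_square: "cblock_valid b \<Longrightarrow> cblock_H b * cblock_H b = 1\<^sub>m (cblock_size b)"
proof (cases b)
  case (RB k l e)
  assume "cblock_valid b"
  hence "e = 1 \<or> e = -1" using RB by simp
  moreover have "(of_int e \<cdot>\<^sub>m antidiag k) * (of_int e \<cdot>\<^sub>m antidiag k) = (of_int e * of_int e) \<cdot>\<^sub>m (antidiag k * antidiag k)"
    using smult_real_mult[of "of_int e \<cdot>\<^sub>m antidiag k" "antidiag k" "of_int e"] calculation
    by (auto simp: smult_mult intro!: eq_matI)
  ultimately show ?thesis unfolding RB by (auto simp: antidiag_square)
qed (auto simp: antidiag_square)

lemma cblock_H_invertible: "cblock_valid b \<Longrightarrow> invertible_mat (cblock_H b)"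
  using invertible_matI[of "cblock_H b" "cblock_size b" "cblock_H b"] cblock_H_square by simp

lemma peq_split_off:
  assumes "m \<le> n" "W \<in> carrier_mat n (n - m)" "V \<in> carrier_mat n m" "invertible_mat (hcat W V)"
    "A * hcat W V = hcat W V * dsum A' J" "qadj (hcat W V) * H * hcat W V = dsum H' G"
  shows "peq n A H (dsum A' J) (dsum H' G)"
  using assms by (intro peqI[of "hcat W V"]) auto

lemma hermitian_form_invertible:
  assumes "H \<in> carrier_mat n n" "invertible_mat H" "P \<in> carrier_mat n n" "invertible_mat P"
  shows "invertible_mat (qadj P * H * P)"
proof -
  have "invertible_mat (qadj P * H)"
    by (rule invertible_mult[OF qadj_invertible]) (use assms in auto)
  thus ?thesis by (rule invertible_mult) (use assms in auto)
qed

text \<open>The columns of a block span an invariant subspace whose Gram matrix is its own inverse.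
  It is thus nondegenerate, and its orthogonal complement is a problem of the same kind in smaller
  dimension.\<close>

theorem canonical_form_exists:
  assumes "H \<in> carrier_mat n n" "invertible_mat H" "qadj H = H"
    "B \<in> carrier_mat n n" "qadj B * H = H * B"
  shows "\<exists>bs. (\<forall>b\<in>set bs. cblock_valid b) \<and> blocks_size bs = n \<and> peq n B H (blocks_B bs) (blocks_H bs)"
  using assms
proof (induction n arbitrary: B H rule: less_induct)
  case (less n)
  show ?case
  proof (cases "n = 0")
    case True
    have "B = 0\<^sub>m 0 0" "H = 0\<^sub>m 0 0" using less.prems True by (auto intro!: eq_matI)
    thus ?thesis using True by (intro exI[of _ "[]"]) (auto intro: peq_refl)
  next
    case False
    then obtain b V where bV: "cblock_valid b" "V \<in> carrier_mat n (cblock_size b)" "B * V = V * cblock_B b"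
      "qadj V * H * V = cblock_H b"
      using matrix_block_exists[OF less.prems] by auto
    let ?m = "cblock_size b"
    obtain W B' H' where W: "?m \<le> n" "W \<in> carrier_mat n (n - ?m)" "B' \<in> carrier_mat (n - ?m) (n - ?m)"
      "H' \<in> carrier_mat (n - ?m) (n - ?m)" "invertible_mat (hcat W V)" "qadj H' = H'" "qadj B' * H' = H' * B'"
      "B * hcat W V = hcat W V * dsum B' (cblock_B b)" "qadj (hcat W V) * H * hcat W V = dsum H' (cblock_H b)"
      using split_off[OF less.prems(1,3,4,5) bV(2) cblock_carrier(1) bV(3,4) cblock_H_invertible[OF bV(1)]] by metis
    have hc: "hcat W V \<in> carrier_mat n n" using W(1,2) bV(2) by auto
    have "invertible_mat (dsum H' (cblock_H b))"
      unfolding W(9)[symmetric] by (rule hermitian_form_invertible[OF less.prems(1,2) hc W(5)])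
    hence H'i: "invertible_mat H'" using invertible_dsumD W(4) cblock_carrier by blast
    have mpos: "?m > 0" using bV(1) by (cases b) auto
    from less.IH[OF _ W(4) H'i W(6,3,7)] mpos False obtain bs where
      bs: "\<forall>b\<in>set bs. cblock_valid b" "blocks_size bs = n - ?m" "peq (n - ?m) B' H' (blocks_B bs) (blocks_H bs)"
      by auto
    have nm: "n - ?m + ?m = n" using W(1) by simp
    have 1: "peq n B H (dsum B' (cblock_B b)) (dsum H' (cblock_H b))"
      by (rule peq_split_off[OF W(1,2) bV(2) W(5,8,9)])
    have "peq (n - ?m + ?m) (dsum B' (cblock_B b)) (dsum H' (cblock_H b)) (dsum (blocks_B bs) (cblock_B b)) (dsum (blocks_H bs) (cblock_H b))"
      by (rule peq_dsum[OF bs(3) peq_refl]) (use W bs in auto)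
    moreover have "dsum B' (cblock_B b) \<in> carrier_mat n n" "dsum (blocks_B bs) (cblock_B b) \<in> carrier_mat n n"
      using W(3) bs(2) nm by (auto intro!: carrier_matI)
    ultimately have "peq n B H (blocks_B (bs @ [b])) (blocks_H (bs @ [b]))"
      using peq_trans[OF 1 _ less.prems(4,1)] by (simp add: nm)
    thus ?thesis using bs bV(1) nm by (intro exI[of _ "bs @ [b]"]) auto
  qed
qed

section \<open>Uniqueness of the blocks with real eigenvalues\<close>

lemma qadj_vcat: "dim_col A = dim_col B \<Longrightarrow> qadj (vcat A B) = hcat (qadj A) (qadj B)"
  by (rule eq_matI) (auto simp: hcat_def vcat_def)

lemma dsum_mult_vcat:
  fixes A B C D :: "'a::semiring_0 mat"
  shows "dim_col C = dim_col D \<Longrightarrow> dim_col A = dim_row C \<Longrightarrow> dim_col B = dim_row D \<Longrightarrow>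
    dsum A B * vcat C D = vcat (A * C) (B * D)"
  by (rule eq_matI) (auto simp: scalar_prod_def dsum_index vcat_def sum_lessThan_add)

lemma vcat_split:
  assumes "v \<in> carrier_mat (n + m) k"
  obtains a b where "v = vcat a b" "a \<in> carrier_mat n k" "b \<in> carrier_mat m k"
proof
  show "v = vcat (mat n k (\<lambda>(i,j). v $$ (i,j))) (mat m k (\<lambda>(i,j). v $$ (n + i,j)))"
    using assms by (intro eq_matI) (auto simp: vcat_def)
qed auto

lemma vcat_zero: "vcat (0\<^sub>m n k) (0\<^sub>m m k) = 0\<^sub>m (n + m) k"
  by (rule eq_matI) (auto simp: vcat_def)

text \<open>The shift is by a real number because only a central multiple of the identity is
  unaffected by every change of basis.\<close>

definition mshift :: "real \<Rightarrow> quat mat \<Rightarrow> quat mat" where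
  "mshift l M = M + qR (- l) \<cdot>\<^sub>m 1\<^sub>m (dim_row M)"

lemma mshift_carrier [simp]: "M \<in> carrier_mat n n \<Longrightarrow> mshift l M \<in> carrier_mat n n"
  by (auto simp: mshift_def)

lemma mshift_dim [simp]: "dim_row (mshift l M) = dim_row M" "dim_col (mshift l M) = dim_row M"
  by (auto simp: mshift_def)

lemma mshift_dsum:
  "A \<in> carrier_mat n n \<Longrightarrow> B \<in> carrier_mat m m \<Longrightarrow> mshift l (dsum A B) = dsum (mshift l A) (mshift l B)"
  by (rule eq_matI) (auto simp: mshift_def dsum_index)

lemma mshift_jordan: "mshift l (jordan_block n a) = jordan_block n (a - qR l)"
  by (rule eq_matI) (auto simp: mshift_def)

lemma mshift_mult:
  assumes "M \<in> carrier_mat n n" "V \<in> carrier_mat n k"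
  shows "mshift l M * V = M * V + qR (- l) \<cdot>\<^sub>m V"
proof -
  have "mshift l M * V = M * V + (qR (- l) \<cdot>\<^sub>m 1\<^sub>m n) * V"
    unfolding mshift_def carrier_matD(1)[OF assms(1)]
    using assms by (intro add_mult_distrib_mat) auto
  thus ?thesis using assms by (simp add: smult_mult)
qed

lemma mult_mshift:
  assumes "M \<in> carrier_mat n n" "V \<in> carrier_mat k n"
  shows "V * mshift l M = V * M + qR (- l) \<cdot>\<^sub>m V"
proof -
  have "V * mshift l M = V * M + V * (qR (- l) \<cdot>\<^sub>m 1\<^sub>m n)"
    unfolding mshift_def carrier_matD(1)[OF assms(1)]
    using assms by (intro mult_add_distrib_mat) auto
  moreover have "V * (qR (- l) \<cdot>\<^sub>m 1\<^sub>m n) = qR (- l) \<cdot>\<^sub>m (V * 1\<^sub>m n)"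
    using assms by (intro smult_real_mult) auto
  ultimately show ?thesis using assms by simp
qed

lemma dsum_pow:
  fixes A :: "'a::semiring_1 mat"
  assumes "A \<in> carrier_mat n n" "B \<in> carrier_mat m m"
  shows "dsum A B ^\<^sub>m k = dsum (A ^\<^sub>m k) (B ^\<^sub>m k)"
proof (induction k)
  case 0
  thus ?case using assms by (simp add: dsum_one)
next
  case (Suc k)
  have "dsum (A ^\<^sub>m k) (B ^\<^sub>m k) * dsum A B = dsum (A ^\<^sub>m k * A) (B ^\<^sub>m k * B)"
    using assms pow_carrier_mat[OF assms(1), of k] pow_carrier_mat[OF assms(2), of k] by (intro dsum_mult) auto
  thus ?case using Suc by simp
qed

lemma pow_mat_intertwine:
  fixes A :: "'a::semiring_1 mat"
  assumes "A \<in> carrier_mat n n" "B \<in> carrier_mat m m" "P \<in> carrier_mat n m" "A * P = P * B"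
  shows "A ^\<^sub>m k * P = P * B ^\<^sub>m k"
proof (induction k)
  case 0
  thus ?case using assms by simp
next
  case (Suc k)
  have Ak: "A ^\<^sub>m k \<in> carrier_mat n n" "B ^\<^sub>m k \<in> carrier_mat m m"
    using pow_carrier_mat assms by auto
  have "A ^\<^sub>m Suc k * P = A ^\<^sub>m k * P * B"
    using Ak assms(1,2,3) by (simp add: mult_assoc_dim assms(4))
  thus ?case unfolding Suc using Ak assms by (simp add: mult_assoc_dim)
qed

lemma minj_pow_zero:
  fixes A :: "'a::division_ring mat"
  assumes "minj A" "A \<in> carrier_mat n n" "V \<in> carrier_mat n m" "A ^\<^sub>m k * V = 0\<^sub>m n m"
  shows "V = 0\<^sub>m n m"
  using assms(3,4)
proof (induction k arbitrary: V)
  case 0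
  thus ?case using assms by simp
next
  case (Suc k)
  have "A ^\<^sub>m k * (A * V) = 0\<^sub>m n m"
    using Suc.prems assms(2) pow_carrier_mat[OF assms(2), of k] by (simp add: mult_assoc_dim)
  hence "A * V = 0\<^sub>m n m" using Suc.IH[of "A * V"] assms(2) Suc.prems by auto
  thus ?case using minj_mult_zero[OF assms(1,2) Suc.prems(1)] by simp
qed

section \<open>Coordinates inside a single Jordan block\<close>

lemma jordan_mult_vec:
  fixes a :: "'a::semiring_1"
  assumes "v \<in> carrier_vec n" "i < n"
  shows "(jordan_block n a *\<^sub>v v) $ i = a * v $ i + (if Suc i < n then v $ Suc i else 0)"
proof -
  have "(jordan_block n a *\<^sub>v v) $ i = (\<Sum>j<n. (if j = i then a * v $ i else 0) + (if j = Suc i then v $ j else 0))"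
    using assms by (auto simp: scalar_prod_def atLeast0LessThan intro!: sum.cong)
  also have "\<dots> = a * v $ i + (if Suc i < n then v $ Suc i else 0)"
    using assms(2) by (simp add: sum.distrib)
  finally show ?thesis .
qed

lemma minj_jordan:
  fixes a :: "'a::division_ring"
  assumes "a \<noteq> 0" shows "minj (jordan_block n a)"
proof (rule minjI)
  fix v :: "'a vec" assume v: "v \<in> carrier_vec n" "jordan_block n a *\<^sub>v v = 0\<^sub>v n"
  have "v $ i = 0" if "i < n" for i
    using that
  proof (induction "n - i" arbitrary: i rule: less_induct)
    case less
    have "(jordan_block n a *\<^sub>v v) $ i = 0" unfolding v(2) using less by simp
    moreover have "Suc i < n \<Longrightarrow> v $ Suc i = 0" using less by simp
    ultimately show ?case using jordan_mult_vec[OF v(1) less.prems, of a] assms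
      by (cases "Suc i < n") auto
  qed
  thus "v = 0\<^sub>v n" using v(1) by (intro eq_vecI) auto
qed simp

lemma minj_dsum:
  fixes A B :: "'a::division_ring mat"
  assumes "minj A" "A \<in> carrier_mat n n" "minj B" "B \<in> carrier_mat m m"
  shows "minj (dsum A B)"
  by (rule invertible_minj[OF invertible_dsum[OF minj_square_invertible[OF assms(1,2)] assms(2)
    minj_square_invertible[OF assms(3,4)] assms(4)] dsum_carrier[OF assms(2,4)]])

lemma nilpotent_jordan_pow:
  "(jordan_block n (0::'a::semiring_1)) ^\<^sub>m k = mat n n (\<lambda>(i,j). if j = i + k then 1 else 0)"
proof (induction k)
  case 0
  show ?case by (rule eq_matI) auto
next
  case (Suc k)
  show ?case unfolding pow_mat.simps Suc
  proof (rule eq_matI)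
    fix i j assume ij: "i < dim_row (mat n n (\<lambda>(i,j). if j = i + Suc k then 1 else (0::'a)))"
      "j < dim_col (mat n n (\<lambda>(i,j). if j = i + Suc k then 1 else (0::'a)))"
    have "(mat n n (\<lambda>(i,j). if j = i + k then 1 else 0) * jordan_block n (0::'a)) $$ (i,j) =
      (\<Sum>l<n. (if l = i + k then 1 else 0) * (if l = j then 0 else if Suc l = j then 1 else 0))"
      using ij by (simp add: scalar_prod_def atLeast0LessThan)
    also have "\<dots> = (\<Sum>l<n. if l = i + k then (if j = Suc l then 1 else 0) else 0)"
      by (rule sum.cong) auto
    also have "\<dots> = (if j = i + Suc k then 1 else 0)" using ij by auto
    finally show "(mat n n (\<lambda>(i,j). if j = i + k then 1 else 0) * jordan_block n (0::'a)) $$ (i,j) =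
      mat n n (\<lambda>(i,j). if j = i + Suc k then 1 else 0) $$ (i,j)" using ij by simp
  qed auto
qed

lemma nilpotent_jordan_pow_mult:
  fixes v :: "'a::semiring_1 mat"
  assumes "v \<in> carrier_mat n m" "i < n" "c < m"
  shows "((jordan_block n 0) ^\<^sub>m k * v) $$ (i,c) = (if i + k < n then v $$ (i + k, c) else 0)"
proof -
  have "((jordan_block n 0) ^\<^sub>m k * v) $$ (i,c) = (\<Sum>l<n. (if l = i + k then 1 else 0) * v $$ (l, c))"
    unfolding nilpotent_jordan_pow using assms by (simp add: scalar_prod_def atLeast0LessThan)
  also have "\<dots> = (\<Sum>l<n. if l = i + k then v $$ (l, c) else 0)"
    by (rule sum.cong) auto
  finally have "((jordan_block n 0) ^\<^sub>m k * v) $$ (i,c) = (\<Sum>l<n. if l = i + k then v $$ (l, c) else 0)" .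
  thus ?thesis by simp
qed

lemma antidiag_mult:
  assumes "v \<in> carrier_mat n m" "i < n" "c < m"
  shows "(antidiag n * v) $$ (i,c) = v $$ (n - Suc i, c)"
proof -
  have "(antidiag n * v) $$ (i,c) = (\<Sum>l<n. (if i + l + 1 = n then 1 else 0) * v $$ (l, c))"
    using assms by (simp add: antidiag_def scalar_prod_def atLeast0LessThan)
  also have "\<dots> = (\<Sum>l<n. if l = n - Suc i then v $$ (l, c) else 0)"
    by (rule sum.cong) (use assms in auto)
  finally have "(antidiag n * v) $$ (i,c) = (\<Sum>l<n. if l = n - Suc i then v $$ (l, c) else 0)" .
  thus ?thesis using assms by simp
qed

lemma qadj_mult_index:
  assumes "v \<in> carrier_mat j 1" "M \<in> carrier_mat j 1"
  shows "(qadj v * M) $$ (0,0) = (\<Sum>i<j. qcnj (v $$ (i,0)) * M $$ (i,0))"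
  using assms by (simp add: scalar_prod_def atLeast0LessThan)

text \<open>A vector killed by \<open>J^k\<close> has zero coordinates from index \<open>k\<close>
  on, so \<open>J^(k-1) v\<close> has at most its coordinate 0, which is the coordinate
  \<open>k - 1\<close> of \<open>v\<close>. The antidiagonal pairs it with coordinate
  \<open>j - 1\<close> of \<open>v\<close>, and both can be nonzero only if
  \<open>j = k\<close>.\<close>

lemma real_block_form:
  assumes v: "v \<in> carrier_mat j 1" and k: "k \<ge> 1"
    and D: "(jordan_block j 0) ^\<^sub>m k * v = 0\<^sub>m j 1"
  shows "(qadj v * (of_int e \<cdot>\<^sub>m antidiag j) * (jordan_block j 0) ^\<^sub>m (k - 1) * v) $$ (0,0) =
    (if j = k then of_int e * qR (qnorm2 (v $$ (k - 1, 0))) else 0)"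
proof -
  have v0: "v $$ (i, 0) = 0" if "k \<le> i" "i < j" for i
  proof -
    have "((jordan_block j 0) ^\<^sub>m k * v) $$ (i - k, 0) = 0" unfolding D using that by simp
    thus ?thesis using nilpotent_jordan_pow_mult[OF v, of "i - k" 0 k] that by simp
  qed
  let ?w = "(jordan_block j 0) ^\<^sub>m (k - 1) * v"
  have w: "?w \<in> carrier_mat j 1" using v pow_carrier_mat[OF jordan_block_carrier] by auto
  have oi: "(of_int e :: quat) = qR (of_int e)"
    by (induction e rule: int_induct[of _ 0]) auto
  have eq: "qadj v * (of_int e \<cdot>\<^sub>m antidiag j) * (jordan_block j 0) ^\<^sub>m (k - 1) * v =
    qadj v * (of_int e \<cdot>\<^sub>m (antidiag j * ?w))"
    using v pow_carrier_mat[OF jordan_block_carrier, of j 0 "k - 1"] by (simp add: mult_assoc_dim smult_mult)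
  have Mc: "of_int e \<cdot>\<^sub>m (antidiag j * ?w) \<in> carrier_mat j 1"
    by (rule smult_carrier_mat[OF mult_carrier_mat[OF antidiag_carrier w]])
  have "(qadj v * (of_int e \<cdot>\<^sub>m antidiag j) * (jordan_block j 0) ^\<^sub>m (k - 1) * v) $$ (0,0) =
    (\<Sum>i<j. qcnj (v $$ (i,0)) * (of_int e \<cdot>\<^sub>m (antidiag j * ?w)) $$ (i,0))"
    unfolding eq by (rule qadj_mult_index[OF v Mc])
  also have "\<dots> = (\<Sum>i<j. qcnj (v $$ (i,0)) * (of_int e * ?w $$ (j - Suc i, 0)))"
  proof (rule sum.cong)
    fix i assume i: "i \<in> {..<j}"
    hence "(of_int e \<cdot>\<^sub>m (antidiag j * ?w)) $$ (i,0) = of_int e * (antidiag j * ?w) $$ (i,0)"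
      using w by (intro index_smult_mat) auto
    thus "qcnj (v $$ (i,0)) * (of_int e \<cdot>\<^sub>m (antidiag j * ?w)) $$ (i,0) = qcnj (v $$ (i,0)) * (of_int e * ?w $$ (j - Suc i, 0))"
      using antidiag_mult[OF w, of i 0] i by simp
  qed simp
  also have "\<dots> = (\<Sum>i<j. if i = k - 1 then (if j = k then of_int e * qR (qnorm2 (v $$ (k - 1, 0))) else 0) else 0)"
  proof (rule sum.cong)
    fix i assume i: "i \<in> {..<j}"
    hence wi: "?w $$ (j - Suc i, 0) = (if j - Suc i + (k - 1) < j then v $$ (j - Suc i + (k - 1), 0) else 0)"
      by (intro nilpotent_jordan_pow_mult[OF v]) auto
    consider "i \<ge> k" | "i < k - 1" | "i = k - 1" using k by linarith
    thus "qcnj (v $$ (i,0)) * (of_int e * ?w $$ (j - Suc i, 0)) =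
      (if i = k - 1 then (if j = k then of_int e * qR (qnorm2 (v $$ (k - 1, 0))) else 0) else 0)"
    proof cases
      case 1
      thus ?thesis using v0[of i] i by auto
    next
      case 2
      hence "\<not> j - Suc i + (k - 1) < j" using i by auto
      thus ?thesis using 2 wi by auto
    next
      case 3
      hence "j - Suc i + (k - 1) = j - 1" using i by auto
      hence "?w $$ (j - Suc i, 0) = v $$ (j - 1, 0)" using wi i by auto
      moreover have "j \<noteq> k \<Longrightarrow> v $$ (j - 1, 0) = 0" using v0[of "j - 1"] 3 i by auto
      ultimately show ?thesis using 3
        by (auto simp: oi quat_of_real_lcomm qcnj_mult_self)
    qed
  qed simp
  also have "\<dots> = (if j = k then of_int e * qR (qnorm2 (v $$ (k - 1, 0))) else 0)" using k by auto
  finally show ?thesis .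
qed

text \<open>
  Restricted to \<open>Ker (B - l)\<^sup>k\<close> the form \<open>[v, (B - l)\<^sup>k\<^sup>-\<^sup>1 v]\<close> sees only the blocks with eigenvalue \<open>l\<close> and
  size exactly \<open>k\<close>, and there only the last coordinate. Its inertia is therefore the number of these
  blocks with either sign.
\<close>

definition block_form :: "real \<Rightarrow> nat \<Rightarrow> quat mat \<Rightarrow> quat mat \<Rightarrow> quat mat \<Rightarrow> quat mat" where
  "block_form l k B H v = qadj v * H * mshift l B ^\<^sub>m (k - 1) * v"

lemma block_form_carrier: "B \<in> carrier_mat n n \<Longrightarrow> H \<in> carrier_mat n n \<Longrightarrow> v \<in> carrier_mat n m \<Longrightarrow>
  block_form l k B H v \<in> carrier_mat m m"
  unfolding block_form_def by auto

lemma block_form_dsum: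
  assumes "B \<in> carrier_mat n n" "H \<in> carrier_mat n n" "B' \<in> carrier_mat m m" "H' \<in> carrier_mat m m"
    "v \<in> carrier_mat n p" "v' \<in> carrier_mat m p"
  shows "block_form l k (dsum B B') (dsum H H') (vcat v v') = block_form l k B H v + block_form l k B' H' v'"
proof -
  let ?D = "mshift l B ^\<^sub>m (k - 1)" and ?D' = "mshift l B' ^\<^sub>m (k - 1)"
  have c: "?D \<in> carrier_mat n n" "?D' \<in> carrier_mat m m" using assms by auto
  have "block_form l k (dsum B B') (dsum H H') (vcat v v') =
    hcat (qadj v) (qadj v') * (dsum H H' * (dsum ?D ?D' * vcat v v'))"
    unfolding block_form_def mshift_dsum[OF assms(1,3)] dsum_pow[OF mshift_carrier[OF assms(1)] mshift_carrier[OF assms(3)]]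
    using assms c by (simp add: mult_assoc_dim qadj_vcat)
  also have "\<dots> = qadj v * (H * (?D * v)) + qadj v' * (H' * (?D' * v'))"
    using assms c by (simp add: dsum_mult_vcat hcat_mult_vcat)
  finally show ?thesis unfolding block_form_def using assms c by (simp add: mult_assoc_dim)
qed

lemma mshift_pow_dsum_kernel:
  assumes "B \<in> carrier_mat n n" "B' \<in> carrier_mat m m" "v \<in> carrier_mat n p" "v' \<in> carrier_mat m p"
  shows "mshift l (dsum B B') ^\<^sub>m k * vcat v v' = 0\<^sub>m (n + m) p \<longleftrightarrow>
    mshift l B ^\<^sub>m k * v = 0\<^sub>m n p \<and> mshift l B' ^\<^sub>m k * v' = 0\<^sub>m m p"
proof -
  let ?D = "mshift l B ^\<^sub>m k" and ?D' = "mshift l B' ^\<^sub>m k"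
  have c: "?D \<in> carrier_mat n n" "?D' \<in> carrier_mat m m" using assms by auto
  have "mshift l (dsum B B') ^\<^sub>m k * vcat v v' = vcat (?D * v) (?D' * v')"
    unfolding mshift_dsum[OF assms(1,2)] dsum_pow[OF mshift_carrier[OF assms(1)] mshift_carrier[OF assms(2)]]
    using assms c by (intro dsum_mult_vcat) auto
  moreover have "vcat (?D * v) (?D' * v') = 0\<^sub>m (n + m) p \<longleftrightarrow> ?D * v = 0\<^sub>m n p \<and> ?D' * v' = 0\<^sub>m m p"
    unfolding vcat_zero[symmetric]
    using vcat_eqD[of "?D * v" "?D' * v'" "0\<^sub>m n p" "0\<^sub>m m p"] assms c by auto
  ultimately show ?thesis by simp
qed

lemma block_kernel_trivial:
  assumes "cblock_valid b" "\<And>j e. b \<noteq> RB j l e" "v \<in> carrier_mat (cblock_size b) p"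
    "mshift l (cblock_B b) ^\<^sub>m k * v = 0\<^sub>m (cblock_size b) p"
  shows "v = 0\<^sub>m (cblock_size b) p"
proof -
  have "minj (mshift l (cblock_B b))"
  proof (cases b)
    case (RB j m e)
    hence "m \<noteq> l" using assms(2) by auto
    hence "qR m - qR l \<noteq> 0" by simp
    thus ?thesis unfolding RB cblock_B.simps mshift_jordan by (rule minj_jordan)
  next
    case (CB j z)
    hence z: "Im z > 0" using assms(1) by simp
    have nz: "qC z - qR l \<noteq> 0" "qC (cnj z) - qR l \<noteq> 0"
      using z by (auto dest: arg_cong[of _ _ qI])
    have "mshift l (cblock_B b) = dsum (jordan_block j (qC z - qR l)) (jordan_block j (qC (cnj z) - qR l))"
      unfolding CB by (simp add: diag_block_Cons mshift_dsum[of _ j _ j] mshift_jordan)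
    thus ?thesis using minj_dsum[OF minj_jordan[OF nz(1)] _ minj_jordan[OF nz(2)], of j j j j] by simp
  qed
  from minj_pow_zero[OF this _ assms(3,4)] show ?thesis by simp
qed

text \<open>A block different from \<open>RB k l e\<close> either contributes nothing, because its
  eigenvalue or size is wrong, or has the opposite sign.\<close>

lemma block_form_upper:
  assumes b: "cblock_valid b" "b \<noteq> RB k l e" and k: "k \<ge> 1" and e: "e = 1 \<or> e = -1"
    and v: "v \<in> carrier_mat (cblock_size b) 1" "mshift l (cblock_B b) ^\<^sub>m k * v = 0\<^sub>m (cblock_size b) 1"
  shows "of_int e * qRe (block_form l k (cblock_B b) (cblock_H b) v $$ (0,0)) \<le> 0"
proof (cases "\<exists>j d. b = RB j l d")
  case False
  hence "v = 0\<^sub>m (cblock_size b) 1" using block_kernel_trivial[OF b(1) _ v] by auto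
  hence "block_form l k (cblock_B b) (cblock_H b) v = 0\<^sub>m 1 1"
    unfolding block_form_def by (simp add: right_mult_zero_mat[of _ 1 "cblock_size b"] mult_carrier_mat[of _ 1 "cblock_size b"])
  thus ?thesis by simp
next
  case True
  then obtain j d where jd: "b = RB j l d" by auto
  hence d: "d = 1 \<or> d = -1" using b(1) by simp
  have D: "mshift l (cblock_B b) = jordan_block j 0" unfolding jd by (simp add: mshift_jordan)
  have f: "block_form l k (cblock_B b) (cblock_H b) v $$ (0,0) =
    (if j = k then of_int d * qR (qnorm2 (v $$ (k - 1, 0))) else 0)"
    unfolding block_form_def D using real_block_form[of v j k d] v[unfolded D] k jd by simp
  show ?thesis unfolding f using jd d e b(2) qnorm2_nonneg[of "v $$ (k - 1, 0)"]
    by (auto simp: quat_sel_times)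
qed

text \<open>The rows of \<open>C\<close> read off the last coordinate of each block
  \<open>RB k l e\<close>. Once these coordinates vanish, every block contributes zero or the sign
  opposite to \<open>e\<close>. Phrasing this as \<open>count_list\<close> many linear conditions
  prepares a dimension count.\<close>

lemma blocks_upper:
  assumes "\<forall>b\<in>set bs. cblock_valid b" and k: "k \<ge> 1" and e: "e = 1 \<or> e = -1"
  shows "\<exists>C\<in>carrier_mat (count_list bs (RB k l e)) (blocks_size bs). \<forall>v\<in>carrier_mat (blocks_size bs) 1.
    mshift l (blocks_B bs) ^\<^sub>m k * v = 0\<^sub>m (blocks_size bs) 1 \<longrightarrow>
    C * v = 0\<^sub>m (count_list bs (RB k l e)) 1 \<longrightarrow>
    of_int e * qRe (block_form l k (blocks_B bs) (blocks_H bs) v $$ (0,0)) \<le> 0"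
  using assms(1)
proof (induction bs)
  case Nil
  show ?case by (intro bexI[of _ "0\<^sub>m 0 0"]) (auto simp: block_form_def scalar_prod_def)
next
  case (Cons b bs)
  let ?m = "cblock_size b" and ?n = "blocks_size bs" and ?c = "count_list bs (RB k l e)"
  from Cons obtain C where C: "C \<in> carrier_mat ?c ?n"
    "\<And>v. v\<in>carrier_mat ?n 1 \<Longrightarrow> mshift l (blocks_B bs) ^\<^sub>m k * v = 0\<^sub>m ?n 1 \<Longrightarrow> C * v = 0\<^sub>m ?c 1 \<Longrightarrow>
      of_int e * qRe (block_form l k (blocks_B bs) (blocks_H bs) v $$ (0,0)) \<le> 0" by auto
  have add: "of_int e * qRe (block_form l k (blocks_B (b # bs)) (blocks_H (b # bs)) (vcat v v') $$ (0,0)) =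
     of_int e * qRe (block_form l k (cblock_B b) (cblock_H b) v $$ (0,0)) +
     of_int e * qRe (block_form l k (blocks_B bs) (blocks_H bs) v' $$ (0,0))"
    if "v \<in> carrier_mat ?m 1" "v' \<in> carrier_mat ?n 1" for v v'
  proof -
    have 1: "block_form l k (blocks_B bs) (blocks_H bs) v' \<in> carrier_mat 1 1"
      using that by (intro block_form_carrier) auto
    show ?thesis using 1
      unfolding blocks_simps
      by (subst block_form_dsum[of _ ?m _ _ ?n _ _ 1]) (use that in \<open>auto simp: distrib_left\<close>)
  qed
  show ?case
  proof (cases "b = RB k l e")
    case True
    define R where "R = mat 1 k (\<lambda>(i,j). if j = k - 1 then 1 else 0 :: quat)"
    have R: "R \<in> carrier_mat 1 k" by (simp add: R_def)
    have Rv: "(R * v) $$ (0,0) = v $$ (k - 1, 0)" if "v \<in> carrier_mat k 1" for v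
    proof -
      have "(R * v) $$ (0,0) = (\<Sum>j<k. (if j = k - 1 then 1 else 0) * v $$ (j,0))"
        using that by (simp add: scalar_prod_def R_def atLeast0LessThan)
      also have "\<dots> = (\<Sum>j<k. if j = k - 1 then v $$ (j,0) else 0)"
        by (rule sum.cong) auto
      finally have "(R * v) $$ (0,0) = (\<Sum>j<k. if j = k - 1 then v $$ (j,0) else 0)" .
      thus ?thesis using k by simp
    qed
    show ?thesis
    proof (intro bexI[of _ "dsum R C"] ballI impI)
      show "dsum R C \<in> carrier_mat (count_list (b # bs) (RB k l e)) (blocks_size (b # bs))"
        using R C(1) True by (auto intro!: carrier_matI)
      fix v assume v: "v \<in> carrier_mat (blocks_size (b # bs)) 1"
        "mshift l (blocks_B (b # bs)) ^\<^sub>m k * v = 0\<^sub>m (blocks_size (b # bs)) 1"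
        "dsum R C * v = 0\<^sub>m (count_list (b # bs) (RB k l e)) 1"
      obtain x y where xy: "v = vcat x y" "x \<in> carrier_mat ?m 1" "y \<in> carrier_mat ?n 1"
        using vcat_split[of v ?m ?n 1] v(1) by auto
      have ker: "mshift l (cblock_B b) ^\<^sub>m k * x = 0\<^sub>m ?m 1" "mshift l (blocks_B bs) ^\<^sub>m k * y = 0\<^sub>m ?n 1"
        using v(2) mshift_pow_dsum_kernel[of "cblock_B b" ?m "blocks_B bs" ?n x 1 y l k] xy by auto
      have "vcat (R * x) (C * y) = vcat (0\<^sub>m 1 1) (0\<^sub>m ?c 1)"
        using v(3) xy R C(1) True by (simp add: dsum_mult_vcat vcat_zero)
      hence rc: "R * x = 0\<^sub>m 1 1" "C * y = 0\<^sub>m ?c 1"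
        using vcat_eqD[of "R * x" "C * y" "0\<^sub>m 1 1" "0\<^sub>m ?c 1"] R C(1) xy by auto
      have x0: "x $$ (k - 1, 0) = 0" using Rv[of x] rc(1) xy True by simp
      have D: "mshift l (cblock_B b) = jordan_block k 0" unfolding True by (simp add: mshift_jordan)
      have "block_form l k (cblock_B b) (cblock_H b) x $$ (0,0) = 0"
        unfolding block_form_def D using real_block_form[of x k k e] ker[unfolded D] xy k True x0 by simp
      thus "of_int e * qRe (block_form l k (blocks_B (b # bs)) (blocks_H (b # bs)) v $$ (0,0)) \<le> 0"
        unfolding xy(1) add[OF xy(2,3)] using C(2)[OF xy(3) ker(2) rc(2)] by simp
    qed
  next
    case False
    show ?thesis
    proof (intro bexI[of _ "hcat (0\<^sub>m ?c ?m) C"] ballI impI)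
      show "hcat (0\<^sub>m ?c ?m) C \<in> carrier_mat (count_list (b # bs) (RB k l e)) (blocks_size (b # bs))"
        using C(1) False by (auto intro!: carrier_matI)
      fix v assume v: "v \<in> carrier_mat (blocks_size (b # bs)) 1"
        "mshift l (blocks_B (b # bs)) ^\<^sub>m k * v = 0\<^sub>m (blocks_size (b # bs)) 1"
        "hcat (0\<^sub>m ?c ?m) C * v = 0\<^sub>m (count_list (b # bs) (RB k l e)) 1"
      obtain x y where xy: "v = vcat x y" "x \<in> carrier_mat ?m 1" "y \<in> carrier_mat ?n 1"
        using vcat_split[of v ?m ?n 1] v(1) by auto
      have ker: "mshift l (cblock_B b) ^\<^sub>m k * x = 0\<^sub>m ?m 1" "mshift l (blocks_B bs) ^\<^sub>m k * y = 0\<^sub>m ?n 1"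
        using v(2) mshift_pow_dsum_kernel[of "cblock_B b" ?m "blocks_B bs" ?n x 1 y l k] xy by auto
      have rc: "C * y = 0\<^sub>m ?c 1"
        using v(3) xy C(1) False by (simp add: hcat_mult_vcat left_mult_zero_mat[of _ ?m 1] left_add_zero_mat[of _ ?c 1])
      show "of_int e * qRe (block_form l k (blocks_B (b # bs)) (blocks_H (b # bs)) v $$ (0,0)) \<le> 0"
        unfolding xy(1) add[OF xy(2,3)]
        using C(2)[OF xy(3) ker(2) rc] block_form_upper[OF _ False k e xy(2) ker(1)] Cons.prems by simp
    qed
  qed
qed

text \<open>The law of inertia: on the range of \<open>V\<close> the form is definite of sign
  \<open>e\<close>. If its dimension \<open>p\<close> exceeded the number of conditions in
  \<open>blocks_upper\<close>, some nonzero combination would satisfy them all, and the form would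
  there be both strictly of sign \<open>e\<close> and at most zero in that sign.\<close>

lemma block_count_bound:
  assumes bs: "\<forall>b\<in>set bs. cblock_valid b" and k: "k \<ge> 1" and e: "e = 1 \<or> e = -1"
    and V: "V \<in> carrier_mat (blocks_size bs) p" "mshift l (blocks_B bs) ^\<^sub>m k * V = 0\<^sub>m (blocks_size bs) p"
      "block_form l k (blocks_B bs) (blocks_H bs) V = qR (of_int e) \<cdot>\<^sub>m 1\<^sub>m p"
  shows "p \<le> count_list bs (RB k l e)"
proof (rule ccontr)
  let ?n = "blocks_size bs" and ?c = "count_list bs (RB k l e)"
  let ?D = "mshift l (blocks_B bs)"
  assume "\<not> p \<le> ?c"
  hence lt: "?c < p" by simp
  obtain C where C: "C \<in> carrier_mat ?c ?n"
    "\<And>v. v\<in>carrier_mat ?n 1 \<Longrightarrow> ?D ^\<^sub>m k * v = 0\<^sub>m ?n 1 \<Longrightarrow> C * v = 0\<^sub>m ?c 1 \<Longrightarrow>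
      of_int e * qRe (block_form l k (blocks_B bs) (blocks_H bs) v $$ (0,0)) \<le> 0"
    using blocks_upper[OF bs k e, of l] by auto
  have "C * V \<in> carrier_mat ?c p" using C(1) V(1) by auto
  from homogeneous_system[OF this lt] obtain x where
    x: "x \<in> carrier_vec p" "x \<noteq> 0\<^sub>v p" "C * V *\<^sub>v x = 0\<^sub>v ?c" by auto
  let ?x = "col_mat x"
  have xc: "?x \<in> carrier_mat p 1" using x by auto
  have Dk: "?D ^\<^sub>m k \<in> carrier_mat ?n ?n" "?D ^\<^sub>m (k - 1) \<in> carrier_mat ?n ?n" by auto
  have 1: "V * ?x \<in> carrier_mat ?n 1" using V(1) xc by auto
  have 2: "?D ^\<^sub>m k * (V * ?x) = 0\<^sub>m ?n 1"
  proof -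
    have "?D ^\<^sub>m k * (V * ?x) = (?D ^\<^sub>m k * V) * ?x"
      using Dk V(1) xc by (intro mult_assoc_dim[symmetric]) auto
    thus ?thesis unfolding V(2) left_mult_zero_mat[OF xc] .
  qed
  have 3: "C * (V * ?x) = 0\<^sub>m ?c 1"
  proof -
    have "C * (V * ?x) = col_mat (C * V *\<^sub>v x)"
      unfolding mult_col_mat[symmetric] using C(1) V(1) xc by (intro mult_assoc_dim[symmetric]) auto
    thus ?thesis unfolding x(3) by (auto simp: col_mat_def intro!: eq_matI)
  qed
  have "block_form l k (blocks_B bs) (blocks_H bs) (V * ?x) = qadj ?x * (block_form l k (blocks_B bs) (blocks_H bs) V * ?x)"
    unfolding block_form_def using V(1) x(1) by (simp add: mult_assoc_dim qadj_mult)
  also have "\<dots> = qR (of_int e) \<cdot>\<^sub>m (qadj ?x * ?x)"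
    unfolding V(3) using xc x(1) by (simp add: smult_mult smult_real_mult left_mult_one_mat[of _ _ 1])
  finally have f: "block_form l k (blocks_B bs) (blocks_H bs) (V * ?x) $$ (0,0) = qR (of_int e) * (\<Sum>i<p. qR (qnorm2 (x $ i)))"
    using x(1) by (simp add: scalar_prod_def col_mat_def qcnj_mult_self atLeast0LessThan)
  have qs: "(\<Sum>i<p. qR (qnorm2 (x $ i))) = qR (\<Sum>i<p. qnorm2 (x $ i))"
    by (induction p) auto
  have "of_int e * qRe (block_form l k (blocks_B bs) (blocks_H bs) (V * ?x) $$ (0,0)) = (\<Sum>i<p. qnorm2 (x $ i))"
    unfolding f qs using e by (auto simp: quat_sel_times)
  moreover obtain i where i: "i < p" "x $ i \<noteq> 0" using x(1,2) by (metis carrier_vecD eq_vecI index_zero_vec)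
  moreover have "(\<Sum>i<p. qnorm2 (x $ i)) > 0"
    by (rule sum_pos2[of _ i]) (use i in \<open>auto simp: qnorm2_nonneg qnorm2_pos\<close>)
  ultimately show False using C(2)[OF 1 2 3] by simp
qed

text \<open>The top chain vectors of the blocks \<open>RB k l e\<close> form an orthonormal family
  up to the sign \<open>e\<close>, which shows that the bound is attained.\<close>

lemma block_count_witness:
  assumes k: "k \<ge> 1" and e: "e = 1 \<or> e = -1"
  shows "\<exists>V\<in>carrier_mat (blocks_size bs) (count_list bs (RB k l e)).
    mshift l (blocks_B bs) ^\<^sub>m k * V = 0\<^sub>m (blocks_size bs) (count_list bs (RB k l e)) \<and>
    block_form l k (blocks_B bs) (blocks_H bs) V = qR (of_int e) \<cdot>\<^sub>m 1\<^sub>m (count_list bs (RB k l e))"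
proof (induction bs)
  case Nil
  show ?case by (intro bexI[of _ "0\<^sub>m 0 0"]) (auto simp: block_form_def intro!: eq_matI)
next
  case (Cons b bs)
  let ?m = "cblock_size b" and ?n = "blocks_size bs" and ?c = "count_list bs (RB k l e)"
  from Cons obtain V where V: "V \<in> carrier_mat ?n ?c" "mshift l (blocks_B bs) ^\<^sub>m k * V = 0\<^sub>m ?n ?c"
    "block_form l k (blocks_B bs) (blocks_H bs) V = qR (of_int e) \<cdot>\<^sub>m 1\<^sub>m ?c" by auto
  show ?case
  proof (cases "b = RB k l e")
    case True
    have kk: "cblock_size b = k" by (simp add: True)
    define u where "u = mat k 1 (\<lambda>(i,j). if i = k - 1 then 1 else 0 :: quat)"
    have u: "u \<in> carrier_mat k 1" by (simp add: u_def)
    have D: "mshift l (cblock_B b) = jordan_block k 0" unfolding True by (simp add: mshift_jordan)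
    have Du: "(jordan_block k 0) ^\<^sub>m k * u = 0\<^sub>m k 1"
      using u by (intro eq_matI) (auto simp: nilpotent_jordan_pow_mult[OF u] simp del: index_mult_mat(1))
    have fu: "(qadj u * cblock_H b * (jordan_block k 0) ^\<^sub>m (k - 1) * u) $$ (0,0) = qR (of_int e)"
      using real_block_form[OF u k Du, of e] k True e by (auto simp: u_def qnorm2_def)
    let ?U = "hcat u (0\<^sub>m k ?c)" and ?V = "hcat (0\<^sub>m ?n 1) V"
    have c: "?U \<in> carrier_mat ?m (1 + ?c)" "?V \<in> carrier_mat ?n (1 + ?c)" using u V(1) kk by auto
    have Dc: "mshift l (cblock_B b) ^\<^sub>m (k - 1) \<in> carrier_mat k k" "mshift l (cblock_B b) ^\<^sub>m k \<in> carrier_mat k k"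
      "mshift l (blocks_B bs) ^\<^sub>m (k - 1) \<in> carrier_mat ?n ?n" "mshift l (blocks_B bs) ^\<^sub>m k \<in> carrier_mat ?n ?n"
      using cblock_carrier(1)[of b] unfolding kk by auto
    have Hc: "cblock_H b \<in> carrier_mat k k" "blocks_H bs \<in> carrier_mat ?n ?n"
      using cblock_carrier(2)[of b] unfolding kk by auto
    have "mshift l (cblock_B b) ^\<^sub>m k * ?U = 0\<^sub>m ?m (1 + ?c)"
      using Dc u Du by (simp add: mult_hcat kk hcat_zero D right_mult_zero_mat[of _ k k])
    moreover have "mshift l (blocks_B bs) ^\<^sub>m k * ?V = 0\<^sub>m ?n (1 + ?c)"
      using Dc V by (simp add: mult_hcat hcat_zero right_mult_zero_mat[of _ ?n ?n])
    ultimately have 1: "mshift l (blocks_B (b # bs)) ^\<^sub>m k * vcat ?U ?V = 0\<^sub>m (?m + ?n) (1 + ?c)"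
      using mshift_pow_dsum_kernel[of "cblock_B b" ?m "blocks_B bs" ?n ?U "1 + ?c" ?V l k] c by simp
    let ?E = "cblock_H b * mshift l (cblock_B b) ^\<^sub>m (k - 1)" and ?F = "blocks_H bs * mshift l (blocks_B bs) ^\<^sub>m (k - 1)"
    have Ec: "?E \<in> carrier_mat k k" "?F \<in> carrier_mat ?n ?n" using Dc Hc by auto
    have "block_form l k (cblock_B b) (cblock_H b) ?U = qadj ?U * ?E * ?U"
      unfolding block_form_def using Dc Hc u c by (simp add: mult_assoc_dim kk)
    also have "\<dots> = dsum (qadj u * ?E * u) (0\<^sub>m ?c ?c)"
      using Ec u by (subst gram_hcat[of _ k 1 _ ?c]) (auto simp: dsum_def right_mult_zero_mat[of _ _ k] left_mult_zero_mat[of _ k])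
    also have "qadj u * ?E * u = qR (of_int e) \<cdot>\<^sub>m 1\<^sub>m 1"
      using fu D u Dc Hc by (intro eq_matI) (auto simp: mult_assoc_dim)
    finally have 2: "block_form l k (cblock_B b) (cblock_H b) ?U = dsum (qR (of_int e) \<cdot>\<^sub>m 1\<^sub>m 1) (0\<^sub>m ?c ?c)" .
    have "block_form l k (blocks_B bs) (blocks_H bs) ?V = qadj ?V * ?F * ?V"
      unfolding block_form_def using Dc Hc V(1) c by (simp add: mult_assoc_dim)
    also have "\<dots> = dsum (0\<^sub>m 1 1) (qadj V * ?F * V)"
      using Ec V(1) by (subst gram_hcat[of _ ?n 1 _ ?c]) (auto simp: dsum_def right_mult_zero_mat[of _ _ ?n] left_mult_zero_mat[of _ ?n])
    also have "qadj V * ?F * V = qR (of_int e) \<cdot>\<^sub>m 1\<^sub>m ?c"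
      using V(3) V(1) Dc Hc by (simp add: block_form_def mult_assoc_dim)
    finally have 3: "block_form l k (blocks_B bs) (blocks_H bs) ?V = dsum (0\<^sub>m 1 1) (qR (of_int e) \<cdot>\<^sub>m 1\<^sub>m ?c)" .
    have "block_form l k (blocks_B (b # bs)) (blocks_H (b # bs)) (vcat ?U ?V) = qR (of_int e) \<cdot>\<^sub>m 1\<^sub>m (1 + ?c)"
    proof -
      have "block_form l k (blocks_B (b # bs)) (blocks_H (b # bs)) (vcat ?U ?V) =
        block_form l k (cblock_B b) (cblock_H b) ?U + block_form l k (blocks_B bs) (blocks_H bs) ?V"
        unfolding blocks_simps by (rule block_form_dsum[OF _ _ _ _ c]) auto
      also have "\<dots> = qR (of_int e) \<cdot>\<^sub>m 1\<^sub>m (1 + ?c)"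
        unfolding 2 3 by (intro eq_matI) (auto simp: dsum_index)
      finally show ?thesis .
    qed
    thus ?thesis using 1 c True by (intro bexI[of _ "vcat ?U ?V"]) (auto intro!: carrier_matI simp: add.commute)
  next
    case False
    have c: "0\<^sub>m ?m ?c \<in> carrier_mat ?m ?c" by simp
    have Dc: "mshift l (cblock_B b) ^\<^sub>m (k - 1) \<in> carrier_mat ?m ?m" "mshift l (cblock_B b) ^\<^sub>m k \<in> carrier_mat ?m ?m"
      by auto
    have 1: "mshift l (blocks_B (b # bs)) ^\<^sub>m k * vcat (0\<^sub>m ?m ?c) V = 0\<^sub>m (?m + ?n) ?c"
      using mshift_pow_dsum_kernel[of "cblock_B b" ?m "blocks_B bs" ?n "0\<^sub>m ?m ?c" "?c" V l k] V Dc
      by (simp add: right_mult_zero_mat[of _ ?m ?m])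
    have z: "block_form l k (cblock_B b) (cblock_H b) (0\<^sub>m ?m ?c) = 0\<^sub>m ?c ?c"
      unfolding block_form_def using Dc by (simp add: right_mult_zero_mat[of _ ?c ?m] mult_carrier_mat[of _ ?c ?m])
    have "block_form l k (blocks_B (b # bs)) (blocks_H (b # bs)) (vcat (0\<^sub>m ?m ?c) V) = qR (of_int e) \<cdot>\<^sub>m 1\<^sub>m ?c"
      unfolding blocks_simps block_form_dsum[OF cblock_carrier blocks_carrier c V(1)] z V(3) by simp
    thus ?thesis using 1 V(1) False by (intro bexI[of _ "vcat (0\<^sub>m ?m ?c) V"]) (auto intro!: carrier_matI)
  qed
qed

text \<open>The definite subspace found in one canonical form is transported by \<open>P\<close> and
  measured against the other.\<close>

lemma block_count_le:
  assumes peq: "peq n (blocks_B bs) (blocks_H bs) (blocks_B cs) (blocks_H cs)"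
    and bs: "\<forall>b\<in>set bs. cblock_valid b" "blocks_size bs = n" "blocks_size cs = n"
    and k: "k \<ge> 1" and e: "e = 1 \<or> e = -1"
  shows "count_list cs (RB k l e) \<le> count_list bs (RB k l e)"
proof -
  let ?c = "count_list cs (RB k l e)"
  let ?B = "blocks_B bs" and ?C = "blocks_B cs" and ?H = "blocks_H bs" and ?K = "blocks_H cs"
  have c: "?B \<in> carrier_mat n n" "?C \<in> carrier_mat n n" "?H \<in> carrier_mat n n" "?K \<in> carrier_mat n n"
    using bs by (auto intro!: carrier_matI)
  obtain P where P: "P\<in>carrier_mat n n" "?B * P = P * ?C" "qadj P * ?H * P = ?K"
    using peq unfolding peq_def by auto
  obtain V where V: "V \<in> carrier_mat n ?c" "mshift l ?C ^\<^sub>m k * V = 0\<^sub>m n ?c"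
    "block_form l k ?C ?K V = qR (of_int e) \<cdot>\<^sub>m 1\<^sub>m ?c"
    using block_count_witness[OF k e, of cs l] bs by auto
  have "mshift l ?B * P = P * mshift l ?C"
    unfolding mshift_mult[OF c(1) P(1)] mult_mshift[OF c(2) P(1)] P(2) ..
  hence int: "mshift l ?B ^\<^sub>m i * P = P * mshift l ?C ^\<^sub>m i" for i
    using pow_mat_intertwine[of "mshift l ?B" n "mshift l ?C" n P i] c P(1) by auto
  have Dc: "mshift l ?B ^\<^sub>m i \<in> carrier_mat n n" "mshift l ?C ^\<^sub>m i \<in> carrier_mat n n" for i using c by auto
  have 1: "mshift l ?B ^\<^sub>m k * (P * V) = 0\<^sub>m n ?c"
  proof -
    have "mshift l ?B ^\<^sub>m k * (P * V) = (mshift l ?B ^\<^sub>m k * P) * V"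
      using Dc[of k] P(1) V(1) by (intro mult_assoc_dim[symmetric]) auto
    also have "\<dots> = P * (mshift l ?C ^\<^sub>m k * V)"
      unfolding int using Dc[of k] P(1) V(1) by (intro mult_assoc_dim) auto
    finally show ?thesis unfolding V(2) using P(1) by (simp add: right_mult_zero_mat[of _ n n])
  qed
  have "block_form l k ?B ?H (P * V) = qadj V * (qadj P * ?H * ((mshift l ?B ^\<^sub>m (k - 1) * P) * V))"
    unfolding block_form_def using P(1) V(1) bs(2,3) c by (simp add: mult_assoc_dim qadj_mult)
  also have "\<dots> = qadj V * ((qadj P * ?H * P) * (mshift l ?C ^\<^sub>m (k - 1) * V))"
    unfolding int using P(1) V(1) bs(2,3) c by (simp add: mult_assoc_dim)
  also have "\<dots> = block_form l k ?C ?K V"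
    unfolding P(3) block_form_def using V(1) bs(2,3) c by (simp add: mult_assoc_dim)
  finally have 2: "block_form l k ?B ?H (P * V) = qR (of_int e) \<cdot>\<^sub>m 1\<^sub>m ?c" unfolding V(3) .
  show ?thesis
    by (rule block_count_bound[OF bs(1) k e, of "P * V"]) (use 1 2 P(1) V(1) bs(2) in auto)
qed

theorem real_blocks_unique:
  assumes "peq n B H (blocks_B bs) (blocks_H bs)" "peq n B H (blocks_B cs) (blocks_H cs)"
    "B \<in> carrier_mat n n" "H \<in> carrier_mat n n"
    "\<forall>b\<in>set bs. cblock_valid b" "blocks_size bs = n" "\<forall>b\<in>set cs. cblock_valid b" "blocks_size cs = n"
  shows "count_list bs (RB k l e) = count_list cs (RB k l e)"
proof (cases "cblock_valid (RB k l e)")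
  case True
  have c: "blocks_B bs \<in> carrier_mat n n" "blocks_H bs \<in> carrier_mat n n"
    "blocks_B cs \<in> carrier_mat n n" "blocks_H cs \<in> carrier_mat n n"
    using assms(6,8) by (auto intro!: carrier_matI)
  have 1: "peq n (blocks_B bs) (blocks_H bs) (blocks_B cs) (blocks_H cs)"
    by (rule peq_trans[OF peq_sym[OF assms(1,3,4) c(1)] assms(2) c(1,2) assms(3) c(3)])
  have 2: "peq n (blocks_B cs) (blocks_H cs) (blocks_B bs) (blocks_H bs)"
    by (rule peq_sym[OF 1 c(1,2,3)])
  show ?thesis using block_count_le[OF 1] block_count_le[OF 2] True assms by (intro antisym) auto
next
  case False
  hence "RB k l e \<notin> set bs" "RB k l e \<notin> set cs" using assms by auto
  thus ?thesis by (simp add: count_list_0_iff)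
qed

text \<open>A definite subspace of sign \<open>e\<close> and maximal dimension is mapped by the
  square root to one of sign \<open>-e\<close> and the same dimension. Used for both signs, the
  inequality becomes an equality.\<close>

lemma negative_blocks_balanced:
  assumes A: "A \<in> carrier_mat n n" "qadj A * H = H * A" and H: "H \<in> carrier_mat n n"
    and bs: "\<forall>b\<in>set bs. cblock_valid b" "blocks_size bs = n" "peq n (A * A) H (blocks_B bs) (blocks_H bs)"
    and l: "l < 0" and k: "k \<ge> 1" and e: "e = 1 \<or> e = -1"
  shows "count_list bs (RB k l e) \<le> count_list bs (RB k l (- e))"
proof -
  let ?c = "count_list bs (RB k l e)"
  let ?B = "blocks_B bs" and ?H = "blocks_H bs"
  have c: "?B \<in> carrier_mat n n" "?H \<in> carrier_mat n n" using bs(2) by (auto intro!: carrier_matI)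
  obtain P where P: "P\<in>carrier_mat n n" "invertible_mat P" "A * A * P = P * ?B" "qadj P * H * P = ?H"
    using bs(3) unfolding peq_def by auto
  obtain R where R: "R \<in> carrier_mat n n" "P * R = 1\<^sub>m n" "R * P = 1\<^sub>m n"
    using invertible_matE[OF P(2,1)] by metis
  \<comment> \<open>The square root in canonical coordinates. As its square is the block matrix
    itself, it commutes with every power of the shifted block matrix and preserves the kernels in
    question.\<close>
  define A' where "A' = R * (A * P)"
  have A': "A' \<in> carrier_mat n n" using R A P by (auto simp: A'_def)
  have PA: "P * A' = A * P"
  proof -
    have "P * A' = (P * R) * (A * P)" unfolding A'_def using P(1) R(1) A(1) by (intro mult_assoc_dim[symmetric]) auto
    thus ?thesis unfolding R(2) using A P by simp
  qed
  have sq: "A' * A' = ?B"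
  proof -
    have "P * (A' * A') = (P * A') * A'" using P(1) A' by (intro mult_assoc_dim[symmetric]) auto
    also have "\<dots> = A * P * A'" by (simp only: PA)
    also have "\<dots> = A * (P * A')" using A(1) P(1) A' by (intro mult_assoc_dim) auto
    also have "\<dots> = A * (A * P)" by (simp only: PA)
    also have "\<dots> = A * A * P" using A(1) P(1) by (intro mult_assoc_dim[symmetric]) auto
    finally have "P * (A' * A') = P * ?B" unfolding P(3) .
    thus ?thesis by (rule minj_mult_cancel[OF invertible_minj[OF P(2,1)] P(1) mult_carrier_mat[OF A' A'] c(1)])
  qed
  have sa: "qadj A' * ?H = ?H * A'"
  proof -
    have "qadj A' * ?H = (qadj A' * qadj P) * H * P"
      unfolding P(4)[symmetric] using A' P(1) H by (simp add: mult_assoc_dim)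
    also have "qadj A' * qadj P = qadj (A * P)"
      unfolding PA[symmetric] using A' P(1) by (simp add: qadj_mult)
    also have "\<dots> * H * P = qadj P * (qadj A * H) * P"
      using A(1) P(1) H by (simp add: qadj_mult mult_assoc_dim)
    also have "\<dots> = qadj P * H * (A * P)"
      unfolding A(2) using A(1) P(1) H by (simp add: mult_assoc_dim)
    also have "\<dots> = ?H * A'" unfolding PA[symmetric] P(4)[symmetric] using A' P(1) H by (simp add: mult_assoc_dim)
    finally show ?thesis .
  qed
  let ?D = "mshift l ?B"
  have Dc: "?D ^\<^sub>m i \<in> carrier_mat n n" "?D \<in> carrier_mat n n" for i using c by auto
  have "?B * A' = A' * ?B" unfolding sq[symmetric] using A' by (intro mult_assoc_dim) auto
  hence "?D * A' = A' * ?D" unfolding mshift_mult[OF c(1) A'] mult_mshift[OF c(1) A'] by simp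
  hence com: "?D ^\<^sub>m i * A' = A' * ?D ^\<^sub>m i" for i
    using pow_mat_intertwine[OF Dc(2) Dc(2) A'] by simp
  obtain V where V: "V \<in> carrier_mat n ?c" "?D ^\<^sub>m k * V = 0\<^sub>m n ?c"
    "block_form l k ?B ?H V = qR (of_int e) \<cdot>\<^sub>m 1\<^sub>m ?c"
    using block_count_witness[OF k e, of bs l] bs by auto
  \<comment> \<open>Normalises the factor \<open>l\<close> that the form acquires under
    \<open>A'\<close> to \<open>-1\<close>.\<close>
  define t where "t = 1 / sqrt (- l)"
  have tt: "t * t * l = - 1" using l by (simp add: t_def real_sqrt_mult_self)
  define W where "W = qR t \<cdot>\<^sub>m (A' * V)"
  have W: "W \<in> carrier_mat n ?c" using A' V(1) by (auto simp: W_def)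
  have 1: "?D ^\<^sub>m k * W = 0\<^sub>m n ?c"
  proof -
    have "?D ^\<^sub>m k * W = qR t \<cdot>\<^sub>m (?D ^\<^sub>m k * (A' * V))"
      unfolding W_def using Dc(1)[of k] A' V(1) by (intro smult_real_mult) auto
    also have "?D ^\<^sub>m k * (A' * V) = (?D ^\<^sub>m k * A') * V"
      using Dc(1)[of k] A' V(1) by (intro mult_assoc_dim[symmetric]) auto
    also have "\<dots> = A' * (?D ^\<^sub>m k * V)"
      unfolding com using Dc(1)[of k] A' V(1) by (intro mult_assoc_dim) auto
    finally show ?thesis unfolding V(2) using A' by (simp add: right_mult_zero_mat[of _ n n])
  qed
  \<comment> \<open>Splits \<open>B\<close> into its nilpotent and scalar parts on the columns of
    \<open>V\<close>: after \<open>k - 1\<close> further shifts the nilpotent part vanishes, and the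
    factor \<open>l\<close> is left.\<close>
  have BV: "?B * V = ?D * V + qR l \<cdot>\<^sub>m V"
    unfolding mshift_mult[OF c(1) V(1)] using c V(1)
    by (intro eq_matI) (auto simp: distrib_right[symmetric] simp del: index_mult_mat(1))
  have "block_form l k ?B ?H W = qR (t * t) \<cdot>\<^sub>m (qadj (A' * V) * (?H * (?D ^\<^sub>m (k - 1) * (A' * V))))"
    unfolding block_form_def W_def using bs(2) c A' V(1)
    by (simp add: mult_assoc_dim qadj_smult_real smult_real_mult smult_mult) (auto intro!: eq_matI simp: mult.assoc)
  also have "qadj (A' * V) * (?H * (?D ^\<^sub>m (k - 1) * (A' * V))) = qadj V * ((qadj A' * ?H) * ((?D ^\<^sub>m (k - 1) * A') * V))"
    using bs(2) c A' V(1) by (simp add: mult_assoc_dim qadj_mult)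
  also have "\<dots> = qadj V * (?H * (A' * ((?D ^\<^sub>m (k - 1) * A') * V)))"
    unfolding sa using bs(2) c A' V(1) by (simp add: mult_assoc_dim)
  also have "A' * ((?D ^\<^sub>m (k - 1) * A') * V) = (A' * ?D ^\<^sub>m (k - 1)) * (A' * V)"
    using bs(2) A' V(1) by (simp add: mult_assoc_dim)
  also have "\<dots> = ?D ^\<^sub>m (k - 1) * ((A' * A') * V)"
    unfolding com[symmetric] using bs(2) A' V(1) by (simp add: mult_assoc_dim)
  also have "\<dots> = ?D ^\<^sub>m (k - 1) * (?D * V) + qR l \<cdot>\<^sub>m (?D ^\<^sub>m (k - 1) * V)"
  proof -
    have "?D ^\<^sub>m (k - 1) * (?D * V + qR l \<cdot>\<^sub>m V) = ?D ^\<^sub>m (k - 1) * (?D * V) + ?D ^\<^sub>m (k - 1) * (qR l \<cdot>\<^sub>m V)"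
      using mult_carrier_mat[OF Dc(2) V(1)] V(1)
      by (intro mult_add_distrib_mat[OF Dc(1)[of "k - 1"], of _ ?c]) auto
    moreover have "?D ^\<^sub>m (k - 1) * (qR l \<cdot>\<^sub>m V) = qR l \<cdot>\<^sub>m (?D ^\<^sub>m (k - 1) * V)"
      using Dc(1)[of "k - 1"] V(1) by (intro smult_real_mult) auto
    ultimately show ?thesis unfolding sq BV by simp
  qed
  also have "?D ^\<^sub>m (k - 1) * (?D * V) = ?D ^\<^sub>m k * V"
    using Dc(1)[of "k - 1"] Dc(2) V(1) k by (cases k) (auto simp: mult_assoc_dim)
  also have "\<dots> + qR l \<cdot>\<^sub>m (?D ^\<^sub>m (k - 1) * V) = qR l \<cdot>\<^sub>m (?D ^\<^sub>m (k - 1) * V)"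
    unfolding V(2) using Dc(1)[of "k - 1"] V(1) by (intro left_add_zero_mat) auto
  also have "qadj V * (?H * (qR l \<cdot>\<^sub>m (?D ^\<^sub>m (k - 1) * V))) = qR l \<cdot>\<^sub>m block_form l k ?B ?H V"
    unfolding block_form_def using bs(2) c V(1)
    by (simp add: mult_assoc_dim smult_real_mult)
  also have "qR (t * t) \<cdot>\<^sub>m \<dots> = qR (of_int (- e)) \<cdot>\<^sub>m 1\<^sub>m ?c"
    unfolding V(3) using arg_cong[OF tt, of qR] by (intro eq_matI) (auto simp: mult.assoc[symmetric])
  finally have 2: "block_form l k ?B ?H W = qR (of_int (- e)) \<cdot>\<^sub>m 1\<^sub>m ?c" .
  show ?thesis
    by (rule block_count_bound[OF bs(1) k, of "- e" W]) (use 1 2 W bs(2) e in auto)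
qed

section \<open>Selfadjoint square roots of blocks\<close>

text \<open>The power series with coefficients \<open>f\<close>, evaluated at the nilpotent Jordan
  block of size \<open>k\<close>; matrix products become Cauchy products.\<close>

definition toeplitz :: "nat \<Rightarrow> (nat \<Rightarrow> 'a::zero) \<Rightarrow> 'a mat" where
  "toeplitz k f = mat k k (\<lambda>(i,j). if i \<le> j then f (j - i) else 0)"

lemma toeplitz_dim [simp]: "dim_row (toeplitz k f) = k" "dim_col (toeplitz k f) = k"
  by (auto simp: toeplitz_def)

lemma toeplitz_carrier [simp]: "toeplitz k f \<in> carrier_mat k k"
  by (simp add: toeplitz_def)

lemma toeplitz_mult:
  fixes f g :: "nat \<Rightarrow> 'a::semiring_0"
  shows "toeplitz k f * toeplitz k g = toeplitz k (\<lambda>m. \<Sum>i\<le>m. f i * g (m - i))"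
proof (rule eq_matI)
  fix i j assume ij: "i < dim_row (toeplitz k (\<lambda>m. \<Sum>i\<le>m. f i * g (m - i)))"
    "j < dim_col (toeplitz k (\<lambda>m. \<Sum>i\<le>m. f i * g (m - i)))"
  have "(toeplitz k f * toeplitz k g) $$ (i,j) =
    (\<Sum>l<k. (if i \<le> l then f (l - i) else 0) * (if l \<le> j then g (j - l) else 0))"
    using ij by (simp add: toeplitz_def scalar_prod_def atLeast0LessThan)
  also have "\<dots> = (\<Sum>l\<in>{i..j}. f (l - i) * g (j - l))"
    using ij by (intro sum.mono_neutral_cong_right) auto
  also have "\<dots> = (if i \<le> j then \<Sum>m\<le>j - i. f m * g (j - i - m) else 0)"
  proof (cases "i \<le> j")
    case True
    have "(\<Sum>l\<in>{i..j}. f (l - i) * g (j - l)) = (\<Sum>m\<le>j - i. f m * g (j - i - m))"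
      by (rule sum.reindex_bij_witness[of _ "\<lambda>m. m + i" "\<lambda>l. l - i"]) (use True in auto)
    thus ?thesis using True by simp
  qed simp
  finally show "(toeplitz k f * toeplitz k g) $$ (i,j) = toeplitz k (\<lambda>m. \<Sum>i\<le>m. f i * g (m - i)) $$ (i,j)"
    using ij by (simp add: toeplitz_def)
qed auto

lemma jordan_toeplitz: "jordan_block k a = toeplitz k (\<lambda>m. if m = 0 then a else if m = 1 then 1 else 0)"
  by (rule eq_matI) (auto simp: toeplitz_def)

text \<open>Square root of the formal series \<open>r^2 + z X\<close>, which exists because the
  constant term is a nonzero square. At the nilpotent block, \<open>z = 1\<close> yields a root of a
  Jordan block and \<open>z = -1\<close> a root of the negative of one.\<close>

lemma power_series_sqrt:
  fixes r :: "'a::field_char_0"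
  assumes "r \<noteq> 0"
  shows "\<exists>c :: nat \<Rightarrow> 'a. \<forall>m. (\<Sum>i\<le>m. c i * c (m - i)) = (if m = 0 then r * r else if m = 1 then z else 0)"
proof -
  define a :: "'a fps" where "a = fps_const (r * r) + fps_const z * fps_X"
  have a0: "fps_nth a 0 = r * r" by (simp add: a_def)
  define c where "c = fps_radical (\<lambda>_ _. r) (Suc 1) a"
  have "c ^ Suc 1 = a" unfolding c_def
    using power_radical[of a "\<lambda>_ _. r" 1] assms a0 by (simp add: power2_eq_square)
  hence "c * c = a" by (simp add: power2_eq_square)
  hence "(\<Sum>i=0..m. fps_nth c i * fps_nth c (m - i)) = fps_nth a m" for m by (metis fps_mult_nth)
  thus ?thesis by (intro exI[of _ "fps_nth c"]) (auto simp: a_def atLeast0AtMost)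
qed

lemma antidiag_qadj [simp]: "qadj (antidiag k) = antidiag k"
  by (rule eq_matI) (auto simp: antidiag_def add.commute)

lemma antidiag_toeplitz:
  assumes "i < k" "j < k"
  shows "(antidiag k * toeplitz k f) $$ (i,j) = (if k \<le> i + j + 1 then f (i + j + 1 - k) else 0)"
proof -
  have "j - (k - Suc i) = Suc (i + j) - k" if "k - Suc i \<le> j" using that assms by simp
  thus ?thesis unfolding antidiag_mult[OF toeplitz_carrier assms] using assms by (auto simp: toeplitz_def)
qed

text \<open>Reflection in the antidiagonal fixes an upper triangular Toeplitz matrix, so the adjoint
  merely conjugates coefficients. For real coefficients the matrix is selfadjoint with respect to
  the antidiagonal form.\<close>

lemma qadj_toeplitz_antidiag:
  "qadj (toeplitz k f) * antidiag k = antidiag k * toeplitz k (\<lambda>i. qcnj (f i))"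
proof -
  have "qadj (toeplitz k f) * antidiag k = qadj (antidiag k * toeplitz k f)"
    by (simp add: qadj_mult)
  also have "\<dots> = antidiag k * toeplitz k (\<lambda>i. qcnj (f i))"
    by (rule eq_matI) (auto simp: antidiag_toeplitz add.commute simp del: index_mult_mat(1))
  finally show ?thesis .
qed

text \<open>The existence of a selfadjoint square root is stated for lists of blocks because it
  passes to direct sums and, by conjugation with a change of basis, to reordered lists; it can thus
  be checked group by group.\<close>

definition sqrtable :: "cblock list \<Rightarrow> bool" where
  "sqrtable bs \<longleftrightarrow> (\<exists>R\<in>carrier_mat (blocks_size bs) (blocks_size bs). R * R = blocks_B bs \<and>
     qadj R * blocks_H bs = blocks_H bs * R)"

lemma sqrtable_append:
  assumes "sqrtable bs" "sqrtable cs"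
  shows "sqrtable (bs @ cs)"
proof -
  obtain R where R: "R\<in>carrier_mat (blocks_size bs) (blocks_size bs)" "R * R = blocks_B bs"
     "qadj R * blocks_H bs = blocks_H bs * R" using assms unfolding sqrtable_def by auto
  obtain S where S: "S\<in>carrier_mat (blocks_size cs) (blocks_size cs)" "S * S = blocks_B cs"
     "qadj S * blocks_H cs = blocks_H cs * S" using assms unfolding sqrtable_def by auto
  show ?thesis unfolding sqrtable_def
    by (rule bexI[of _ "dsum R S"]) (use R S in \<open>auto simp: dsum_mult qadj_dsum intro!: carrier_matI\<close>)
qed

lemma sqrtable_Nil: "sqrtable []"
  unfolding sqrtable_def by (rule bexI[of _ "0\<^sub>m 0 0"]) auto

lemma selfadjoint_conjugate:
  assumes c: "P \<in> carrier_mat n n" "Q \<in> carrier_mat n n" "R \<in> carrier_mat n n" "H \<in> carrier_mat n n"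
    and PQ: "P * Q = 1\<^sub>m n" "Q * P = 1\<^sub>m n" and R: "qadj R * (qadj P * H * P) = (qadj P * H * P) * R"
  shows "qadj (P * R * Q) * H = H * (P * R * Q)"
proof -
  have QP': "qadj Q * qadj P = 1\<^sub>m n" using PQ(1) c by (metis qadj_mult qadj_one carrier_matD)
  have "qadj (P * R * Q) * H = qadj Q * (qadj R * (qadj P * (H * (P * Q))))"
    unfolding PQ(1) using c by (simp add: qadj_mult mult_assoc_dim)
  also have "\<dots> = qadj Q * (qadj R * (qadj P * H * P)) * Q"
    using c by (simp add: mult_assoc_dim)
  also have "\<dots> = (qadj Q * qadj P) * (H * (P * R * Q))"
    unfolding R using c by (simp add: mult_assoc_dim)
  finally show ?thesis unfolding QP' using c by simp
qed

lemma square_conjugate: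
  assumes c: "P \<in> carrier_mat n n" "Q \<in> carrier_mat n n" "R \<in> carrier_mat n n"
    and PQ: "Q * P = 1\<^sub>m n"
  shows "(P * R * Q) * (P * R * Q) = P * (R * R) * (Q :: quat mat)"
proof -
  have "(P * R * Q) * (P * R * Q) = P * (R * ((Q * P) * (R * Q)))"
    using c by (simp add: mult_assoc_dim)
  also have "\<dots> = P * (R * R) * Q" unfolding PQ using c by (simp add: mult_assoc_dim)
  finally show ?thesis .
qed

lemma sqrtable_mset:
  assumes "mset bs = mset cs" "sqrtable cs"
  shows "sqrtable bs"
proof -
  let ?n = "blocks_size bs"
  have "sum_mset (image_mset cblock_size (mset bs)) = sum_mset (image_mset cblock_size (mset cs))"
    unfolding assms(1) ..
  hence sz: "blocks_size cs = ?n" by (simp add: sum_mset_sum_list[symmetric])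
  obtain R where R: "R\<in>carrier_mat ?n ?n" "R * R = blocks_B cs"
     "qadj R * blocks_H cs = blocks_H cs * R" using assms(2) unfolding sqrtable_def sz by auto
  obtain P where P: "P\<in>carrier_mat ?n ?n" "invertible_mat P" "blocks_B bs * P = P * blocks_B cs"
    "qadj P * blocks_H bs * P = blocks_H cs"
    using peq_blocks_mset[OF assms(1)] unfolding peq_def by auto
  obtain Q where Q: "Q \<in> carrier_mat ?n ?n" "P * Q = 1\<^sub>m ?n" "Q * P = 1\<^sub>m ?n"
    using invertible_matE[OF P(2,1)] by metis
  show ?thesis unfolding sqrtable_def
  proof (intro bexI[of _ "P * R * Q"] conjI)
    have "(P * R * Q) * (P * R * Q) = (P * blocks_B cs) * Q"
      using square_conjugate[OF P(1) Q(1) R(1) Q(3)] R(2) by simp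
    also have "\<dots> = blocks_B bs * (P * Q)" unfolding P(3)[symmetric] using P(1) Q(1) by (simp add: mult_assoc_dim)
    finally show "(P * R * Q) * (P * R * Q) = blocks_B bs" unfolding Q(2) by simp
    show "qadj (P * R * Q) * blocks_H bs = blocks_H bs * (P * R * Q)"
      by (rule selfadjoint_conjugate[OF P(1) Q(1) R(1) blocks_carrier(2) Q(2,3)]) (use R P in simp)
  qed (use P Q R in auto)
qed

lemma smult_of_int_real: "(of_int e :: quat) = qR (of_int e)"
  by (induction e rule: int_induct[of _ 0]) auto

lemma sqrtable_positive:
  assumes "l > 0" shows "sqrtable [RB k l e]"
proof -
  obtain c :: "nat \<Rightarrow> real" where c: "\<And>m. (\<Sum>i\<le>m. c i * c (m - i)) = (if m = 0 then sqrt l * sqrt l else if m = 1 then 1 else 0)"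
    using power_series_sqrt[of "sqrt l" 1] assms by auto
  let ?R = "toeplitz k (\<lambda>i. qR (c i))"
  have s: "(\<Sum>i\<le>m. qR (c i) * qR (c (m - i))) = (if m = 0 then qR l else if m = 1 then 1 else 0)" for m
  proof -
    have e: "(\<Sum>i\<in>A. qR (c i) * qR (c (m - i))) = qR (\<Sum>i\<in>A. c i * c (m - i))" for A :: "nat set"
      by (induction A rule: infinite_finite_induct) auto
    show ?thesis unfolding e c using assms by (auto simp del: quat_of_real_simps(6))
  qed
  have "?R * ?R = jordan_block k (qR l)" unfolding toeplitz_mult s jordan_toeplitz ..
  moreover have "qadj ?R * (of_int e \<cdot>\<^sub>m antidiag k) = (of_int e \<cdot>\<^sub>m antidiag k) * ?R"
    unfolding smult_of_int_real by (simp add: smult_real_mult smult_mult qadj_toeplitz_antidiag)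
  ultimately show ?thesis unfolding sqrtable_def by (intro bexI[of _ ?R]) auto
qed

lemma antidiag_double: "antidiag (2 * k) = four_block_mat (0\<^sub>m k k) (antidiag k) (antidiag k) (0\<^sub>m k k)"
  by (rule eq_matI) (auto simp: antidiag_def)

text \<open>The two halves carry conjugate Toeplitz coefficients. The antidiagonal of size
  \<open>2 * k\<close> exchanges the halves, which compensates for the conjugation done by the
  adjoint.\<close>

lemma sqrtable_complex:
  assumes "z \<noteq> 0" shows "sqrtable [CB k z]"
proof -
  obtain c :: "nat \<Rightarrow> complex" where c: "\<And>m. (\<Sum>i\<le>m. c i * c (m - i)) = (if m = 0 then csqrt z * csqrt z else if m = 1 then 1 else 0)"
    using power_series_sqrt[of "csqrt z" 1] assms by auto
  have cc: "csqrt z * csqrt z = z" by (metis power2_csqrt power2_eq_square)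
  let ?R = "toeplitz k (\<lambda>i. qC (c i))" and ?S = "toeplitz k (\<lambda>i. qC (cnj (c i)))"
  have s: "(\<Sum>i\<le>m. qC (c i) * qC (c (m - i))) = (if m = 0 then qC z else if m = 1 then 1 else 0)" for m
  proof -
    have e: "(\<Sum>i\<in>A. qC (c i) * qC (c (m - i))) = qC (\<Sum>i\<in>A. c i * c (m - i))" for A :: "nat set"
      by (induction A rule: infinite_finite_induct) auto
    show ?thesis unfolding e c cc by auto
  qed
  have s': "(\<Sum>i\<le>m. qC (cnj (c i)) * qC (cnj (c (m - i)))) = (if m = 0 then qC (cnj z) else if m = 1 then 1 else 0)" for m
  proof -
    have e: "(\<Sum>i\<in>A. qC (cnj (c i)) * qC (cnj (c (m - i)))) = qC (cnj (\<Sum>i\<in>A. c i * c (m - i)))" for A :: "nat set"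
      by (induction A rule: infinite_finite_induct) auto
    show ?thesis unfolding e c cc by auto
  qed
  have "dsum ?R ?S * dsum ?R ?S = cblock_B (CB k z)"
    by (simp add: dsum_mult toeplitz_mult s s' jordan_toeplitz diag_block_Cons)
  moreover have "qadj (dsum ?R ?S) * antidiag (2 * k) = antidiag (2 * k) * dsum ?R ?S"
    unfolding qadj_dsum antidiag_double
    by (simp add: qadj_carrier dsum_mult_four_block[of _ k k _ k k _ k _ k] four_block_mult_dsum[of _ k k _ k k _ k _ _ k]
        qadj_toeplitz_antidiag right_mult_zero_mat[of _ k k] left_mult_zero_mat[of _ k k])
  ultimately show ?thesis unfolding sqrtable_def by (intro bexI[of _ "dsum ?R ?S"]) (auto intro!: carrier_matI)
qed

text \<open>With \<open>R\<close> a Toeplitz root of \<open>-J\<close>, the matrix with off-diagonal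
  blocks \<open>R\<close> and \<open>-R\<close> squares to \<open>J\<close> on both summands. The
  opposite signs of these blocks match the opposite signs of the two forms, which makes it
  selfadjoint.\<close>

lemma sqrtable_negative_pair:
  assumes "l < 0" shows "sqrtable [RB k l 1, RB k l (-1)]"
proof -
  obtain c :: "nat \<Rightarrow> real" where c: "\<And>m. (\<Sum>i\<le>m. c i * c (m - i)) = (if m = 0 then sqrt (- l) * sqrt (- l) else if m = 1 then -1 else 0)"
    using power_series_sqrt[of "sqrt (- l)" "-1"] assms by auto
  let ?R = "toeplitz k (\<lambda>i. qR (c i))" and ?Q = "antidiag k"
  have s: "(\<Sum>i\<le>m. qR (c i) * qR (c (m - i))) = (if m = 0 then - qR l else if m = 1 then -1 else 0)" for m
  proof -
    have e: "(\<Sum>i\<in>A. qR (c i) * qR (c (m - i))) = qR (\<Sum>i\<in>A. c i * c (m - i))" for A :: "nat set"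
      by (induction A rule: infinite_finite_induct) auto
    show ?thesis unfolding e c using assms by (auto simp del: quat_of_real_simps(6))
  qed
  have RR: "?R * ?R = - jordan_block k (qR l)"
    unfolding toeplitz_mult s by (rule eq_matI) (auto simp: toeplitz_def)
  have mR: "- ?R \<in> carrier_mat k k" by simp
  have neg: "- jordan_block k (qR l) = (-1) \<cdot>\<^sub>m jordan_block k (qR l)" by (rule eq_matI) auto
  let ?S = "four_block_mat (0\<^sub>m k k) ?R (- ?R) (0\<^sub>m k k)"
  have S: "?S \<in> carrier_mat (k + k) (k + k)" by (intro carrier_matI) auto
  have m1: "(- ?R) * ?R = jordan_block k (qR l)" "?R * (- ?R) = jordan_block k (qR l)"
    using RR by (auto simp: uminus_mult_left_mat uminus_mult_right_mat)
  have BB: "blocks_B [RB k l 1, RB k l (-1)] = four_block_mat (jordan_block k (qR l)) (0\<^sub>m k k) (0\<^sub>m k k) (jordan_block k (qR l))"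
    by (simp, simp add: dsum_def)
  have HH: "blocks_H [RB k l 1, RB k l (-1)] = dsum ?Q (- ?Q)"
    by (simp, rule arg_cong2[of _ _ _ _ dsum]; rule eq_matI; auto)
  have "?S * ?S = blocks_B [RB k l 1, RB k l (-1)]"
    unfolding BB
    by (subst mult_four_block_mat[of _ k k _ k _ k _ _ k _ k])
       (auto simp: m1 left_mult_zero_mat[of _ k k] right_mult_zero_mat[of _ k k] left_add_zero_mat[of _ k k] right_add_zero_mat[of _ k k])
  moreover have "qadj ?S * dsum ?Q (- ?Q) = dsum ?Q (- ?Q) * ?S"
  proof -
    have qS: "qadj ?S = four_block_mat (0\<^sub>m k k) (- qadj ?R) (qadj ?R) (0\<^sub>m k k)"
      by (rule eq_matI) auto
    have a: "(- qadj ?R) * (- ?Q) = qadj ?R * ?Q" "(- ?Q) * (- ?R) = ?Q * ?R"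
      by (auto simp: uminus_mult_left_mat uminus_mult_right_mat)
    show ?thesis unfolding qS
      by (subst dsum_mult_four_block[of _ k k _ k k _ k _ k])
         (auto simp: qadj_carrier four_block_mult_dsum[of _ k k _ k k _ k _ _ k] a
        qadj_toeplitz_antidiag right_mult_zero_mat[of _ k k] left_mult_zero_mat[of _ k k])
  qed
  ultimately show ?thesis unfolding sqrtable_def HH by (intro bexI[of _ ?S]) (use S in auto)
qed

lemma sqrtable_pairable:
  assumes nz: "\<forall>b\<in>set bs. \<not> zero_block b" and val: "\<forall>b\<in>set bs. cblock_valid b" and np: "neg_pairable bs"
  shows "sqrtable bs"
proof -
  obtain ps :: "(nat \<times> real) list" where ps: "\<forall>(k,l)\<in>set ps. l < 0"
    "mset (filter neg_block bs) = mset (concat (map (\<lambda>(k,l). [RB k l 1, RB k l (-1)]) ps))"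
    using np unfolding neg_pairable_def by auto
  have 1: "sqrtable (concat (map (\<lambda>(k,l). [RB k l 1, RB k l (-1)]) ps))"
    using ps(1)
  proof (induction ps)
    case (Cons p ps)
    obtain k l where p: "p = (k, l)" by (cases p)
    have "sqrtable ([RB k l 1, RB k l (-1)] @ concat (map (\<lambda>(k,l). [RB k l 1, RB k l (-1)]) ps))"
      by (rule sqrtable_append[OF sqrtable_negative_pair]) (use Cons p in auto)
    thus ?case by (simp add: p)
  qed (simp add: sqrtable_Nil)
  have single: "sqrtable [b]" if "\<not> neg_block b" "\<not> zero_block b" "cblock_valid b" for b
    using that by (cases b) (auto intro!: sqrtable_positive sqrtable_complex)
  have 2: "sqrtable cs" if "\<forall>b\<in>set cs. \<not> neg_block b \<and> \<not> zero_block b \<and> cblock_valid b" for cs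
    using that
  proof (induction cs)
    case (Cons b cs)
    have "sqrtable ([b] @ cs)" by (rule sqrtable_append[OF single]) (use Cons in auto)
    thus ?case by simp
  qed (simp add: sqrtable_Nil)
  have "mset bs = mset (filter neg_block bs) + mset (filter (\<lambda>b. \<not> neg_block b) bs)"
    by (simp add: multiset_partition[of "mset bs" neg_block, symmetric])
  hence "mset bs = mset (concat (map (\<lambda>(k,l). [RB k l 1, RB k l (-1)]) ps) @ filter (\<lambda>b. \<not> neg_block b) bs)"
    unfolding ps(2) by simp
  thus ?thesis by (rule sqrtable_mset) (intro sqrtable_append 1 2; use nz val in auto)
qed

lemma blocks_H_invertible: "\<forall>b\<in>set bs. cblock_valid b \<Longrightarrow> invertible_mat (blocks_H bs)"
proof (induction bs)
  case Nil
  have "(0\<^sub>m 0 0 :: quat mat) = 1\<^sub>m 0" by (rule eq_matI) auto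
  thus ?case by simp
next
  case (Cons b bs)
  thus ?case using invertible_dsum[OF cblock_H_invertible cblock_carrier(2) _ blocks_carrier(2), of b bs] by simp
qed

section \<open>Square roots of the zero groups with prescribed kernel\<close>

abbreviation "zgroup_B g \<equiv> blocks_B (zgroup_blocks g)"
abbreviation "zgroup_H g \<equiv> blocks_H (zgroup_blocks g)"

text \<open>The kernel generator required by condition (iii), in coordinates of the group counted
  from 0.\<close>

fun zkernel :: "zgroup \<Rightarrow> nat \<Rightarrow> quat" where
  "zkernel (ZOdd k e) i = (if i = 0 then 1 else 0)"
| "zkernel (ZEven k) i = (if i = 0 \<or> i = k then 1 else 0)"

text \<open>The last clause says that the kernel is the right line through \<open>zkernel g\<close>;
  the multiplier can be read off as \<open>t $ 0\<close> because
  \<open>zkernel g 0 = 1\<close>.\<close>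

definition is_zroot :: "zgroup \<Rightarrow> quat mat \<Rightarrow> bool" where
  "is_zroot g R \<longleftrightarrow> R \<in> carrier_mat (zgroup_size g) (zgroup_size g) \<and> R * R = zgroup_B g \<and>
     qadj R * zgroup_H g = zgroup_H g * R \<and>
     (\<forall>t\<in>carrier_vec (zgroup_size g). R *\<^sub>v t = 0\<^sub>v (zgroup_size g) \<longleftrightarrow>
        (\<forall>i<zgroup_size g. t $ i = zkernel g i * t $ 0))"

lemma jordan_zero_dim: "jordan_block 0 a = 0\<^sub>m 0 0" "antidiag 0 = 0\<^sub>m 0 0"
  by (auto intro!: eq_matI)

text \<open>For \<open>k = 0\<close> the missing second block of \<open>ZOdd\<close> is an empty
  summand, so the single block needs no separate treatment afterwards.\<close>

lemma zgroup_matrices: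
  "zgroup_B (ZOdd k e) = dsum (jordan_block (k + 1) 0) (jordan_block k 0)"
  "zgroup_H (ZOdd k e) = dsum (of_int e \<cdot>\<^sub>m antidiag (k + 1)) (of_int e \<cdot>\<^sub>m antidiag k)"
  "zgroup_B (ZEven k) = dsum (jordan_block k 0) (jordan_block k 0)"
  "zgroup_H (ZEven k) = dsum (antidiag k) (of_int (-1) \<cdot>\<^sub>m antidiag k)"
  by (auto simp: jordan_zero_dim intro!: arg_cong2[of _ _ _ _ dsum] eq_matI)

lemma zgroup_blocks_size [simp]: "blocks_size (zgroup_blocks g) = zgroup_size g"
  by (cases g) auto

lemma zgroup_blocks_valid: "zgroup_valid g \<Longrightarrow> \<forall>b\<in>set (zgroup_blocks g). cblock_valid b"
  by (cases g) auto

lemma jordan_antidiag_selfadjoint: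
  "qadj (jordan_block k (qR l)) * (of_int e \<cdot>\<^sub>m antidiag k) = (of_int e \<cdot>\<^sub>m antidiag k) * jordan_block k (qR l)"
proof -
  have "(\<lambda>i. qcnj (if i = 0 then qR l else if i = 1 then 1 else 0)) = (\<lambda>i::nat. if i = 0 then qR l else if i = 1 then 1 else 0)"
    by auto
  thus ?thesis unfolding smult_of_int_real jordan_toeplitz
    by (simp add: smult_real_mult smult_mult qadj_toeplitz_antidiag)
qed

text \<open>The columns of \<open>P\<close> rearrange one Jordan chain of length \<open>K\<close>
  into a basis of the group, and the root is the Jordan block itself seen in this basis. Its kernel
  is the line through the first chain vector; the premise \<open>ker\<close> says that
  \<open>P\<close> sends \<open>zkernel g\<close> to a nonzero multiple of that vector.\<close>

lemma zroot_from_chain: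
  assumes g: "zgroup_valid g" and K: "K = zgroup_size g" and P: "P \<in> carrier_mat K K"
    and gram: "qadj P * (of_int s \<cdot>\<^sub>m antidiag K) * P = zgroup_H g"
    and sq: "jordan_block K 0 * jordan_block K 0 * P = P * zgroup_B g"
    and ker: "\<And>a. a < K \<Longrightarrow> (\<Sum>i<K. P $$ (a,i) * zkernel g i) = (if a = 0 then \<gamma> else 0)" and \<gamma>: "\<gamma> \<noteq> 0"
  shows "\<exists>R. is_zroot g R \<and> peq K (jordan_block K 0) (of_int s \<cdot>\<^sub>m antidiag K) R (zgroup_H g)"
proof -
  let ?J = "jordan_block K 0 :: quat mat" and ?Q = "of_int s \<cdot>\<^sub>m antidiag K"
  have Qc: "?Q \<in> carrier_mat K K" by simp
  have K0: "K > 0" using g K by (cases g) auto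
  have Hinv: "invertible_mat (zgroup_H g)" using blocks_H_invertible zgroup_blocks_valid[OF g] by blast
  have zc: "zgroup_H g \<in> carrier_mat K K" "zgroup_B g \<in> carrier_mat K K"
    using blocks_carrier[of "zgroup_blocks g"] K by auto
  have "minj P"
  proof (rule minjI[OF P])
    fix v :: "quat vec" assume v: "v \<in> carrier_vec K" "P *\<^sub>v v = 0\<^sub>v K"
    have "zgroup_H g *\<^sub>v v = (qadj P * ?Q) *\<^sub>v (P *\<^sub>v v)"
      unfolding gram[symmetric] using P v Qc by (intro assoc_mult_mat_vec[of _ K K _ K]) auto
    also have "\<dots> = 0\<^sub>v K" unfolding v(2) using P by (intro mult_zero_vec) auto
    finally show "v = 0\<^sub>v K" using minjD[OF invertible_minj[OF Hinv zc(1)] zc(1) v(1)] by simp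
  qed
  hence Pinv: "invertible_mat P" using minj_square_invertible P by blast
  obtain Q where Q: "Q \<in> carrier_mat K K" "P * Q = 1\<^sub>m K" "Q * P = 1\<^sub>m K"
    using invertible_matE[OF Pinv P] by metis
  define R where "R = Q * ?J * P"
  have R: "R \<in> carrier_mat K K" using P Q by (auto simp: R_def)
  have JP: "?J * P = P * R"
  proof -
    have "P * R = (P * Q) * (?J * P)" unfolding R_def using P Q(1) by (simp add: mult_assoc_dim)
    thus ?thesis unfolding Q(2) using P by simp
  qed
  have "R * R = zgroup_B g"
  proof -
    have "R * R = Q * (?J * ?J * P)"
      unfolding R_def using square_conjugate[OF Q(1) P jordan_block_carrier Q(2), of 0] P Q(1)
      by (simp add: mult_assoc_dim)
    also have "\<dots> = (Q * P) * zgroup_B g" unfolding sq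
      by (rule assoc_mult_mat[OF Q(1) P zc(2), symmetric])
    finally show ?thesis unfolding Q(3) left_mult_one_mat[OF zc(2)] .
  qed
  moreover have "qadj R * zgroup_H g = zgroup_H g * R"
    unfolding R_def
  proof (rule selfadjoint_conjugate[OF Q(1) P jordan_block_carrier zc(1) Q(3,2)])
    have "qadj Q * zgroup_H g * Q = (qadj Q * qadj P) * (?Q * (P * Q))"
      unfolding gram[symmetric] using P Q(1) by (simp add: mult_assoc_dim)
    also have "qadj Q * qadj P = qadj (P * Q)" using P Q(1) by (simp add: qadj_mult)
    finally have e: "qadj Q * zgroup_H g * Q = ?Q" unfolding Q(2) using Qc by simp
    show "qadj ?J * (qadj Q * zgroup_H g * Q) = qadj Q * zgroup_H g * Q * ?J"
      unfolding e using jordan_antidiag_selfadjoint[of K 0 s] by simp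
  qed
  moreover have "R *\<^sub>v t = 0\<^sub>v K \<longleftrightarrow> (\<forall>i<K. t $ i = zkernel g i * t $ 0)" if t: "t \<in> carrier_vec K" for t
  proof -
    define \<kappa> where "\<kappa> = vec K (zkernel g)"
    have \<kappa>: "\<kappa> \<in> carrier_vec K" by (simp add: \<kappa>_def)
    have P\<kappa>: "(P *\<^sub>v rscale \<kappa> q) $ a = (if a = 0 then \<gamma> * q else 0)" if "a < K" for a q
    proof -
      have "(P *\<^sub>v rscale \<kappa> q) $ a = (\<Sum>i<K. P $$ (a,i) * zkernel g i) * q"
        using P \<kappa> that by (simp add: mult_rscale scalar_prod_def \<kappa>_def atLeast0LessThan)
      thus ?thesis using ker[OF that] by simp
    qed
    have RP: "R *\<^sub>v t = 0\<^sub>v K \<longleftrightarrow> ?J *\<^sub>v (P *\<^sub>v t) = 0\<^sub>v K"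
    proof -
      have e: "?J *\<^sub>v (P *\<^sub>v t) = P *\<^sub>v (R *\<^sub>v t)"
        using JP P R t by (metis assoc_mult_mat_vec jordan_block_carrier)
      show ?thesis unfolding e using minjD[OF \<open>minj P\<close> P] R P t by auto
    qed
    have z0: "zkernel g 0 = 1" by (cases g) auto
    have Pt: "P *\<^sub>v t \<in> carrier_vec K" using P t by auto
    have J: "?J *\<^sub>v (P *\<^sub>v t) = 0\<^sub>v K \<longleftrightarrow> (\<forall>a<K. a > 0 \<longrightarrow> (P *\<^sub>v t) $ a = 0)"
    proof
      assume e: "?J *\<^sub>v (P *\<^sub>v t) = 0\<^sub>v K"
      show "\<forall>a<K. a > 0 \<longrightarrow> (P *\<^sub>v t) $ a = 0"
      proof (intro allI impI)
        fix a assume a: "a < K" "0 < a"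
        have "(?J *\<^sub>v (P *\<^sub>v t)) $ (a - 1) = 0" unfolding e using a by simp
        thus "(P *\<^sub>v t) $ a = 0" using jordan_mult_vec[OF Pt, of "a - 1" 0] a by auto
      qed
    next
      assume h: "\<forall>a<K. a > 0 \<longrightarrow> (P *\<^sub>v t) $ a = 0"
      show "?J *\<^sub>v (P *\<^sub>v t) = 0\<^sub>v K"
      proof (rule eq_vecI)
        fix i assume i: "i < dim_vec (0\<^sub>v K :: quat vec)"
        thus "(?J *\<^sub>v (P *\<^sub>v t)) $ i = 0\<^sub>v K $ i"
          using jordan_mult_vec[OF Pt, of i 0] h by (simp del: index_mult_mat_vec)
      qed simp
    qed
    show ?thesis unfolding RP J
    proof
      assume h: "\<forall>a<K. a > 0 \<longrightarrow> (P *\<^sub>v t) $ a = 0"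
      define q where "q = inverse \<gamma> * (P *\<^sub>v t) $ 0"
      have "P *\<^sub>v t = P *\<^sub>v rscale \<kappa> q"
      proof (rule eq_vecI)
        fix a assume "a < dim_vec (P *\<^sub>v rscale \<kappa> q)"
        hence a: "a < K" using P by simp
        show "(P *\<^sub>v t) $ a = (P *\<^sub>v rscale \<kappa> q) $ a"
          unfolding P\<kappa>[OF a] using h a \<gamma> by (auto simp: q_def mult.assoc[symmetric])
      qed (use P in auto)
      hence "P * col_mat t = P * col_mat (rscale \<kappa> q)" unfolding mult_col_mat by simp
      moreover have "col_mat t \<in> carrier_mat K 1" "col_mat (rscale \<kappa> q) \<in> carrier_mat K 1" using t \<kappa> by auto
      ultimately have cm: "col_mat t = col_mat (rscale \<kappa> q)"
        using minj_mult_cancel[OF \<open>minj P\<close> P] by blast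
      have tq: "t $ i = zkernel g i * q" if "i < K" for i
        using arg_cong[OF cm, of "\<lambda>M. M $$ (i,0)"] that t \<kappa> by (simp add: col_mat_def \<kappa>_def)
      have "t $ 0 = q" using tq[OF K0] z0 by simp
      thus "\<forall>i<K. t $ i = zkernel g i * t $ 0" using tq by simp
    next
      assume h: "\<forall>i<K. t $ i = zkernel g i * t $ 0"
      have te: "rscale \<kappa> (t $ 0) = t"
      proof (rule eq_vecI)
        fix i assume "i < dim_vec t"
        hence i: "i < K" using t by simp
        have "rscale \<kappa> (t $ 0) $ i = zkernel g i * t $ 0" using i by (simp add: \<kappa>_def)
        thus "rscale \<kappa> (t $ 0) $ i = t $ i" using h[rule_format, OF i] by simp
      qed (use t \<kappa> in auto)
      show "\<forall>a<K. a > 0 \<longrightarrow> (P *\<^sub>v t) $ a = 0" using P\<kappa>[of _ "t $ 0"] unfolding te by simp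
    qed
  qed
  ultimately have "is_zroot g R" unfolding is_zroot_def using R by (simp add: K)
  moreover have "peq K ?J ?Q R (zgroup_H g)"
    by (rule peqI[OF P Pinv JP gram])
  ultimately show ?thesis by blast
qed

lemma sum_two_points:
  fixes f :: "nat \<Rightarrow> quat"
  assumes "i < n" "j < n" "i \<noteq> j"
  shows "(\<Sum>a<n. (if a = i then p else if a = j then q else 0) * f a) = p * f i + q * f j"
proof -
  have "(\<Sum>a<n. (if a = i then p else if a = j then q else 0) * f a) =
    (\<Sum>a<n. (if a = i then p * f i else 0) + (if a = j then q * f j else 0))"
    by (rule sum.cong) (use assms in auto)
  thus ?thesis using assms by (simp add: sum.distrib)
qed

lemma mult_jordan_zero:
  assumes "M \<in> carrier_mat n k" "i < n" "c < k"
  shows "(M * jordan_block k 0) $$ (i,c) = (if c = 0 then 0 else M $$ (i, c - 1) :: quat)"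
proof -
  have "(M * jordan_block k 0) $$ (i,c) = (\<Sum>l<k. M $$ (i,l) * (if l = c then 0 else if Suc l = c then 1 else 0))"
    using assms by (simp add: scalar_prod_def atLeast0LessThan)
  also have "\<dots> = (\<Sum>l<k. if l = c - 1 then (if c = 0 then 0 else M $$ (i, l)) else 0)"
    by (rule sum.cong) auto
  also have "\<dots> = (if c = 0 then 0 else M $$ (i, c - 1))" using assms by auto
  finally show ?thesis .
qed

lemma jordan_square_mult:
  assumes "M \<in> carrier_mat n k" "i < n" "c < k"
  shows "(jordan_block n 0 * jordan_block n 0 * M) $$ (i,c) = (if i + 2 < n then M $$ (i + 2, c) else 0 :: quat)"
proof -
  have "jordan_block n 0 ^\<^sub>m 2 = jordan_block n 0 * (jordan_block n 0 :: quat mat)"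
    by (simp add: numeral_2_eq_2)
  thus ?thesis using nilpotent_jordan_pow_mult[OF assms, of 2] by simp
qed

lemma qadj_mult_sum:
  assumes "U \<in> carrier_mat n k" "M \<in> carrier_mat n m" "c < k" "d < m"
  shows "(qadj U * M) $$ (c,d) = (\<Sum>a<n. qcnj (U $$ (a,c)) * M $$ (a,d))"
  using assms by (simp add: scalar_prod_def atLeast0LessThan)

text \<open>
  Counting the chain from \<open>0\<close>, the even and the odd members are Jordan chains of the square, and they
  are orthogonal to each other when the chain has odd length.
\<close>

lemma zroot_odd:
  assumes e: "e = 1 \<or> e = -1"
  shows "\<exists>R. is_zroot (ZOdd k e) R \<and>
    peq (2 * k + 1) (jordan_block (2 * k + 1) 0) (of_int e \<cdot>\<^sub>m antidiag (2 * k + 1)) R (zgroup_H (ZOdd k e))"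
proof -
  define K where "K = 2 * k + 1"
  define P1 P2 :: "quat mat" where "P1 = mat K (k + 1) (\<lambda>(a,c). if a = 2 * c then 1 else 0)"
    and "P2 = mat K k (\<lambda>(a,c). if a = 2 * c + 1 then 1 else 0)"
  have P: "P1 \<in> carrier_mat K (k + 1)" "P2 \<in> carrier_mat K k" by (auto simp: P1_def P2_def)
  let ?Q = "of_int e \<cdot>\<^sub>m antidiag K :: quat mat"
  have QM: "(?Q * M) $$ (a,d) = of_int e * M $$ (K - Suc a, d)" if "M \<in> carrier_mat K m" "a < K" "d < m" for M m a d
    using that antidiag_mult[OF that] by (simp add: smult_mult del: index_mult_mat(1))
  have gr1: "(qadj P1 * (?Q * M)) $$ (c,d) = of_int e * M $$ (K - Suc (2 * c), d)"
    if "M \<in> carrier_mat K m" "c < k + 1" "d < m" for M m c d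
  proof -
    have "(qadj P1 * (?Q * M)) $$ (c,d) = (\<Sum>a<K. (if a = 2 * c then 1 else 0) * (?Q * M) $$ (a,d))"
      using that P by (subst qadj_mult_sum[of _ K _ _ m])
        (auto simp: P1_def simp del: index_mult_mat(1) intro!: sum.cong)
    also have "\<dots> = (\<Sum>a<K. if a = 2 * c then (?Q * M) $$ (a,d) else 0)" by (rule sum.cong) auto
    also have "\<dots> = (?Q * M) $$ (2 * c,d)" using that by (simp add: K_def del: index_mult_mat(1))
    also have "\<dots> = of_int e * M $$ (K - Suc (2 * c), d)" by (rule QM) (use that in \<open>auto simp: K_def\<close>)
    finally show ?thesis .
  qed
  have gr2: "(qadj P2 * (?Q * M)) $$ (c,d) = of_int e * M $$ (K - Suc (2 * c + 1), d)"
    if "M \<in> carrier_mat K m" "c < k" "d < m" for M m c d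
  proof -
    have "(qadj P2 * (?Q * M)) $$ (c,d) = (\<Sum>a<K. (if a = 2 * c + 1 then 1 else 0) * (?Q * M) $$ (a,d))"
      using that P by (subst qadj_mult_sum[of _ K _ _ m])
        (auto simp: P2_def simp del: index_mult_mat(1) intro!: sum.cong)
    also have "\<dots> = (\<Sum>a<K. if a = 2 * c + 1 then (?Q * M) $$ (a,d) else 0)" by (rule sum.cong) auto
    also have "\<dots> = (?Q * M) $$ (2 * c + 1,d)" using that by (simp add: K_def del: index_mult_mat(1))
    also have "\<dots> = of_int e * M $$ (K - Suc (2 * c + 1), d)" by (rule QM) (use that in \<open>auto simp: K_def\<close>)
    finally show ?thesis .
  qed
  have as: "qadj P' * ?Q * M = qadj P' * (?Q * M)" if "P' \<in> carrier_mat K m" "M \<in> carrier_mat K m'" for P' M m m'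
    using that by (intro mult_assoc_dim) auto
  have g11: "qadj P1 * ?Q * P1 = of_int e \<cdot>\<^sub>m antidiag (k + 1)"
    unfolding as[OF P(1,1)]
  proof (rule eq_matI)
    fix c d assume "c < dim_row (of_int e \<cdot>\<^sub>m antidiag (k + 1) :: quat mat)" "d < dim_col (of_int e \<cdot>\<^sub>m antidiag (k + 1) :: quat mat)"
    thus "(qadj P1 * (?Q * P1)) $$ (c,d) = (of_int e \<cdot>\<^sub>m antidiag (k + 1)) $$ (c,d)"
      using gr1[OF P(1), of c d] by (auto simp: P1_def K_def antidiag_def simp del: index_mult_mat(1))
  qed (use P in auto)
  have g12: "qadj P1 * ?Q * P2 = 0\<^sub>m (k + 1) k"
    unfolding as[OF P(1,2)]
  proof (rule eq_matI)
    fix c d assume cd: "c < dim_row (0\<^sub>m (k + 1) k :: quat mat)" "d < dim_col (0\<^sub>m (k + 1) k :: quat mat)"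
    \<comment> \<open>Indices paired by the antidiagonal add up to the even number
      \<open>K - 1 = 2 * k\<close>, so an even index is never paired with an odd one.\<close>
    have "2 * k - 2 * c \<noteq> Suc (2 * d)" by presburger
    thus "(qadj P1 * (?Q * P2)) $$ (c,d) = 0\<^sub>m (k + 1) k $$ (c,d)"
      using cd gr1[OF P(2), of c d] by (auto simp: P2_def K_def simp del: index_mult_mat(1))
  qed (use P in auto)
  have g21: "qadj P2 * ?Q * P1 = 0\<^sub>m k (k + 1)"
    unfolding as[OF P(2,1)]
  proof (rule eq_matI)
    fix c d assume cd: "c < dim_row (0\<^sub>m k (k + 1) :: quat mat)" "d < dim_col (0\<^sub>m k (k + 1) :: quat mat)"
    have "2 * k - Suc (2 * c) \<noteq> 2 * d" using cd by (simp, presburger)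
    thus "(qadj P2 * (?Q * P1)) $$ (c,d) = 0\<^sub>m k (k + 1) $$ (c,d)"
      using cd gr2[OF P(1), of c d] by (auto simp: P1_def K_def simp del: index_mult_mat(1))
  qed (use P in auto)
  have g22: "qadj P2 * ?Q * P2 = of_int e \<cdot>\<^sub>m antidiag k"
    unfolding as[OF P(2,2)]
  proof (rule eq_matI)
    fix c d assume "c < dim_row (of_int e \<cdot>\<^sub>m antidiag k :: quat mat)" "d < dim_col (of_int e \<cdot>\<^sub>m antidiag k :: quat mat)"
    thus "(qadj P2 * (?Q * P2)) $$ (c,d) = (of_int e \<cdot>\<^sub>m antidiag k) $$ (c,d)"
      using gr2[OF P(2), of c d] by (auto simp: P2_def K_def antidiag_def simp del: index_mult_mat(1))
  qed (use P in auto)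
  have "zgroup_valid (ZOdd k e)" using e by simp
  moreover have "K = zgroup_size (ZOdd k e)" by (simp add: K_def)
  moreover have "hcat P1 P2 \<in> carrier_mat K K" using P by (auto simp: K_def)
  moreover have "qadj (hcat P1 P2) * ?Q * hcat P1 P2 = zgroup_H (ZOdd k e)"
    unfolding gram_hcat[OF P smult_carrier_mat[OF antidiag_carrier]] g11 g12 g21 g22 zgroup_matrices by (simp add: dsum_def)
  moreover have "jordan_block K 0 * jordan_block K 0 * hcat P1 P2 = hcat P1 P2 * zgroup_B (ZOdd k e)"
  proof -
    have a: "jordan_block K 0 * jordan_block K 0 * P1 = P1 * jordan_block (k + 1) 0"
    proof (rule eq_matI)
      fix a c assume "a < dim_row (P1 * jordan_block (k + 1) 0)" "c < dim_col (P1 * jordan_block (k + 1) 0)"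
      hence "a < K" "c < k + 1" using P by auto
      thus "(jordan_block K 0 * jordan_block K 0 * P1) $$ (a,c) = (P1 * jordan_block (k + 1) 0) $$ (a,c)"
        unfolding jordan_square_mult[OF P(1) \<open>a < K\<close> \<open>c < k + 1\<close>] mult_jordan_zero[OF P(1) \<open>a < K\<close> \<open>c < k + 1\<close>]
        by (auto simp: P1_def K_def)
    qed (use P in auto)
    have b: "jordan_block K 0 * jordan_block K 0 * P2 = P2 * jordan_block k 0"
    proof (rule eq_matI)
      fix a c assume "a < dim_row (P2 * jordan_block k 0)" "c < dim_col (P2 * jordan_block k 0)"
      hence "a < K" "c < k" using P by auto
      thus "(jordan_block K 0 * jordan_block K 0 * P2) $$ (a,c) = (P2 * jordan_block k 0) $$ (a,c)"
        unfolding jordan_square_mult[OF P(2) \<open>a < K\<close> \<open>c < k\<close>] mult_jordan_zero[OF P(2) \<open>a < K\<close> \<open>c < k\<close>]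
        by (auto simp: P2_def K_def)
    qed (use P in auto)
    have "jordan_block K 0 * jordan_block K 0 * hcat P1 P2 = hcat (P1 * jordan_block (k + 1) 0) (P2 * jordan_block k 0)"
      unfolding a[symmetric] b[symmetric] using P by (intro mult_hcat) auto
    thus ?thesis unfolding zgroup_matrices using P by (subst hcat_mult_dsum) auto
  qed
  moreover have "(\<Sum>i<K. hcat P1 P2 $$ (a,i) * zkernel (ZOdd k e) i) = (if a = 0 then 1 else 0)" if "a < K" for a
  proof -
    have "(\<Sum>i<K. hcat P1 P2 $$ (a,i) * zkernel (ZOdd k e) i) = (\<Sum>i<K. if i = 0 then hcat P1 P2 $$ (a,i) else 0)"
      by (rule sum.cong) auto
    also have "\<dots> = (if a = 0 then 1 else 0)" using that P by (auto simp: hcat_def P1_def K_def)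
    finally show ?thesis .
  qed
  ultimately show ?thesis using zroot_from_chain[of "ZOdd k e" K "hcat P1 P2" e 1] unfolding K_def by auto
qed

text \<open>
  In even length the even and the odd members \<open>e\<^sub>2\<^sub>c\<close>, \<open>e\<^sub>2\<^sub>c\<^sub>+\<^sub>1\<close> span isotropic subspaces instead, so one
  passes to the combinations \<open>(e\<^sub>2\<^sub>c + s e\<^sub>2\<^sub>c\<^sub>+\<^sub>1) / \<surd>2\<close> and \<open>(e\<^sub>2\<^sub>c - s e\<^sub>2\<^sub>c\<^sub>+\<^sub>1) / \<surd>2\<close>.
\<close>

lemma zroot_even:
  assumes e: "e = 1 \<or> e = -1" and k: "k \<ge> 1"
  shows "\<exists>R. is_zroot (ZEven k) R \<and>
    peq (2 * k) (jordan_block (2 * k) 0) (of_int e \<cdot>\<^sub>m antidiag (2 * k)) R (zgroup_H (ZEven k))"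
proof -
  define K where "K = 2 * k"
  define h :: real where "h = 1 / sqrt 2"
  have hh: "h * h = 1 / 2" by (simp add: h_def)
  have h0: "h \<noteq> 0" by (simp add: h_def)
  define re :: real where "re = of_int e"
  have ree: "re * re = 1" "re = 1 \<or> re = -1" using e by (auto simp: re_def)
  \<comment> \<open>The values \<open>x = 1\<close> and \<open>x = -1\<close> give the two halves of
    the basis. With \<open>re * re = 1\<close> the Gram matrix of \<open>PP x\<close> against
    \<open>PP y\<close> is \<open>(x + y) / 2\<close> times the antidiagonal, whatever the sign of
    the chain; even chains of either sign thus yield the same group.\<close>
  define PP :: "real \<Rightarrow> quat mat" where
    "PP x = mat K k (\<lambda>(a,c). if a = 2 * c then qR h else if a = 2 * c + 1 then qR (re * x * h) else 0)" for x
  have P: "PP x \<in> carrier_mat K k" for x by (simp add: PP_def)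
  let ?Q = "of_int e \<cdot>\<^sub>m antidiag K :: quat mat"
  have QM: "(?Q * M) $$ (a,d) = qR re * M $$ (K - Suc a, d)" if "M \<in> carrier_mat K m" "a < K" "d < m" for M m a d
    using that antidiag_mult[OF that] by (simp add: smult_mult smult_of_int_real re_def del: index_mult_mat(1))
  have gr: "(qadj (PP x) * (?Q * PP y)) $$ (c,d) = (if c + d + 1 = k then qR ((x + y) / 2) else 0)"
    if "c < k" "d < k" for x y c d
  proof -
    have lt: "2 * c < K" "2 * c + 1 < K" using that by (auto simp: K_def)
    have "(qadj (PP x) * (?Q * PP y)) $$ (c,d) =
      (\<Sum>a<K. (if a = 2 * c then qR h else if a = 2 * c + 1 then qR (re * x * h) else 0) * (?Q * PP y) $$ (a,d))"
      using that P by (subst qadj_mult_sum[of _ K k _ k])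
        (auto simp: PP_def simp del: index_mult_mat(1) quat_of_real_simps(6) intro!: sum.cong)
    also have "\<dots> = qR h * (?Q * PP y) $$ (2 * c, d) + qR (re * x * h) * (?Q * PP y) $$ (2 * c + 1, d)"
      using lt by (intro sum_two_points) auto
    also have "(?Q * PP y) $$ (2 * c, d) = qR re * PP y $$ (K - Suc (2 * c), d)" by (rule QM[OF P lt(1) that(2)])
    also have "PP y $$ (K - Suc (2 * c), d) = (if c + d + 1 = k then qR (re * y * h) else 0)"
    proof -
      have "K - Suc (2 * c) \<noteq> 2 * d" using lt by (simp add: K_def, presburger)
      moreover have "K - Suc (2 * c) = 2 * d + 1 \<longleftrightarrow> c + d + 1 = k" using lt by (auto simp: K_def)
      ultimately show ?thesis using that lt by (simp add: PP_def)
    qed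
    also have "(?Q * PP y) $$ (2 * c + 1, d) = qR re * PP y $$ (K - Suc (2 * c + 1), d)" by (rule QM[OF P lt(2) that(2)])
    also have "PP y $$ (K - Suc (2 * c + 1), d) = (if c + d + 1 = k then qR h else 0)"
    proof -
      have "K - Suc (2 * c + 1) \<noteq> 2 * d + 1" by (simp add: K_def, presburger)
      moreover have "K - Suc (2 * c + 1) = 2 * d \<longleftrightarrow> c + d + 1 = k" using lt by (auto simp: K_def)
      ultimately show ?thesis using that lt by (simp add: PP_def)
    qed
    also have "qR h * (qR re * (if c + d + 1 = k then qR (re * y * h) else 0)) + qR (re * x * h) * (qR re * (if c + d + 1 = k then qR h else 0))
      = (if c + d + 1 = k then qR (h * re * (re * y * h) + re * x * h * re * h) else 0)" by (simp add: mult.assoc)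
    also have "h * re * (re * y * h) + re * x * h * re * h = (re * re) * (h * h) * (x + y)" by (simp add: algebra_simps)
    also have "\<dots> = (x + y) / 2" unfolding ree hh by simp
    finally show ?thesis .
  qed
  have as: "qadj (PP x) * ?Q * PP y = qadj (PP x) * (?Q * PP y)" for x y
    using P[of x] P[of y] by (intro mult_assoc_dim) auto
  have g: "qadj (PP x) * ?Q * PP y = qR ((x + y) / 2) \<cdot>\<^sub>m antidiag k" for x y
    unfolding as
  proof (rule eq_matI)
    fix c d assume "c < dim_row (qR ((x + y) / 2) \<cdot>\<^sub>m antidiag k :: quat mat)" "d < dim_col (qR ((x + y) / 2) \<cdot>\<^sub>m antidiag k :: quat mat)"
    thus "(qadj (PP x) * (?Q * PP y)) $$ (c,d) = (qR ((x + y) / 2) \<cdot>\<^sub>m antidiag k) $$ (c,d)"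
      using gr[of c d x y] by (auto simp: antidiag_def simp del: index_mult_mat(1))
  qed (use P[of x] P[of y] in auto)
  define PT where "PT = hcat (PP 1) (PP (-1))"
  have "zgroup_valid (ZEven k)" using k by simp
  moreover have "K = zgroup_size (ZEven k)" by (simp add: K_def)
  moreover have "PT \<in> carrier_mat K K" using P[of 1] P[of "-1"] by (auto simp: K_def PT_def)
  moreover have "qadj PT * ?Q * PT = zgroup_H (ZEven k)"
  proof -
    have z: "qR ((1 + - 1) / 2) \<cdot>\<^sub>m antidiag k = 0\<^sub>m k k" "qR ((- 1 + 1) / 2) \<cdot>\<^sub>m antidiag k = 0\<^sub>m k k"
      "qR ((1 + 1) / 2) \<cdot>\<^sub>m antidiag k = antidiag k" "qR ((- 1 + - 1) / 2) \<cdot>\<^sub>m antidiag k = of_int (-1) \<cdot>\<^sub>m antidiag k"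
      by (auto intro!: eq_matI)
    show ?thesis unfolding PT_def gram_hcat[OF P P smult_carrier_mat[OF antidiag_carrier]] g zgroup_matrices z
      by (simp add: dsum_def)
  qed
  moreover have "jordan_block K 0 * jordan_block K 0 * PT = PT * zgroup_B (ZEven k)"
  proof -
    have a: "jordan_block K 0 * jordan_block K 0 * PP x = PP x * jordan_block k 0" for x
    proof (rule eq_matI)
      fix a c assume "a < dim_row (PP x * jordan_block k 0)" "c < dim_col (PP x * jordan_block k 0)"
      hence "a < K" "c < k" using P[of x] by auto
      have "(if a + 2 < K then PP x $$ (a + 2, c) else 0) = (if c = 0 then 0 else PP x $$ (a, c - 1))"
      proof (cases c)
        case 0
        show ?thesis unfolding 0 using \<open>c < k\<close> by (simp add: PP_def)
      next
        case (Suc c')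
        have "a + 2 = 2 * Suc c' \<longleftrightarrow> a = 2 * c'" "a + 2 = 2 * Suc c' + 1 \<longleftrightarrow> a = 2 * c' + 1"
          "\<not> a + 2 < K \<Longrightarrow> a \<noteq> 2 * c' \<and> a \<noteq> 2 * c' + 1"
          using \<open>c < k\<close> Suc by (auto simp: K_def)
        thus ?thesis using \<open>a < K\<close> \<open>c < k\<close> Suc by (cases "a + 2 < K") (simp_all add: PP_def)
      qed
      thus "(jordan_block K 0 * jordan_block K 0 * PP x) $$ (a,c) = (PP x * jordan_block k 0) $$ (a,c)"
        unfolding jordan_square_mult[OF P \<open>a < K\<close> \<open>c < k\<close>] mult_jordan_zero[OF P \<open>a < K\<close> \<open>c < k\<close>] .
    qed (use P[of x] in auto)
    have "jordan_block K 0 * jordan_block K 0 * PT = hcat (PP 1 * jordan_block k 0) (PP (-1) * jordan_block k 0)"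
      unfolding a[symmetric] PT_def using P[of 1] P[of "-1"] by (intro mult_hcat) auto
    thus ?thesis unfolding zgroup_matrices PT_def using P[of 1] P[of "-1"] by (subst hcat_mult_dsum) auto
  qed
  \<comment> \<open>Adding the first columns of the two halves cancels the odd member and leaves
    \<open>2 * h\<close> times the eigenvector.\<close>
  moreover have "(\<Sum>i<K. PT $$ (a,i) * zkernel (ZEven k) i) = (if a = 0 then qR (2 * h) else 0)" if "a < K" for a
  proof -
    have "(\<Sum>i<K. PT $$ (a,i) * zkernel (ZEven k) i) = (\<Sum>i<K. (if i = 0 then 1 else if i = k then 1 else 0) * PT $$ (a,i))"
      by (rule sum.cong) auto
    also have "\<dots> = 1 * PT $$ (a,0) + 1 * PT $$ (a,k)" using k by (intro sum_two_points) (auto simp: K_def)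
    also have "PT $$ (a,0) = (if a = 0 then qR h else if a = 1 then qR (re * h) else 0)"
      using that k by (simp add: PT_def hcat_def PP_def K_def)
    also have "PT $$ (a,k) = (if a = 0 then qR h else if a = 1 then - qR (re * h) else 0)"
      using that k by (simp add: PT_def hcat_def PP_def K_def)
    also have "1 * (if a = 0 then qR h else if a = 1 then qR (re * h) else 0) +
      1 * (if a = 0 then qR h else if a = 1 then - qR (re * h) else 0) = (if a = 0 then qR (2 * h) else 0)"
      by (simp only: mult_2 quat_of_real_simps(3)) simp
    finally show ?thesis .
  qed
  moreover have "qR (2 * h) \<noteq> 0" using h0 by (simp del: quat_of_real_simps(6))
  ultimately show ?thesis using zroot_from_chain[of "ZEven k" K PT e "qR (2 * h)"] unfolding K_def by auto
qed

lemma zroot_exists: "zgroup_valid g \<Longrightarrow> \<exists>R. is_zroot g R"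
proof (cases g)
  case (ZOdd k e)
  assume "zgroup_valid g"
  thus ?thesis using zroot_odd[of e k] ZOdd by (metis zgroup_valid.simps(1))
next
  case (ZEven k)
  assume "zgroup_valid g"
  thus ?thesis using zroot_even[of 1 k] ZEven by (metis zgroup_valid.simps(2))
qed

text \<open>The parity of the chain length decides the group: an odd chain passes its sign on to
  \<open>ZOdd\<close>, an even chain becomes \<open>ZEven\<close> for both signs.\<close>

lemma zroot_of_nilpotent_block:
  assumes "cblock_valid (RB K 0 s)"
  shows "\<exists>g R. zgroup_valid g \<and> zgroup_size g = K \<and> is_zroot g R \<and>
    peq K (jordan_block K 0) (of_int s \<cdot>\<^sub>m antidiag K) R (zgroup_H g)"
proof (cases "even K")
  case True
  then obtain k where K: "K = 2 * k" by (elim evenE)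
  hence k: "k \<ge> 1" using assms by simp
  show ?thesis using zroot_even[of s k] k assms K by (intro exI[of _ "ZEven k"]) auto
next
  case False
  then obtain k where K: "K = 2 * k + 1" by (elim oddE)
  show ?thesis using zroot_odd[of s k] assms K by (intro exI[of _ "ZOdd k s"]) auto
qed

section \<open>Squares of selfadjoint matrices\<close>

lemma hcat_split:
  assumes "M \<in> carrier_mat n (p + q)"
  obtains A B where "M = hcat A B" "A \<in> carrier_mat n p" "B \<in> carrier_mat n q"
proof
  show "M = hcat (mat n p (\<lambda>(i,j). M $$ (i,j))) (mat n q (\<lambda>(i,j). M $$ (i,p + j)))"
    using assms by (intro eq_matI) (auto simp: hcat_def)
qed auto

lemma minj_mult_left:
  fixes A :: "'a::semiring_0 mat"
  assumes "minj (A * B)" "A \<in> carrier_mat m n" "B \<in> carrier_mat n k"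
  shows "minj B"
proof (rule minjI[OF assms(3)])
  fix v :: "'a vec" assume v: "v \<in> carrier_vec k" "B *\<^sub>v v = 0\<^sub>v n"
  have "(A * B) *\<^sub>v v = A *\<^sub>v (B *\<^sub>v v)" by (rule assoc_mult_mat_vec[OF assms(2,3) v(1)])
  also have "\<dots> = 0\<^sub>v m" unfolding v(2) by (rule mult_zero_vec[OF assms(2)])
  finally show "v = 0\<^sub>v k" using minjD[OF assms(1) mult_carrier_mat[OF assms(2,3)] v(1)] by simp
qed

lemma nonzero_blocks_minj:
  assumes "\<forall>b\<in>set bs. cblock_valid b \<and> \<not> zero_block b"
  shows "minj (blocks_B bs)"
  using assms
proof (induction bs)
  case Nil
  show ?case by (rule minjI[of _ 0 0]) auto
next
  case (Cons b bs)
  have "minj (cblock_B b)"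
  proof (cases b)
    case (RB k l e)
    thus ?thesis using Cons.prems minj_jordan[of "qR l" k] by simp
  next
    case (CB k z)
    hence "z \<noteq> 0" using Cons.prems by auto
    hence "qC z \<noteq> 0" "qC (cnj z) \<noteq> 0" by auto
    thus ?thesis using CB minj_dsum[OF minj_jordan _ minj_jordan, of "qC z" k k "qC (cnj z)" k k]
      by (simp add: diag_block_Cons)
  qed
  thus ?case using Cons minj_dsum[OF _ cblock_carrier(1) _ blocks_carrier(1), of b bs] by simp
qed

lemma not_minj_nilpotent:
  assumes "k \<ge> 1" shows "\<not> minj (jordan_block k (0::quat))"
proof
  assume m: "minj (jordan_block k (0::quat))"
  have "jordan_block k (0::quat) *\<^sub>v unit_vec k 0 = 0\<^sub>v k"
  proof (rule eq_vecI)
    fix i assume "i < dim_vec (0\<^sub>v k :: quat vec)"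
    thus "(jordan_block k (0::quat) *\<^sub>v unit_vec k 0) $ i = 0\<^sub>v k $ i"
      using jordan_mult_vec[of "unit_vec k 0 :: quat vec" k i 0] by (auto simp del: index_mult_mat_vec)
  qed simp
  hence "(unit_vec k 0 :: quat vec) = 0\<^sub>v k" using minjD[OF m jordan_block_carrier] by simp
  hence "(unit_vec k 0 :: quat vec) $ 0 = 0\<^sub>v k $ 0" by simp
  thus False using assms by simp
qed

lemma minj_blocks_nonzero:
  assumes "minj (blocks_B bs)" "\<forall>b\<in>set bs. cblock_valid b"
  shows "\<forall>b\<in>set bs. \<not> zero_block b"
  using assms
proof (induction bs)
  case (Cons b bs)
  have "invertible_mat (dsum (cblock_B b) (blocks_B bs))"
    using minj_square_invertible[OF Cons.prems(1) blocks_carrier(1)] by simp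
  hence i: "invertible_mat (cblock_B b)" "invertible_mat (blocks_B bs)"
    using invertible_dsumD cblock_carrier(1) blocks_carrier(1) by blast+
  have "\<not> zero_block b"
  proof
    assume "zero_block b"
    then obtain k e where b: "b = RB k 0 e" by (cases b) auto
    hence "k \<ge> 1" using Cons.prems by simp
    thus False using not_minj_nilpotent invertible_minj[OF i(1) cblock_carrier(1)] b by simp
  qed
  thus ?case using Cons invertible_minj[OF i(2) blocks_carrier(1)] by auto
qed simp

section \<open>Sequences of zero groups and their roots\<close>

abbreviation "zgroups_blocks gs \<equiv> concat (map zgroup_blocks gs)"
abbreviation "zgroups_size gs \<equiv> sum_list (map zgroup_size gs)"

lemma zgroups_blocks_size: "blocks_size (zgroups_blocks gs) = zgroups_size gs"
  by (induction gs) auto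

lemma zroots_carrier:
  "list_all2 is_zroot gs Rs \<Longrightarrow> diag_block_mat Rs \<in> carrier_mat (zgroups_size gs) (zgroups_size gs)"
  by (induction rule: list_all2_induct) (auto simp: diag_block_Cons is_zroot_def)

lemma zroots_square:
  "list_all2 is_zroot gs Rs \<Longrightarrow> diag_block_mat Rs * diag_block_mat Rs = blocks_B (zgroups_blocks gs)"
proof (induction rule: list_all2_induct)
  case (Cons g gs R Rs)
  have "R \<in> carrier_mat (zgroup_size g) (zgroup_size g)" "R * R = zgroup_B g"
    using Cons(1) by (auto simp: is_zroot_def)
  thus ?case using Cons zroots_carrier[OF Cons(2)] by (simp add: diag_block_Cons dsum_mult)
qed simp

lemma zroots_selfadjoint:
  "list_all2 is_zroot gs Rs \<Longrightarrow>
   qadj (diag_block_mat Rs) * blocks_H (zgroups_blocks gs) = blocks_H (zgroups_blocks gs) * diag_block_mat Rs"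
proof (induction rule: list_all2_induct)
  case (Cons g gs R Rs)
  have "R \<in> carrier_mat (zgroup_size g) (zgroup_size g)" "qadj R * zgroup_H g = zgroup_H g * R"
    using Cons(1) by (auto simp: is_zroot_def)
  thus ?case using Cons zroots_carrier[OF Cons(2)]
    by (simp add: diag_block_Cons dsum_mult qadj_dsum zgroups_blocks_size)
qed simp

lemma conjugate_root:
  assumes A: "A \<in> carrier_mat n n" and P: "P \<in> carrier_mat n n" "invertible_mat P"
  obtains R where "R \<in> carrier_mat n n" "A * P = P * R"
proof -
  obtain Q where Q: "Q \<in> carrier_mat n n" "P * Q = 1\<^sub>m n" using invertible_matE[OF P(2,1)] by metis
  have "P * (Q * (A * P)) = (P * Q) * (A * P)" using A P(1) Q(1) by (intro mult_assoc_dim[symmetric]) auto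
  also have "\<dots> = A * P" unfolding Q(2) by (rule left_mult_one_mat[OF mult_carrier_mat[OF A P(1)]])
  finally show ?thesis using that[of "Q * (A * P)"] A P Q by auto
qed

lemma square_intertwine:
  fixes A :: "quat mat"
  assumes "A \<in> carrier_mat n n" "P \<in> carrier_mat n m" "R \<in> carrier_mat m m" "A * P = P * R"
  shows "A * A * P = P * (R * R)"
proof -
  have "A * A * P = A * (A * P)" by (rule assoc_mult_mat[OF assms(1,1,2)])
  also have "\<dots> = A * (P * R)" by (simp only: assms(4))
  also have "\<dots> = A * P * R" by (rule assoc_mult_mat[OF assms(1-3), symmetric])
  also have "\<dots> = P * R * R" by (simp only: assms(4))
  also have "\<dots> = P * (R * R)" by (rule assoc_mult_mat[OF assms(2,3,3)])
  finally show ?thesis .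
qed

text \<open>As long as \<open>A\<close> is singular, one of its nilpotent Jordan blocks is split off
  and rewritten as the root of a zero group. Once \<open>A\<close> is injective so is its square,
  and any canonical form of the square has nonzero eigenvalues only. The roots \<open>R\<close> and
  \<open>Rs\<close> are kept in the statement, since the kernel of \<open>A\<close> is read off from
  them.\<close>

theorem selfadjoint_square_canonical:
  assumes "H \<in> carrier_mat n n" "invertible_mat H" "qadj H = H"
    "A \<in> carrier_mat n n" "qadj A * H = H * A"
  shows "\<exists>bs gs Rs R S. (\<forall>b\<in>set bs. cblock_valid b \<and> \<not> zero_block b) \<and> (\<forall>g\<in>set gs. zgroup_valid g) \<and>
    list_all2 is_zroot gs Rs \<and> blocks_size bs + zgroups_size gs = n \<and>
    R \<in> carrier_mat (blocks_size bs) (blocks_size bs) \<and> minj R \<and> R * R = blocks_B bs \<and>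
    S \<in> carrier_mat n n \<and> invertible_mat S \<and> A * S = S * dsum R (diag_block_mat Rs) \<and>
    qadj S * H * S = blocks_H (bs @ zgroups_blocks gs)"
  using assms
proof (induction n arbitrary: A H rule: less_induct)
  case (less n)
  note H = less.prems(1-3) and A = less.prems(4,5)
  show ?case
  proof (cases "minj A")
    case True
    have AA: "A * A \<in> carrier_mat n n" "qadj (A * A) * H = H * (A * A)"
    proof -
      show "A * A \<in> carrier_mat n n" using A by auto
      have "qadj (A * A) * H = qadj A * (qadj A * H)" using A H by (simp add: qadj_mult mult_assoc_dim)
      also have "\<dots> = (qadj A * H) * A" unfolding A(2) using A(1) H(1) by (simp add: mult_assoc_dim A(2)[symmetric])
      also have "\<dots> = H * (A * A)" unfolding A(2) using A(1) H(1) by (simp add: mult_assoc_dim)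
      finally show "qadj (A * A) * H = H * (A * A)" .
    qed
    from canonical_form_exists[OF H AA] obtain bs where
      bs: "\<forall>b\<in>set bs. cblock_valid b" "blocks_size bs = n" "peq n (A * A) H (blocks_B bs) (blocks_H bs)" by auto
    obtain P where P: "P \<in> carrier_mat n n" "invertible_mat P" "A * A * P = P * blocks_B bs" "qadj P * H * P = blocks_H bs"
      using bs(3) unfolding peq_def by auto
    obtain R where R: "R \<in> carrier_mat n n" "A * P = P * R" using conjugate_root[OF A(1) P(1,2)] .
    have Pm: "minj P" by (rule invertible_minj[OF P(2,1)])
    have BB: "blocks_B bs \<in> carrier_mat n n" using blocks_carrier(1)[of bs] bs(2) by simp
    have RR: "R * R = blocks_B bs"
      by (rule minj_mult_cancel[OF Pm P(1) mult_carrier_mat[OF R(1,1)] BB])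
         (simp only: square_intertwine[OF A(1) P(1) R, symmetric] P(3))
    have "invertible_mat (A * P)"
      by (rule invertible_mult[OF minj_square_invertible[OF True A(1)] A(1) P(2,1)])
    hence "minj (P * R)" unfolding R(2)[symmetric] by (rule invertible_minj) (use A P in auto)
    hence Rm: "minj R" using minj_mult_left[OF _ P(1) R(1)] by simp
    have "invertible_mat (R * R)"
      by (rule invertible_mult) (use minj_square_invertible[OF Rm R(1)] R(1) in auto)
    hence "minj (blocks_B bs)" unfolding RR using invertible_minj BB by blast
    hence "\<forall>b\<in>set bs. \<not> zero_block b" using minj_blocks_nonzero bs(1) by blast
    thus ?thesis
      using bs P R RR Rm
      by (intro exI[of _ bs] exI[of _ "[]"] exI[of _ "[]"] exI[of _ R] exI[of _ P]) auto
  next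
    case False
    obtain k s V where V: "cblock_valid (RB k 0 s)" "V \<in> carrier_mat n k" "A * V = V * cblock_B (RB k 0 s)"
      "qadj V * H * V = cblock_H (RB k 0 s)"
      using matrix_zero_block_exists[OF H A False] .
    obtain g Q where g: "zgroup_valid g" "zgroup_size g = k" "is_zroot g Q"
      "peq k (jordan_block k 0) (of_int s \<cdot>\<^sub>m antidiag k) Q (zgroup_H g)"
      using zroot_of_nilpotent_block[OF V(1)] by auto
    obtain P where P: "P \<in> carrier_mat k k" "jordan_block k 0 * P = P * Q" "qadj P * (of_int s \<cdot>\<^sub>m antidiag k) * P = zgroup_H g"
      using g(4) unfolding peq_def by auto
    have Q: "Q \<in> carrier_mat k k" using g(2,3) by (auto simp: is_zroot_def)
    \<comment> \<open>The chain in the order adapted to the group: \<open>A\<close> acts as the root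
      \<open>Q\<close>, and the square of \<open>A\<close> is already in canonical form on these
      columns.\<close>
    define Y where "Y = V * P"
    have Y: "Y \<in> carrier_mat n k" using V P by (auto simp: Y_def)
    have AY: "A * Y = Y * Q"
    proof -
      have "A * Y = A * V * P" unfolding Y_def by (rule assoc_mult_mat[OF A(1) V(2) P(1), symmetric])
      also have "\<dots> = V * jordan_block k 0 * P" unfolding V(3) by simp
      also have "\<dots> = V * (P * Q)" unfolding P(2)[symmetric] by (rule assoc_mult_mat[OF V(2) jordan_block_carrier P(1)])
      also have "\<dots> = Y * Q" unfolding Y_def by (rule assoc_mult_mat[OF V(2) P(1) Q, symmetric])
      finally show ?thesis .
    qed
    have gram: "qadj Y * H * Y = zgroup_H g"
    proof -
      have "qadj Y * H * Y = qadj P * (qadj V * H * V) * P"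
        unfolding Y_def using V(2) P(1) H(1) by (simp add: qadj_mult mult_assoc_dim)
      thus ?thesis unfolding V(4) using P(3) by simp
    qed
    have Hi: "invertible_mat (zgroup_H g)" using blocks_H_invertible zgroup_blocks_valid[OF g(1)] by blast
    obtain W A' H' where W: "k \<le> n" "W \<in> carrier_mat n (n - k)" "A' \<in> carrier_mat (n - k) (n - k)"
      "H' \<in> carrier_mat (n - k) (n - k)" "invertible_mat (hcat W Y)" "qadj H' = H'" "qadj A' * H' = H' * A'"
      "A * hcat W Y = hcat W Y * dsum A' Q" "qadj (hcat W Y) * H * hcat W Y = dsum H' (zgroup_H g)"
      using split_off[OF H(1,3) A Y Q AY gram Hi] .
    have nk: "n - k + k = n" using W(1) by simp
    have S0: "hcat W Y \<in> carrier_mat n n" using W(2) Y nk by auto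
    have zH: "zgroup_H g \<in> carrier_mat k k" using blocks_carrier(2)[of "zgroup_blocks g"] g(2) by simp
    have "invertible_mat (dsum H' (zgroup_H g))"
      unfolding W(9)[symmetric] by (rule hermitian_form_invertible[OF H(1,2) S0 W(5)])
    hence H'i: "invertible_mat H'" using invertible_dsumD W(4) zH by blast
    have k0: "k > 0" using V(1) by simp
    from less.IH[OF _ W(4) H'i W(6,3,7)] k0 W(1) obtain bs gs Rs R S where
      IH: "\<forall>b\<in>set bs. cblock_valid b \<and> \<not> zero_block b" "\<forall>g\<in>set gs. zgroup_valid g"
      "list_all2 is_zroot gs Rs" "blocks_size bs + zgroups_size gs = n - k"
      "R \<in> carrier_mat (blocks_size bs) (blocks_size bs)" "minj R" "R * R = blocks_B bs"
      "S \<in> carrier_mat (n - k) (n - k)" "invertible_mat S" "A' * S = S * dsum R (diag_block_mat Rs)"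
      "qadj S * H' * S = blocks_H (bs @ zgroups_blocks gs)" by auto
    let ?S = "hcat W Y * dsum S (1\<^sub>m k)"
    define D where "D = dsum R (diag_block_mat Rs)"
    have Dc: "D \<in> carrier_mat (n - k) (n - k)" using dsum_carrier[OF IH(5) zroots_carrier[OF IH(3)]] IH(4) by (simp add: D_def)
    have DQ: "dsum D Q \<in> carrier_mat n n" using dsum_carrier[OF Dc Q] nk by simp
    have S1: "dsum S (1\<^sub>m k) \<in> carrier_mat n n" using IH(8) nk by (metis dsum_carrier one_carrier_mat)
    have S1i: "invertible_mat (dsum S (1\<^sub>m k))" by (rule invertible_dsum[OF IH(9,8)]) auto
    have AQ: "dsum A' Q \<in> carrier_mat n n" using W(3) Q nk by (metis dsum_carrier)
    have "A * ?S = A * hcat W Y * dsum S (1\<^sub>m k)" by (rule assoc_mult_mat[OF A(1) S0 S1, symmetric])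
    also have "\<dots> = hcat W Y * (dsum A' Q * dsum S (1\<^sub>m k))"
      unfolding W(8) by (rule assoc_mult_mat[OF S0 AQ S1])
    also have "dsum A' Q * dsum S (1\<^sub>m k) = dsum S (1\<^sub>m k) * dsum D Q"
      using W(3) Q IH(8) Dc by (simp add: dsum_mult IH(10)[folded D_def])
    also have "hcat W Y * (dsum S (1\<^sub>m k) * dsum D Q) = ?S * dsum D Q"
      by (rule assoc_mult_mat[OF S0 S1 DQ, symmetric])
    also have "dsum D Q = dsum R (diag_block_mat (Rs @ [Q]))"
      by (simp add: D_def diag_block_append dsum_assoc)
    finally have 1: "A * ?S = ?S * dsum R (diag_block_mat (Rs @ [Q]))" .
    have "qadj ?S * H * ?S = qadj (dsum S (1\<^sub>m k)) * (qadj (hcat W Y) * H * hcat W Y) * dsum S (1\<^sub>m k)"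
      using S0 S1 H(1) by (simp only: qadj_mult mult_assoc_dim carrier_matD index_mult_mat qadj_dim)
    also have "\<dots> = dsum (qadj S * H' * S) (zgroup_H g)"
      unfolding W(9) qadj_dsum using IH(8) W(4) zH g(2) by (simp add: dsum_mult)
    also have "\<dots> = blocks_H (bs @ zgroups_blocks (gs @ [g]))"
      unfolding IH(11) by (simp add: dsum_assoc)
    finally have 2: "qadj ?S * H * ?S = blocks_H (bs @ zgroups_blocks (gs @ [g]))" .
    have 3: "?S \<in> carrier_mat n n" "invertible_mat ?S"
      using invertible_mult[OF W(5) S0 S1i S1] S0 S1 by auto
    have 4: "list_all2 is_zroot (gs @ [g]) (Rs @ [Q])" using IH(3) g(3) by (simp add: list_all2_appendI)
    show ?thesis
      by (rule exI[of _ bs], rule exI[of _ "gs @ [g]"], rule exI[of _ "Rs @ [Q]"], rule exI[of _ R], rule exI[of _ ?S])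
         (use 1 2 3 4 IH(1,2,4,5,6,7) g(1,2) nk in auto)
  qed
qed

section \<open>Right spans and kernels in canonical coordinates\<close>

lemma rspan_Nil: "rspan n [] = {0\<^sub>v n}"
  by (auto simp: rspan_def intro!: eq_vecI)

lemma rspan_Cons:
  assumes "v \<in> carrier_vec n"
  shows "rspan n (v # vs) = {rscale v c + w | c w. w \<in> rspan n vs}"
proof safe
  fix x assume "x \<in> rspan n (v # vs)"
  then obtain c where x: "x = vec n (\<lambda>i. \<Sum>j<length (v # vs). ((v # vs) ! j) $ i * c j)"
    unfolding rspan_def by auto
  have "x = rscale v (c 0) + vec n (\<lambda>i. \<Sum>j<length vs. (vs ! j) $ i * c (Suc j))"
    unfolding x using assms by (intro eq_vecI) (auto simp: sum.lessThan_Suc_shift simp del: sum.lessThan_Suc)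
  thus "\<exists>c w. x = rscale v c + w \<and> w \<in> rspan n vs"
    by (intro exI[of _ "c 0"] exI[of _ "vec n (\<lambda>i. \<Sum>j<length vs. (vs ! j) $ i * c (Suc j))"])
       (auto simp: rspan_def intro!: exI[of _ "\<lambda>j. c (Suc j)"])
next
  fix c w assume "w \<in> rspan n vs"
  then obtain d where w: "w = vec n (\<lambda>i. \<Sum>j<length vs. (vs ! j) $ i * d j)" unfolding rspan_def by auto
  have "rscale v c + w = vec n (\<lambda>i. \<Sum>j<length (v # vs). ((v # vs) ! j) $ i * (case j of 0 \<Rightarrow> c | Suc j \<Rightarrow> d j))"
    unfolding w using assms by (intro eq_vecI) (auto simp: sum.lessThan_Suc_shift simp del: sum.lessThan_Suc)
  thus "rscale v c + w \<in> rspan n (v # vs)" unfolding rspan_def by blast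
qed

lemma rspan_carrier: "w \<in> rspan n vs \<Longrightarrow> w \<in> carrier_vec n"
  by (auto simp: rspan_def)

lemma rspan_map:
  assumes "S \<in> carrier_mat n n" "\<forall>u\<in>set us. u \<in> carrier_vec n"
  shows "rspan n (map (\<lambda>u. S *\<^sub>v u) us) = (\<lambda>u. S *\<^sub>v u) ` rspan n us"
  using assms(2)
proof (induction us)
  case Nil
  thus ?case using assms(1) by (simp add: rspan_Nil)
next
  case (Cons u us)
  have Su: "S *\<^sub>v u \<in> carrier_vec n" using Cons.prems by (intro mult_mat_vec_carrier[OF assms(1)]) auto
  have e: "S *\<^sub>v (rscale u c + w) = rscale (S *\<^sub>v u) c + S *\<^sub>v w" if "w \<in> rspan n us" for c w
  proof -
    have "S *\<^sub>v (rscale u c + w) = S *\<^sub>v rscale u c + S *\<^sub>v w"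
      using rspan_carrier[OF that] Cons.prems by (intro mult_add_distrib_mat_vec[OF assms(1)]) auto
    moreover have "dim_col S = dim_vec u" using assms(1) Cons.prems by auto
    ultimately show ?thesis by (simp add: mult_rscale)
  qed
  have IH: "rspan n (map ((*\<^sub>v) S) us) = (*\<^sub>v) S ` rspan n us" using Cons by simp
  have "u \<in> carrier_vec n" using Cons.prems by simp
  show ?case
    unfolding list.map rspan_Cons[OF Su] rspan_Cons[OF \<open>u \<in> carrier_vec n\<close>] IH
  proof safe
    fix c w assume "w \<in> rspan n us"
    thus "rscale (S *\<^sub>v u) c + S *\<^sub>v w \<in> (*\<^sub>v) S ` {rscale u c + w |c w. w \<in> rspan n us}"
      unfolding e[symmetric, OF \<open>w \<in> rspan n us\<close>] by blast
  next
    fix c w assume w: "w \<in> rspan n us"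
    show "\<exists>c' w'. S *\<^sub>v (rscale u c + w) = rscale (S *\<^sub>v u) c' + w' \<and> w' \<in> (*\<^sub>v) S ` rspan n us"
      unfolding e[OF w] using w by blast
  qed
qed

text \<open>Coordinates with respect to the columns of \<open>S\<close> of the kernel generator
  belonging to a group that starts at \<open>off\<close>; the kernel vectors of the statement are
  the images of these under \<open>S\<close>.\<close>

definition zvec :: "nat \<Rightarrow> nat \<Rightarrow> zgroup \<Rightarrow> quat vec" where
  "zvec n off g = vec n (\<lambda>i. if off \<le> i \<and> i < off + zgroup_size g then zkernel g (i - off) else 0)"

fun zvecs :: "nat \<Rightarrow> nat \<Rightarrow> zgroup list \<Rightarrow> quat vec list" where
  "zvecs n off [] = []"
| "zvecs n off (g # gs) = zvec n off g # zvecs n (off + zgroup_size g) gs"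

lemma zvec_carrier [simp]: "zvec n off g \<in> carrier_vec n"
  by (simp add: zvec_def)

lemma zvec_dim [simp]: "dim_vec (zvec n off g) = n"
  by (simp add: zvec_def)

lemma zvecs_carrier: "u \<in> set (zvecs n off gs) \<Longrightarrow> u \<in> carrier_vec n"
  by (induction gs arbitrary: off) auto

lemma mult_zvec:
  assumes "S \<in> carrier_mat n n" "off + zgroup_size g \<le> n" "zgroup_valid g"
  shows "S *\<^sub>v zvec n off g = (case g of ZOdd k e \<Rightarrow> col S off | ZEven k \<Rightarrow> col S off + col S (off + k))"
proof (cases g)
  case (ZOdd k e)
  have "zvec n off g = unit_vec n off"
    using assms(2) ZOdd by (intro eq_vecI) (auto simp: zvec_def)
  moreover have "S *\<^sub>v unit_vec n off = col S off"
  proof (rule eq_vecI)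
    fix i assume "i < dim_vec (col S off)"
    hence i: "i < n" using assms(1) by simp
    have "(S *\<^sub>v unit_vec n off) $ i = (\<Sum>j<n. S $$ (i,j) * (if j = off then 1 else 0))"
      using i assms ZOdd by (auto simp: scalar_prod_def atLeast0LessThan intro!: sum.cong)
    also have "\<dots> = (\<Sum>j<n. if j = off then S $$ (i,j) else 0)" by (rule sum.cong) auto
    finally show "(S *\<^sub>v unit_vec n off) $ i = col S off $ i" using i assms ZOdd by simp
  qed (use assms in auto)
  ultimately show ?thesis using ZOdd by simp
next
  case (ZEven k)
  have k: "k \<ge> 1" using assms(3) ZEven by simp
  have "S *\<^sub>v zvec n off g = col S off + col S (off + k)"
  proof (rule eq_vecI)
    fix i assume "i < dim_vec (col S off + col S (off + k))"
    hence i: "i < n" using assms(1) by simp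
    have "(S *\<^sub>v zvec n off g) $ i = (\<Sum>j<n. S $$ (i,j) * zvec n off g $ j)"
      using i assms(1) by (simp add: scalar_prod_def atLeast0LessThan zvec_def)
    also have "\<dots> = (\<Sum>j<n. (if j = off then S $$ (i,j) else 0) + (if j = off + k then S $$ (i,j) else 0))"
      by (rule sum.cong) (use k assms(2) ZEven in \<open>auto simp: zvec_def\<close>)
    also have "\<dots> = S $$ (i,off) + S $$ (i, off + k)"
      using assms(2) ZEven k by (simp add: sum.distrib)
    finally show "(S *\<^sub>v zvec n off g) $ i = (col S off + col S (off + k)) $ i"
      using i assms ZEven k by simp
  qed (use assms in auto)
  thus ?thesis using ZEven by simp
qed

lemma zgroup_kernel_vecs_eq:
  assumes "S \<in> carrier_mat n n" "off + zgroups_size gs \<le> n" "\<forall>g\<in>set gs. zgroup_valid g"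
  shows "zgroup_kernel_vecs S off gs = map (\<lambda>u. S *\<^sub>v u) (zvecs n off gs)"
  using assms(2,3)
proof (induction gs arbitrary: off)
  case (Cons g gs)
  have "S *\<^sub>v zvec n off g = (case g of ZOdd k e \<Rightarrow> col S off | ZEven k \<Rightarrow> col S off + col S (off + k))"
    by (rule mult_zvec[OF assms(1)]) (use Cons.prems in auto)
  moreover have "zgroup_kernel_vecs S (off + zgroup_size g) gs = map (\<lambda>u. S *\<^sub>v u) (zvecs n (off + zgroup_size g) gs)"
    by (rule Cons.IH) (use Cons.prems in auto)
  ultimately show ?case by (cases g) auto
qed simp

text \<open>Ambient dimension and offset are kept explicit so that removing the first group merely
  moves the offset; the vanishing of the coordinates before it replaces a restriction to a smaller
  space.\<close>

lemma zroots_kernel: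
  assumes "list_all2 is_zroot gs Rs" "off + zgroups_size gs = n" "w \<in> carrier_vec n"
  shows "w \<in> rspan n (zvecs n off gs) \<longleftrightarrow> (\<forall>i<off. w $ i = 0) \<and>
    diag_block_mat Rs *\<^sub>v vec (zgroups_size gs) (\<lambda>i. w $ (off + i)) = 0\<^sub>v (zgroups_size gs)"
  using assms
proof (induction arbitrary: off w rule: list_all2_induct)
  case Nil
  have "w = 0\<^sub>v n \<longleftrightarrow> (\<forall>i<n. w $ i = 0)" using Nil by (auto intro: eq_vecI)
  moreover have "0\<^sub>m 0 0 *\<^sub>v vec 0 (\<lambda>i. w $ (off + i)) = 0\<^sub>v 0" by (rule eq_vecI) auto
  ultimately show ?case using Nil by (simp add: rspan_Nil)
next
  case (Cons g gs R Rs)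
  let ?k = "zgroup_size g" and ?m = "zgroups_size gs"
  let ?D = "diag_block_mat Rs"
  have R: "R \<in> carrier_mat ?k ?k" and Rk: "\<And>t. t\<in>carrier_vec ?k \<Longrightarrow> R *\<^sub>v t = 0\<^sub>v ?k \<longleftrightarrow> (\<forall>i<?k. t $ i = zkernel g i * t $ 0)"
    using Cons(1) by (auto simp: is_zroot_def)
  have D: "?D \<in> carrier_mat ?m ?m" by (rule zroots_carrier[OF Cons(2)])
  have n: "off + ?k + ?m = n" using Cons.prems by simp
  have IH: "w \<in> rspan n (zvecs n (off + ?k) gs) \<longleftrightarrow> (\<forall>i<off + ?k. w $ i = 0) \<and>
    ?D *\<^sub>v vec ?m (\<lambda>i. w $ (off + ?k + i)) = 0\<^sub>v ?m" if "w \<in> carrier_vec n" for w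
    using Cons.IH[OF n that] .
  define a b where "a = vec ?k (\<lambda>i. w $ (off + i))" and "b = vec ?m (\<lambda>i. w $ (off + ?k + i))"
  have ab: "a \<in> carrier_vec ?k" "b \<in> carrier_vec ?m" by (auto simp: a_def b_def)
  have "vec (?k + ?m) (\<lambda>i. w $ (off + i)) = a @\<^sub>v b"
    by (rule eq_vecI) (auto simp: a_def b_def add.assoc)
  hence "diag_block_mat (R # Rs) *\<^sub>v vec (?k + ?m) (\<lambda>i. w $ (off + i)) = (R *\<^sub>v a) @\<^sub>v (?D *\<^sub>v b)"
    using R D ab by (simp add: diag_block_Cons dsum_mult_append)
  moreover have "(R *\<^sub>v a) @\<^sub>v (?D *\<^sub>v b) = 0\<^sub>v (?k + ?m) \<longleftrightarrow> R *\<^sub>v a = 0\<^sub>v ?k \<and> ?D *\<^sub>v b = 0\<^sub>v ?m"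
    by (rule append_vec_eq_0[OF mult_mat_vec_carrier[OF R ab(1)] mult_mat_vec_carrier[OF D ab(2)]])
  moreover have "R *\<^sub>v a = 0\<^sub>v ?k \<longleftrightarrow> (\<forall>i<?k. w $ (off + i) = zkernel g i * a $ 0)"
    using Rk[OF ab(1)] by (simp add: a_def)
  ultimately have rhs: "diag_block_mat (R # Rs) *\<^sub>v vec (?k + ?m) (\<lambda>i. w $ (off + i)) = 0\<^sub>v (?k + ?m) \<longleftrightarrow>
    (\<forall>i<?k. w $ (off + i) = zkernel g i * a $ 0) \<and> ?D *\<^sub>v b = 0\<^sub>v ?m" by simp
  let ?z = "zvec n off g"
  show ?case
  proof
    assume "w \<in> rspan n (zvecs n off (g # gs))"
    then obtain c w' where w: "w = rscale ?z c + w'" "w' \<in> rspan n (zvecs n (off + ?k) gs)"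
      using rspan_Cons[OF zvec_carrier, of n off g] by auto
    have w'c: "w' \<in> carrier_vec n" by (rule rspan_carrier[OF w(2)])
    have w': "\<And>i. i < off + ?k \<Longrightarrow> w' $ i = 0" "?D *\<^sub>v vec ?m (\<lambda>i. w' $ (off + ?k + i)) = 0\<^sub>v ?m"
      using IH[OF w'c] w(2) by auto
    have wi: "w $ i = (if off \<le> i \<and> i < off + ?k then zkernel g (i - off) * c else 0) + w' $ i" if "i < n" for i
      unfolding w(1) using that w'c by (simp add: zvec_def)
    have 1: "\<forall>i<off. w $ i = 0" using wi w' n by auto
    have 2: "w $ (off + i) = zkernel g i * c" if "i < ?k" for i using wi[of "off + i"] w'(1)[of "off + i"] that n by simp
    have z0: "zkernel g 0 = 1" by (cases g) auto
    have 3: "w $ (off + i) = zkernel g i * a $ 0" if "i < ?k" for i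
      using 2[of 0] 2[OF that] that z0 by (simp add: a_def)
    have "b = vec ?m (\<lambda>i. w' $ (off + ?k + i))" unfolding b_def
      by (rule eq_vecI) (use wi n in auto)
    hence 4: "?D *\<^sub>v b = 0\<^sub>v ?m" using w'(2) by simp
    show "(\<forall>i<off. w $ i = 0) \<and> diag_block_mat (R # Rs) *\<^sub>v vec (zgroups_size (g # gs)) (\<lambda>i. w $ (off + i)) = 0\<^sub>v (zgroups_size (g # gs))"
      using 1 3 4 rhs by simp
  next
    assume "(\<forall>i<off. w $ i = 0) \<and> diag_block_mat (R # Rs) *\<^sub>v vec (zgroups_size (g # gs)) (\<lambda>i. w $ (off + i)) = 0\<^sub>v (zgroups_size (g # gs))"
    hence h: "\<forall>i<off. w $ i = 0" "\<And>i. i < ?k \<Longrightarrow> w $ (off + i) = zkernel g i * a $ 0" "?D *\<^sub>v b = 0\<^sub>v ?m"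
      using rhs by auto
    \<comment> \<open>Removes the multiple of the first generator contained in \<open>w\<close>;
      what remains vanishes on the whole first group.\<close>
    define w' where "w' = w - rscale ?z (a $ 0)"
    have w'c: "w' \<in> carrier_vec n" using Cons.prems(2) by (simp add: w'_def)
    have w'i: "w' $ i = w $ i - (if off \<le> i \<and> i < off + ?k then zkernel g (i - off) * a $ 0 else 0)" if "i < n" for i
      unfolding w'_def using that Cons.prems(2) by (simp add: zvec_def)
    have "w' $ i = 0" if "i < off + ?k" for i
    proof (cases "i < off")
      case True
      thus ?thesis using h(1) w'i[of i] n by simp
    next
      case False
      thus ?thesis using h(2)[of "i - off"] w'i[of i] that n by simp
    qed
    moreover have "vec ?m (\<lambda>i. w' $ (off + ?k + i)) = b"
      unfolding b_def by (rule eq_vecI) (use w'i n in auto)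
    ultimately have "w' \<in> rspan n (zvecs n (off + ?k) gs)" using IH[OF w'c] h(3) by simp
    moreover have "w = rscale ?z (a $ 0) + w'"
      unfolding w'_def using Cons.prems(2) by (intro eq_vecI) auto
    ultimately show "w \<in> rspan n (zvecs n off (g # gs))"
      using rspan_Cons[OF zvec_carrier, of n off g] by auto
  qed
qed

text \<open>As \<open>R\<close> is injective, the kernel of \<open>A\<close> lies entirely in the
  zero groups, where each root contributes its own line. This serves both directions of the
  equivalence.\<close>

lemma zgroup_kernel:
  assumes S: "S \<in> carrier_mat n n" "invertible_mat S" and A: "A \<in> carrier_mat n n" "A * S = S * dsum R (diag_block_mat Rs)"
    and R: "R \<in> carrier_mat m m" "minj R" and gs: "list_all2 is_zroot gs Rs" "m + zgroups_size gs = n"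
    and val: "\<forall>g\<in>set gs. zgroup_valid g"
  shows "qker n A = rspan n (zgroup_kernel_vecs S m gs)"
proof -
  let ?k = "zgroups_size gs" and ?D = "diag_block_mat Rs"
  have D: "?D \<in> carrier_mat ?k ?k" by (rule zroots_carrier[OF gs(1)])
  have RD: "dsum R ?D \<in> carrier_mat n n" using dsum_carrier[OF R(1) D] gs(2) by simp
  note Sm = invertible_minj[OF S(2,1)]
  have key: "A *\<^sub>v (S *\<^sub>v w) = 0\<^sub>v n \<longleftrightarrow> w \<in> rspan n (zvecs n m gs)" if w: "w \<in> carrier_vec n" for w
  proof -
    have "A *\<^sub>v (S *\<^sub>v w) = S *\<^sub>v (dsum R ?D *\<^sub>v w)"
      using assoc_mult_mat_vec[OF A(1) S(1) w] assoc_mult_mat_vec[OF S(1) RD w] A(2) by simp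
    moreover have "dsum R ?D *\<^sub>v w \<in> carrier_vec n" using RD w by auto
    ultimately have "A *\<^sub>v (S *\<^sub>v w) = 0\<^sub>v n \<longleftrightarrow> dsum R ?D *\<^sub>v w = 0\<^sub>v n"
      using minjD[OF Sm S(1)] mult_zero_vec[OF S(1)] by metis
    also have "\<dots> \<longleftrightarrow> (\<forall>i<m. w $ i = 0) \<and> ?D *\<^sub>v vec ?k (\<lambda>i. w $ (m + i)) = 0\<^sub>v ?k"
    proof -
      define a b where "a = vec m (\<lambda>i. w $ i)" and "b = vec ?k (\<lambda>i. w $ (m + i))"
      have ab: "a \<in> carrier_vec m" "b \<in> carrier_vec ?k" by (auto simp: a_def b_def)
      have "w = a @\<^sub>v b" using w gs(2) by (intro eq_vecI) (auto simp: a_def b_def)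
      hence "dsum R ?D *\<^sub>v w = (R *\<^sub>v a) @\<^sub>v (?D *\<^sub>v b)" using R(1) D ab by (simp add: dsum_mult_append)
      moreover have "(R *\<^sub>v a) @\<^sub>v (?D *\<^sub>v b) = 0\<^sub>v (m + ?k) \<longleftrightarrow> R *\<^sub>v a = 0\<^sub>v m \<and> ?D *\<^sub>v b = 0\<^sub>v ?k"
        by (rule append_vec_eq_0[OF mult_mat_vec_carrier[OF R(1) ab(1)] mult_mat_vec_carrier[OF D ab(2)]])
      moreover have "R *\<^sub>v a = 0\<^sub>v m \<longleftrightarrow> a = 0\<^sub>v m"
        using minjD[OF R(2,1) ab(1)] mult_zero_vec[OF R(1)] by auto
      moreover have "a = 0\<^sub>v m \<longleftrightarrow> (\<forall>i<m. w $ i = 0)"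
        by (auto simp: a_def vec_eq_iff)
      ultimately show ?thesis using gs(2) by (simp add: b_def)
    qed
    also have "\<dots> \<longleftrightarrow> w \<in> rspan n (zvecs n m gs)"
      using zroots_kernel[OF gs w] by simp
    finally show ?thesis .
  qed
  obtain Q where Q: "Q \<in> carrier_mat n n" "S * Q = 1\<^sub>m n" using invertible_matE[OF S(2,1)] by metis
  have surj: "\<exists>w\<in>carrier_vec n. v = S *\<^sub>v w" if "v \<in> carrier_vec n" for v
  proof -
    have "S *\<^sub>v (Q *\<^sub>v v) = (S * Q) *\<^sub>v v" by (rule assoc_mult_mat_vec[OF S(1) Q(1) that, symmetric])
    thus ?thesis unfolding Q(2) using that Q(1) by (intro bexI[of _ "Q *\<^sub>v v"]) auto
  qed
  have "qker n A = (\<lambda>w. S *\<^sub>v w) ` rspan n (zvecs n m gs)"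
  proof safe
    fix v assume "v \<in> qker n A"
    hence v: "v \<in> carrier_vec n" "A *\<^sub>v v = 0\<^sub>v n" by (auto simp: qker_def)
    from surj[OF v(1)] obtain w where w: "w \<in> carrier_vec n" "v = S *\<^sub>v w" by auto
    thus "v \<in> (\<lambda>w. S *\<^sub>v w) ` rspan n (zvecs n m gs)" using key[OF w(1)] v(2) by auto
  next
    fix w assume "w \<in> rspan n (zvecs n m gs)"
    thus "S *\<^sub>v w \<in> qker n A" using key[OF rspan_carrier] rspan_carrier[of w] S(1) by (auto simp: qker_def)
  qed
  also have "\<dots> = rspan n (map (\<lambda>u. S *\<^sub>v u) (zvecs n m gs))"
    by (rule rspan_map[OF S(1), symmetric]) (auto intro: zvecs_carrier)
  also have "\<dots> = rspan n (zgroup_kernel_vecs S m gs)"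
    using zgroup_kernel_vecs_eq[OF S(1) _ val, of m] gs(2) by simp
  finally show ?thesis .
qed

section \<open>Witt's theorem\<close>

lemma minj_left_inverse:
  fixes V :: "'a::division_ring mat"
  assumes "minj V" "V \<in> carrier_mat n m"
  obtains L where "L \<in> carrier_mat m n" "L * V = 1\<^sub>m m"
proof -
  have mn: "m \<le> n" by (rule minj_dim_le[OF assms])
  obtain W where W: "W \<in> carrier_mat n (n - m)" "invertible_mat (hcat W V)"
    using minj_extend_basis[OF assms] by auto
  have c: "hcat W V \<in> carrier_mat n n" using W(1) assms(2) mn by auto
  obtain R where R: "R \<in> carrier_mat n n" "R * hcat W V = 1\<^sub>m n" using invertible_matE[OF W(2) c] by metis
  have "hcat (R * W) (R * V) = R * hcat W V" using R(1) W(1) assms(2) by (intro mult_hcat[symmetric]) auto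
  also have "\<dots> = hcat (vcat (1\<^sub>m (n - m)) (0\<^sub>m m (n - m))) (vcat (0\<^sub>m (n - m) m) (1\<^sub>m m))"
    unfolding R(2) using mn by (intro eq_matI) (auto simp: hcat_def vcat_def)
  finally have RV: "R * V = vcat (0\<^sub>m (n - m) m) (1\<^sub>m m)"
    using R(1) W(1) assms(2) mn by (elim hcat_eqD(2)) auto
  let ?E = "hcat (0\<^sub>m m (n - m)) (1\<^sub>m m) :: 'a mat"
  have E: "?E \<in> carrier_mat m n" using mn by auto
  have "?E * R * V = ?E * (R * V)" by (rule assoc_mult_mat[OF E R(1) assms(2)])
  also have "\<dots> = 1\<^sub>m m" unfolding RV by (subst hcat_mult_vcat) auto
  finally show ?thesis using that[of "?E * R"] E R(1) by auto
qed

text \<open>The columns of \<open>Tb\<close> span the radical and those of \<open>Ta\<close> a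
  complement. If \<open>G * Ta\<close> applied to a vector is annihilated by the adjoint of
  \<open>Ta\<close>, it is annihilated by that of \<open>Tb\<close> as well, hence zero; so the form
  is nondegenerate on the complement.\<close>

lemma hermitian_radical:
  assumes G: "G \<in> carrier_mat r r" "qadj G = G"
  obtains q Ta Tb where "q \<le> r" "Ta \<in> carrier_mat r q" "Tb \<in> carrier_mat r (r - q)"
    "invertible_mat (hcat Ta Tb)" "G * Tb = 0\<^sub>m r (r - q)" "invertible_mat (qadj Ta * G * Ta)"
proof -
  obtain T q G1 where T: "T \<in> carrier_mat r r" "invertible_mat T" "q \<le> r" "G1 \<in> carrier_mat r q" "minj G1"
    "G * T = hcat G1 (0\<^sub>m r (r - q))"
    using column_rank_factorization[OF G(1)] by auto
  have rq: "q + (r - q) = r" using T(3) by simp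
  obtain Ta Tb where ab: "T = hcat Ta Tb" "Ta \<in> carrier_mat r q" "Tb \<in> carrier_mat r (r - q)"
    using hcat_split[of T r q "r - q"] T(1) rq by auto
  have e: "hcat (G * Ta) (G * Tb) = hcat G1 (0\<^sub>m r (r - q))"
    unfolding T(6)[symmetric] ab(1) using G(1) ab by (intro mult_hcat[symmetric]) auto
  have GTa: "G * Ta = G1" by (rule hcat_eqD(1)[OF e]) (use G(1) ab T(4) in auto)
  have GTb: "G * Tb = 0\<^sub>m r (r - q)" by (rule hcat_eqD(2)[OF e]) (use G(1) ab T(4) in auto)
  let ?G0 = "qadj Ta * G * Ta"
  have G0: "?G0 \<in> carrier_mat q q" using G(1) ab by auto
  have ba: "qadj Tb * (G * Ta) = 0\<^sub>m (r - q) q"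
  proof -
    have "qadj Tb * (G * Ta) = qadj (G * Tb) * Ta" using G ab by (simp add: qadj_mult mult_assoc_dim)
    thus ?thesis unfolding GTb using ab by (simp add: left_mult_zero_mat[of _ r])
  qed
  have "minj ?G0"
  proof (rule minjI[OF G0])
    fix v :: "quat vec" assume v: "v \<in> carrier_vec q" "?G0 *\<^sub>v v = 0\<^sub>v q"
    let ?x = "col_mat v"
    have x: "?x \<in> carrier_mat q 1" using v(1) by auto
    have GX: "G * Ta * ?x \<in> carrier_mat r 1" using G(1) ab x by auto
    have "?G0 * ?x = 0\<^sub>m q 1" unfolding mult_col_mat v(2) by (rule eq_matI) (auto simp: col_mat_def)
    hence 1: "qadj Ta * (G * Ta * ?x) = 0\<^sub>m q 1" using G(1) ab v(1) by (simp add: mult_assoc_dim)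
    have "qadj Tb * (G * Ta * ?x) = qadj Tb * (G * Ta) * ?x" using G(1) ab v(1) by (simp add: mult_assoc_dim)
    hence 2: "qadj Tb * (G * Ta * ?x) = 0\<^sub>m (r - q) 1" unfolding ba using x by (simp add: left_mult_zero_mat[of _ q 1])
    have "qadj T * (G * Ta * ?x) = vcat (qadj Ta * (G * Ta * ?x)) (qadj Tb * (G * Ta * ?x))"
      unfolding ab(1) using ab GX by (subst qadj_hcat) (auto intro!: vcat_mult)
    also have "\<dots> = 0\<^sub>m r 1" unfolding 1 2 using vcat_zero[of q 1 "r - q"] rq by simp
    finally have "G * Ta * ?x = 0\<^sub>m r 1"
      using minj_mult_zero[OF invertible_minj[OF qadj_invertible[OF T(2,1)] qadj_carrier[OF T(1)]] qadj_carrier[OF T(1)] GX] by simp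
    hence "?x = 0\<^sub>m q 1" using minj_mult_zero[OF T(5,4) x] by (simp add: GTa)
    hence "?x $$ (i,0) = 0" if "i < q" for i using that by simp
    thus "v = 0\<^sub>v q" using v(1) by (intro eq_vecI) (auto simp: col_mat_def)
  qed
  hence "invertible_mat ?G0" using minj_square_invertible G0 by blast
  thus ?thesis using that[OF T(3) ab(2,3) _ GTb] T(2) ab(1) by simp
qed

text \<open>A right inverse \<open>Y\<^sub>0\<close> of the Gram rows becomes isotropic after subtracting \<open>R\<close> times half of its Gram matrix.\<close>

lemma hyperbolic_complement:
  assumes H: "H \<in> carrier_mat n n" "invertible_mat H" "qadj H = H"
    and P: "P \<in> carrier_mat n q" and R: "R \<in> carrier_mat n d" and inj: "minj (hcat P R)"
    and PR: "qadj P * H * R = 0\<^sub>m q d" and RR: "qadj R * H * R = 0\<^sub>m d d"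
  obtains Y where "Y \<in> carrier_mat n d" "qadj P * H * Y = 0\<^sub>m q d" "qadj R * H * Y = 1\<^sub>m d" "qadj Y * H * Y = 0\<^sub>m d d"
proof -
  have F: "hcat P R \<in> carrier_mat n (q + d)" using P R by auto
  obtain L where L: "L \<in> carrier_mat (q + d) n" "L * hcat P R = 1\<^sub>m (q + d)"
    using minj_left_inverse[OF inj F] by auto
  obtain Hi where Hi: "Hi \<in> carrier_mat n n" "H * Hi = 1\<^sub>m n" using invertible_matE[OF H(2,1)] by metis
  let ?E = "vcat (0\<^sub>m q d) (1\<^sub>m d) :: quat mat"
  have E: "?E \<in> carrier_mat (q + d) d" by auto
  \<comment> \<open>The left inverse \<open>L\<close> prescribes the pairings, zero with
    \<open>P\<close> and the identity with \<open>R\<close>; as \<open>H\<close> is invertible, they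
    are realised by the vectors \<open>Y0\<close> with \<open>H * Y0 = Z\<close>.\<close>
  define Z where "Z = qadj L * ?E"
  have Z: "Z \<in> carrier_mat n d" using L(1) E by (auto simp: Z_def)
  define Y0 where "Y0 = Hi * Z"
  have Y0: "Y0 \<in> carrier_mat n d" using Hi Z by (auto simp: Y0_def)
  have HY0: "H * Y0 = Z"
  proof -
    have "H * Y0 = H * Hi * Z" unfolding Y0_def by (rule assoc_mult_mat[OF H(1) Hi(1) Z, symmetric])
    thus ?thesis unfolding Hi(2) using Z by simp
  qed
  have "vcat (qadj P * Z) (qadj R * Z) = qadj (hcat P R) * Z"
    using P R Z by (subst qadj_hcat) (auto intro!: vcat_mult[symmetric])
  also have "\<dots> = qadj (hcat P R) * qadj L * ?E" unfolding Z_def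
    by (rule assoc_mult_mat[OF qadj_carrier[OF F] qadj_carrier[OF L(1)] E, symmetric])
  also have "qadj (hcat P R) * qadj L = qadj (L * hcat P R)" using L(1) F by (intro qadj_mult[symmetric]) auto
  also have "qadj (L * hcat P R) * ?E = ?E" unfolding L(2) using E by simp
  finally have e: "vcat (qadj P * Z) (qadj R * Z) = ?E" .
  have PZ: "qadj P * Z = 0\<^sub>m q d" by (rule vcat_eqD(1)[OF e]) (use P R Z in auto)
  have RZ: "qadj R * Z = 1\<^sub>m d" by (rule vcat_eqD(2)[OF e]) (use P R Z in auto)
  define K where "K = qadj Y0 * Z"
  have K: "K \<in> carrier_mat d d" using Y0 Z by (auto simp: K_def)
  define C where "C = qR (1/2) \<cdot>\<^sub>m K"
  have C: "C \<in> carrier_mat d d" using K by (auto simp: C_def)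
  have Kh: "qadj K = K"
  proof -
    have "qadj K = qadj (qadj Y0 * (H * Y0))" unfolding K_def HY0 ..
    also have "\<dots> = qadj Y0 * (H * Y0)" using Y0 H by (simp add: qadj_mult mult_assoc_dim)
    finally show ?thesis unfolding HY0 K_def .
  qed
  have Ch: "qadj C = C" unfolding C_def qadj_smult_real Kh ..
  define Y where "Y = Y0 - R * C"
  have RC: "R * C \<in> carrier_mat n d" using R C by auto
  have Y: "Y \<in> carrier_mat n d" unfolding Y_def by (rule minus_carrier_mat[OF RC])
  have HR: "H * R \<in> carrier_mat n d" using H R by auto
  have HY: "H * Y = Z - H * R * C"
  proof -
    have "H * Y = H * Y0 - H * (R * C)" unfolding Y_def by (rule mult_minus_distrib_mat[OF H(1) Y0 RC])
    thus ?thesis unfolding HY0 using assoc_mult_mat[OF H(1) R C] by simp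
  qed
  have HRC: "H * R * C \<in> carrier_mat n d" using HR C by auto
  have left: "M * H * Y = M * Z - (M * H * R) * C" if M: "M \<in> carrier_mat m n" for M m
  proof -
    have "M * H * Y = M * (H * Y)" by (rule assoc_mult_mat[OF M H(1) Y])
    also have "\<dots> = M * Z - M * (H * R * C)" unfolding HY by (rule mult_minus_distrib_mat[OF M Z HRC])
    also have "M * (H * R * C) = (M * H * R) * C" using M H R C by (simp add: mult_assoc_dim)
    finally show ?thesis .
  qed
  have 1: "qadj P * H * Y = 0\<^sub>m q d"
    unfolding left[OF qadj_carrier[OF P]] PZ PR using C by (simp add: left_mult_zero_mat[of _ d d])
  have 2: "qadj R * H * Y = 1\<^sub>m d"
    unfolding left[OF qadj_carrier[OF R]] RZ RR left_mult_zero_mat[OF C] by (rule eq_matI) auto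
  have YR: "qadj Y * H * R = 1\<^sub>m d"
  proof -
    have "qadj Y * H * R = qadj (qadj R * H * Y)" using Y H R by (simp add: qadj_mult mult_assoc_dim)
    thus ?thesis unfolding 2 by simp
  qed
  have YZ: "qadj Y * Z = K - C"
  proof -
    have "qadj Y * Z = (qadj Y0 - qadj (R * C)) * Z" unfolding Y_def using Y0 RC by (subst qadj_minus) auto
    also have "\<dots> = K - qadj (R * C) * Z" unfolding K_def
      by (rule minus_mult_distrib_mat[OF qadj_carrier[OF Y0] qadj_carrier[OF RC] Z])
    also have "qadj (R * C) * Z = C * (qadj R * Z)" using R C Z by (simp add: qadj_mult mult_assoc_dim Ch)
    finally show ?thesis unfolding RZ using C by simp
  qed
  have 3: "qadj Y * H * Y = 0\<^sub>m d d"
  proof -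
    have "qadj Y * H * Y = K - C - C" unfolding left[OF qadj_carrier[OF Y]] YZ YR using C by simp
    also have "\<dots> = 0\<^sub>m d d"
    proof (rule eq_matI)
      fix i j assume ij: "i < dim_row (0\<^sub>m d d :: quat mat)" "j < dim_col (0\<^sub>m d d :: quat mat)"
      have "qR (1/2) * x + qR (1/2) * x = x" for x :: quat
        by (simp add: distrib_right[symmetric] quat_of_real_simps(3)[symmetric] del: quat_of_real_simps(3))
      hence "K $$ (i,j) = qR (1/2) * K $$ (i,j) + qR (1/2) * K $$ (i,j)" by simp
      thus "(K - C - C) $$ (i,j) = 0\<^sub>m d d $$ (i,j)" using ij K C by (simp add: C_def diff_diff_eq)
    qed (use K C in auto)
    finally show ?thesis .
  qed
  show ?thesis by (rule that[OF Y 1 2 3])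
qed

lemma zero_blocks_real:
  assumes "blocks_B bs = 0\<^sub>m n n" "\<forall>b\<in>set bs. cblock_valid b"
  shows "\<forall>k z. CB k z \<notin> set bs"
  using assms
proof (induction bs arbitrary: n)
  case (Cons b bs)
  have n: "cblock_size b + blocks_size bs = n" using arg_cong[OF Cons.prems(1), of dim_row] by simp
  have e: "dsum (cblock_B b) (blocks_B bs) = dsum (0\<^sub>m (cblock_size b) (cblock_size b)) (0\<^sub>m (blocks_size bs) (blocks_size bs))"
    using Cons.prems(1) n by (simp add: dsum_zero)
  have 1: "cblock_B b = 0\<^sub>m (cblock_size b) (cblock_size b)"
    by (rule dsum_eqD(1)[OF e cblock_carrier(1) blocks_carrier(1)]) auto
  have 2: "blocks_B bs = 0\<^sub>m (blocks_size bs) (blocks_size bs)"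
    by (rule dsum_eqD(2)[OF e cblock_carrier(1) blocks_carrier(1)]) auto
  have "b \<noteq> CB k z" for k z
  proof
    assume b: "b = CB k z"
    hence k: "k \<ge> 1" "Im z > 0" using Cons.prems by auto
    have "cblock_B b $$ (0,0) = qC z" unfolding b using k by (simp add: diag_block_Cons dsum_index del: dsum_empty)
    hence "qC z = 0" unfolding 1 using k b by simp
    thus False using k by simp
  qed
  thus ?case using Cons.IH[OF 2] Cons.prems(2) by auto
qed simp

text \<open>
  The canonical form of \<open>(0, H)\<close> is a diagonal of signs, so cancellation is the uniqueness of the number
  of real blocks for the zero endomorphism.
\<close>

lemma hermitian_cancel:
  assumes H1: "H1 \<in> carrier_mat p p" "invertible_mat H1" "qadj H1 = H1"
    and H2: "H2 \<in> carrier_mat p p" "invertible_mat H2" "qadj H2 = H2"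
    and M: "M \<in> carrier_mat m m" "invertible_mat M" "qadj M = M"
    and P: "P \<in> carrier_mat (p + m) (p + m)" "invertible_mat P" "qadj P * dsum H1 M * P = dsum H2 M"
  obtains T where "T \<in> carrier_mat p p" "invertible_mat T" "qadj T * H1 * T = H2"
proof -
  have z: "qadj (0\<^sub>m k k) * N = N * 0\<^sub>m k k" if "N \<in> carrier_mat k k" for N k
    using that by (simp add: left_mult_zero_mat[of _ k k] right_mult_zero_mat[of _ k k])
  obtain b1 where b1: "\<forall>b\<in>set b1. cblock_valid b" "blocks_size b1 = p" "peq p (0\<^sub>m p p) H1 (blocks_B b1) (blocks_H b1)"
    using canonical_form_exists[OF H1 _ z[OF H1(1)]] by auto
  obtain b2 where b2: "\<forall>b\<in>set b2. cblock_valid b" "blocks_size b2 = p" "peq p (0\<^sub>m p p) H2 (blocks_B b2) (blocks_H b2)"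
    using canonical_form_exists[OF H2 _ z[OF H2(1)]] by auto
  obtain b3 where b3: "\<forall>b\<in>set b3. cblock_valid b" "blocks_size b3 = m" "peq m (0\<^sub>m m m) M (blocks_B b3) (blocks_H b3)"
    using canonical_form_exists[OF M _ z[OF M(1)]] by auto
  have zero: "blocks_B bs = 0\<^sub>m p p" if pq: "peq p (0\<^sub>m p p) H (blocks_B bs) (blocks_H bs)" "blocks_size bs = p" for bs H
  proof -
    obtain Q where Q: "Q \<in> carrier_mat p p" "invertible_mat Q" "0\<^sub>m p p = Q * blocks_B bs"
      using pq(1) unfolding peq_def by auto
    have "blocks_B bs \<in> carrier_mat p p" using blocks_carrier(1)[of bs] pq(2) by simp
    thus ?thesis using minj_mult_zero[OF invertible_minj[OF Q(2,1)] Q(1)] Q(3) by metis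
  qed
  have c: "blocks_B b1 \<in> carrier_mat p p" "blocks_H b1 \<in> carrier_mat p p" "blocks_B b2 \<in> carrier_mat p p"
    "blocks_H b2 \<in> carrier_mat p p" "blocks_B b3 \<in> carrier_mat m m" "blocks_H b3 \<in> carrier_mat m m"
    using blocks_carrier b1(2) b2(2) b3(2) by auto
  have n: "p + m = p + m" "0\<^sub>m (p + m) (p + m) = dsum (0\<^sub>m p p) (0\<^sub>m m m :: quat mat)" by (simp_all add: dsum_zero)
  have dH: "dsum H1 M \<in> carrier_mat (p + m) (p + m)" "dsum H2 M \<in> carrier_mat (p + m) (p + m)"
    using dsum_carrier H1(1) H2(1) M(1) by auto
  have 1: "peq (p + m) (0\<^sub>m (p + m) (p + m)) (dsum H1 M) (blocks_B (b1 @ b3)) (blocks_H (b1 @ b3))"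
    unfolding n(2) blocks_simps by (rule peq_dsum[OF b1(3) b3(3)]) (use H1 M c in auto)
  have 2: "peq (p + m) (0\<^sub>m (p + m) (p + m)) (dsum H2 M) (blocks_B (b2 @ b3)) (blocks_H (b2 @ b3))"
    unfolding n(2) blocks_simps by (rule peq_dsum[OF b2(3) b3(3)]) (use H2 M c in auto)
  have "peq (p + m) (0\<^sub>m (p + m) (p + m)) (dsum H1 M) (0\<^sub>m (p + m) (p + m)) (dsum H2 M)"
    by (rule peqI[OF P(1,2) _ P(3)]) (use P(1) in auto)
  hence 3: "peq (p + m) (0\<^sub>m (p + m) (p + m)) (dsum H1 M) (blocks_B (b2 @ b3)) (blocks_H (b2 @ b3))"
    by (rule peq_trans[OF _ 2]) (use dH b2(2) b3(2) in \<open>auto intro!: carrier_matI\<close>)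
  \<comment> \<open>Both lists contain the blocks of \<open>M\<close>, which drop out of the
    comparison of multiplicities.\<close>
  have cnt: "count_list b1 (RB k l e) = count_list b2 (RB k l e)" for k l e
    using real_blocks_unique[OF 1 3 zero_carrier_mat dH(1), of k l e] b1 b2 b3 by auto
  have noCB: "\<forall>k z. CB k z \<notin> set b1" "\<forall>k z. CB k z \<notin> set b2"
    using zero_blocks_real zero b1 b2 by blast+
  have "count_list b1 b = count_list b2 b" for b
    using cnt noCB by (cases b) (auto simp: count_list_0_iff)
  hence "mset b1 = mset b2" by (intro multiset_eqI) (simp add: count_mset)
  from peq_blocks_mset[OF this] have "peq p (blocks_B b1) (blocks_H b1) (blocks_B b2) (blocks_H b2)"
    using b1(2) by simp
  from peq_trans[OF peq_trans[OF b1(3) this] peq_sym[OF b2(3)]] have "peq p (0\<^sub>m p p) H1 (0\<^sub>m p p) H2"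
    using c H1(1) H2(1) by auto
  thus ?thesis unfolding peq_def using that by auto
qed

text \<open>The result depends on \<open>G0\<close> and the dimensions alone, so two isometric
  subspaces completed in this way have the same Gram matrix.\<close>

lemma hyperbolic_gram:
  assumes H: "H \<in> carrier_mat n n" "qadj H = H"
    and P: "P \<in> carrier_mat n q" and R: "R \<in> carrier_mat n d" and Y: "Y \<in> carrier_mat n d"
    and PP: "qadj P * H * P = G0" and PR: "qadj P * H * R = 0\<^sub>m q d" and RR: "qadj R * H * R = 0\<^sub>m d d"
    and PY: "qadj P * H * Y = 0\<^sub>m q d" and RY: "qadj R * H * Y = 1\<^sub>m d" and YY: "qadj Y * H * Y = 0\<^sub>m d d"
  shows "qadj (hcat (hcat P R) Y) * H * hcat (hcat P R) Y =
    four_block_mat (dsum G0 (0\<^sub>m d d)) (vcat (0\<^sub>m q d) (1\<^sub>m d)) (hcat (0\<^sub>m d q) (1\<^sub>m d)) (0\<^sub>m d d)"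
proof -
  have F: "hcat P R \<in> carrier_mat n (q + d)" using P R by auto
  have adj: "qadj B * H * A = qadj (qadj A * H * B)" if "A \<in> carrier_mat n k" "B \<in> carrier_mat n l" for A B k l
    using that H by (simp add: qadj_mult mult_assoc_dim)
  have RP: "qadj R * H * P = 0\<^sub>m d q" "qadj Y * H * P = 0\<^sub>m d q" "qadj Y * H * R = 1\<^sub>m d"
    using adj[OF P R] adj[OF P Y] adj[OF R Y] PR PY RY by auto
  have G0: "G0 \<in> carrier_mat q q" using P H PP by auto
  have 1: "qadj (hcat P R) * H * hcat P R = dsum G0 (0\<^sub>m d d)"
    unfolding gram_hcat[OF P R H(1)] PP PR RR RP dsum_def using G0 by simp
  have 2: "qadj (hcat P R) * H * Y = vcat (0\<^sub>m q d) (1\<^sub>m d)"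
    unfolding PY[symmetric] RY[symmetric] using P R Y H by (simp add: qadj_hcat vcat_mult)
  have 3: "qadj Y * H * hcat P R = hcat (0\<^sub>m d q) (1\<^sub>m d)"
    unfolding RP(2,3)[symmetric] using P R Y H by (intro mult_hcat) auto
  show ?thesis unfolding gram_hcat[OF F Y H(1)] 1 2 3 YY ..
qed

text \<open>The inverse has the same shape, with \<open>G0\<close> replaced by its inverse: the
  identity blocks exchange the radical and its dual.\<close>

lemma hyperbolic_gram_invertible:
  fixes G0 :: "'a::division_ring mat"
  assumes "G0 \<in> carrier_mat q q" "invertible_mat G0"
  shows "invertible_mat (four_block_mat (dsum G0 (0\<^sub>m d d)) (vcat (0\<^sub>m q d) (1\<^sub>m d)) (hcat (0\<^sub>m d q) (1\<^sub>m d)) (0\<^sub>m d d))"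
    (is "invertible_mat ?M")
proof -
  obtain Gi where Gi: "Gi \<in> carrier_mat q q" "G0 * Gi = 1\<^sub>m q" using invertible_matE[OF assms(2,1)] by metis
  let ?E = "vcat (0\<^sub>m q d) (1\<^sub>m d) :: 'a mat" and ?F = "hcat (0\<^sub>m d q) (1\<^sub>m d) :: 'a mat"
  let ?N = "four_block_mat (dsum Gi (0\<^sub>m d d)) ?E ?F (0\<^sub>m d d)"
  have EF: "?E * ?F = dsum (0\<^sub>m q q) (1\<^sub>m d)"
    by (subst vcat_mult_hcat) (auto simp: dsum_def)
  have FE: "?F * ?E = 1\<^sub>m d" by (subst hcat_mult_vcat) auto
  have a: "dsum G0 (0\<^sub>m d d) * dsum Gi (0\<^sub>m d d) + ?E * ?F = 1\<^sub>m (q + d)"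
  proof -
    have "dsum G0 (0\<^sub>m d d) * dsum Gi (0\<^sub>m d d) = dsum (G0 * Gi) (0\<^sub>m d d * 0\<^sub>m d d)"
      using assms(1) Gi(1) by (intro dsum_mult) auto
    also have "\<dots> + ?E * ?F = dsum (1\<^sub>m q + 0\<^sub>m q q) (0\<^sub>m d d + 1\<^sub>m d)"
      unfolding EF Gi(2) by (subst dsum_add) auto
    finally show ?thesis by (simp add: dsum_one)
  qed
  have b: "dsum G0 (0\<^sub>m d d) * ?E = 0\<^sub>m (q + d) d"
    using assms(1) by (subst dsum_mult_vcat) (auto simp: vcat_zero right_mult_zero_mat[of _ q q])
  have c: "?F * dsum Gi (0\<^sub>m d d) = 0\<^sub>m d (q + d)"
    using Gi(1) by (subst hcat_mult_dsum) (auto simp: hcat_zero left_mult_zero_mat[of _ q q])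
  have E: "?E \<in> carrier_mat (q + d) d" and F: "?F \<in> carrier_mat d (q + d)" by auto
  have D: "dsum G0 (0\<^sub>m d d) \<in> carrier_mat (q + d) (q + d)" "dsum Gi (0\<^sub>m d d) \<in> carrier_mat (q + d) (q + d)"
    using dsum_carrier assms(1) Gi(1) by auto
  have z: "?E * 0\<^sub>m d d = 0\<^sub>m (q + d) d" "0\<^sub>m d d * ?F = 0\<^sub>m d (q + d)"
    using right_mult_zero_mat[OF E] left_mult_zero_mat[OF F] by auto
  have "?M * ?N = four_block_mat (1\<^sub>m (q + d)) (0\<^sub>m (q + d) d) (0\<^sub>m d (q + d)) (1\<^sub>m d)"
    unfolding mult_four_block_mat[OF D(1) E F zero_carrier_mat D(2) E F zero_carrier_mat] a b c FE z by simp
  hence "?M * ?N = 1\<^sub>m (q + d + d)" by simp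
  moreover have "?M \<in> carrier_mat (q + d + d) (q + d + d)" "?N \<in> carrier_mat (q + d + d) (q + d + d)"
    using assms(1) Gi(1) by (auto intro!: carrier_matI)
  ultimately show ?thesis using right_inverse_invertible(1) by blast
qed

text \<open>Both subspaces split off with orthogonal complements carrying forms \<open>H1\<close>
  and \<open>H2\<close>. The two sums with \<open>M\<close> are isometric, being \<open>H\<close> in
  different bases; cancelling \<open>M\<close> gives an isometry of the complements, which is glued
  to the given one.\<close>

lemma witt_nondegenerate:
  assumes H: "H \<in> carrier_mat n n" "invertible_mat H" "qadj H = H"
    and F1: "F1 \<in> carrier_mat n m" "qadj F1 * H * F1 = M" and F2: "F2 \<in> carrier_mat n m" "qadj F2 * H * F2 = M"
    and M: "invertible_mat M"
  obtains U where "U \<in> carrier_mat n n" "qadj U * H * U = H" "U * F1 = F2"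
proof -
  \<comment> \<open>Orthogonal splitting is stated for a selfadjoint endomorphism; the zero map is
    one that leaves every subspace invariant.\<close>
  have z: "0\<^sub>m n n \<in> carrier_mat n n" "qadj (0\<^sub>m n n) * H = H * 0\<^sub>m n n"
    using H by (auto simp: left_mult_zero_mat[of _ n n] right_mult_zero_mat[of _ n n])
  have z1: "0\<^sub>m n n * F1 = F1 * 0\<^sub>m m m" "0\<^sub>m n n * F2 = F2 * 0\<^sub>m m m"
    using F1(1) F2(1) by (auto simp: left_mult_zero_mat[of _ n m] right_mult_zero_mat[of _ n m])
  have Mc: "M \<in> carrier_mat m m" "qadj M = M"
    using F1 H by (auto simp: F1(2)[symmetric] qadj_mult mult_assoc_dim)
  obtain Z1 A1 H1 where Z1: "m \<le> n" "Z1 \<in> carrier_mat n (n - m)" "A1 \<in> carrier_mat (n - m) (n - m)"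
    "H1 \<in> carrier_mat (n - m) (n - m)" "invertible_mat (hcat Z1 F1)" "qadj H1 = H1" "qadj A1 * H1 = H1 * A1"
    "0\<^sub>m n n * hcat Z1 F1 = hcat Z1 F1 * dsum A1 (0\<^sub>m m m)" "qadj (hcat Z1 F1) * H * hcat Z1 F1 = dsum H1 M"
    using split_off[OF H(1,3) z F1(1) zero_carrier_mat z1(1) F1(2) M] .
  obtain Z2 A2 H2 where Z2: "m \<le> n" "Z2 \<in> carrier_mat n (n - m)" "A2 \<in> carrier_mat (n - m) (n - m)"
    "H2 \<in> carrier_mat (n - m) (n - m)" "invertible_mat (hcat Z2 F2)" "qadj H2 = H2" "qadj A2 * H2 = H2 * A2"
    "0\<^sub>m n n * hcat Z2 F2 = hcat Z2 F2 * dsum A2 (0\<^sub>m m m)" "qadj (hcat Z2 F2) * H * hcat Z2 F2 = dsum H2 M"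
    using split_off[OF H(1,3) z F2(1) zero_carrier_mat z1(2) F2(2) M] .
  have nm: "n - m + m = n" using Z1(1) by simp
  let ?S1 = "hcat Z1 F1" and ?S2 = "hcat Z2 F2"
  have S: "?S1 \<in> carrier_mat n n" "?S2 \<in> carrier_mat n n"
    using hcat_carrier[OF Z1(2) F1(1)] hcat_carrier[OF Z2(2) F2(1)] nm by simp_all
  have "invertible_mat (dsum H1 M)" "invertible_mat (dsum H2 M)"
    unfolding Z1(9)[symmetric] Z2(9)[symmetric]
    using hermitian_form_invertible[OF H(1,2) S(1) Z1(5)] hermitian_form_invertible[OF H(1,2) S(2) Z2(5)] by auto
  hence Hi: "invertible_mat H1" "invertible_mat H2" using invertible_dsumD Z1(4) Z2(4) Mc(1) by blast+
  obtain Q where Q: "Q \<in> carrier_mat n n" "?S1 * Q = 1\<^sub>m n" "Q * ?S1 = 1\<^sub>m n" using invertible_matE[OF Z1(5) S(1)] by metis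
  have Qi: "invertible_mat Q" by (rule invertible_matI[OF Q(1) S(1) Q(3,2)])
  have "qadj (Q * ?S2) * (qadj ?S1 * H * ?S1) * (Q * ?S2) =
     qadj ?S2 * ((qadj Q * qadj ?S1) * (H * ((?S1 * Q) * ?S2)))"
    using S Q(1) H(1) by (simp only: qadj_mult mult_assoc_dim carrier_matD index_mult_mat qadj_dim)
  also have "qadj Q * qadj ?S1 = qadj (?S1 * Q)" using S Q(1) by (intro qadj_mult[symmetric]) auto
  also have "qadj ?S2 * (qadj (?S1 * Q) * (H * ((?S1 * Q) * ?S2))) = qadj ?S2 * H * ?S2"
    unfolding Q(2) using S H(1) by (simp only: qadj_one left_mult_one_mat[OF S(2)] left_mult_one_mat[OF mult_carrier_mat[OF H(1) S(2)]])
      (simp only: mult_assoc_dim carrier_matD index_mult_mat qadj_dim)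
  finally have g: "qadj (Q * ?S2) * dsum H1 M * (Q * ?S2) = dsum H2 M" unfolding Z1(9) Z2(9) .
  have QS: "Q * ?S2 \<in> carrier_mat n n" by (rule mult_carrier_mat[OF Q(1) S(2)])
  obtain T where T: "T \<in> carrier_mat (n - m) (n - m)" "invertible_mat T" "qadj T * H1 * T = H2"
    by (rule hermitian_cancel[OF Z1(4) Hi(1) Z1(6) Z2(4) Hi(2) Z2(6) Mc(1) M Mc(2), of "Q * ?S2"])
       (use QS g invertible_mult[OF Qi Q(1) Z2(5) S(2)] nm in auto)
  let ?S3 = "hcat (Z1 * T) F1"
  have S3: "?S3 \<in> carrier_mat n n" using hcat_carrier[OF mult_carrier_mat[OF Z1(2) T(1)] F1(1)] nm by simp
  have S3e: "?S3 = ?S1 * dsum T (1\<^sub>m m)" using Z1(2) F1(1) T(1) by (subst hcat_mult_dsum) auto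
  have T1: "dsum T (1\<^sub>m m) \<in> carrier_mat n n" using dsum_carrier[OF T(1) one_carrier_mat[of m]] nm by simp
  have S3i: "invertible_mat ?S3" unfolding S3e
    by (rule invertible_mult[OF Z1(5) S(1) invertible_dsum[OF T(2,1) invertible_one one_carrier_mat] T1])
  have "qadj ?S3 * H * ?S3 = qadj (dsum T (1\<^sub>m m)) * (qadj ?S1 * H * ?S1) * dsum T (1\<^sub>m m)"
    unfolding S3e using S(1) T1 H(1) by (simp only: qadj_mult mult_assoc_dim carrier_matD index_mult_mat qadj_dim)
  also have "\<dots> = dsum H2 M"
    unfolding Z1(9) qadj_dsum using T Z1(4) Mc(1) by (simp add: dsum_mult)
  finally have gram3: "qadj ?S3 * H * ?S3 = qadj ?S2 * H * ?S2" unfolding Z2(9) .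
  obtain R where R: "R \<in> carrier_mat n n" "?S3 * R = 1\<^sub>m n" "R * ?S3 = 1\<^sub>m n" using invertible_matE[OF S3i S3] by metis
  define U where "U = ?S2 * R"
  have U: "U \<in> carrier_mat n n" using S(2) R(1) by (auto simp: U_def)
  have US3: "U * ?S3 = ?S2"
  proof -
    have "U * ?S3 = ?S2 * (R * ?S3)" unfolding U_def by (rule assoc_mult_mat[OF S(2) R(1) S3])
    thus ?thesis unfolding R(3) using right_mult_one_mat[OF S(2)] by simp
  qed
  have "qadj U * H * U = qadj R * (qadj ?S2 * H * ?S2) * R"
    unfolding U_def using S(2) R(1) H(1) by (simp only: qadj_mult mult_assoc_dim carrier_matD index_mult_mat qadj_dim)
  also have "\<dots> = (qadj R * qadj ?S3) * (H * (?S3 * R))"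
    unfolding gram3[symmetric] using S3 R(1) H(1) by (simp only: mult_assoc_dim carrier_matD index_mult_mat qadj_dim)
  also have "qadj R * qadj ?S3 = qadj (?S3 * R)" using S3 R(1) by (intro qadj_mult[symmetric]) auto
  also have "qadj (?S3 * R) * (H * (?S3 * R)) = H" unfolding R(2) using H(1) by simp
  finally have 1: "qadj U * H * U = H" .
  have e: "hcat (U * (Z1 * T)) (U * F1) = hcat Z2 F2"
    unfolding US3[symmetric] using U Z1(2) T(1) F1(1) by (intro mult_hcat[symmetric]) auto
  have "U * F1 = F2" by (rule hcat_eqD(2)[OF e]) (use U Z1(2) Z2(2) T(1) F1(1) F2(1) in auto)
  with U 1 show ?thesis using that by blast
qed

text \<open>The matrices \<open>Ta\<close> and \<open>Tb\<close> are computed from the common Gram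
  matrix, so the same column combinations isolate the radical in both ranges. Each radical receives
  its own isotropic partner, after which the nondegenerate case applies.\<close>

lemma witt_injective:
  assumes H: "H \<in> carrier_mat n n" "invertible_mat H" "qadj H = H"
    and W1: "W1 \<in> carrier_mat n r" "minj W1" and W2: "W2 \<in> carrier_mat n r" "minj W2"
    and gram: "qadj W1 * H * W1 = qadj W2 * H * W2"
  obtains U where "U \<in> carrier_mat n n" "qadj U * H * U = H" "U * W1 = W2"
proof -
  define G where "G = qadj W1 * H * W1"
  have G: "G \<in> carrier_mat r r" "qadj G = G" using W1(1) H by (auto simp: G_def qadj_mult mult_assoc_dim)
  have G2: "qadj W2 * H * W2 = G" using gram G_def by simp
  obtain q Ta Tb where T: "q \<le> r" "Ta \<in> carrier_mat r q" "Tb \<in> carrier_mat r (r - q)"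
    "invertible_mat (hcat Ta Tb)" "G * Tb = 0\<^sub>m r (r - q)" "invertible_mat (qadj Ta * G * Ta)"
    using hermitian_radical[OF G] .
  let ?d = "r - q"
  have rq: "q + ?d = r" using T(1) by simp
  have Tc: "hcat Ta Tb \<in> carrier_mat r r" using hcat_carrier[OF T(2,3)] rq by simp
  define G0 where "G0 = qadj Ta * G * Ta"
  have G0: "G0 \<in> carrier_mat q q" using T(2) G(1) by (auto simp: G0_def)
  define M where "M = four_block_mat (dsum G0 (0\<^sub>m ?d ?d)) (vcat (0\<^sub>m q ?d) (1\<^sub>m ?d)) (hcat (0\<^sub>m ?d q) (1\<^sub>m ?d)) (0\<^sub>m ?d ?d)"
  have Mi: "invertible_mat M" unfolding M_def by (rule hyperbolic_gram_invertible[OF G0]) (use T(6) G0_def in simp)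
  have main: "\<exists>Y. Y \<in> carrier_mat n ?d \<and> qadj (hcat (hcat (W * Ta) (W * Tb)) Y) * H * hcat (hcat (W * Ta) (W * Tb)) Y = M"
    if W: "W \<in> carrier_mat n r" "minj W" and WG: "qadj W * H * W = G" for W
  proof -
    have WT: "W * Ta \<in> carrier_mat n q" "W * Tb \<in> carrier_mat n ?d" using W(1) T by auto
    have gr: "qadj (W * X) * H * (W * Y) = qadj X * (G * Y)" if "X \<in> carrier_mat r k" "Y \<in> carrier_mat r l" for X Y k l
      unfolding WG[symmetric] using that W(1) H(1) by (simp add: qadj_mult mult_assoc_dim)
    have PP: "qadj (W * Ta) * H * (W * Ta) = G0"
      unfolding gr[OF T(2,2)] G0_def using T(2) G(1) by (simp add: mult_assoc_dim)
    have PR: "qadj (W * Ta) * H * (W * Tb) = 0\<^sub>m q ?d"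
      unfolding gr[OF T(2,3)] T(5) by (rule right_mult_zero_mat[OF qadj_carrier[OF T(2)]])
    have RR: "qadj (W * Tb) * H * (W * Tb) = 0\<^sub>m ?d ?d"
      unfolding gr[OF T(3,3)] T(5) by (rule right_mult_zero_mat[OF qadj_carrier[OF T(3)]])
    have hc: "hcat (W * Ta) (W * Tb) = W * hcat Ta Tb" using W(1) T by (intro mult_hcat[symmetric]) auto
    have "minj (W * hcat Ta Tb)"
    proof (rule minjI[OF mult_carrier_mat[OF W(1) Tc]])
      fix v :: "quat vec" assume v: "v \<in> carrier_vec r" "W * hcat Ta Tb *\<^sub>v v = 0\<^sub>v n"
      have "W *\<^sub>v (hcat Ta Tb *\<^sub>v v) = 0\<^sub>v n" using v assoc_mult_mat_vec[OF W(1) Tc v(1)] by simp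
      hence "hcat Ta Tb *\<^sub>v v = 0\<^sub>v r" using minjD[OF W(2,1)] mult_mat_vec_carrier[OF Tc v(1)] by simp
      thus "v = 0\<^sub>v r" using minjD[OF invertible_minj[OF T(4) Tc] Tc v(1)] by simp
    qed
    hence "minj (hcat (W * Ta) (W * Tb))" unfolding hc .
    from hyperbolic_complement[OF H WT this PR RR] obtain Y where
      Y: "Y \<in> carrier_mat n ?d" "qadj (W * Ta) * H * Y = 0\<^sub>m q ?d" "qadj (W * Tb) * H * Y = 1\<^sub>m ?d" "qadj Y * H * Y = 0\<^sub>m ?d ?d" .
    show ?thesis
      using hyperbolic_gram[OF H(1,3) WT Y(1) PP PR RR Y(2-4)] Y(1) M_def by auto
  qed
  obtain Y1 where Y1: "Y1 \<in> carrier_mat n ?d" "qadj (hcat (hcat (W1 * Ta) (W1 * Tb)) Y1) * H * hcat (hcat (W1 * Ta) (W1 * Tb)) Y1 = M"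
    using main[OF W1 G_def[symmetric]] by auto
  obtain Y2 where Y2: "Y2 \<in> carrier_mat n ?d" "qadj (hcat (hcat (W2 * Ta) (W2 * Tb)) Y2) * H * hcat (hcat (W2 * Ta) (W2 * Tb)) Y2 = M"
    using main[OF W2 G2] by auto
  have hc: "hcat (W * Ta) (W * Tb) = W * hcat Ta Tb" if "W \<in> carrier_mat n r" for W
    using that T by (intro mult_hcat[symmetric]) auto
  have WT: "W1 * hcat Ta Tb \<in> carrier_mat n r" "W2 * hcat Ta Tb \<in> carrier_mat n r" using W1(1) W2(1) Tc by auto
  have F: "hcat (W1 * hcat Ta Tb) Y1 \<in> carrier_mat n (r + ?d)" "hcat (W2 * hcat Ta Tb) Y2 \<in> carrier_mat n (r + ?d)"
    using hcat_carrier[OF WT(1) Y1(1)] hcat_carrier[OF WT(2) Y2(1)] by auto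
  obtain U where U: "U \<in> carrier_mat n n" "qadj U * H * U = H" "U * hcat (W1 * hcat Ta Tb) Y1 = hcat (W2 * hcat Ta Tb) Y2"
    using witt_nondegenerate[OF H F(1) Y1(2)[unfolded hc[OF W1(1)]] F(2) Y2(2)[unfolded hc[OF W2(1)]] Mi] .
  have e: "hcat (U * (W1 * hcat Ta Tb)) (U * Y1) = hcat (W2 * hcat Ta Tb) Y2"
    unfolding U(3)[symmetric] by (rule mult_hcat[symmetric]) (use U(1) WT Y1(1) in auto)
  have e1: "U * (W1 * hcat Ta Tb) = W2 * hcat Ta Tb"
    by (rule hcat_eqD(1)[OF e]) (use WT U(1) Y1(1) Y2(1) in auto)
  obtain R where R: "R \<in> carrier_mat r r" "hcat Ta Tb * R = 1\<^sub>m r" using invertible_matE[OF T(4) Tc] by metis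
  have "U * W1 = (U * (W1 * hcat Ta Tb)) * R"
  proof -
    have "(U * (W1 * hcat Ta Tb)) * R = U * (W1 * (hcat Ta Tb * R))"
      using U(1) W1(1) Tc R(1) by (simp only: mult_assoc_dim carrier_matD index_mult_mat)
    thus ?thesis unfolding R(2) using W1(1) by simp
  qed
  also have "\<dots> = W2 * (hcat Ta Tb * R)" unfolding e1 by (rule assoc_mult_mat[OF W2(1) Tc R(1)])
  also have "\<dots> = W2" unfolding R(2) using W2(1) by simp
  finally show ?thesis using that U by blast
qed

text \<open>Because the kernels agree, column operations that remove the kernel of \<open>A\<close>
  do the same for \<open>X\<close>. The remaining columns of both are independent with equal Gram
  matrices, so an isometry between them extends.\<close>

theorem witt_factorization:
  assumes H: "H \<in> carrier_mat n n" "invertible_mat H" "qadj H = H"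
    and A: "A \<in> carrier_mat n n" and X: "X \<in> carrier_mat n n"
    and gram: "qadj A * H * A = qadj X * H * X" and ker: "qker n A = qker n X"
  obtains U where "U \<in> carrier_mat n n" "qadj U * H * U = H" "X = U * A"
proof -
  obtain T r W1 where T: "T \<in> carrier_mat n n" "invertible_mat T" "r \<le> n" "W1 \<in> carrier_mat n r" "minj W1"
    "A * T = hcat W1 (0\<^sub>m n (n - r))"
    using column_rank_factorization[OF A] by auto
  have rn: "r + (n - r) = n" using T(3) by simp
  obtain Ta Tb where ab: "T = hcat Ta Tb" "Ta \<in> carrier_mat n r" "Tb \<in> carrier_mat n (n - r)"
    using hcat_split[of T n r "n - r"] T(1) rn by auto
  have e: "hcat (A * Ta) (A * Tb) = hcat W1 (0\<^sub>m n (n - r))"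
    unfolding T(6)[symmetric] ab(1) using A ab by (intro mult_hcat[symmetric]) auto
  have ATa: "A * Ta = W1" by (rule hcat_eqD(1)[OF e]) (use A ab T(4) in auto)
  have ATb: "A * Tb = 0\<^sub>m n (n - r)" by (rule hcat_eqD(2)[OF e]) (use A ab T(4) in auto)
  have kv: "A *\<^sub>v v = 0\<^sub>v n \<longleftrightarrow> X *\<^sub>v v = 0\<^sub>v n" if "v \<in> carrier_vec n" for v
    using ker that unfolding qker_def by blast
  have XTb: "X * Tb = 0\<^sub>m n (n - r)"
  proof (rule eq_matI)
    fix i j assume ij: "i < dim_row (0\<^sub>m n (n - r) :: quat mat)" "j < dim_col (0\<^sub>m n (n - r) :: quat mat)"
    have j: "j < n - r" using ij by simp
    have c: "col Tb j \<in> carrier_vec n" using ab(3) j by auto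
    have "A *\<^sub>v col Tb j = col (A * Tb) j" by (rule col_mult2[OF A ab(3) j, symmetric])
    also have "\<dots> = 0\<^sub>v n" unfolding ATb using j by simp
    finally have "X *\<^sub>v col Tb j = 0\<^sub>v n" using kv[OF c] by simp
    hence "col (X * Tb) j = 0\<^sub>v n" using col_mult2[OF X ab(3) j] by simp
    hence "col (X * Tb) j $ i = 0" using ij by simp
    moreover have "col (X * Tb) j $ i = (X * Tb) $$ (i,j)" by (rule index_col) (use ij X ab(3) in auto)
    ultimately show "(X * Tb) $$ (i,j) = 0\<^sub>m n (n - r) $$ (i,j)" using ij by simp
  qed (use X ab in auto)
  let ?W2 = "X * Ta"
  have W2: "?W2 \<in> carrier_mat n r" using X ab by auto
  have W2m: "minj ?W2"
  proof (rule minjI[OF W2])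
    fix v :: "quat vec" assume v: "v \<in> carrier_vec r" "?W2 *\<^sub>v v = 0\<^sub>v n"
    have c: "Ta *\<^sub>v v \<in> carrier_vec n" by (rule mult_mat_vec_carrier[OF ab(2) v(1)])
    have "X *\<^sub>v (Ta *\<^sub>v v) = 0\<^sub>v n" using v assoc_mult_mat_vec[OF X ab(2) v(1)] by simp
    hence "A *\<^sub>v (Ta *\<^sub>v v) = 0\<^sub>v n" using kv[OF c] by simp
    hence "W1 *\<^sub>v v = 0\<^sub>v n" using assoc_mult_mat_vec[OF A ab(2) v(1)] ATa by simp
    thus "v = 0\<^sub>v r" using minjD[OF T(5,4) v(1)] by simp
  qed
  have "qadj W1 * H * W1 = qadj Ta * (qadj A * H * A) * Ta"
    unfolding ATa[symmetric] using A ab H(1) by (simp add: qadj_mult mult_assoc_dim)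
  also have "\<dots> = qadj ?W2 * H * ?W2"
    unfolding gram using X ab H(1) by (simp add: qadj_mult mult_assoc_dim)
  finally obtain U where U: "U \<in> carrier_mat n n" "qadj U * H * U = H" "U * W1 = ?W2"
    using witt_injective[OF H T(4,5) W2 W2m] by metis
  have "(U * A) * T = U * (A * T)" by (rule assoc_mult_mat[OF U(1) A T(1)])
  also have "\<dots> = hcat (U * W1) (U * 0\<^sub>m n (n - r))"
    unfolding T(6) using U(1) T(4) by (intro mult_hcat) auto
  also have "\<dots> = hcat (X * Ta) (X * Tb)" unfolding U(3) XTb using right_mult_zero_mat[OF U(1)] by simp
  also have "\<dots> = X * T" unfolding ab(1) using X ab by (intro mult_hcat[symmetric]) auto
  finally have UT: "(U * A) * T = X * T" .
  obtain R where R: "R \<in> carrier_mat n n" "T * R = 1\<^sub>m n" using invertible_matE[OF T(2,1)] by metis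
  have "X = X * T * R" using assoc_mult_mat[OF X T(1) R(1)] R(2) X by simp
  also have "\<dots> = U * A * (T * R)" unfolding UT[symmetric]
    by (rule assoc_mult_mat[OF mult_carrier_mat[OF U(1) A] T(1) R(1)])
  also have "\<dots> = U * A" unfolding R(2) using U(1) A by simp
  finally show ?thesis using that U by blast
qed

section \<open>Polar decompositions\<close>

lemma canonical_formD:
  assumes "canonical_form n B H bs S" "B \<in> carrier_mat n n"
  shows "S \<in> carrier_mat n n" "invertible_mat S" "\<forall>b\<in>set bs. cblock_valid b" "blocks_size bs = n"
    "B * S = S * blocks_B bs" "qadj S * H * S = blocks_H bs" "peq n B H (blocks_B bs) (blocks_H bs)"
proof -
  show S: "S \<in> carrier_mat n n" "invertible_mat S" "\<forall>b\<in>set bs. cblock_valid b"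
    and gram: "qadj S * H * S = blocks_H bs"
    using assms(1) by (auto simp: canonical_form_def blocks_H_def)
  have e: "qinv S * B * S = blocks_B bs" using assms(1) by (simp add: canonical_form_def blocks_B_def)
  note Q = qinv[OF S(2,1)]
  have "dim_row (blocks_B bs) = n" unfolding e[symmetric] using Q(1) by simp
  thus "blocks_size bs = n" by simp
  have "S * blocks_B bs = (S * qinv S) * (B * S)"
    unfolding e[symmetric] using S(1) Q(1) assms(2) by (simp only: mult_assoc_dim carrier_matD index_mult_mat)
  also have "\<dots> = B * S" unfolding Q(2) by (rule left_mult_one_mat[OF mult_carrier_mat[OF assms(2) S(1)]])
  finally show BS: "B * S = S * blocks_B bs" by simp
  show "peq n B H (blocks_B bs) (blocks_H bs)" by (rule peqI[OF S(1,2) BS gram])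
qed

lemma canonical_formI:
  assumes "S \<in> carrier_mat n n" "invertible_mat S" "\<forall>b\<in>set bs. cblock_valid b" "blocks_size bs = n"
    "B \<in> carrier_mat n n" "B * S = S * blocks_B bs" "qadj S * H * S = blocks_H bs"
  shows "canonical_form n B H bs S"
proof -
  note Q = qinv[OF assms(2,1)]
  have c: "blocks_B bs \<in> carrier_mat n n" using blocks_carrier(1)[of bs] assms(4) by simp
  have "qinv S * B * S = qinv S * (S * blocks_B bs)"
    unfolding assms(6)[symmetric] by (rule assoc_mult_mat[OF Q(1) assms(5,1)])
  also have "\<dots> = qinv S * S * blocks_B bs" by (rule assoc_mult_mat[OF Q(1) assms(1) c, symmetric])
  also have "\<dots> = blocks_B bs" unfolding Q(3) by (rule left_mult_one_mat[OF c])
  finally show ?thesis using assms by (simp add: canonical_form_def blocks_B_def blocks_H_def)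
qed

section \<open>Adjoints with respect to the form\<close>

lemma H_adjoint_mult:
  assumes "H \<in> carrier_mat n n" "invertible_mat H" "X \<in> carrier_mat n n"
  shows "H_adjoint H X \<in> carrier_mat n n" "H * H_adjoint H X = qadj X * H"
proof -
  note Q = qinv[OF assms(2,1)]
  show "H_adjoint H X \<in> carrier_mat n n" using Q(1) assms by (auto simp: H_adjoint_def)
  have "H * H_adjoint H X = (H * qinv H) * (qadj X * H)"
    unfolding H_adjoint_def using Q(1) assms by (simp only: mult_assoc_dim carrier_matD index_mult_mat qadj_dim)
  thus "H * H_adjoint H X = qadj X * H"
    unfolding Q(2) using left_mult_one_mat[OF mult_carrier_mat[OF qadj_carrier[OF assms(3)] assms(1)]] by simp
qed

lemma H_selfadjoint_iff:
  assumes "H \<in> carrier_mat n n" "invertible_mat H" "A \<in> carrier_mat n n"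
  shows "H_selfadjoint H A \<longleftrightarrow> qadj A * H = H * A"
proof
  assume "H_selfadjoint H A"
  thus "qadj A * H = H * A" using H_adjoint_mult(2)[OF assms] by (simp add: H_selfadjoint_def)
next
  assume "qadj A * H = H * A"
  hence "H * H_adjoint H A = H * A" using H_adjoint_mult(2)[OF assms] by simp
  thus "H_selfadjoint H A" unfolding H_selfadjoint_def
    by (rule minj_mult_cancel[OF invertible_minj[OF assms(2,1)] assms(1) H_adjoint_mult(1)[OF assms] assms(3)])
qed

lemma H_gram:
  assumes "H \<in> carrier_mat n n" "invertible_mat H" "X \<in> carrier_mat n n"
  shows "H * (H_adjoint H X * X) = qadj X * H * X"
  using assoc_mult_mat[OF assms(1) H_adjoint_mult(1)[OF assms] assms(3)] H_adjoint_mult(2)[OF assms] by simp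

lemma count_list_filter: "count_list (filter P xs) x = (if P x then count_list xs x else 0)"
  by (induction xs) auto

text \<open>Every negative block of sign \<open>1\<close> opens a pair; its partner of sign
  \<open>-1\<close> is guaranteed by counting.\<close>

definition neg_pairs :: "cblock list \<Rightarrow> (nat \<times> real) list" where
  "neg_pairs bs = concat (map (\<lambda>b. case b of RB k l e \<Rightarrow> (if l < 0 \<and> e = 1 then [(k, l)] else []) | CB k z \<Rightarrow> []) bs)"

lemma neg_pairs_count: "count_list (neg_pairs bs) (k, l) = (if l < 0 then count_list bs (RB k l 1) else 0)"
  by (induction bs) (auto simp: neg_pairs_def split: cblock.splits)

lemma neg_pairableI:
  assumes val: "\<forall>b\<in>set bs. cblock_valid b"
    and bal: "\<And>k l. l < 0 \<Longrightarrow> count_list bs (RB k l 1) = count_list bs (RB k l (-1))"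
  shows "neg_pairable bs"
  unfolding neg_pairable_def
proof (intro exI conjI)
  show "\<forall>(k,l)\<in>set (neg_pairs bs). l < 0"
    by (auto simp: neg_pairs_def split: cblock.splits if_splits)
  have c1: "count_list (concat (map (\<lambda>(k,l). [RB k l 1, RB k l (-1)]) ps)) (RB k l e) =
     (if e = 1 \<or> e = -1 then count_list ps (k, l) else 0)" for ps k l e
    by (induction ps) auto
  have c2: "count_list (concat (map (\<lambda>(k,l). [RB k l 1, RB k l (-1)]) ps)) (CB k z) = 0" for ps k z
    by (induction ps) auto
  show "mset (filter neg_block bs) = mset (concat (map (\<lambda>(k,l). [RB k l 1, RB k l (-1)]) (neg_pairs bs)))"
  proof (rule multiset_eqI)
    fix b
    show "count (mset (filter neg_block bs)) b =
      count (mset (concat (map (\<lambda>(k,l). [RB k l 1, RB k l (-1)]) (neg_pairs bs)))) b"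
    proof (cases b)
      case (RB k l e)
      have "\<not> (e = 1 \<or> e = -1) \<Longrightarrow> count_list bs (RB k l e) = 0"
        using val by (auto simp: count_list_0_iff)
      thus ?thesis unfolding RB count_mset count_list_filter c1 neg_pairs_count using bal[of l k] by auto
    next
      case (CB k z)
      show ?thesis unfolding CB count_mset count_list_filter c2 by simp
    qed
  qed
qed

lemma zgroups_zero_blocks:
  "b \<in> set (zgroups_blocks gs) \<Longrightarrow> zero_block b \<and> \<not> neg_block b"
proof (induction gs)
  case (Cons g gs)
  thus ?case by (cases g) (auto split: if_splits)
qed simp

lemma polar_imp_conditions:
  assumes H: "H \<in> carrier_mat n n" "invertible_mat H" "qadj H = H" and X: "X \<in> carrier_mat n n"
    and polar: "has_H_polar_decomposition n H X"
  defines "B \<equiv> H_adjoint H X * X"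
  shows "canonical_form n B H bs S \<Longrightarrow> neg_pairable bs"
    "canonical_form n B H bs S \<Longrightarrow> zero_groupable bs"
    "\<exists>bs gs S. (\<forall>b\<in>set bs. \<not> zero_block b) \<and> (\<forall>g\<in>set gs. zgroup_valid g) \<and>
        canonical_form n B H (bs @ zgroups_blocks gs) S \<and>
        qker n X = rspan n (zgroup_kernel_vecs S (sum_list (map cblock_size bs)) gs)"
proof -
  obtain U A where UA: "U \<in> carrier_mat n n" "A \<in> carrier_mat n n" "qadj U * H * U = H" "H_selfadjoint H A" "X = U * A"
    using polar unfolding has_H_polar_decomposition_def H_unitary_def by auto
  have A: "A \<in> carrier_mat n n" "qadj A * H = H * A" using UA(2,4) H_selfadjoint_iff[OF H(1,2)] by auto
  have Bc: "B \<in> carrier_mat n n" using H_adjoint_mult(1)[OF H(1,2) X] X by (auto simp: B_def)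
  have "H * B = qadj A * (qadj U * H * U) * A"
    unfolding B_def H_gram[OF H(1,2) X] unfolding UA(5)
    using UA(1,2) H(1) by (simp add: qadj_mult mult_assoc_dim)
  also have "\<dots> = H * (A * A)" unfolding UA(3) A(2) by (rule assoc_mult_mat[OF H(1) A(1,1)])
  finally have BA: "B = A * A"
    by (rule minj_mult_cancel[OF invertible_minj[OF H(2,1)] H(1) Bc mult_carrier_mat[OF A(1,1)]])
  \<comment> \<open>A vector killed by \<open>U\<close> is killed by the product that equals
    \<open>H\<close>, which is invertible.\<close>
  have Uinj: "minj U"
  proof (rule minjI[OF UA(1)])
    fix v :: "quat vec" assume v: "v \<in> carrier_vec n" "U *\<^sub>v v = 0\<^sub>v n"
    have c: "qadj U * H \<in> carrier_mat n n" using UA(1) H(1) by auto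
    have "H *\<^sub>v v = (qadj U * H) *\<^sub>v (U *\<^sub>v v)"
      using assoc_mult_mat_vec[OF c UA(1) v(1)] UA(3) by simp
    also have "\<dots> = 0\<^sub>v n" unfolding v(2) by (rule mult_zero_vec[OF c])
    finally show "v = 0\<^sub>v n" using minjD[OF invertible_minj[OF H(2,1)] H(1) v(1)] by simp
  qed
  have kerX: "qker n X = qker n A"
  proof -
    have "X *\<^sub>v v = 0\<^sub>v n \<longleftrightarrow> A *\<^sub>v v = 0\<^sub>v n" if v: "v \<in> carrier_vec n" for v
    proof -
      have "X *\<^sub>v v = U *\<^sub>v (A *\<^sub>v v)" unfolding UA(5) by (rule assoc_mult_mat_vec[OF UA(1,2) v])
      thus ?thesis using minjD[OF Uinj UA(1) mult_mat_vec_carrier[OF A(1) v]] mult_zero_vec[OF UA(1)] by auto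
    qed
    thus ?thesis unfolding qker_def by blast
  qed
  obtain cs gs Rs R S0 where c: "\<forall>b\<in>set cs. cblock_valid b \<and> \<not> zero_block b" "\<forall>g\<in>set gs. zgroup_valid g"
    "list_all2 is_zroot gs Rs" "blocks_size cs + zgroups_size gs = n"
    "R \<in> carrier_mat (blocks_size cs) (blocks_size cs)" "minj R" "R * R = blocks_B cs"
    "S0 \<in> carrier_mat n n" "invertible_mat S0" "A * S0 = S0 * dsum R (diag_block_mat Rs)"
    "qadj S0 * H * S0 = blocks_H (cs @ zgroups_blocks gs)"
    using selfadjoint_square_canonical[OF H A] by auto
  note Dc = zroots_carrier[OF c(3)]
  have RD: "dsum R (diag_block_mat Rs) \<in> carrier_mat n n" using dsum_carrier[OF c(5) Dc] c(4) by simp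
  have "dsum R (diag_block_mat Rs) * dsum R (diag_block_mat Rs) = blocks_B (cs @ zgroups_blocks gs)"
    using c(5) Dc by (subst dsum_mult) (auto simp: c(7) zroots_square[OF c(3)])
  hence "B * S0 = S0 * blocks_B (cs @ zgroups_blocks gs)"
    unfolding BA square_intertwine[OF A(1) c(8) RD c(10)] by simp
  hence cf: "canonical_form n B H (cs @ zgroups_blocks gs) S0"
    using c zgroup_blocks_valid Bc by (intro canonical_formI) (auto simp: zgroups_blocks_size)
  show "\<exists>bs gs S. (\<forall>b\<in>set bs. \<not> zero_block b) \<and> (\<forall>g\<in>set gs. zgroup_valid g) \<and>
        canonical_form n B H (bs @ zgroups_blocks gs) S \<and>
        qker n X = rspan n (zgroup_kernel_vecs S (sum_list (map cblock_size bs)) gs)"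
    using cf c(1,2) kerX zgroup_kernel[OF c(8,9) A(1) c(10,5,6,3,4,2)] by (intro exI[of _ cs] exI[of _ gs] exI[of _ S0]) auto
  note cfD = canonical_formD[OF cf Bc]
  {
    assume "canonical_form n B H bs S"
    note D = canonical_formD[OF this Bc]
    show "neg_pairable bs"
    proof (rule neg_pairableI[OF D(3)])
      fix k and l :: real assume l: "l < 0"
      show "count_list bs (RB k l 1) = count_list bs (RB k l (-1))"
      proof (cases "k \<ge> 1")
        case True
        note nb = negative_blocks_balanced[OF A H(1) D(3,4) D(7)[unfolded BA] l True]
        show ?thesis using nb[of 1] nb[of "-1"] by simp
      next
        case False
        hence "RB k l 1 \<notin> set bs" "RB k l (-1) \<notin> set bs" using D(3) by auto
        thus ?thesis by (simp add: count_list_0_iff)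
      qed
    qed
    \<comment> \<open>The form \<open>bs\<close> is arbitrary here. Uniqueness of real blocks
      transfers the grouping from the form built out of \<open>A\<close> to this one.\<close>
    have cnt: "count_list bs (RB k l e) = count_list (cs @ zgroups_blocks gs) (RB k l e)" for k l e
      by (rule real_blocks_unique[OF D(7) cfD(7) Bc H(1) D(3,4) cfD(3,4)])
    have "mset (filter zero_block bs) = mset (zgroups_blocks gs)"
    proof (rule multiset_eqI)
      fix b
      show "count (mset (filter zero_block bs)) b = count (mset (zgroups_blocks gs)) b"
      proof (cases "zero_block b")
        case True
        then obtain k e where b: "b = RB k 0 e" by (cases b) auto
        have "count_list cs b = 0" using True c(1) by (auto simp: count_list_0_iff)
        thus ?thesis using True cnt[of k 0 e] b by (simp add: count_list_filter count_mset)
      next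
        case False
        hence "b \<notin> set (zgroups_blocks gs)" using zgroups_zero_blocks by blast
        thus ?thesis using False by (simp add: count_list_filter count_mset count_list_0_iff)
      qed
    qed
    thus "zero_groupable bs" unfolding zero_groupable_def using c(2) by blast
  }
qed

lemma conditions_imp_polar:
  assumes H: "H \<in> carrier_mat n n" "invertible_mat H" "qadj H = H" and X: "X \<in> carrier_mat n n"
  defines "B \<equiv> H_adjoint H X * X"
  assumes np: "neg_pairable (bs @ zgroups_blocks gs)" and nz: "\<forall>b\<in>set bs. \<not> zero_block b"
    and gs: "\<forall>g\<in>set gs. zgroup_valid g"
    and cf: "canonical_form n B H (bs @ zgroups_blocks gs) S"
    and ker: "qker n X = rspan n (zgroup_kernel_vecs S (sum_list (map cblock_size bs)) gs)"
  shows "has_H_polar_decomposition n H X"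
proof -
  have Bc: "B \<in> carrier_mat n n" using H_adjoint_mult(1)[OF H(1,2) X] X by (auto simp: B_def)
  note D = canonical_formD[OF cf Bc]
  \<comment> \<open>Negative blocks can occur in \<open>bs\<close> only, so the pairing hypothesis
    restricts to it.\<close>
  have "filter neg_block (zgroups_blocks gs) = []" using zgroups_zero_blocks by (auto simp: filter_empty_conv)
  hence "neg_pairable bs" using np unfolding neg_pairable_def by simp
  hence "sqrtable bs" using sqrtable_pairable[OF nz] D(3) by auto
  then obtain R where R: "R \<in> carrier_mat (blocks_size bs) (blocks_size bs)" "R * R = blocks_B bs"
     "qadj R * blocks_H bs = blocks_H bs * R" unfolding sqrtable_def by auto
  \<comment> \<open>Away from the eigenvalue 0 the square is injective, hence so is its root, and
    the kernel of the assembled root comes from the zero groups alone.\<close>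
  have "minj (R * R)" unfolding R(2) using nonzero_blocks_minj nz D(3) by auto
  hence Rm: "minj R" using minj_mult_left[OF _ R(1,1)] by simp
  obtain f where f: "\<And>g. zgroup_valid g \<Longrightarrow> is_zroot g (f g)" using zroot_exists by metis
  define Rs where "Rs = map f gs"
  have Rs: "list_all2 is_zroot gs Rs" using f gs by (simp add: Rs_def list_all2_map2 list_all2_same)
  define E where "E = dsum R (diag_block_mat Rs)"
  note Dc = zroots_carrier[OF Rs]
  have sz: "blocks_size bs + zgroups_size gs = n" using D(4) by (simp add: zgroups_blocks_size)
  have E: "E \<in> carrier_mat n n" using dsum_carrier[OF R(1) Dc] sz by (simp add: E_def)
  have EE: "E * E = blocks_B (bs @ zgroups_blocks gs)"
    unfolding E_def using R Dc by (subst dsum_mult) (auto simp: zroots_square[OF Rs])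
  have EH: "qadj E * blocks_H (bs @ zgroups_blocks gs) = blocks_H (bs @ zgroups_blocks gs) * E"
    unfolding E_def using R Dc zroots_selfadjoint[OF Rs]
    by (simp add: qadj_dsum dsum_mult zgroups_blocks_size)
  obtain Q where Q: "Q \<in> carrier_mat n n" "S * Q = 1\<^sub>m n" "Q * S = 1\<^sub>m n" using invertible_matE[OF D(2,1)] by metis
  define A where "A = S * E * Q"
  have A: "A \<in> carrier_mat n n" using D(1) E Q(1) by (auto simp: A_def)
  have AS: "A * S = S * E"
  proof -
    have "A * S = S * E * (Q * S)" unfolding A_def
      by (rule assoc_mult_mat[OF mult_carrier_mat[OF D(1) E] Q(1) D(1)])
    thus ?thesis unfolding Q(3) using right_mult_one_mat[OF mult_carrier_mat[OF D(1) E]] by simp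
  qed
  have AA: "A * A = B"
  proof -
    have "A * A = S * (E * E) * Q" unfolding A_def by (rule square_conjugate[OF D(1) Q(1) E Q(3)])
    also have "\<dots> = B * S * Q" unfolding EE D(5) ..
    also have "\<dots> = B * (S * Q)" by (rule assoc_mult_mat[OF Bc D(1) Q(1)])
    finally show ?thesis unfolding Q(2) using right_mult_one_mat[OF Bc] by simp
  qed
  have sa: "qadj A * H = H * A"
    unfolding A_def by (rule selfadjoint_conjugate[OF D(1) Q(1) E H(1) Q(2,3)]) (simp only: D(6) EH)
  have "qadj A * H * A = H * (A * A)" unfolding sa by (rule assoc_mult_mat[OF H(1) A A])
  also have "\<dots> = qadj X * H * X" unfolding AA B_def by (rule H_gram[OF H(1,2) X])
  finally have gram: "qadj A * H * A = qadj X * H * X" .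
  have "qker n A = qker n X"
    unfolding ker by (rule zgroup_kernel[OF D(1,2) A AS[unfolded E_def] R(1) Rm Rs sz gs])
  from witt_factorization[OF H A X gram this] obtain U where
    "U \<in> carrier_mat n n" "qadj U * H * U = H" "X = U * A" .
  thus ?thesis unfolding has_H_polar_decomposition_def H_unitary_def
    using A sa H_selfadjoint_iff[OF H(1,2) A] by blast
qed

theorem theorem6p2:
  fixes n :: nat and H X :: "quat mat"
  assumes "H \<in> carrier_mat n n" and "invertible_mat H" and "qadj H = H"
    and "X \<in> carrier_mat n n"
  defines "B \<equiv> H_adjoint H X * X"
  shows "has_H_polar_decomposition n H X \<longleftrightarrow>
    ((\<forall>bs S. canonical_form n B H bs S \<longrightarrow> neg_pairable bs) \<and>
     (\<forall>bs S. canonical_form n B H bs S \<longrightarrow> zero_groupable bs) \<and>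
     (\<exists>bs gs S. (\<forall>b\<in>set bs. \<not> zero_block b) \<and> (\<forall>g\<in>set gs. zgroup_valid g) \<and>
        canonical_form n B H (bs @ concat (map zgroup_blocks gs)) S \<and>
        qker n X = rspan n (zgroup_kernel_vecs S (sum_list (map cblock_size bs)) gs)))"
  (is "_ \<longleftrightarrow> ?conditions")
proof
  assume polar: "has_H_polar_decomposition n H X"
  show ?conditions
    using polar_imp_conditions[OF assms(1-4) polar] unfolding B_def by blast
next
  assume "?conditions"
  thus "has_H_polar_decomposition n H X"
    using conditions_imp_polar[OF assms(1-4)] unfolding B_def by blast
qed

end
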